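(* Let $\mathbf k$ be an arbitrary commutative ring. For all $n\ge 6$, $$\mathrm H_1(\mathrm{GL}_n(\mathbb Z);\mathrm{St}_n(\mathbb Z)\otimes_{\mathbb Z}\mathbf k)=0\qquad\text{and}\qquad \mathrm H_1(\mathrm{SL}_n(\mathbb Z);\mathrm{St}_n(\mathbb Z)\otimes_{\mathbb Z}\mathbf k)=0 .$$
   Context: $\mathrm{St}_n(\mathbb Z)=\widetilde{\mathrm H}_{n-2}(\mathcal T(\mathbb Q^n);\mathbb Z)$ is the Steinberg module, where $\mathcal T(\mathbb Q^n)$ is the Tits building: the geometric realization of the poset of nonzero proper subspaces of $\mathbb Q^n$ ordered by inclusion. $\mathrm{GL}_n(\mathbb Z)$ and $\mathrm{SL}_n(\mathbb Z)$ act through their action on $\mathbb Q^n$. *)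

theory Defs
  imports
    "HOL-Homology.Homology"
    "HOL-Algebra.Algebra"
    "Jordan_Normal_Form.Determinant"
    "Jordan_Normal_Form.VS_Connect"
begin

section \<open>Geometric realization of a poset of sets ordered by inclusion\<close>

definition order_simplices :: "'a set set \<Rightarrow> 'a set set set" where
  "order_simplices P = {\<sigma>. finite \<sigma> \<and> \<sigma> \<noteq> {} \<and> subset.chain P \<sigma>}"

text \<open>Points are given by their barycentric coordinates.\<close>

definition closed_simplex :: "'v set \<Rightarrow> ('v \<Rightarrow> real) set" where
  "closed_simplex \<sigma> = {x. (\<forall>v. 0 \<le> x v) \<and> (\<forall>v. v \<notin> \<sigma> \<longrightarrow> x v = 0) \<and> (\<Sum>v\<in>\<sigma>. x v) = 1}"

definition realization_points :: "'a set set \<Rightarrow> ('a set \<Rightarrow> real) set" where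
  "realization_points P = (\<Union>\<sigma>\<in>order_simplices P. closed_simplex \<sigma>)"

text \<open>The weak topology: each closed simplex carries its Euclidean topology (the coordinates
  outside the finite set \<open>\<sigma>\<close> vanish, so this is the topology induced by the product topology),
  and a set is open iff its intersection with every closed simplex is open in that simplex.\<close>

definition geometric_realization :: "'a set set \<Rightarrow> ('a set \<Rightarrow> real) topology" where
  "geometric_realization P = topology (\<lambda>U. U \<subseteq> realization_points P \<and>
     (\<forall>\<sigma>\<in>order_simplices P.
        openin (subtopology (powertop_real UNIV) (closed_simplex \<sigma>)) (U \<inter> closed_simplex \<sigma>)))"

lemma openin_geometric_realization:
  "openin (geometric_realization P) U \<longleftrightarrow> U \<subseteq> realization_points P \<and>
     (\<forall>\<sigma>\<in>order_simplices P.
        openin (subtopology (powertop_real UNIV) (closed_simplex \<sigma>)) (U \<inter> closed_simplex \<sigma>))"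
proof -
  let ?L = "\<lambda>U. U \<subseteq> realization_points P \<and> (\<forall>\<sigma>\<in>order_simplices P.
        openin (subtopology (powertop_real UNIV) (closed_simplex \<sigma>)) (U \<inter> closed_simplex \<sigma>))"
  have "istopology ?L"
    unfolding istopology_def
  proof (intro conjI allI impI)
    fix S T assume S: "?L S" and T: "?L T"
    have "S \<inter> T \<inter> closed_simplex \<sigma> = (S \<inter> closed_simplex \<sigma>) \<inter> (T \<inter> closed_simplex \<sigma>)" for \<sigma>
      by blast
    with S T show "S \<inter> T \<subseteq> realization_points P"
      and "\<forall>\<sigma>\<in>order_simplices P.
        openin (subtopology (powertop_real UNIV) (closed_simplex \<sigma>)) (S \<inter> T \<inter> closed_simplex \<sigma>)"
      by (auto intro: openin_Int)
  next
    fix \<K> assume K: "\<forall>K\<in>\<K>. ?L K"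
    have eq: "\<Union>\<K> \<inter> closed_simplex \<sigma> = (\<Union>K\<in>\<K>. K \<inter> closed_simplex \<sigma>)" for \<sigma>
      by blast
    show "\<Union>\<K> \<subseteq> realization_points P"
      using K by blast
    show "\<forall>\<sigma>\<in>order_simplices P.
        openin (subtopology (powertop_real UNIV) (closed_simplex \<sigma>)) (\<Union>\<K> \<inter> closed_simplex \<sigma>)"
      unfolding eq using K by (intro ballI openin_Union) auto
  qed
  then show ?thesis
    by (simp add: geometric_realization_def topology_inverse')
qed

text \<open>The map of realizations induced by a map of vertices, affine on each simplex. Realization
  points have finite support, so the sum is finite.\<close>

definition realization_map :: "('v \<Rightarrow> 'w) \<Rightarrow> ('v \<Rightarrow> real) \<Rightarrow> ('w \<Rightarrow> real)" where
  "realization_map f x = (\<lambda>w. \<Sum>v | x v \<noteq> 0 \<and> f v = w. x v)"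


section \<open>The Tits building and the Steinberg module\<close>

definition tits_building :: "nat \<Rightarrow> rat Matrix.vec set set" where
  "tits_building n = {W. VectorSpace.subspace class_ring W (module_vec TYPE(rat) n)
                         \<and> W \<noteq> {0\<^sub>v n} \<and> W \<noteq> carrier_vec n}"

definition GL_int :: "nat \<Rightarrow> int mat monoid" where
  "GL_int n = units_of (ring_mat TYPE(int) n ())"

definition SL_int :: "nat \<Rightarrow> int mat monoid" where
  "SL_int n = (GL_int n)\<lparr>carrier := {A \<in> carrier_mat n n. Determinant.det A = 1}\<rparr>"

definition building_action :: "int mat \<Rightarrow> rat Matrix.vec set \<Rightarrow> rat Matrix.vec set" where
  "building_action A W = (\<lambda>v. map_mat rat_of_int A *\<^sub>v v) ` W"

text \<open>Only used for \<open>n \<ge> 2\<close>: for \<open>n = 1\<close> the building is empty, and the library's reduced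
  homology groups vanish in negative degrees, even for the empty space.\<close>

definition steinberg :: "nat \<Rightarrow> (rat Matrix.vec set \<Rightarrow> real) chain set monoid" where
  "steinberg n = reduced_homology_group (int n - 2) (geometric_realization (tits_building n))"

definition steinberg_action ::
  "nat \<Rightarrow> int mat \<Rightarrow> (rat Matrix.vec set \<Rightarrow> real) chain set \<Rightarrow> (rat Matrix.vec set \<Rightarrow> real) chain set"
where
  "steinberg_action n A =
     hom_induced (int n - 2) (geometric_realization (tits_building n)) {}
       (geometric_realization (tits_building n)) {} (realization_map (building_action A))"


section \<open>Tensor product of (multiplicatively written) abelian groups\<close>

definition tensor_relations ::
  "('a, 'x) monoid_scheme \<Rightarrow> ('b, 'y) monoid_scheme \<Rightarrow> ('a \<times> 'b \<Rightarrow>\<^sub>0 int) set" where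
  "tensor_relations A B = generate (free_Abelian_group (carrier A \<times> carrier B))
     ({frag_of (a \<otimes>\<^bsub>A\<^esub> a', b) - frag_of (a, b) - frag_of (a', b) | a a' b.
         a \<in> carrier A \<and> a' \<in> carrier A \<and> b \<in> carrier B}
    \<union> {frag_of (a, b \<otimes>\<^bsub>B\<^esub> b') - frag_of (a, b) - frag_of (a, b') | a b b'.
         a \<in> carrier A \<and> b \<in> carrier B \<and> b' \<in> carrier B})"

definition tensor_product ::
  "('a, 'x) monoid_scheme \<Rightarrow> ('b, 'y) monoid_scheme \<Rightarrow> ('a \<times> 'b \<Rightarrow>\<^sub>0 int) set monoid" where
  "tensor_product A B = free_Abelian_group (carrier A \<times> carrier B) Mod tensor_relations A B"

text \<open>For homomorphisms \<open>f\<close> from \<open>A\<close> to \<open>A'\<close> and \<open>g\<close> from \<open>B\<close> to \<open>B'\<close>, the map \<open>f \<otimes> g\<close> from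
  \<open>tensor_product A B\<close> to \<open>tensor_product A' B'\<close>. The image of a coset under the induced map of
  free groups lies in a single coset; multiplying by the relations gives all of that coset.\<close>

definition tensor_map ::
  "('a', 'x) monoid_scheme \<Rightarrow> ('b', 'y) monoid_scheme \<Rightarrow> ('a \<Rightarrow> 'a') \<Rightarrow> ('b \<Rightarrow> 'b')
    \<Rightarrow> ('a \<times> 'b \<Rightarrow>\<^sub>0 int) set \<Rightarrow> ('a' \<times> 'b' \<Rightarrow>\<^sub>0 int) set" where
  "tensor_map A' B' f g C =
     tensor_relations A' B' <#>\<^bsub>free_Abelian_group (carrier A' \<times> carrier B')\<^esub>
       (frag_extend (\<lambda>(a, b). frag_of (f a, g b)) ` C)"

definition steinberg_coeff ::
  "nat \<Rightarrow> ('k, 'r) ring_scheme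
     \<Rightarrow> ((rat Matrix.vec set \<Rightarrow> real) chain set \<times> 'k \<Rightarrow>\<^sub>0 int) set monoid" where
  "steinberg_coeff n k = tensor_product (steinberg n) (add_monoid k)"

definition steinberg_coeff_action ::
  "nat \<Rightarrow> ('k, 'r) ring_scheme \<Rightarrow> int mat
     \<Rightarrow> ((rat Matrix.vec set \<Rightarrow> real) chain set \<times> 'k \<Rightarrow>\<^sub>0 int) set
     \<Rightarrow> ((rat Matrix.vec set \<Rightarrow> real) chain set \<times> 'k \<Rightarrow>\<^sub>0 int) set" where
  "steinberg_coeff_action n k A =
     tensor_map (steinberg n) (add_monoid k) (steinberg_action n A) id"


section \<open>Group homology\<close>

text \<open>Homology of a group \<open>G\<close> with coefficients in a left \<open>G\<close>-module, given by a (multiplicatively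
  written) abelian group \<open>M\<close> and an action \<open>act\<close>. It is the homology of the complex obtained by
  tensoring \<open>M\<close>, viewed as a right module via \<open>m g = g\<^sup>-\<^sup>1 m\<close>, over \<open>G\<close> with the bar resolution:
  the group of \<open>q\<close>-chains is the direct sum of copies of \<open>M\<close> indexed by \<open>q\<close>-tuples
  \<open>[g\<^sub>1|\<dots>|g\<^sub>q]\<close>, and the faces of \<open>m[g\<^sub>1|\<dots>|g\<^sub>q]\<close> are \<open>(g\<^sub>1\<^sup>-\<^sup>1 m)[g\<^sub>2|\<dots>|g\<^sub>q]\<close>,
  \<open>m[g\<^sub>1|\<dots>|g\<^sub>i g\<^sub>i\<^sub>+\<^sub>1|\<dots>|g\<^sub>q]\<close> for \<open>0 < i < q\<close>, and \<open>m[g\<^sub>1|\<dots>|g\<^sub>q\<^sub>-\<^sub>1]\<close>.\<close>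

definition bar_tuples :: "('g, 'x) monoid_scheme \<Rightarrow> nat \<Rightarrow> 'g list set" where
  "bar_tuples G q = {gs. length gs = q \<and> set gs \<subseteq> carrier G}"

definition bar_chain_group ::
  "('g, 'x) monoid_scheme \<Rightarrow> ('m, 'y) monoid_scheme \<Rightarrow> nat \<Rightarrow> ('g list \<Rightarrow> 'm) monoid" where
  "bar_chain_group G M q = sum_group (bar_tuples G q) (\<lambda>_. M)"

definition bar_elem ::
  "('g, 'x) monoid_scheme \<Rightarrow> ('m, 'y) monoid_scheme \<Rightarrow> nat \<Rightarrow> 'm \<Rightarrow> 'g list \<Rightarrow> 'g list \<Rightarrow> 'm" where
  "bar_elem G M q m gs = (\<lambda>hs\<in>bar_tuples G q. if hs = gs then m else \<one>\<^bsub>M\<^esub>)"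

definition bar_face ::
  "('g, 'x) monoid_scheme \<Rightarrow> ('m, 'y) monoid_scheme \<Rightarrow> ('g \<Rightarrow> 'm \<Rightarrow> 'm)
     \<Rightarrow> nat \<Rightarrow> nat \<Rightarrow> 'm \<Rightarrow> 'g list \<Rightarrow> 'g list \<Rightarrow> 'm" where
  "bar_face G M act q i m gs =
     (if i = 0 then bar_elem G M (q - 1) (act (inv\<^bsub>G\<^esub> (hd gs)) m) (tl gs)
      else if i < q then
        bar_elem G M (q - 1) m (take (i - 1) gs @ [gs ! (i - 1) \<otimes>\<^bsub>G\<^esub> gs ! i] @ drop (i + 1) gs)
      else bar_elem G M (q - 1) m (butlast gs))"

text \<open>The boundary of \<open>q\<close>-chains, for \<open>q \<ge> 1\<close>.\<close>

definition bar_boundary ::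
  "('g, 'x) monoid_scheme \<Rightarrow> ('m, 'y) monoid_scheme \<Rightarrow> ('g \<Rightarrow> 'm \<Rightarrow> 'm)
     \<Rightarrow> nat \<Rightarrow> ('g list \<Rightarrow> 'm) \<Rightarrow> ('g list \<Rightarrow> 'm)" where
  "bar_boundary G M act q c =
     gfinprod (bar_chain_group G M (q - 1))
       (\<lambda>gs. finprod (bar_chain_group G M (q - 1))
          (\<lambda>i. bar_face G M act q i (c gs) gs [^]\<^bsub>bar_chain_group G M (q - 1)\<^esub> ((-1::int) ^ i)) {..q})
       (bar_tuples G q)"

definition bar_cycles ::
  "('g, 'x) monoid_scheme \<Rightarrow> ('m, 'y) monoid_scheme \<Rightarrow> ('g \<Rightarrow> 'm \<Rightarrow> 'm)
     \<Rightarrow> nat \<Rightarrow> ('g list \<Rightarrow> 'm) set" where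
  "bar_cycles G M act q =
     (if q = 0 then carrier (bar_chain_group G M 0)
      else kernel (bar_chain_group G M q) (bar_chain_group G M (q - 1)) (bar_boundary G M act q))"

definition group_homology ::
  "nat \<Rightarrow> ('g, 'x) monoid_scheme \<Rightarrow> ('m, 'y) monoid_scheme \<Rightarrow> ('g \<Rightarrow> 'm \<Rightarrow> 'm)
     \<Rightarrow> ('g list \<Rightarrow> 'm) set monoid" where
  "group_homology q G M act =
     subgroup_generated (bar_chain_group G M q) (bar_cycles G M act q)
       Mod (bar_boundary G M act (Suc q) ` carrier (bar_chain_group G M (Suc q)))"

end

(* The building has dimension n - 2, so St_n is the group of simplicial (n-2)-cycles of flags. It is
   generated by the integral apartment classes [g], g in GL_n(Z), with only Bykovskii's relations:
   [g] is invariant under sign changes of columns, odd under exchanging adjacent columns, and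
   [x, y, ..] + [y, -x-y, ..] + [-x-y, x, ..] = 0. Both facts are proved by induction on the rank,
   reducing with division by the height |h| of the columns for a functional h.

   To kill H_1(G; M) it suffices to write the universal cocycle m[g], valued in one-chains modulo
   boundaries, as a coboundary U(g^-1 m) - U(m). Fix a coefficient and put X(g) = [1][g]. Signed
   permutations w map [1] to +-[1], so X(w h) = X(w) +- X(h). Let r be the rotation of order three in
   the first two coordinates and Y = X(r) + X(r^2). Commuting with r forces X(d) = 0 for diagonal d
   and 3 X(w) = 2 Y for a transposition w away from the first two coordinates; commutation gives
   2 (X(w) - X(w')) = 0 for distant adjacent transpositions, the braid relation
   3 (X(w) - X(w')) = 0 for neighbouring ones. As n is large, distant pairs link all adjacent
   transpositions, so all X(w) coincide and equal -2t, where t = X(w) - Y and Y = -3t. These identities say exactly that g |-> X(g^-1) + t respects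
   Bykovskii's relations, so it descends to the required U on St_n. *)
theory Submission
  imports Defs
begin

section \<open>Simplicial chains of the order complex\<close>

text \<open>Since \<open>k\<close> is arbitrary, nothing may be divided by 2 or 3. The exchange
  relation forces X(w) = -2t and the three-term relation forces Y = -3t; as 3 - 2 = 1, the only
  candidate is t = X(w) - Y, and for it both equations become the one identity 3 X(w) = 2 Y. Other
  torsion is removed by finding both the double and the triple of an element to be zero.

  The building is not locally finite and its realization has the weak topology, so singular homology
  is compared with flag chains for finite posets, by removing one vertex at a time, and then in
  general by compactness. The inductions on the rank pass to the link of a line; they are therefore
  stated for frames of a lattice L modulo a subgroup, and no quotient is formed. Chains modulo
  boundaries are not formed either: an identity between them is membership of a difference in a
  subgroup N, and the primitive is an ordinary function that is additive only modulo N.\<close>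

abbreviation keys :: "('a \<Rightarrow>\<^sub>0 'b::zero) \<Rightarrow> 'a set" where "keys \<equiv> Poly_Mapping.keys"

abbreviation frag_map :: "('a \<Rightarrow> 'b) \<Rightarrow> ('a \<Rightarrow>\<^sub>0 int) \<Rightarrow> ('b \<Rightarrow>\<^sub>0 int)" where
  "frag_map f \<equiv> frag_extend (\<lambda>x. frag_of (f x))"

definition delete_nth :: "nat \<Rightarrow> 'a list \<Rightarrow> 'a list" where
  "delete_nth k l = take k l @ drop (Suc k) l"

lemma length_delete_nth: "k < length l \<Longrightarrow> length (delete_nth k l) = length l - 1"
  by (simp add: delete_nth_def)

lemma nth_delete_nth:
  "k < length l \<Longrightarrow> i < length l - 1 \<Longrightarrow> delete_nth k l ! i = (if i < k then l ! i else l ! Suc i)"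
  by (auto simp: delete_nth_def nth_append min_def)

lemma set_delete_nth: "set (delete_nth k l) \<subseteq> set l"
  by (auto simp: delete_nth_def dest: in_set_takeD in_set_dropD)

lemma delete_nth_0 [simp]: "delete_nth 0 (x # l) = l"
  by (simp add: delete_nth_def)

lemma delete_nth_Suc [simp]: "delete_nth (Suc k) (x # l) = x # delete_nth k l"
  by (simp add: delete_nth_def)

lemma sorted_wrt_delete_nth:
  assumes "sorted_wrt P l"
  shows "sorted_wrt P (delete_nth k l)"
proof (cases "k < length l")
  case True
  thus ?thesis using assms
    by (auto simp: sorted_wrt_iff_nth_less nth_delete_nth length_delete_nth)
qed (use assms in \<open>simp add: delete_nth_def\<close>)

lemma realization_points_iff:
  assumes "finite S"
  shows "x \<in> realization_points S \<longleftrightarrow> (\<forall>w. 0 \<le> x w) \<and> (\<forall>w. x w \<noteq> 0 \<longrightarrow> w \<in> S) \<and>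
    (\<forall>w w'. x w \<noteq> 0 \<longrightarrow> x w' \<noteq> 0 \<longrightarrow> w \<subseteq> w' \<or> w' \<subseteq> w) \<and> sum x S = 1" (is "?L = ?R")
proof
  assume ?L
  then obtain \<sigma> where s: "finite \<sigma>" "subset.chain S \<sigma>" "x \<in> closed_simplex \<sigma>"
    by (auto simp: realization_points_def order_simplices_def)
  have x: "\<And>v. 0 \<le> x v" "\<And>v. v \<notin> \<sigma> \<Longrightarrow> x v = 0" "sum x \<sigma> = 1"
    using s(3) by (auto simp: closed_simplex_def)
  have "sum x S = sum x \<sigma>"
    using s(2) assms x by (intro sum.mono_neutral_right) (auto simp: subset_chain_def)
  moreover have "w \<in> \<sigma>" if "x w \<noteq> 0" for w using x(2) that by blast
  ultimately show ?R using x s(2) unfolding subset_chain_def by (auto 4 3)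
next
  assume R: ?R
  let ?s = "{w. x w \<noteq> 0}"
  have sub: "?s \<subseteq> S" using R by auto
  have "sum x ?s = sum x S" using sub assms by (intro sum.mono_neutral_left) auto
  hence "sum x ?s = 1" using R by simp
  moreover from this have "?s \<noteq> {}" by (metis sum.empty zero_neq_one)
  moreover have "finite ?s" using sub assms finite_subset by blast
  moreover have "subset.chain S ?s" using R sub by (auto simp: subset_chain_def)
  ultimately show ?L using R
    by (auto simp: realization_points_def order_simplices_def closed_simplex_def intro!: exI[of _ ?s])
qed

text \<open>The product topology makes continuity a matter of coordinates. For finite posets it
  serves in place of the weak topology; the two are linked through the continuity of identity maps
  proved further below.\<close>

definition polyhedron :: "'a set set \<Rightarrow> ('a set \<Rightarrow> real) topology" where
  "polyhedron S = subtopology (powertop_real UNIV) (realization_points S)"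

lemma topspace_polyhedron [simp]: "topspace (polyhedron S) = realization_points S"
  by (simp add: polyhedron_def)

lemma realization_points_mono: "S \<subseteq> T \<Longrightarrow> realization_points S \<subseteq> realization_points T"
  unfolding realization_points_def order_simplices_def subset_chain_def
  by (intro UN_mono) auto

lemma singular_chain_polyhedron_mono:
  "singular_chain p (polyhedron S) c \<Longrightarrow> S \<subseteq> T \<Longrightarrow> singular_chain p (polyhedron T) c"
  unfolding polyhedron_def using singular_chain_mono realization_points_mono by metis

text \<open>Summing over positions keeps the formula meaningful for lists with repeated vertices,
  which can occur as images of flags under a map of vertices. Singular simplices are extensional
  functions, hence the restriction.\<close>

definition affine_simplex :: "'v list \<Rightarrow> (nat \<Rightarrow> real) \<Rightarrow> 'v \<Rightarrow> real" where
  "affine_simplex l = restrict (\<lambda>t w. \<Sum>i<length l. if l ! i = w then t i else 0)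
     (standard_simplex (length l - 1))"

definition flags :: "nat \<Rightarrow> 'a set set \<Rightarrow> 'a set list set" where
  "flags p S = {l. length l = Suc p \<and> sorted_wrt (\<subset>) l \<and> set l \<subseteq> S}"

definition realize :: "('v list \<Rightarrow>\<^sub>0 int) \<Rightarrow> ('v \<Rightarrow> real) chain" where
  "realize = frag_map affine_simplex"

text \<open>Degree 0 is a separate case so that the map agrees with \<open>chain_boundary\<close>,
  which vanishes there; the complex is not augmented.\<close>

definition flag_boundary :: "nat \<Rightarrow> ('v list \<Rightarrow>\<^sub>0 int) \<Rightarrow> ('v list \<Rightarrow>\<^sub>0 int)" where
  "flag_boundary p = (if p = 0 then (\<lambda>c. 0) else
     frag_extend (\<lambda>l. \<Sum>k\<le>p. frag_cmul ((-1) ^ k) (frag_of (delete_nth k l))))"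

lemma realize_add: "realize (a + b) = realize a + realize b"
  by (simp add: realize_def frag_extend_add)
lemma realize_diff: "realize (a - b) = realize a - realize b"
  by (simp add: realize_def frag_extend_diff)
lemma realize_minus: "realize (- a) = - realize a"
  by (simp add: realize_def frag_extend_minus)
lemma realize_0 [simp]: "realize 0 = 0"
  by (simp add: realize_def)
lemma realize_of [simp]: "realize (frag_of l) = frag_of (affine_simplex l)"
  by (simp add: realize_def)
lemma realize_cmul: "realize (frag_cmul m a) = frag_cmul m (realize a)"
  by (simp add: realize_def frag_extend_cmul)
lemma realize_sum: "realize (sum f I) = (\<Sum>i\<in>I. realize (f i))"
  by (induction I rule: infinite_finite_induct) (auto simp: realize_add)
lemma flag_boundary_diff: "flag_boundary p (a - b) = flag_boundary p a - flag_boundary p b"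
  by (simp add: flag_boundary_def frag_extend_diff)
lemma flag_boundary_add: "flag_boundary p (a + b) = flag_boundary p a + flag_boundary p b"
  by (simp add: flag_boundary_def frag_extend_add)
lemma flag_boundary_0 [simp]: "flag_boundary p 0 = 0"
  by (simp add: flag_boundary_def)

lemma keys_frag_extend_subset:
  "keys c \<subseteq> A \<Longrightarrow> (\<And>x. x \<in> A \<Longrightarrow> keys (f x) \<subseteq> B) \<Longrightarrow> keys (frag_extend f c) \<subseteq> B"
  using keys_frag_extend[of f c] by blast

lemma keys_add_subset: "keys a \<subseteq> B \<Longrightarrow> keys b \<subseteq> B \<Longrightarrow> keys (a + b) \<subseteq> B"
  for a b :: "'a \<Rightarrow>\<^sub>0 int"
  using keys_add[of a b] by blast

lemma keys_diff_subset: "keys a \<subseteq> B \<Longrightarrow> keys b \<subseteq> B \<Longrightarrow> keys (a - b) \<subseteq> B"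
  for a b :: "'a \<Rightarrow>\<^sub>0 int"
  using keys_diff[of a b] by blast

lemma keys_sum_subset: "(\<And>i. i \<in> I \<Longrightarrow> keys (f i) \<subseteq> B) \<Longrightarrow> keys (sum f I) \<subseteq> B"
  for f :: "'i \<Rightarrow> 'a \<Rightarrow>\<^sub>0 int"
  by (induction I rule: infinite_finite_induct) (simp_all add: keys_add_subset)

lemma keys_cmul_subset: "keys a \<subseteq> B \<Longrightarrow> keys (frag_cmul m a) \<subseteq> B"
  using keys_cmul by fastforce

lemma delete_nth_flags: "l \<in> flags (Suc p) S \<Longrightarrow> k \<le> Suc p \<Longrightarrow> delete_nth k l \<in> flags p S"
  using set_delete_nth[of k l]
  by (auto simp: flags_def length_delete_nth sorted_wrt_delete_nth)

lemma flag_boundary_keys: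
  "keys c \<subseteq> flags (Suc p) S \<Longrightarrow> keys (flag_boundary (Suc p) c) \<subseteq> flags p S"
  unfolding flag_boundary_def
  apply (simp del: sum.atMost_Suc)
  apply (erule keys_frag_extend_subset)
  apply (rule keys_sum_subset)
  apply (rule keys_cmul_subset)
  by (simp add: delete_nth_flags)

text \<open>A face inserts a zero coordinate at position k, so the sum loses the term k and the
  others are reindexed by skipping k.\<close>

lemma affine_simplex_face:
  assumes "length l = Suc (Suc p)" "k \<le> Suc p"
  shows "singular_face (Suc p) k (affine_simplex l) = affine_simplex (delete_nth k l)"
proof
  fix t
  show "singular_face (Suc p) k (affine_simplex l) t = affine_simplex (delete_nth k l) t"
  proof (cases "t \<in> standard_simplex p")
    case True
    have "simplical_face k t \<in> standard_simplex (Suc p)"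
      using simplical_face_in_standard_simplex[of "Suc p" k t] assms True by simp
    moreover have "(\<Sum>i<Suc (Suc p). if l ! i = w then simplical_face k t i else 0)
        = (\<Sum>i<Suc p. if delete_nth k l ! i = w then t i else 0)" for w
    proof -
      let ?h = "\<lambda>i. if i < k then i else Suc i"
      have inj: "inj_on ?h {..<Suc p}" by (auto simp: inj_on_def split: if_splits)
      have img: "?h ` {..<Suc p} = {..<Suc (Suc p)} - {k}"
      proof -
        have "i \<in> ?h ` {..<Suc p}" if "i < Suc (Suc p)" "i \<noteq> k" for i
          using that assms by (intro image_eqI[of _ _ "if i < k then i else i - 1"]) auto
        thus ?thesis by auto
      qed
      have "(\<Sum>i<Suc (Suc p). if l ! i = w then simplical_face k t i else 0)
          = (\<Sum>i\<in>{..<Suc (Suc p)} - {k}. if l ! i = w then simplical_face k t i else 0)"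
        using assms by (intro sum.mono_neutral_right) (auto simp: simplical_face_def)
      also have "\<dots> = (\<Sum>i<Suc p. if l ! ?h i = w then simplical_face k t (?h i) else 0)"
        by (subst img[symmetric], subst sum.reindex[OF inj]) simp
      also have "\<dots> = (\<Sum>i<Suc p. if delete_nth k l ! i = w then t i else 0)"
        using assms by (intro sum.cong) (auto simp: nth_delete_nth simplical_face_def)
      finally show ?thesis .
    qed
    ultimately show ?thesis
      using True assms by (auto simp: singular_face_def affine_simplex_def length_delete_nth)
  next
    case False
    thus ?thesis
      using assms by (auto simp: singular_face_def affine_simplex_def length_delete_nth)
  qed
qed

lemma chain_boundary_realize:
  assumes "keys c \<subseteq> flags p S"
  shows "chain_boundary p (realize c) = realize (flag_boundary p c)"
  using assms
proof (induction c rule: frag_induction)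
  case (one l)
  show ?case
  proof (cases p)
    case 0 thus ?thesis by (simp add: chain_boundary_def flag_boundary_def)
  next
    case (Suc q)
    with one have "length l = Suc (Suc q)" by (simp add: flags_def)
    thus ?thesis
      using Suc by (simp add: chain_boundary_of flag_boundary_def realize_sum realize_cmul
          affine_simplex_face del: sum.atMost_Suc)
  qed
qed (simp_all add: realize_diff chain_boundary_diff flag_boundary_diff)

lemma affine_simplex_vertex:
  assumes "i < length l" "distinct l"
  shows "affine_simplex l (\<lambda>j. if j = i then 1 else 0) = (\<lambda>w. if w = l ! i then 1 else 0)"
proof
  fix w
  have "(\<lambda>j. if j = i then 1 else 0) \<in> standard_simplex (length l - 1)"
    using assms by simp
  moreover have "(\<Sum>j<length l. if l ! j = w then (if j = i then 1 else 0) else 0)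
      = (\<Sum>j\<in>{i}. if l ! j = w then 1 else (0::real))"
    using assms by (intro sum.mono_neutral_cong_right) auto
  ultimately show "affine_simplex l (\<lambda>j. if j = i then 1 else 0) w = (if w = l ! i then 1 else 0)"
    by (auto simp: affine_simplex_def)
qed

lemma sorted_wrt_psubset_distinct: "sorted_wrt (\<subset>) l \<Longrightarrow> distinct l"
  by (induction l) auto

lemma flags_distinct: "l \<in> flags p S \<Longrightarrow> distinct l"
  by (simp add: flags_def sorted_wrt_psubset_distinct)

lemma sum_indicator_nth:
  fixes t :: "nat \<Rightarrow> real"
  shows "(\<Sum>w\<in>set l. \<Sum>i<length l. if l ! i = w then t i else 0) = (\<Sum>i<length l. t i)"
  by (subst sum.swap) (auto intro!: sum.cong simp: sum.delta')

lemma singular_simplex_affine: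
  assumes l: "l \<in> flags p S"
  shows "singular_simplex p (polyhedron S) (affine_simplex l)"
proof -
  have len: "length l = Suc p" and ss: "sorted_wrt (\<subset>) l" and sub: "set l \<subseteq> S"
    using l by (auto simp: flags_def)
  define f where "f = (\<lambda>t w. \<Sum>i<length l. if l ! i = w then t i else (0::real))"
  have comp: "w \<subseteq> w' \<or> w' \<subseteq> w" if "w \<in> set l" "w' \<in> set l" for w w'
    using ss that by (induction l) auto
  have "f t \<in> realization_points (set l)" if t: "t \<in> standard_simplex p" for t
  proof (subst realization_points_iff, simp, intro conjI allI impI)
    fix w show "0 \<le> f t w" using t by (auto simp: f_def standard_simplex_def intro: sum_nonneg)
  next
    have *: "w \<in> set l" if "f t w \<noteq> 0" for w
    proof (rule ccontr)
      assume "w \<notin> set l"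
      hence "f t w = 0" unfolding f_def by (intro sum.neutral) auto
      with that show False by simp
    qed
    fix w show "w \<in> set l" if "f t w \<noteq> 0" using * that by simp
    fix w' show "w \<subseteq> w' \<or> w' \<subseteq> w" if "f t w \<noteq> 0" "f t w' \<noteq> 0"
      using comp * that by blast
  next
    show "sum (f t) (set l) = 1"
      using t len unfolding f_def sum_indicator_nth by (simp add: standard_simplex_def lessThan_Suc_atMost)
  qed
  moreover have "affine_simplex l = restrict f (standard_simplex p)"
    by (simp add: affine_simplex_def f_def len)
  moreover have "continuous_map (subtopology (powertop_real UNIV) (standard_simplex p)) (powertop_real UNIV) f"
    unfolding f_def continuous_map_componentwise_UNIV
    by (intro allI continuous_map_sum) (auto intro: continuous_map_from_subtopology continuous_map_product_projection)
  ultimately show ?thesis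
    using realization_points_mono[OF sub]
    by (auto simp: singular_simplex_def polyhedron_def continuous_map_in_subtopology)
qed

lemma singular_chain_realize:
  assumes "keys z \<subseteq> flags p S"
  shows "singular_chain p (polyhedron S) (realize z)"
  using assms
  by (induction z rule: frag_induction)
     (auto simp: realize_diff singular_chain_diff singular_chain_of singular_simplex_affine)

lemma lookup_frag_extend_inj:
  assumes "inj_on f A" "keys z \<subseteq> A" "a \<in> A"
  shows "Poly_Mapping.lookup (frag_map f z) (f a) = Poly_Mapping.lookup z a"
  using assms(2)
proof (induction z rule: frag_induction)
  case (one x) thus ?case using assms by (auto dest: inj_onD)
qed (auto simp: frag_extend_diff lookup_minus)

lemma frag_extend_inj_eq_0:
  assumes "inj_on f A" "keys z \<subseteq> A" "frag_map f z = 0"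
  shows "z = 0"
proof (rule poly_mapping_eqI)
  fix a show "Poly_Mapping.lookup z a = Poly_Mapping.lookup 0 a"
    using lookup_frag_extend_inj[OF assms(1,2), of a] assms(2,3)
    by (cases "a \<in> A") (auto simp: in_keys_iff)
qed

text \<open>A vertex of the standard simplex is sent to a vertex of the flag, so evaluation there
  recovers the list entry by entry. Hence \<open>realize\<close> is injective on flag chains, and a
  flag chain is a cycle as soon as its realization is one.\<close>

lemma inj_on_affine_simplex: "inj_on affine_simplex (flags p S)"
proof
  fix l l' assume l: "l \<in> flags p S" and l': "l' \<in> flags p S" and eq: "affine_simplex l = affine_simplex l'"
  have len: "length l = Suc p" "length l' = Suc p" using l l' by (auto simp: flags_def)
  show "l = l'"
  proof (rule nth_equalityI)
    fix i assume i: "i < length l"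
    let ?e = "\<lambda>j. if j = i then 1 else (0::real)"
    have "(\<lambda>w. if w = l ! i then 1 else (0::real)) = (\<lambda>w. if w = l' ! i then 1 else 0)"
      using affine_simplex_vertex[of i l] affine_simplex_vertex[of i l'] i len eq
        flags_distinct[OF l] flags_distinct[OF l'] by simp
    thus "l ! i = l' ! i" by (metis zero_neq_one)
  qed (simp add: len)
qed

lemma realize_eq_0: "keys z \<subseteq> flags p S \<Longrightarrow> realize z = 0 \<Longrightarrow> z = 0"
  using frag_extend_inj_eq_0[OF inj_on_affine_simplex] unfolding realize_def by blast

section \<open>Homotopies along line segments, and cones\<close>

lemma homotopic_polyhedron:
  assumes f: "continuous_map Y (polyhedron S) f" and g: "continuous_map Y (polyhedron S) g"
    and *: "\<And>x t. x \<in> topspace Y \<Longrightarrow> 0 \<le> t \<Longrightarrow> t \<le> 1 \<Longrightarrow>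
       (\<lambda>w. (1 - t) * f x w + t * g x w) \<in> realization_points S"
  shows "homotopic_with (\<lambda>h. h \<in> {} \<rightarrow> {}) Y (polyhedron S) f g"
proof -
  let ?h = "\<lambda>z w. (1 - fst z) * f (snd z) w + fst z * g (snd z) w"
  let ?P = "prod_topology (top_of_set {0..1::real}) Y"
  have cf: "continuous_map ?P euclideanreal (\<lambda>z. f (snd z) w)" for w
    using continuous_map_compose[OF continuous_map_snd, of Y "euclideanreal" "\<lambda>x. f x w" "top_of_set {0..1::real}"] f
    by (simp add: polyhedron_def continuous_map_in_subtopology continuous_map_componentwise_UNIV o_def)
  have cg: "continuous_map ?P euclideanreal (\<lambda>z. g (snd z) w)" for w
    using continuous_map_compose[OF continuous_map_snd, of Y "euclideanreal" "\<lambda>x. g x w" "top_of_set {0..1::real}"] g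
    by (simp add: polyhedron_def continuous_map_in_subtopology continuous_map_componentwise_UNIV o_def)
  have c1: "continuous_map ?P euclideanreal fst"
    using continuous_map_fst[of "top_of_set {0..1::real}" Y] continuous_map_into_fulltopology by blast
  have "continuous_map ?P (powertop_real UNIV) ?h"
    unfolding continuous_map_componentwise_UNIV
    by (intro allI continuous_map_add continuous_map_real_mult continuous_map_diff cf cg c1) auto
  hence "continuous_map ?P (polyhedron S) ?h"
    using * by (auto simp: polyhedron_def continuous_map_in_subtopology topspace_prod_topology)
  thus ?thesis
    unfolding homotopic_with_def by (intro exI[of _ ?h]) auto
qed

lemma homologous_rel_polyhedron:
  assumes f: "continuous_map (polyhedron S) (polyhedron S) f"
    and *: "\<And>x t. x \<in> realization_points S \<Longrightarrow> 0 \<le> t \<Longrightarrow> t \<le> 1 \<Longrightarrow>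
       (\<lambda>w. (1 - t) * x w + t * f x w) \<in> realization_points S"
    and c: "singular_relcycle p (polyhedron S) {} c"
  shows "singular_relboundary p (polyhedron S) {} (c - chain_map p f c)"
proof -
  have "homotopic_with (\<lambda>h. h \<in> {} \<rightarrow> {}) (polyhedron S) (polyhedron S) id f"
    using * by (intro homotopic_polyhedron f) auto
  from homotopic_imp_homologous_rel_chain_maps[OF this c]
  show ?thesis using c
    by (metis homologous_rel_def chain_map_ident singular_cycle)
qed

definition vertex_point :: "'v \<Rightarrow> 'v \<Rightarrow> real" where
  "vertex_point v = (\<lambda>w. if w = v then 1 else 0)"

text \<open>The vertex v lies below all of T, so adding it to a chain of T gives a chain again; the
  complex is a cone, and every segment towards its apex stays inside.\<close>

lemma cone_homotopy:
  assumes "finite T" "\<And>w. w \<in> T \<Longrightarrow> v \<subset> w" "x \<in> realization_points (insert v T)" "0 \<le> t" "t \<le> 1"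
  shows "(\<lambda>w. (1 - t) * x w + t * vertex_point v w) \<in> realization_points (insert v T)"
proof -
  have vT: "v \<notin> T" using assms(2) by blast
  have x: "\<And>w. 0 \<le> x w" "\<And>w. x w \<noteq> 0 \<Longrightarrow> w \<in> insert v T"
     "\<And>w w'. x w \<noteq> 0 \<Longrightarrow> x w' \<noteq> 0 \<Longrightarrow> w \<subseteq> w' \<or> w' \<subseteq> w" "sum x (insert v T) = 1"
    using assms(1,3) by (auto simp: realization_points_iff)
  have "(\<Sum>w\<in>insert v T. (1 - t) * x w + t * vertex_point v w) = (1-t) * sum x (insert v T) + t * sum (vertex_point v) (insert v T)"
    by (simp only: sum.distrib sum_distrib_left)
  moreover have "sum (vertex_point v) (insert v T) = 1"
    using assms(1) by (simp add: vertex_point_def sum.delta)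
  ultimately have s: "(\<Sum>w\<in>insert v T. (1 - t) * x w + t * vertex_point v w) = 1" using x(4) by simp
  have n: "w = v \<or> x w \<noteq> 0" if "(1 - t) * x w + t * vertex_point v w \<noteq> 0" for w
    using that by (auto simp: vertex_point_def split: if_splits)
  have vle: "v \<subseteq> w" if "w = v \<or> x w \<noteq> 0" for w using x(2)[of w] assms(2) that by blast
  show ?thesis
    unfolding realization_points_iff[OF finite.insertI[OF assms(1)]]
  proof (intro conjI allI impI)
    show "0 \<le> (1 - t) * x w + t * vertex_point v w" for w
      using x(1) assms by (simp add: vertex_point_def)
    show "w \<in> insert v T" if "(1 - t) * x w + t * vertex_point v w \<noteq> 0" for w
      using n[OF that] x(2) by blast
    show "w \<subseteq> w' \<or> w' \<subseteq> w" if "(1 - t) * x w + t * vertex_point v w \<noteq> 0"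
       "(1 - t) * x w' + t * vertex_point v w' \<noteq> 0" for w w'
      using n[OF that(1)] n[OF that(2)] vle[of w] vle[of w'] x(3) by blast
    show "(\<Sum>w\<in>insert v T. (1 - t) * x w + t * vertex_point v w) = 1" by (rule s)
  qed
qed

text \<open>The two halves of the comparison between simplicial and singular homology in degree p.
  They are separate predicates because the Mayer-Vietoris induction uses them for different
  subcomplexes and in different degrees.\<close>

definition simplicial_surj :: "nat \<Rightarrow> 'a set set \<Rightarrow> bool" where
  "simplicial_surj p S \<longleftrightarrow> (\<forall>c. singular_relcycle p (polyhedron S) {} c \<longrightarrow>
     (\<exists>z. keys z \<subseteq> flags p S \<and> singular_relboundary p (polyhedron S) {} (c - realize z)))"

definition simplicial_inj :: "nat \<Rightarrow> 'a set set \<Rightarrow> bool" where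
  "simplicial_inj p S \<longleftrightarrow> (\<forall>z. keys z \<subseteq> flags p S \<longrightarrow>
     singular_relboundary p (polyhedron S) {} (realize z) \<longrightarrow>
     (\<exists>y. keys y \<subseteq> flags (Suc p) S \<and> flag_boundary (Suc p) y = z))"

lemma flag_boundary_eq_0:
  assumes "keys z \<subseteq> flags p S" "chain_boundary p (realize z) = 0"
  shows "flag_boundary p z = 0"
proof (cases p)
  case 0 thus ?thesis by (simp add: flag_boundary_def)
next
  case (Suc q)
  thus ?thesis
    using assms chain_boundary_realize[OF assms(1)] flag_boundary_keys[of z q S] realize_eq_0 by metis
qed

lemma vertex_point_in: "v \<in> S \<Longrightarrow> vertex_point v \<in> realization_points S"
proof -
  assume "v \<in> S"
  moreover have "vertex_point v \<in> realization_points {v}"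
    by (subst realization_points_iff) (auto simp: vertex_point_def split: if_splits)
  ultimately show ?thesis using realization_points_mono[of "{v}" S] by auto
qed

lemma continuous_vertex:
  assumes "v \<in> S" shows "continuous_map Y (polyhedron S) (\<lambda>x. vertex_point v)"
  using vertex_point_in[OF assms] by simp

lemma affine_simplex_single: "affine_simplex [v] = restrict (\<lambda>t. vertex_point v) (standard_simplex 0)"
  by (auto simp: affine_simplex_def vertex_point_def standard_simplex_0 fun_eq_iff restrict_def)

text \<open>Contracting to the apex moves a cycle into a one-point space, where cycles of positive
  degree bound and a 0-chain is a multiple of the point.\<close>

lemma cone_chain:
  assumes T: "finite T" "\<And>w. w \<in> T \<Longrightarrow> v \<subset> w"
    and c: "singular_relcycle p (polyhedron (insert v T)) {} c"
  shows "if p = 0 then \<exists>m. singular_relboundary p (polyhedron (insert v T)) {} (c - frag_cmul m (realize (frag_of [v])))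
         else singular_relboundary p (polyhedron (insert v T)) {} c"
proof -
  let ?X = "polyhedron (insert v T)" and ?e = "vertex_point v"
  have hom: "singular_relboundary p ?X {} (c - chain_map p (\<lambda>x. ?e) c)"
    using cone_homotopy[OF T] by (intro homologous_rel_polyhedron c continuous_vertex) auto
  have top: "topspace (subtopology ?X {?e}) = {?e}" using vertex_point_in[of v "insert v T"] by simp
  have cyc: "singular_relcycle p (subtopology ?X {?e}) {} (chain_map p (\<lambda>x. ?e) c)"
    by (rule singular_relcycle_chain_map[OF c]) (use top in \<open>auto simp: continuous_map_const\<close>)
  show ?thesis
  proof (cases "p = 0")
    case True
    from cyc obtain m where "chain_map p (\<lambda>x. ?e) c = frag_cmul m (frag_of (restrict (\<lambda>x. ?e) (standard_simplex p)))"
      using singular_chain_singleton[OF top] by (auto simp: singular_cycle)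
    thus ?thesis using True hom by (auto simp: affine_simplex_single)
  next
    case False
    hence "singular_relboundary p (subtopology ?X {?e}) {} (chain_map p (\<lambda>x. ?e) c)"
      using cyc singular_boundary_eq_cycle_singleton[OF top] by simp
    hence "singular_relboundary p ?X {} (chain_map p (\<lambda>x. ?e) c)"
      by (auto simp: singular_boundary singular_chain_subtopology)
    with hom False show ?thesis
      using singular_relboundary_add by fastforce
  qed
qed

text \<open>Flags that already begin with v would become degenerate and are sent to 0.\<close>

definition flag_cone :: "'v \<Rightarrow> ('v list \<Rightarrow>\<^sub>0 int) \<Rightarrow> 'v list \<Rightarrow>\<^sub>0 int" where
  "flag_cone v = frag_extend (\<lambda>l. if hd l = v then 0 else frag_of (v # l))"

lemma flag_cone_keys:
  assumes "\<And>w. w \<in> T \<Longrightarrow> v \<subset> w" "keys z \<subseteq> flags p (insert v T)"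
  shows "keys (flag_cone v z) \<subseteq> flags (Suc p) (insert v T)"
  unfolding flag_cone_def
proof (rule keys_frag_extend_subset[OF assms(2)])
  fix l assume l: "l \<in> flags p (insert v T)"
  then obtain x l' where "l = x # l'" by (cases l) (auto simp: flags_def)
  thus "keys (if hd l = v then 0 else frag_of (v # l)) \<subseteq> flags (Suc p) (insert v T)"
    using l assms(1) by (auto simp: flags_def)
qed

lemma flag_boundary_Cons:
  assumes "length l = Suc p"
  shows "flag_boundary (Suc p) (frag_of (v # l)) =
    frag_of l - (\<Sum>k\<le>p. frag_cmul ((-1) ^ k) (frag_of (v # delete_nth k l)))"
  using assms by (simp add: flag_boundary_def sum.atMost_Suc_shift sum_negf[symmetric] del: sum.atMost_Suc)

text \<open>The usual contracting homotopy. For a flag starting with v the first term is 0 and only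
  the face omitting v survives in the second; for any other flag the first face of its cone is the
  flag itself, and the remaining faces cancel against the second term.\<close>

lemma flag_cone_boundary:
  assumes T: "\<And>w. w \<in> T \<Longrightarrow> v \<subset> w" and "keys z \<subseteq> flags (Suc p) (insert v T)"
  shows "flag_boundary (Suc (Suc p)) (flag_cone v z) + flag_cone v (flag_boundary (Suc p) z) = z"
  using assms(2)
proof (induction z rule: frag_induction)
  case (one l)
  then obtain x l' where l: "l = x # l'" "length l' = Suc p" by (cases l) (auto simp: flags_def)
  have fc: "flag_cone v (\<Sum>k\<le>q. frag_cmul ((-1) ^ k) (frag_of (h k))) =
      (\<Sum>k\<le>q. frag_cmul ((-1) ^ k) (if hd (h k) = v then 0 else frag_of (v # h k)))" for h q
    by (simp add: flag_cone_def frag_extend_sum frag_extend_cmul o_def del: sum.atMost_Suc)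
  show ?case
  proof (cases "x = v")
    case True
    have "hd l' \<noteq> v" using one l True by (cases l') (auto simp: flags_def)
    moreover have "flag_cone v (flag_boundary (Suc p) (frag_of l)) = flag_cone v (frag_of l')
       - flag_cone v (\<Sum>k\<le>p. frag_cmul ((-1) ^ k) (frag_of (v # delete_nth k l')))"
      using l True by (simp add: flag_boundary_Cons) (simp add: flag_cone_def frag_extend_diff)
    ultimately show ?thesis using l True unfolding fc by (simp add: flag_cone_def)
  next
    case False
    have hdk: "hd (delete_nth k l) \<noteq> v" if "k \<le> Suc p" for k
    proof -
      have "delete_nth k l \<noteq> []" using l that by (cases k) (auto simp: delete_nth_def)
      hence "hd (delete_nth k l) \<in> set l" using set_delete_nth[of k l] by (meson hd_in_set subsetD)
      moreover have "v \<notin> set l" using one l False T by (auto simp: flags_def)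
      ultimately show ?thesis by blast
    qed
    have "flag_boundary (Suc p) (frag_of l) = (\<Sum>k\<le>Suc p. frag_cmul ((-1) ^ k) (frag_of (delete_nth k l)))"
      by (simp add: flag_boundary_def del: sum.atMost_Suc)
    hence "flag_cone v (flag_boundary (Suc p) (frag_of l)) = (\<Sum>k\<le>Suc p. frag_cmul ((-1) ^ k) (frag_of (v # delete_nth k l)))"
      using fc[where h = "\<lambda>k. delete_nth k l" and q = "Suc p"] hdk by (simp del: sum.atMost_Suc cong: sum.cong_simp)
    moreover have "flag_cone v (frag_of l) = frag_of (v # l)" using False l by (simp add: flag_cone_def)
    ultimately show ?thesis using flag_boundary_Cons[of l "Suc p" v] l by (simp del: sum.atMost_Suc)
  qed
next
  case (diff a b)
  thus ?case by (simp add: flag_cone_def flag_boundary_diff frag_extend_diff algebra_simps)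
qed (simp add: flag_cone_def)

lemma cone_simplicial:
  assumes T: "finite T" "\<And>w. w \<in> T \<Longrightarrow> v \<subset> w"
  shows "simplicial_surj p (insert v T)" "simplicial_inj p (insert v T)"
proof -
  let ?S = "insert v T"
  have v0: "[v] \<in> flags 0 ?S" by (simp add: flags_def)
  show "simplicial_surj p ?S"
    unfolding simplicial_surj_def
  proof (intro allI impI)
    fix c assume c: "singular_relcycle p (polyhedron ?S) {} c"
    show "\<exists>z. keys z \<subseteq> flags p ?S \<and> singular_relboundary p (polyhedron ?S) {} (c - realize z)"
    proof (cases "p = 0")
      case True
      then obtain m where "singular_relboundary p (polyhedron ?S) {} (c - frag_cmul m (realize (frag_of [v])))"
        using cone_chain[OF T c] by auto
      thus ?thesis using True v0 keys_cmul[of m "frag_of [v]"]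
        by (intro exI[of _ "frag_cmul m (frag_of [v])"]) (auto simp only: realize_cmul keys_frag_of)
    next
      case False
      thus ?thesis using cone_chain[OF T c] by (intro exI[of _ 0]) auto
    qed
  qed
  show "simplicial_inj p ?S"
    unfolding simplicial_inj_def
  proof (intro allI impI)
    fix z assume z: "keys z \<subseteq> flags p ?S" and b: "singular_relboundary p (polyhedron ?S) {} (realize z)"
    have cyc: "flag_boundary p z = 0"
      using singular_relboundary_imp_relcycle[OF b] flag_boundary_eq_0[OF z] by (simp add: singular_cycle)
    show "\<exists>y. keys y \<subseteq> flags (Suc p) ?S \<and> flag_boundary (Suc p) y = z"
    proof (cases p)
      case (Suc q)
      have "flag_boundary (Suc p) (flag_cone v z) = z"
        using flag_cone_boundary[of T v z q] T z Suc cyc by (simp add: flag_cone_def)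
      thus ?thesis using flag_cone_keys[OF T(2) z] by blast
    next
      case 0
      define m where "m = frag_extend (\<lambda>l. frag_of (0::nat))"
      have "flag_boundary 1 (flag_cone v z) = z - frag_extend (\<lambda>l. frag_of [v]) z"
        using z unfolding 0
      proof (induction z rule: frag_induction)
        case (one l)
        then obtain x where "l = [x]" by (auto simp: flags_def length_Suc_conv)
        thus ?case by (auto simp: flag_cone_def flag_boundary_def delete_nth_def)
      qed (auto simp: flag_cone_def flag_boundary_diff frag_extend_diff)
      \<comment> \<open>This chain is the augmentation of z times the vertex [v]. It vanishes
        because z bounds a singular chain and the two ends of a singular edge carry opposite
        signs.\<close>
      moreover have "frag_extend (\<lambda>l. frag_of [v]) z = 0"
      proof -
        obtain d where d: "singular_chain 1 (polyhedron ?S) d" "chain_boundary 1 d = realize z"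
          using b 0 by (auto simp: singular_boundary)
        have "frag_extend (\<lambda>f. frag_of [v]) (chain_boundary 1 d) = 0"
          using d(1) unfolding singular_chain_def
          by (induction d rule: frag_induction)
             (auto simp: chain_boundary_of chain_boundary_diff frag_extend_diff frag_extend_add frag_extend_minus)
        moreover have "frag_extend (\<lambda>f. frag_of [v]) (realize z) = frag_extend (\<lambda>l. frag_of [v]) z"
          unfolding realize_def using frag_extend_compose[of "\<lambda>f. frag_of [v]" affine_simplex z] by (simp add: o_def)
        ultimately show ?thesis using d by simp
      qed
      ultimately show ?thesis using flag_cone_keys[OF T(2) z] 0 by auto
    qed
  qed
qed

text \<open>This map sends the open set \<open>x v < 1/2\<close> into the subcomplex without \<open>v\<close> and the open set
  \<open>x v > 0\<close> into the star of \<open>v\<close>, and is homotopic to the identity. With barycentric subdivision it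
  replaces Mayer-Vietoris for the decomposition into these two subcomplexes.\<close>

definition push :: "'v \<Rightarrow> ('v \<Rightarrow> real) \<Rightarrow> 'v \<Rightarrow> real" where
  "push v x = (\<lambda>w. x w / max (1 - x v) (1/2) + (1 - 1 / max (1 - x v) (1/2)) * vertex_point v w)"

text \<open>The scaling is chosen so that a v-coordinate of at most 1/2 becomes 0 while the vertex v
  itself stays fixed.\<close>

lemma push_v: "x v \<le> 1 \<Longrightarrow> push v x v = max 0 (2 * x v - 1)"
  by (auto simp: push_def vertex_point_def max_def field_simps)

lemma push_other: "w \<noteq> v \<Longrightarrow> push v x w = x w / max (1 - x v) (1/2)"
  by (simp add: push_def vertex_point_def)

lemma realization_point_le_1:
  assumes "finite S" "x \<in> realization_points S" shows "x w \<le> 1"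
proof (cases "w \<in> S")
  case True
  have "x w \<le> sum x S" using assms True by (intro member_le_sum) (auto simp: realization_points_iff)
  thus ?thesis using assms by (simp add: realization_points_iff)
next
  case False
  hence "x w = 0" using assms unfolding realization_points_iff[OF assms(1)] by blast
  thus ?thesis by simp
qed

text \<open>A point y whose support lies in that of x belongs to the closed simplex of x, which is
  convex. This is applied to \<open>push\<close>, which never enlarges supports.\<close>

lemma convex_comb_realization:
  assumes "finite S" "x \<in> realization_points S" "0 \<le> t" "t \<le> 1"
    and y: "\<And>w. 0 \<le> y w" "\<And>w. x w = 0 \<Longrightarrow> y w = 0" "sum y S = 1"
  shows "(\<lambda>w. (1 - t) * x w + t * y w) \<in> realization_points S"
proof -
  have x: "\<And>w. 0 \<le> x w" "\<And>w. x w \<noteq> 0 \<Longrightarrow> w \<in> S"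
     "\<And>w w'. x w \<noteq> 0 \<Longrightarrow> x w' \<noteq> 0 \<Longrightarrow> w \<subseteq> w' \<or> w' \<subseteq> w" "sum x S = 1"
    using assms(1,2) by (auto simp: realization_points_iff)
  have n: "x w \<noteq> 0" if "(1 - t) * x w + t * y w \<noteq> 0" for w using that y(2) by auto
  have "(\<Sum>w\<in>S. (1 - t) * x w + t * y w) = (1-t) * sum x S + t * sum y S"
    by (simp only: sum.distrib sum_distrib_left)
  thus ?thesis
    using x y n assms(3,4) unfolding realization_points_iff[OF assms(1)] by auto
qed

lemma push_props:
  assumes "finite S" "v \<in> S" "x \<in> realization_points S"
  shows "\<And>w. 0 \<le> push v x w" "\<And>w. x w = 0 \<Longrightarrow> push v x w = 0" "sum (push v x) S = 1"
proof -
  have x: "\<And>w. 0 \<le> x w" "sum x S = 1" using assms by (auto simp: realization_points_iff)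
  have x1: "x v \<le> 1" using realization_point_le_1[OF assms(1,3)] .
  show "0 \<le> push v x w" for w
    using x x1 push_v[of x v] push_other[of w v x] by (cases "w = v") auto
  show "push v x w = 0" if "x w = 0" for w
    using push_v[of x v] push_other[of w v x] that by (cases "w = v") auto
  have "sum (push v x) S = sum x S / max (1 - x v) (1/2) + (1 - 1 / max (1 - x v) (1/2)) * sum (vertex_point v) S"
    by (simp add: push_def sum.distrib sum_divide_distrib sum_distrib_left)
  moreover have "sum (vertex_point v) S = 1" using assms by (simp add: vertex_point_def sum.delta)
  ultimately show "sum (push v x) S = 1" using x by simp
qed

lemma push_in: "finite S \<Longrightarrow> v \<in> S \<Longrightarrow> x \<in> realization_points S \<Longrightarrow> push v x \<in> realization_points S"
  using convex_comb_realization[of S x 1 "push v x"] push_props[of S v x] by simp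

lemma push_id: "x v = 0 \<Longrightarrow> push v x = x"
  by (auto simp: push_def)

lemma continuous_push:
  assumes "finite S" "v \<in> S"
  shows "continuous_map (polyhedron S) (polyhedron S) (push v)"
proof -
  have c: "continuous_map (polyhedron S) euclideanreal (\<lambda>x. x w)" for w
    unfolding polyhedron_def by (auto intro: continuous_map_from_subtopology continuous_map_product_projection)
  have m: "continuous_map (polyhedron S) euclideanreal (\<lambda>x. max (1 - x v) (1/2))"
    by (intro continuous_map_real_max continuous_map_diff c) auto
  have nz: "max (1 - x v) (1/2) \<noteq> 0" for x :: "'a set \<Rightarrow> real" by (simp add: max_def)
  have "continuous_map (polyhedron S) (powertop_real UNIV) (push v)"
    unfolding continuous_map_componentwise_UNIV push_def
    by (intro allI continuous_map_add continuous_map_real_mult continuous_map_diff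
        continuous_map_real_divide c m nz) auto
  thus ?thesis using push_in[OF assms] by (auto simp: polyhedron_def continuous_map_in_subtopology)
qed

section \<open>Deleting a minimal vertex: Mayer-Vietoris on the level of chains\<close>

lemma chain_identity:
  fixes a :: "'c::ab_group_add"
  assumes "a = s + t" "h + k = s - x" "h' + k' = y - x'" "k + k' = 0" "b = y - t"
  shows "a - h + (b - h') = x + x'"
proof -
  have "h = s - x - k" "h' = y - x' + k"
    using assms(2,3,4) by (auto simp: eq_diff_eq add_eq_0_iff2 diff_eq_eq)
  thus ?thesis using assms(1,5) by simp
qed

text \<open>Minimality of v makes its star the cone \<open>insert v T\<close> over its link T:
  everything comparable to v lies above it. The complex is the union of this cone and of the
  subcomplex L, meeting exactly in T, and both L and T have fewer vertices than S.\<close>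

locale minimal_vertex =
  fixes S :: "'a set set" and v
  assumes fin: "finite S" and v: "v \<in> S" and min: "\<And>w. w \<in> S \<Longrightarrow> \<not> w \<subset> v"
begin

definition "L = S - {v}"
definition "T = {w \<in> S. v \<subset> w}"

lemma finT: "finite T" and finL: "finite L" and vT: "w \<in> T \<Longrightarrow> v \<subset> w" and TL: "T \<subseteq> L" and LS: "L \<subseteq> S"
  and TS: "insert v T \<subseteq> S"
  using fin v by (auto simp: T_def L_def)

lemma realization_L:
  assumes "x \<in> realization_points S" "x v = 0" shows "x \<in> realization_points L"
proof -
  have "sum x S = x v + sum x L" unfolding L_def using fin v by (simp add: sum.remove)
  thus ?thesis using assms unfolding realization_points_iff[OF fin] realization_points_iff[OF finL]
    by (auto simp: L_def)
qed

lemma realization_star: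
  assumes "x \<in> realization_points S" "x v \<noteq> 0" shows "x \<in> realization_points (insert v T)"
proof -
  have x: "\<And>w. 0 \<le> x w" "\<And>w. x w \<noteq> 0 \<Longrightarrow> w \<in> S"
     "\<And>w w'. x w \<noteq> 0 \<Longrightarrow> x w' \<noteq> 0 \<Longrightarrow> w \<subseteq> w' \<or> w' \<subseteq> w" "sum x S = 1"
    using assms(1) fin by (auto simp: realization_points_iff)
  have in_star: "w \<in> insert v T" if "x w \<noteq> 0" for w
    using x(2)[OF that] x(3)[OF that assms(2)] min[of w] by (auto simp: T_def)
  have "sum x S = sum x (insert v T)"
    using fin TS in_star by (intro sum.mono_neutral_right) auto
  thus ?thesis using x in_star finT by (auto simp: realization_points_iff)
qed

lemma realization_L_0: "x \<in> realization_points L \<Longrightarrow> x v = 0"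
  unfolding realization_points_iff[OF finL] by (auto simp: L_def)

lemma realization_link:
  assumes "x \<in> realization_points L" "x \<in> realization_points (insert v T)"
  shows "x \<in> realization_points T"
proof -
  have "x v = 0" using assms(1) unfolding realization_points_iff[OF finL] by (auto simp: L_def)
  moreover have "sum x (insert v T) = x v + sum x T" using finT vT by (subst sum.insert) auto
  ultimately show ?thesis using assms(2) finT unfolding realization_points_iff[OF finT]
    realization_points_iff[OF finite.insertI[OF finT]] by auto
qed

lemma singular_chain_link:
  assumes "singular_chain p (polyhedron L) c" "singular_chain p (polyhedron (insert v T)) c"
  shows "singular_chain p (polyhedron T) c"
proof -
  have "singular_simplex p (polyhedron T) f"
    if "singular_simplex p (polyhedron L) f" "singular_simplex p (polyhedron (insert v T)) f" for f
    using that realization_link unfolding polyhedron_def singular_simplex_subtopology by blast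
  thus ?thesis using assms unfolding singular_chain_def by blast
qed

text \<open>By minimality, the other members of a flag through v all lie above v.\<close>

lemma flags_split: "flags p S \<subseteq> flags p L \<union> flags p (insert v T)"
proof
  fix l assume l: "l \<in> flags p S"
  show "l \<in> flags p L \<union> flags p (insert v T)"
  proof (cases "v \<in> set l")
    case False thus ?thesis using l by (auto simp: flags_def L_def)
  next
    case True
    have "w = v \<or> v \<subset> w" if "w \<in> set l" for w
    proof -
      have ss: "sorted_wrt (\<subset>) l" using l by (simp add: flags_def)
      have "w = v \<or> v \<subset> w \<or> w \<subset> v" using ss True that by (induction l) auto
      thus ?thesis using min that l by (auto simp: flags_def)
    qed
    thus ?thesis using l by (auto simp: flags_def T_def)
  qed
qed

lemma flags_link: "l \<in> flags p L \<Longrightarrow> l \<in> flags p (insert v T) \<Longrightarrow> l \<in> flags p T"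
  by (auto simp: flags_def L_def)

lemma chain_map_push_L:
  "singular_chain p (polyhedron L) c \<Longrightarrow> chain_map p (push v) c = c"
  by (rule chain_map_id_gen, assumption) (simp add: push_id realization_L_0)

lemma push_star: "x \<in> realization_points (insert v T) \<Longrightarrow> push v x \<in> realization_points (insert v T)"
  using push_in[of "insert v T" v x] finT by simp

text \<open>Iterated subdivision makes every simplex small for the open cover by x v < 1/2 and x v >
  0; the first set is pushed into L, the second into the star.\<close>

lemma push_split:
  assumes "singular_chain p (polyhedron S) c"
  obtains m a b where "singular_chain p (polyhedron L) a" "singular_chain p (polyhedron (insert v T)) b"
    "chain_map p (push v) ((singular_subdivision p ^^ m) c) = a + b"
proof -
  let ?Y = "polyhedron S"
  have c: "continuous_map ?Y euclideanreal (\<lambda>x. x v)"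
    unfolding polyhedron_def by (auto intro: continuous_map_from_subtopology continuous_map_product_projection)
  let ?A = "{x \<in> topspace ?Y. x v \<in> {..<1/2}}" and ?B = "{x \<in> topspace ?Y. x v \<in> {0<..}}"
  have A: "openin ?Y ?A" "openin ?Y ?B"
    by (rule openin_continuous_map_preimage[OF c], force)+
  have AB: "openin ?Y U" if "U \<in> {?A, ?B}" for U using A that by blast
  have cov: "topspace ?Y \<subseteq> \<Union>{?A, ?B}" by auto
  obtain m where "\<forall>k\<ge>m. \<forall>f \<in> keys ((singular_subdivision p ^^ k) c).
      \<exists>V \<in> {?A, ?B}. f \<in> (standard_simplex p) \<rightarrow> V"
  proof (rule sufficient_iterated_singular_subdivision_exists[OF AB cov assms])
    fix n assume *: "\<And>m f. n \<le> m \<Longrightarrow> f \<in> keys ((singular_subdivision p ^^ m) c) \<Longrightarrow>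
      \<exists>V \<in> {?A, ?B}. f \<in> standard_simplex p \<rightarrow> V"
    show thesis by (intro that[of n] allI impI ballI *)
  qed
  hence m: "f \<in> standard_simplex p \<rightarrow> ?A \<or> f \<in> standard_simplex p \<rightarrow> ?B"
    if "f \<in> keys ((singular_subdivision p ^^ m) c)" for f
    using that by blast
  have ch: "singular_chain p ?Y ((singular_subdivision p ^^ m) c)"
    by (induction m) (auto simp: assms singular_chain_singular_subdivision)
  let ?d = "chain_map p (push v) ((singular_subdivision p ^^ m) c)"
  have pA: "push v x \<in> realization_points L" if "x \<in> ?A" for x
  proof -
    have "x v \<le> 1" "x v < 1/2" using that by auto
    hence "push v x v = 0" using push_v[of x v] by simp
    thus ?thesis using push_in[OF fin v] that realization_L by auto
  qed
  have pB: "push v x \<in> realization_points (insert v T)" if "x \<in> ?B" for x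
    by (rule push_star, rule realization_star) (use that in auto)
  have ks: "keys ?d \<subseteq> singular_simplex_set p (polyhedron L) \<union> singular_simplex_set p (polyhedron (insert v T))"
    unfolding chain_map_def
  proof (rule order_trans[OF keys_frag_extend], rule UN_least)
    fix f assume f: "f \<in> keys ((singular_subdivision p ^^ m) c)"
    hence sf: "singular_simplex p ?Y f" using ch by (auto simp: singular_chain_def)
    hence sp: "singular_simplex p ?Y (simplex_map p (push v) f)"
      using singular_simplex_simplex_map continuous_push[OF fin v] by blast
    from m[OF f] have "simplex_map p (push v) f ` standard_simplex p \<subseteq> realization_points L \<or>
       simplex_map p (push v) f ` standard_simplex p \<subseteq> realization_points (insert v T)"
    proof
      assume "f \<in> standard_simplex p \<rightarrow> ?A"
      hence "push v (f x) \<in> realization_points L" if "x \<in> standard_simplex p" for x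
        using pA that unfolding Pi_iff by blast
      thus ?thesis by (auto simp: simplex_map_def)
    next
      assume "f \<in> standard_simplex p \<rightarrow> ?B"
      hence "push v (f x) \<in> realization_points (insert v T)" if "x \<in> standard_simplex p" for x
        using pB that unfolding Pi_iff by blast
      thus ?thesis by (auto simp: simplex_map_def)
    qed
    hence "singular_simplex p (polyhedron L) (simplex_map p (push v) f) \<or>
        singular_simplex p (polyhedron (insert v T)) (simplex_map p (push v) f)"
      using sp by (auto simp: polyhedron_def singular_simplex_subtopology)
    thus "keys ((frag_of \<circ> simplex_map p (push v)) f) \<subseteq> singular_simplex_set p (polyhedron L) \<union> singular_simplex_set p (polyhedron (insert v T))"
      by auto
  qed
  obtain a b where "keys a \<subseteq> singular_simplex_set p (polyhedron L)"
     "keys b \<subseteq> singular_simplex_set p (polyhedron (insert v T))" "a + b = ?d"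
    using frag_split[OF ks] by metis
  thus thesis by (intro that[of a b m]) (simp_all add: singular_chain_def)
qed

text \<open>Each point and its image under \<open>push\<close> lie in a common simplex, so
  \<open>push\<close> is homotopic to the identity both on S and on the star.\<close>

lemma push_homologous:
  assumes "U = S \<or> U = insert v T" "singular_relcycle p (polyhedron U) {} c"
  shows "singular_relboundary p (polyhedron U) {} (c - chain_map p (push v) c)"
proof (rule homologous_rel_polyhedron[OF _ _ assms(2)])
  have U: "finite U" "v \<in> U" using assms(1) fin finT v by auto
  show "continuous_map (polyhedron U) (polyhedron U) (push v)" by (rule continuous_push[OF U])
  show "(\<lambda>w. (1 - t) * x w + t * push v x w) \<in> realization_points U"
    if "x \<in> realization_points U" "0 \<le> t" "t \<le> 1" for x t
    using convex_comb_realization[of U x t "push v x"] push_props[of U v x] U that by auto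
qed

text \<open>Neither subdivision nor \<open>push\<close> changes the homology class of a cycle, so
  \<open>push_split\<close> yields a splitting up to a boundary.\<close>

lemma mayer_vietoris_cycle:
  assumes c: "singular_relcycle p (polyhedron S) {} c"
  obtains a b where "singular_chain p (polyhedron L) a" "singular_chain p (polyhedron (insert v T)) b"
    "singular_relboundary p (polyhedron S) {} (c - (a + b))"
proof -
  obtain m a b where ab: "singular_chain p (polyhedron L) a" "singular_chain p (polyhedron (insert v T)) b"
    "chain_map p (push v) ((singular_subdivision p ^^ m) c) = a + b"
    using push_split c by (metis singular_cycle)
  have "homologous_rel p (polyhedron S) {} c ((singular_subdivision p ^^ m) c) \<and>
      singular_relcycle p (polyhedron S) {} ((singular_subdivision p ^^ m) c)"
  proof (induction m)
    case 0 thus ?case by (simp add: c)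
  next
    case (Suc m)
    thus ?case
      by simp (metis homologous_rel_eq homologous_rel_singular_subdivision homologous_rel_singular_relcycle)
  qed
  hence 1: "singular_relboundary p (polyhedron S) {} (c - (singular_subdivision p ^^ m) c)"
    and 2: "singular_relboundary p (polyhedron S) {} ((singular_subdivision p ^^ m) c - (a + b))"
    using push_homologous[of S p "(singular_subdivision p ^^ m) c"] ab(3)
    by (auto simp: homologous_rel_def)
  show thesis
    by (rule that[OF ab(1,2)]) (use singular_relboundary_add[OF 1 2] in \<open>simp only: diff_add_cancel add_diff_eq\<close>)
qed

text \<open>Splitting the bounding chain d distorts its boundary, since subdivision and
  \<open>push\<close> act on x0 and x1. The errors are boundaries of chains that live in L and in
  the star separately, so they can be absorbed without losing the splitting.\<close>

lemma mayer_vietoris_boundary: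
  assumes d: "singular_chain (Suc p) (polyhedron S) d" and dx: "chain_boundary (Suc p) d = x0 + x1"
    and x0: "singular_chain p (polyhedron L) x0" and x1: "singular_chain p (polyhedron (insert v T)) x1"
  obtains a b where "singular_chain (Suc p) (polyhedron L) a" "singular_chain (Suc p) (polyhedron (insert v T)) b"
    "chain_boundary (Suc p) (a + b) = x0 + x1"
proof -
  obtain m a b where ab: "singular_chain (Suc p) (polyhedron L) a" "singular_chain (Suc p) (polyhedron (insert v T)) b"
    "chain_map (Suc p) (push v) ((singular_subdivision (Suc p) ^^ m) d) = a + b"
    using push_split d by metis
  obtain h where h: "\<And>p. h p 0 = (0 :: ('a set \<Rightarrow> real) chain)"
        "\<And>p c1 c2. h p (c1-c2) = h p c1 - h p c2"
        "\<And>p Y c. singular_chain p Y c \<Longrightarrow> singular_chain (Suc p) Y (h p c)"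
        "\<And>p Y c. singular_chain p Y c
                 \<Longrightarrow> chain_boundary (Suc p) (h p c) + h (p - Suc 0) (chain_boundary p c)
                   = (singular_subdivision p ^^ m) c - c"
    using chain_homotopic_iterated_singular_subdivision[of m] by metis
  let ?sd = "\<lambda>p. singular_subdivision p ^^ m"
  have hadd: "h q (c1 + c2) = h q c1 + h q c2" for q c1 c2
    using h(1)[of q] h(2)[of q c1 "- c2"] h(2)[of q 0 c2] by simp
  have sdadd: "?sd q (c1 + c2) = ?sd q c1 + ?sd q c2" for q and c1 c2 :: "('a set \<Rightarrow> real) chain"
    by (induction m) (auto simp: singular_subdivision_add)
  have sdc: "singular_chain q Y c \<Longrightarrow> singular_chain q Y (?sd q c)" for q Y and c :: "('a set \<Rightarrow> real) chain"
    by (induction m) (auto simp: singular_chain_singular_subdivision)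
  have sdb: "singular_chain q Y c \<Longrightarrow> chain_boundary q (?sd q c) = (singular_subdivision (q - Suc 0) ^^ m) (chain_boundary q c)"
    for q Y and c :: "('a set \<Rightarrow> real) chain"
  proof (induction m)
    case (Suc m)
    have "singular_chain q Y ((singular_subdivision q ^^ m) c)"
      using Suc.prems by (induction m) (auto simp: singular_chain_singular_subdivision)
    thus ?case using Suc by (simp add: chain_boundary_singular_subdivision)
  qed auto
  have bb: "chain_boundary p x0 + chain_boundary p x1 = 0"
    using chain_boundary_boundary[OF d] dx by (simp add: chain_boundary_add)
  define y where "y = ?sd p x1"
  have y: "singular_chain p (polyhedron (insert v T)) y" by (simp add: y_def sdc x1)
  have py: "singular_chain p (polyhedron (insert v T)) (chain_map p (push v) y)"
    using singular_chain_chain_map[OF y] continuous_push[of "insert v T" v] finT by simp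
  \<comment> \<open>In positive degree y and its image under \<open>push\<close> have the same
    boundary: it is minus the boundary coming from x0, so it lies in L, where \<open>push\<close> is
    the identity. Their difference is a cycle in a cone.\<close>
  have "singular_relboundary p (polyhedron (insert v T)) {} (y - chain_map p (push v) y)"
  proof (cases "p = 0")
    case True
    thus ?thesis using push_homologous[of "insert v T" p y] y by (simp add: singular_cycle chain_boundary_def)
  next
    case False
    have "chain_boundary p y = - ?sd (p - Suc 0) (chain_boundary p x0)"
    proof -
      have "chain_boundary p y = ?sd (p - Suc 0) (chain_boundary p x1)" unfolding y_def by (rule sdb[OF x1])
      moreover have "?sd (p - Suc 0) (chain_boundary p x0 + chain_boundary p x1) = 0" unfolding bb by simp
      ultimately show ?thesis unfolding sdadd by (simp add: eq_neg_iff_add_eq_0 add.commute)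
    qed
    hence "singular_chain (p - Suc 0) (polyhedron L) (chain_boundary p y)"
      using sdc singular_chain_boundary[OF x0] by (simp add: singular_chain_minus)
    hence "chain_boundary p (chain_map p (push v) y) = chain_boundary p y"
      using chain_boundary_chain_map[OF y, of "push v"] chain_map_push_L by simp
    hence "singular_relcycle p (polyhedron (insert v T)) {} (y - chain_map p (push v) y)"
      using y py by (simp add: singular_cycle singular_chain_diff chain_boundary_diff)
    thus ?thesis using cone_chain[OF finT vT] False by fastforce
  qed
  then obtain b' where b': "singular_chain (Suc p) (polyhedron (insert v T)) b'"
     "chain_boundary (Suc p) b' = y - chain_map p (push v) y"
    by (auto simp: singular_boundary)
  have "chain_boundary (Suc p) (a + b) = chain_map p (push v) (?sd p (x0 + x1))"
    unfolding ab(3)[symmetric]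
    using chain_boundary_chain_map[OF sdc[OF d], of "push v"] sdb[OF d] dx by simp
  also have "\<dots> = ?sd p x0 + chain_map p (push v) y"
    unfolding sdadd chain_map_add y_def using chain_map_push_L[OF sdc[OF x0]] by simp
  finally have 1: "chain_boundary (Suc p) (a + b) = ?sd p x0 + chain_map p (push v) y" .
  have 2: "chain_boundary (Suc p) (h p x0) + h (p - Suc 0) (chain_boundary p x0) = ?sd p x0 - x0"
    "chain_boundary (Suc p) (h p x1) + h (p - Suc 0) (chain_boundary p x1) = y - x1"
    unfolding y_def by (rule h(4)[OF x0], rule h(4)[OF x1])
  have 3: "h (p - Suc 0) (chain_boundary p x0) + h (p - Suc 0) (chain_boundary p x1) = 0"
    unfolding hadd[symmetric] bb h(1) ..
  \<comment> \<open>The subdivision homotopy h is subtracted on x0 and x1 separately, which keeps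
    the pieces apart; its lower terms cancel because x0 + x1 is a boundary and hence closed.\<close>
  have "chain_boundary (Suc p) ((a - h p x0) + (b + b' - h p x1)) = x0 + x1"
    using chain_identity[OF 1 2 3 b'(2)] by (simp add: chain_boundary_add chain_boundary_diff algebra_simps)
  thus thesis
    using that[of "a - h p x0" "b + b' - h p x1"] ab b' h(3) x0 x1
    by (simp add: singular_chain_diff singular_chain_add)
qed

end

context minimal_vertex begin

text \<open>A diagram chase in the Mayer-Vietoris sequence: the common boundary of a and b in the
  link is made simplicial, filled by flag chains in L and in the star, and the closed remainders are
  treated in each piece.\<close>

lemma surj_step:
  assumes IH: "\<And>p. simplicial_surj p L" "\<And>p. simplicial_inj p L" "\<And>p. simplicial_surj p T"
  shows "simplicial_surj p S"
  unfolding simplicial_surj_def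
proof (intro allI impI)
  let ?st = "insert v T"
  have Cs: "simplicial_surj q ?st" "simplicial_inj q ?st" for q
    using cone_simplicial[OF finT vT] by auto
  fix c assume c: "singular_relcycle p (polyhedron S) {} c"
  obtain a b where a: "singular_chain p (polyhedron L) a" and b: "singular_chain p (polyhedron ?st) b"
    and ab: "singular_relboundary p (polyhedron S) {} (c - (a + b))"
    using mayer_vietoris_cycle[OF c] .
  have mono: "singular_relboundary p (polyhedron S) {} x"
    if "singular_relboundary p (polyhedron U) {} x" "U = L \<or> U = ?st" for U x
    using that LS TS singular_chain_polyhedron_mono unfolding singular_boundary by blast
  have "\<exists>x0 x1. keys x0 \<subseteq> flags p L \<and> keys x1 \<subseteq> flags p ?st \<and>
     (\<exists>f. singular_chain p (polyhedron T) f \<and>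
      singular_relcycle p (polyhedron L) {} (a + f - realize x0) \<and> singular_relcycle p (polyhedron ?st) {} (b - f - realize x1))"
  proof (cases p)
    case 0
    thus ?thesis using a b by (intro exI[of _ 0] conjI) (simp_all add: singular_cycle chain_boundary_def)
  next
    case (Suc q)
    have "chain_boundary p (c - (a + b)) = 0" using singular_relboundary_imp_relcycle[OF ab] by (simp add: singular_cycle)
    hence bab: "chain_boundary p b = - chain_boundary p a"
      using c by (simp add: singular_cycle chain_boundary_diff chain_boundary_add eq_neg_iff_add_eq_0 add.commute)
    \<comment> \<open>The boundary of b is minus that of a, so it lies in both pieces and therefore
      in the link.\<close>
    define e where "e = chain_boundary p b"
    have e: "singular_chain q (polyhedron T) e"
      using singular_chain_boundary[OF a] singular_chain_boundary[OF b] Suc bab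
      by (intro singular_chain_link) (auto simp: e_def singular_chain_minus)
    have "singular_relcycle q (polyhedron T) {} e"
      using e chain_boundary_boundary_alt[of q "polyhedron ?st" b] b Suc by (simp add: singular_cycle e_def)
    then obtain w where w: "keys w \<subseteq> flags q T" and "singular_relboundary q (polyhedron T) {} (e - realize w)"
      using IH(3) unfolding simplicial_surj_def by blast
    then obtain f where f: "singular_chain p (polyhedron T) f" "chain_boundary p f = e - realize w"
      using Suc by (auto simp: singular_boundary)
    have fL: "singular_chain p (polyhedron L) f" and fst: "singular_chain p (polyhedron ?st) f"
      using f(1) TL singular_chain_polyhedron_mono by blast+
    have wT: "keys w \<subseteq> flags q ?st" "keys (- w) \<subseteq> flags q L"
      using w TL by (auto simp: flags_def)
    have "chain_boundary p (b - f) = realize w" "chain_boundary p (a + f) = realize (- w)"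
      using f(2) bab by (auto simp: chain_boundary_diff chain_boundary_add realize_minus e_def)
    \<comment> \<open>The flag chain w bounds singularly on either side; injectivity for L and for
      the star makes it, up to sign, a simplicial boundary in both.\<close>
    hence "singular_relboundary q (polyhedron ?st) {} (realize w)" "singular_relboundary q (polyhedron L) {} (realize (- w))"
      using a b fL fst Suc unfolding singular_boundary by (metis singular_chain_diff, metis singular_chain_add)
    then obtain x0 x1 where x1: "keys x1 \<subseteq> flags p ?st" "flag_boundary p x1 = w"
      and x0: "keys x0 \<subseteq> flags p L" "flag_boundary p x0 = - w"
      using IH(2)[of q] Cs(2)[of q] wT Suc unfolding simplicial_inj_def by metis
    have "singular_relcycle p (polyhedron L) {} (a + f - realize x0)"
      using a fL singular_chain_realize[OF x0(1)] chain_boundary_realize[OF x0(1)] x0(2) f(2) bab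
      by (simp add: singular_cycle singular_chain_diff singular_chain_add chain_boundary_diff chain_boundary_add realize_minus e_def)
    moreover have "singular_relcycle p (polyhedron ?st) {} (b - f - realize x1)"
      using b fst singular_chain_realize[OF x1(1)] chain_boundary_realize[OF x1(1)] x1(2) f(2)
      by (simp add: singular_cycle singular_chain_diff chain_boundary_diff e_def)
    ultimately show ?thesis using x0 x1 f(1) by blast
  qed
  then obtain x0 x1 f where x: "keys x0 \<subseteq> flags p L" "keys x1 \<subseteq> flags p ?st"
    and cy: "singular_relcycle p (polyhedron L) {} (a + f - realize x0)" "singular_relcycle p (polyhedron ?st) {} (b - f - realize x1)"
    by blast
  obtain y0 where y0: "keys y0 \<subseteq> flags p L" "singular_relboundary p (polyhedron L) {} (a + f - realize x0 - realize y0)"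
    using cy(1) IH(1) unfolding simplicial_surj_def by blast
  obtain y1 where y1: "keys y1 \<subseteq> flags p ?st" "singular_relboundary p (polyhedron ?st) {} (b - f - realize x1 - realize y1)"
    using cy(2) Cs(1) unfolding simplicial_surj_def by blast
  have fl: "flags p L \<subseteq> flags p S" "flags p ?st \<subseteq> flags p S" using LS TS by (auto simp: flags_def)
  have "singular_relboundary p (polyhedron S) {} ((c - (a + b)) + ((a + f - realize x0 - realize y0) + (b - f - realize x1 - realize y1)))"
    by (intro singular_relboundary_add ab) (use mono y0 y1 in blast)+
  also have "(c - (a + b)) + ((a + f - realize x0 - realize y0) + (b - f - realize x1 - realize y1))
      = c - realize (x0 + y0 + (x1 + y1))"
    by (simp add: realize_add)
  finally show "\<exists>z. keys z \<subseteq> flags p S \<and> singular_relboundary p (polyhedron S) {} (c - realize z)"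
    using order_trans[OF x(1) fl(1)] order_trans[OF y0(1) fl(1)] order_trans[OF x(2) fl(2)] order_trans[OF y1(1) fl(2)]
    by (intro exI[of _ "x0 + y0 + (x1 + y1)"] conjI keys_add_subset)
qed

text \<open>The companion chase: z is divided into z0 and z1, and a flag chain t of the link is
  transferred between them so that each part bounds in its own piece.\<close>

lemma inj_step:
  assumes IH: "\<And>p. simplicial_inj p L" "\<And>p. simplicial_surj p T" "\<And>p. simplicial_inj p T"
  shows "simplicial_inj p S"
  unfolding simplicial_inj_def
proof (intro allI impI)
  let ?st = "insert v T"
  have Cs: "simplicial_surj q ?st" "simplicial_inj q ?st" for q
    using cone_simplicial[OF finT vT] by auto
  fix z assume z: "keys z \<subseteq> flags p S" and bz: "singular_relboundary p (polyhedron S) {} (realize z)"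
  obtain z0 z1 where z01: "keys z0 \<subseteq> flags p L" "keys z1 \<subseteq> flags p ?st" "z0 + z1 = z"
    using frag_split[of z "flags p L" "flags p ?st"] z flags_split by (metis order_trans)
  obtain d where d: "singular_chain (Suc p) (polyhedron S) d" "chain_boundary (Suc p) d = realize z0 + realize z1"
    using bz z01(3) by (auto simp: singular_boundary realize_add)
  obtain a b where a: "singular_chain (Suc p) (polyhedron L) a" and b: "singular_chain (Suc p) (polyhedron ?st) b"
    and ab: "chain_boundary (Suc p) (a + b) = realize z0 + realize z1"
    using mayer_vietoris_boundary[OF d] z01 singular_chain_realize by metis
  \<comment> \<open>The mismatch e lies in L and in the star, hence in the link, but it need not be
    closed. In positive degree its boundary is the realization of a flag chain of the link; as this
    bounds e's own boundary singularly, injectivity for the link provides a flag chain u with the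
    same boundary as e.\<close>
  define e where "e = realize z0 - chain_boundary (Suc p) a"
  have e': "e = chain_boundary (Suc p) b - realize z1"
    using ab by (simp add: e_def chain_boundary_add algebra_simps)
  have "singular_chain p (polyhedron L) e"
    unfolding e_def using singular_chain_realize[OF z01(1)] singular_chain_boundary[OF a]
    by (simp add: singular_chain_diff)
  moreover have "singular_chain p (polyhedron ?st) e"
    unfolding e' using singular_chain_realize[OF z01(2)] singular_chain_boundary[OF b]
    by (simp add: singular_chain_diff)
  ultimately have e: "singular_chain p (polyhedron T) e" by (rule singular_chain_link)
  have "\<exists>u. keys u \<subseteq> flags p T \<and> chain_boundary p (realize u) = chain_boundary p e"
  proof (cases p)
    case 0 thus ?thesis by (intro exI[of _ 0]) (simp add: chain_boundary_def)
  next
    case (Suc q)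
    have cz: "flag_boundary p z = 0"
      using singular_relboundary_imp_relcycle[OF bz] flag_boundary_eq_0[OF z] by (simp add: singular_cycle)
    define w where "w = flag_boundary p z0"
    have w': "w = - flag_boundary p z1"
      using cz z01(3) by (auto simp: w_def flag_boundary_add eq_neg_iff_add_eq_0)
    have "keys w \<subseteq> flags q L" "keys w \<subseteq> flags q ?st"
      using flag_boundary_keys z01 Suc by (metis w_def, metis w' keys_minus)
    hence w: "keys w \<subseteq> flags q T" using flags_link by blast
    have ew: "chain_boundary p e = realize w"
      using chain_boundary_boundary[OF a] chain_boundary_realize[OF z01(1)]
      by (simp add: e_def chain_boundary_diff w_def)
    hence "singular_relboundary q (polyhedron T) {} (realize w)"
      using e Suc by (auto simp: singular_boundary)
    then obtain u where "keys u \<subseteq> flags p T" "flag_boundary p u = w"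
      using IH(3) w Suc unfolding simplicial_inj_def by metis
    thus ?thesis using ew chain_boundary_realize by metis
  qed
  then obtain u where u: "keys u \<subseteq> flags p T" "chain_boundary p (realize u) = chain_boundary p e" by blast
  hence "singular_relcycle p (polyhedron T) {} (e - realize u)"
    using e singular_chain_realize[OF u(1)] by (simp add: singular_cycle singular_chain_diff chain_boundary_diff)
  then obtain u' where u': "keys u' \<subseteq> flags p T" "singular_relboundary p (polyhedron T) {} (e - realize u - realize u')"
    using IH(2) unfolding simplicial_surj_def by blast
  then obtain g where g: "singular_chain (Suc p) (polyhedron T) g" "chain_boundary (Suc p) g = e - realize u - realize u'"
    by (auto simp: singular_boundary)
  define t where "t = u + u'"
  have t: "keys t \<subseteq> flags p T" using u(1) u'(1) by (simp add: t_def keys_add_subset)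
  hence tL: "keys t \<subseteq> flags p L" "keys t \<subseteq> flags p ?st" using TL by (auto simp: flags_def)
  have gL: "singular_chain (Suc p) (polyhedron L) g" and gst: "singular_chain (Suc p) (polyhedron ?st) g"
    using g(1) TL singular_chain_polyhedron_mono by blast+
  have g2: "chain_boundary (Suc p) g = e - realize t" using g by (simp add: t_def realize_add)
  have "chain_boundary (Suc p) (a + g) = realize (z0 - t)"
    using g2 by (simp add: chain_boundary_add e_def realize_diff)
  moreover have "chain_boundary (Suc p) (b - g) = realize (z1 + t)"
    using g2 by (simp add: chain_boundary_diff e' realize_add)
  ultimately have "singular_relboundary p (polyhedron L) {} (realize (z0 - t))" "singular_relboundary p (polyhedron ?st) {} (realize (z1 + t))"
    using a b gL gst unfolding singular_boundary by (metis singular_chain_add, metis singular_chain_diff)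
  moreover have "keys (z0 - t) \<subseteq> flags p L" "keys (z1 + t) \<subseteq> flags p ?st"
    using z01 tL by (simp_all add: keys_diff_subset keys_add_subset)
  ultimately obtain y0 y1 where "keys y0 \<subseteq> flags (Suc p) L" "flag_boundary (Suc p) y0 = z0 - t"
     "keys y1 \<subseteq> flags (Suc p) ?st" "flag_boundary (Suc p) y1 = z1 + t"
    using IH(1)[of p] Cs(2)[of p] unfolding simplicial_inj_def by metis
  moreover have "flags (Suc p) L \<subseteq> flags (Suc p) S" "flags (Suc p) ?st \<subseteq> flags (Suc p) S"
    using LS TS by (auto simp: flags_def)
  ultimately show "\<exists>y. keys y \<subseteq> flags (Suc p) S \<and> flag_boundary (Suc p) y = z"
    using z01(3) by (intro exI[of _ "y0 + y1"] conjI keys_add_subset) (auto simp: flag_boundary_add)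
qed

end

theorem simplicial_finite:
  assumes "finite S"
  shows "simplicial_surj p S \<and> simplicial_inj p S"
  using assms
proof (induction "card S" arbitrary: S p rule: less_induct)
  case less
  show ?case
  proof (cases "S = {}")
    case True
    have "realization_points S = {}" by (auto simp: True realization_points_iff)
    hence "singular_chain q (polyhedron S) c \<longleftrightarrow> c = 0" for q c by (simp add: singular_chain_empty)
    moreover have "flags q S = {}" for q using True by (auto simp: flags_def)
    ultimately show ?thesis
      by (auto simp: simplicial_surj_def simplicial_inj_def singular_cycle intro!: exI[of _ 0])
  next
    case False
    obtain v where v: "v \<in> S" "\<And>w. w \<in> S \<Longrightarrow> \<not> w \<subset> v"
      using finite_has_minimal[OF less.prems False] by blast
    interpret minimal_vertex S v by (rule minimal_vertex.intro[OF less.prems v])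
    have "card L < card S" unfolding L_def using v(1) less.prems by (metis card_Diff1_less)
    moreover have "card T \<le> card L" using card_mono[OF finL TL] .
    ultimately show ?thesis
      using surj_step inj_step less.hyps[of L] less.hyps[of T] finL finT by simp
  qed
qed

section \<open>From finite posets to arbitrary ones: compactness in the weak topology\<close>

lemma powertop_real_euclidean: "powertop_real UNIV = (euclidean :: ('a \<Rightarrow> real) topology)"
  by (simp add: euclidean_product_topology)

lemma continuous_on_coordinate: "continuous_on A (\<lambda>x. (x :: 'a \<Rightarrow> real) w)"
  by (rule continuous_on_subset[OF continuous_on_product_coordinates subset_UNIV])

lemma closed_closed_simplex:
  assumes "finite \<sigma>" shows "closed (closed_simplex \<sigma>)"
proof -
  have "closed_simplex \<sigma> = {x. \<forall>v. 0 \<le> x v} \<inter> {x. \<forall>v. v \<notin> \<sigma> \<longrightarrow> x v = 0} \<inter> {x. (\<Sum>v\<in>\<sigma>. x v) = 1}"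
    by (auto simp: closed_simplex_def)
  moreover have "closed {x :: 'a \<Rightarrow> real. \<forall>v. 0 \<le> x v}"
    by (intro closed_Collect_all closed_Collect_le continuous_on_const continuous_on_coordinate)
  moreover have "closed {x :: 'a \<Rightarrow> real. \<forall>v. v \<notin> \<sigma> \<longrightarrow> x v = 0}"
    by (intro closed_Collect_all closed_Collect_imp open_Collect_const closed_Collect_eq continuous_on_const continuous_on_coordinate)
  moreover have "closed {x :: 'a \<Rightarrow> real. (\<Sum>v\<in>\<sigma>. x v) = 1}"
    by (intro closed_Collect_eq continuous_on_const continuous_on_sum continuous_on_coordinate)
  ultimately show ?thesis by auto
qed

lemma openin_realization:
  "openin (geometric_realization P) U \<longleftrightarrow> U \<subseteq> realization_points P \<and>
     (\<forall>\<sigma>\<in>order_simplices P. openin (top_of_set (closed_simplex \<sigma>)) (U \<inter> closed_simplex \<sigma>))"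
  by (simp add: openin_geometric_realization powertop_real_euclidean)

lemma closed_simplex_subset: "\<sigma> \<in> order_simplices P \<Longrightarrow> closed_simplex \<sigma> \<subseteq> realization_points P"
  by (auto simp: realization_points_def)

lemma topspace_realization [simp]: "topspace (geometric_realization P) = realization_points P"
proof -
  have "openin (geometric_realization P) (realization_points P)"
    unfolding openin_realization
  proof (intro conjI ballI subset_refl)
    fix \<sigma> assume "\<sigma> \<in> order_simplices P"
    hence "realization_points P \<inter> closed_simplex \<sigma> = closed_simplex \<sigma>"
      using closed_simplex_subset by blast
    thus "openin (top_of_set (closed_simplex \<sigma>)) (realization_points P \<inter> closed_simplex \<sigma>)" by simp
  qed
  thus ?thesis
    using openin_realization openin_subset by (metis openin_topspace subset_antisym)
qed

lemma polyhedron_euclidean: "polyhedron S = top_of_set (realization_points S)"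
  by (simp add: polyhedron_def powertop_real_euclidean)

text \<open>A finite polyhedron is the union of finitely many closed simplices, so the complement in
  it of a weakly open set is a finite union of closed sets.\<close>

lemma continuous_polyhedron_realization:
  assumes "finite S" "S \<subseteq> P"
  shows "continuous_map (polyhedron S) (geometric_realization P) id"
  unfolding continuous_map_def
proof (intro conjI allI impI)
  show "id \<in> topspace (polyhedron S) \<rightarrow> topspace (geometric_realization P)"
    using realization_points_mono[OF assms(2)] by auto
  fix U assume U: "openin (geometric_realization P) U"
  have os: "order_simplices S \<subseteq> order_simplices P"
    using assms by (auto simp: order_simplices_def subset_chain_def)
  have "order_simplices S \<subseteq> Pow S" by (auto simp: order_simplices_def subset_chain_def)
  hence fin: "finite (order_simplices S)" using assms(1) by (meson finite_Pow_iff finite_subset)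
  have "closed (closed_simplex \<sigma> - U)" if s: "\<sigma> \<in> order_simplices S" for \<sigma>
  proof -
    have "openin (top_of_set (closed_simplex \<sigma>)) (U \<inter> closed_simplex \<sigma>)"
      using U os s unfolding openin_realization by blast
    hence "closedin (top_of_set (closed_simplex \<sigma>)) (closed_simplex \<sigma> - U \<inter> closed_simplex \<sigma>)"
      by (metis closedin_diff closedin_topspace topspace_euclidean_subtopology)
    moreover have "closed_simplex \<sigma> - U \<inter> closed_simplex \<sigma> = closed_simplex \<sigma> - U" by blast
    ultimately show ?thesis
      using closed_closed_simplex[of \<sigma>] s closedin_closed_trans by (auto simp: order_simplices_def)
  qed
  hence "closed (\<Union>\<sigma>\<in>order_simplices S. closed_simplex \<sigma> - U)" using fin by (intro closed_UN) auto
  also have "(\<Union>\<sigma>\<in>order_simplices S. closed_simplex \<sigma> - U) = realization_points S - U"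
    by (auto simp: realization_points_def)
  finally have "open (- (realization_points S - U))" by (rule open_Compl)
  hence "openin (top_of_set (realization_points S)) (realization_points S \<inter> - (realization_points S - U))"
    by (simp add: openin_open_Int)
  moreover have "realization_points S \<inter> - (realization_points S - U) = {x \<in> topspace (polyhedron S). id x \<in> U}"
    by auto
  ultimately show "openin (polyhedron S) {x \<in> topspace (polyhedron S). id x \<in> U}"
    by (simp add: polyhedron_euclidean)
qed

lemma singular_simplex_polyhedron_imp:
  assumes "finite S" "S \<subseteq> P" "singular_simplex p (polyhedron S) f"
  shows "singular_simplex p (geometric_realization P) f"
  using assms(3) continuous_map_compose[OF _ continuous_polyhedron_realization[OF assms(1,2)]]
  unfolding singular_simplex_def by fastforce

lemma continuous_realization_euclidean: "continuous_map (geometric_realization P) euclidean id"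
  unfolding continuous_map_def
proof (intro conjI allI impI)
  fix U :: "('a set \<Rightarrow> real) set" assume U: "openin euclidean U"
  have "openin (top_of_set (closed_simplex \<sigma>)) ((realization_points P \<inter> U) \<inter> closed_simplex \<sigma>)"
    if "\<sigma> \<in> order_simplices P" for \<sigma>
  proof -
    have "(realization_points P \<inter> U) \<inter> closed_simplex \<sigma> = closed_simplex \<sigma> \<inter> U"
      using closed_simplex_subset[OF that] by blast
    thus ?thesis using U by (simp add: openin_open_Int)
  qed
  moreover have "{x \<in> topspace (geometric_realization P). id x \<in> U} = realization_points P \<inter> U" by auto
  ultimately show "openin (geometric_realization P) {x \<in> topspace (geometric_realization P). id x \<in> U}"
    by (simp add: openin_realization)
qed auto

lemma closed_finite_functions: "finite F \<Longrightarrow> closed F" for F :: "('a \<Rightarrow> real) set"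
proof -
  have "closed {y}" for y :: "'a \<Rightarrow> real"
  proof -
    have "{y} = {x. \<forall>w. x w = y w}" by auto
    moreover have "closed {x. \<forall>w. x w = y w}"
      by (intro closed_Collect_all closed_Collect_eq continuous_on_const continuous_on_coordinate)
    ultimately show ?thesis by simp
  qed
  moreover assume "finite F"
  ultimately have "closed (\<Union>y\<in>F. {y})" by (intro closed_UN) auto
  thus ?thesis by simp
qed

text \<open>Finite sets of points are closed in each simplex, and the weak topology is tested there.
  The hypothesis passes to subsets of E, so such an E is closed and discrete.\<close>

lemma openin_realization_locally_finite:
  assumes "\<And>\<sigma>. \<sigma> \<in> order_simplices P \<Longrightarrow> finite (E \<inter> closed_simplex \<sigma>)"
  shows "openin (geometric_realization P) (realization_points P - E)"
  unfolding openin_realization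
proof (intro conjI ballI)
  fix \<sigma> assume s: "\<sigma> \<in> order_simplices P"
  have "(realization_points P - E) \<inter> closed_simplex \<sigma> = closed_simplex \<sigma> \<inter> - (E \<inter> closed_simplex \<sigma>)"
    using closed_simplex_subset[OF s] by blast
  moreover have "open (- (E \<inter> closed_simplex \<sigma>))" by (intro open_Compl closed_finite_functions assms[OF s])
  ultimately show "openin (top_of_set (closed_simplex \<sigma>)) ((realization_points P - E) \<inter> closed_simplex \<sigma>)"
    by (simp add: openin_open_Int)
qed auto

text \<open>Choose one point of \<open>K\<close> for every vertex in the support of \<open>K\<close>. The chosen points form a
  closed discrete set, since every closed simplex contains only finitely many of them.\<close>

lemma compact_finite_support:
  assumes K: "compactin (geometric_realization P) K"
  shows "finite {w. \<exists>x\<in>K. x w \<noteq> 0}"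
proof -
  let ?V = "{w. \<exists>x\<in>K. x w \<noteq> 0}"
  have KP: "K \<subseteq> realization_points P" using compactin_subset_topspace[OF K] by simp
  obtain f where f: "\<And>w. w \<in> ?V \<Longrightarrow> f w \<in> K \<and> f w w \<noteq> 0"
    using bchoice[of ?V "\<lambda>w x. x \<in> K \<and> x w \<noteq> 0"] by auto
  let ?D = "f ` ?V"
  have lf: "finite (?D \<inter> closed_simplex \<sigma>)" if "\<sigma> \<in> order_simplices P" for \<sigma>
  proof (rule finite_subset)
    show "?D \<inter> closed_simplex \<sigma> \<subseteq> f ` \<sigma>"
    proof
      fix d assume "d \<in> ?D \<inter> closed_simplex \<sigma>"
      then obtain w where w: "w \<in> ?V" "d = f w" "d \<in> closed_simplex \<sigma>" by blast
      hence "w \<in> \<sigma>" using f[OF w(1)] by (auto simp: closed_simplex_def)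
      thus "d \<in> f ` \<sigma>" using w(2) by blast
    qed
    show "finite (f ` \<sigma>)" using that by (auto simp: order_simplices_def)
  qed
  \<comment> \<open>\<open>?U d\<close> omits all chosen points except d, so the existence of a
    finite subcover forces the set of chosen points to be finite.\<close>
  let ?U = "\<lambda>d. realization_points P - (?D - {d})"
  have op: "openin (geometric_realization P) (?U d)" for d
  proof (rule openin_realization_locally_finite)
    fix \<sigma> assume "\<sigma> \<in> order_simplices P"
    thus "finite ((?D - {d}) \<inter> closed_simplex \<sigma>)"
      by (rule finite_subset[OF Int_mono[OF Diff_subset order_refl] lf])
  qed
  have "finite ?D"
  proof (cases "?D = {}")
    case False
    then obtain d0 where d0: "d0 \<in> ?D" by blast
    have "K \<subseteq> \<Union>(?U ` ?D)"
    proof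
      fix x assume x: "x \<in> K"
      show "x \<in> \<Union>(?U ` ?D)"
      proof (cases "x \<in> ?D")
        case True
        moreover have "x \<in> ?U x" using x KP by auto
        ultimately show ?thesis by (intro UN_I[of x])
      next
        case False
        hence "x \<in> ?U d0" using x KP by auto
        with d0 show ?thesis by (intro UN_I[of d0])
      qed
    qed
    moreover have "openin (geometric_realization P) V" if "V \<in> ?U ` ?D" for V
      using that op by (elim imageE) simp
    ultimately obtain \<F> where F: "finite \<F>" "\<F> \<subseteq> ?U ` ?D" "K \<subseteq> \<Union>\<F>"
      using compactinD[OF K, of "?U ` ?D"] by auto
    obtain F' where F': "F' \<subseteq> ?D" "finite F'" "\<F> = ?U ` F'"
      using finite_subset_image[OF F(1,2)] by blast
    have "?D \<subseteq> F'"
    proof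
      fix d assume d: "d \<in> ?D"
      hence "d \<in> K" using f by auto
      hence "d \<in> \<Union>(?U ` F')" using F(3) unfolding F'(3) by (rule subsetD[rotated])
      then obtain e where "e \<in> F'" "d \<in> ?U e" by (rule UN_E)
      thus "d \<in> F'" using d by simp
    qed
    thus ?thesis using F'(2) finite_subset by blast
  qed simp
  moreover have "?V \<subseteq> (\<Union>d\<in>?D. {w. d w \<noteq> 0})"
  proof
    fix w assume w: "w \<in> ?V"
    hence "f w \<in> ?D" "w \<in> {u. f w u \<noteq> 0}" using f[OF w] by simp_all
    thus "w \<in> (\<Union>d\<in>?D. {w. d w \<noteq> 0})" by (intro UN_I[of "f w"])
  qed
  moreover have "finite {w. d w \<noteq> 0}" if "d \<in> ?D" for d
  proof -
    have "d \<in> realization_points P" using that f KP by auto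
    then obtain \<sigma> where "finite \<sigma>" "d \<in> closed_simplex \<sigma>"
      by (auto simp: realization_points_def order_simplices_def)
    thus ?thesis by (auto simp: closed_simplex_def intro: finite_subset[of _ \<sigma>])
  qed
  ultimately show ?thesis by (meson finite_UN_I finite_subset)
qed

lemma realization_points_support:
  assumes "x \<in> realization_points P" "finite V" "V \<subseteq> P" "{w. x w \<noteq> 0} \<subseteq> V"
  shows "x \<in> realization_points V"
proof -
  obtain \<sigma> where s: "finite \<sigma>" "subset.chain P \<sigma>" "x \<in> closed_simplex \<sigma>"
    using assms(1) by (auto simp: realization_points_def order_simplices_def)
  hence x: "\<And>v. 0 \<le> x v" "\<And>v. x v \<noteq> 0 \<Longrightarrow> v \<in> \<sigma>" "sum x \<sigma> = 1"
    by (auto simp: closed_simplex_def)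
  have "sum x V = sum x {w. x w \<noteq> 0}" using assms by (intro sum.mono_neutral_right) auto
  also have "\<dots> = sum x \<sigma>" using s x by (intro sum.mono_neutral_left) auto
  finally show ?thesis using x assms(4) s(2) unfolding realization_points_iff[OF assms(2)] subset_chain_def by auto
qed

text \<open>The image of a simplex is compact, so only finitely many vertices occur in it.
  Continuity into the finite polyhedron follows because the weak topology is finer than the product
  topology.\<close>

lemma singular_simplex_realization_imp:
  assumes "singular_simplex p (geometric_realization P) f"
  obtains S where "finite S" "S \<subseteq> P" "singular_simplex p (polyhedron S) f"
proof -
  let ?K = "f ` standard_simplex p" and ?\<Delta> = "subtopology (powertop_real UNIV) (standard_simplex p)"
  have cf: "continuous_map ?\<Delta> (geometric_realization P) f" and ext: "f \<in> extensional (standard_simplex p)"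
    using assms by (auto simp: singular_simplex_def)
  have K: "compactin (geometric_realization P) ?K"
    using image_compactin[OF _ cf] compactin_standard_simplex compactin_subtopology by fastforce
  hence KP: "?K \<subseteq> realization_points P" using compactin_subset_topspace by fastforce
  define S where "S = {w. \<exists>x\<in>?K. x w \<noteq> 0}"
  have fin: "finite S" unfolding S_def by (rule compact_finite_support[OF K])
  have SP: "S \<subseteq> P"
  proof
    fix w assume "w \<in> S"
    then obtain x where x: "x \<in> realization_points P" "x w \<noteq> 0" using KP by (auto simp: S_def)
    then obtain \<sigma> where "subset.chain P \<sigma>" "x \<in> closed_simplex \<sigma>"
      by (auto simp: realization_points_def order_simplices_def)
    thus "w \<in> P" using x(2) by (auto simp: closed_simplex_def subset_chain_def)
  qed
  have "x \<in> realization_points S" if "x \<in> ?K" for x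
    by (rule realization_points_support[OF _ fin SP]) (use that KP in \<open>auto simp: S_def\<close>)
  hence img: "f \<in> standard_simplex p \<rightarrow> realization_points S" by auto
  have "continuous_map ?\<Delta> euclidean f"
    using continuous_map_compose[OF cf continuous_realization_euclidean] by simp
  hence "continuous_map ?\<Delta> (polyhedron S) f"
    using img by (auto simp: polyhedron_euclidean continuous_map_in_subtopology)
  thus thesis using that fin SP ext by (auto simp: singular_simplex_def)
qed

lemma singular_simplex_polyhedron_mono:
  "singular_simplex p (polyhedron S) f \<Longrightarrow> S \<subseteq> T \<Longrightarrow> singular_simplex p (polyhedron T) f"
  unfolding polyhedron_def using singular_simplex_mono realization_points_mono by metis

lemma singular_chain_realization_imp:
  assumes "singular_chain p (geometric_realization P) c"
  obtains S where "finite S" "S \<subseteq> P" "singular_chain p (polyhedron S) c"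
proof -
  have "\<exists>S. finite S \<and> S \<subseteq> P \<and> singular_simplex p (polyhedron S) f" if "f \<in> keys c" for f
  proof -
    have "singular_simplex p (geometric_realization P) f" using assms that by (auto simp: singular_chain_def)
    thus ?thesis by (meson singular_simplex_realization_imp)
  qed
  then obtain S where S: "\<And>f. f \<in> keys c \<Longrightarrow> finite (S f) \<and> S f \<subseteq> P \<and> singular_simplex p (polyhedron (S f)) f"
    by metis
  show thesis
  proof (rule that[of "\<Union>(S ` keys c)"])
    show "singular_chain p (polyhedron (\<Union>(S ` keys c))) c"
      unfolding singular_chain_def using S singular_simplex_polyhedron_mono by blast
  qed (use S in auto)
qed

lemma singular_chain_polyhedron_imp:
  "finite S \<Longrightarrow> S \<subseteq> P \<Longrightarrow> singular_chain p (polyhedron S) c \<Longrightarrow> singular_chain p (geometric_realization P) c"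
  unfolding singular_chain_def using singular_simplex_polyhedron_imp by blast

lemma keys_flags_finite:
  assumes "keys z \<subseteq> flags p P"
  obtains S where "finite S" "S \<subseteq> P" "keys z \<subseteq> flags p S"
proof (rule that[of "\<Union>(set ` keys z)"])
  show "\<Union>(set ` keys z) \<subseteq> P" using assms by (auto simp: flags_def)
  show "keys z \<subseteq> flags p (\<Union>(set ` keys z))" using assms by (auto simp: flags_def)
qed auto

lemma flags_mono: "S \<subseteq> T \<Longrightarrow> flags p S \<subseteq> flags p T"
  by (auto simp: flags_def)

lemma realize_chain: "keys z \<subseteq> flags p P \<Longrightarrow> singular_chain p (geometric_realization P) (realize z)"
  by (meson keys_flags_finite singular_chain_realize singular_chain_polyhedron_imp)

text \<open>Singular chains and flag chains each involve only finitely many vertices, so both halves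
  of the comparison descend to a finite subposet.\<close>

theorem simplicial_surjective:
  assumes "singular_relcycle p (geometric_realization P) {} c"
  obtains z where "keys z \<subseteq> flags p P" "singular_relboundary p (geometric_realization P) {} (c - realize z)"
proof -
  obtain S where S: "finite S" "S \<subseteq> P" "singular_chain p (polyhedron S) c"
    using assms singular_chain_realization_imp by (metis singular_cycle)
  hence "singular_relcycle p (polyhedron S) {} c" using assms by (simp add: singular_cycle)
  then obtain z where z: "keys z \<subseteq> flags p S" "singular_relboundary p (polyhedron S) {} (c - realize z)"
    using simplicial_finite[OF S(1)] unfolding simplicial_surj_def by blast
  have "singular_relboundary p (geometric_realization P) {} (c - realize z)"
    using z(2) singular_chain_polyhedron_imp[OF S(1,2)] unfolding singular_boundary by blast
  thus thesis using that z(1) flags_mono[OF S(2)] by blast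
qed

theorem simplicial_injective:
  assumes z: "keys z \<subseteq> flags p P" and b: "singular_relboundary p (geometric_realization P) {} (realize z)"
  obtains y where "keys y \<subseteq> flags (Suc p) P" "flag_boundary (Suc p) y = z"
proof -
  obtain d where d: "singular_chain (Suc p) (geometric_realization P) d" "chain_boundary (Suc p) d = realize z"
    using b by (auto simp: singular_boundary)
  obtain S where S: "finite S" "S \<subseteq> P" "singular_chain (Suc p) (polyhedron S) d"
    using singular_chain_realization_imp[OF d(1)] .
  obtain S' where S': "finite S'" "S' \<subseteq> P" "keys z \<subseteq> flags p S'" using keys_flags_finite[OF z] .
  let ?S = "S \<union> S'"
  have "singular_relboundary p (polyhedron ?S) {} (realize z)"
    unfolding singular_boundary using S(3) d(2) singular_chain_polyhedron_mono by blast
  moreover have "keys z \<subseteq> flags p ?S" using S'(3) flags_mono[of S' ?S] by blast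
  ultimately obtain y where "keys y \<subseteq> flags (Suc p) ?S" "flag_boundary (Suc p) y = z"
    using simplicial_finite[of ?S] S(1) S'(1) unfolding simplicial_inj_def by blast
  thus thesis using that flags_mono[of ?S P] S(2) S'(2) by blast
qed

section \<open>Induced maps of realizations and their effect on flag chains\<close>

lemma realization_map_simplex:
  assumes "finite \<sigma>" "x \<in> closed_simplex \<sigma>"
  shows "realization_map f x w = (\<Sum>v\<in>\<sigma>. if f v = w then x v else 0)"
proof -
  have "(\<Sum>v\<in>\<sigma>. if f v = w then x v else 0) = (\<Sum>v\<in>{v \<in> \<sigma>. f v = w}. x v)"
    using assms(1) by (simp add: sum.inter_filter)
  also have "\<dots> = (\<Sum>v | x v \<noteq> 0 \<and> f v = w. x v)"
    using assms by (intro sum.mono_neutral_right) (auto simp: closed_simplex_def)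
  finally show ?thesis by (simp add: realization_map_def)
qed

lemma realization_map_closed_simplex:
  assumes "finite \<sigma>" "x \<in> closed_simplex \<sigma>"
  shows "realization_map f x \<in> closed_simplex (f ` \<sigma>)"
proof -
  have "(\<Sum>w\<in>f ` \<sigma>. \<Sum>v\<in>\<sigma>. if f v = w then x v else 0) = (\<Sum>v\<in>\<sigma>. x v)"
    using assms(1) by (subst sum.swap) (auto intro!: sum.cong simp: sum.delta')
  thus ?thesis
    using assms unfolding closed_simplex_def mem_Collect_eq
    by (auto simp: realization_map_simplex[of \<sigma>, OF assms] intro!: sum_nonneg sum.neutral)
qed

text \<open>On one closed simplex the coordinates of the image are sums over a fixed finite index
  set, hence continuous, and openness in the weak topology is tested on closed simplices.\<close>

lemma continuous_realization_map:
  assumes f: "\<And>W. W \<in> P \<Longrightarrow> f W \<in> Q" "\<And>V W. V \<in> P \<Longrightarrow> W \<in> P \<Longrightarrow> V \<subseteq> W \<Longrightarrow> f V \<subseteq> f W"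
  shows "continuous_map (geometric_realization P) (geometric_realization Q) (realization_map f)"
  unfolding continuous_map_def
proof (intro conjI allI impI)
  have os: "f ` \<sigma> \<in> order_simplices Q" if "\<sigma> \<in> order_simplices P" for \<sigma>
  proof -
    have s: "finite \<sigma>" "\<sigma> \<noteq> {}" "\<sigma> \<subseteq> P" and c: "\<And>V W. V \<in> \<sigma> \<Longrightarrow> W \<in> \<sigma> \<Longrightarrow> V \<subseteq> W \<or> W \<subseteq> V"
      using that unfolding order_simplices_def subset_chain_def by blast+
    have "f V \<subseteq> f W \<or> f W \<subseteq> f V" if "V \<in> \<sigma>" "W \<in> \<sigma>" for V W
      using c[OF that] f(2)[of V W] f(2)[of W V] that s(3) by blast
    thus ?thesis using s f(1) by (auto simp: order_simplices_def subset_chain_def)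
  qed
  have img: "realization_map f x \<in> realization_points Q" if "x \<in> realization_points P" for x
  proof -
    obtain \<sigma> where s: "\<sigma> \<in> order_simplices P" "x \<in> closed_simplex \<sigma>"
      using \<open>x \<in> realization_points P\<close> by (auto simp: realization_points_def)
    hence "realization_map f x \<in> closed_simplex (f ` \<sigma>)"
      by (intro realization_map_closed_simplex) (auto simp: order_simplices_def)
    thus ?thesis using os[OF s(1)] closed_simplex_subset by blast
  qed
  thus "realization_map f \<in> topspace (geometric_realization P) \<rightarrow> topspace (geometric_realization Q)" by auto
  fix U assume U: "openin (geometric_realization Q) U"
  show "openin (geometric_realization P) {x \<in> topspace (geometric_realization P). realization_map f x \<in> U}"
    unfolding openin_realization
  proof (intro conjI ballI)
    fix \<sigma> assume s: "\<sigma> \<in> order_simplices P"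
    hence fs: "finite \<sigma>" by (simp add: order_simplices_def)
    have "continuous_on (closed_simplex \<sigma>) (\<lambda>x w. \<Sum>v\<in>\<sigma>. if f v = w then x v else 0)"
    proof (rule continuous_on_coordinatewise_then_product)
      fix w
      have "continuous_on (closed_simplex \<sigma>) (\<lambda>x. if f v = w then x v else 0)" for v
        by (cases "f v = w") (simp_all add: continuous_on_coordinate)
      thus "continuous_on (closed_simplex \<sigma>) (\<lambda>x. \<Sum>v\<in>\<sigma>. if f v = w then x v else 0)"
        by (intro continuous_on_sum)
    qed
    hence "continuous_on (closed_simplex \<sigma>) (realization_map f)"
      by (rule continuous_on_eq) (auto simp: realization_map_simplex[OF fs])
    hence "openin (top_of_set (closed_simplex \<sigma>)) (closed_simplex \<sigma> \<inter> realization_map f -` (U \<inter> closed_simplex (f ` \<sigma>)))"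
      using U os[OF s] realization_map_closed_simplex[OF fs] unfolding openin_realization
      by (intro continuous_openin_preimage[of _ _ "closed_simplex (f ` \<sigma>)"]) auto
    moreover have "closed_simplex \<sigma> \<inter> realization_map f -` (U \<inter> closed_simplex (f ` \<sigma>)) =
       {x \<in> topspace (geometric_realization P). realization_map f x \<in> U} \<inter> closed_simplex \<sigma>"
      using closed_simplex_subset[OF s] realization_map_closed_simplex[OF fs] by auto
    ultimately show "openin (top_of_set (closed_simplex \<sigma>))
        ({x \<in> topspace (geometric_realization P). realization_map f x \<in> U} \<inter> closed_simplex \<sigma>)" by simp
  qed auto
qed

lemma affine_simplex_closed:
  assumes l: "length l = Suc p" and t: "t \<in> standard_simplex p"
  shows "affine_simplex l t \<in> closed_simplex (set l)"
proof -
  have "affine_simplex l t = (\<lambda>w. \<Sum>i<length l. if l ! i = w then t i else 0)"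
    using assms by (simp add: affine_simplex_def)
  moreover have "(\<Sum>i<length l. t i) = 1" using assms by (simp add: standard_simplex_def lessThan_Suc_atMost)
  ultimately show ?thesis
    using t unfolding closed_simplex_def mem_Collect_eq
    by (auto simp: sum_indicator_nth standard_simplex_def intro!: sum_nonneg sum.neutral)
qed

lemma flags_length: "l \<in> flags p P \<Longrightarrow> length l = Suc p"
  by (simp add: flags_def)

lemma chain_map_realization:
  assumes "keys z \<subseteq> flags p P"
  shows "chain_map p (realization_map f) (realize z) = realize (frag_map (map f) z)"
  using assms
proof (induction z rule: frag_induction)
  case (one l)
  hence l: "length l = Suc p" by (rule flags_length)
  have "realization_map f (affine_simplex l t) w = affine_simplex (map f l) t w"
    if t: "t \<in> standard_simplex p" for t w
  proof -
    have "realization_map f (affine_simplex l t) w = (\<Sum>v\<in>set l. if f v = w then affine_simplex l t v else 0)"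
      by (rule realization_map_simplex[OF _ affine_simplex_closed[OF l t]]) simp
    also have "\<dots> = (\<Sum>v\<in>set l. \<Sum>i<length l. if l ! i = v then (if f (l ! i) = w then t i else 0) else 0)"
    proof (rule sum.cong[OF refl])
      fix v assume "v \<in> set l"
      have "affine_simplex l t v = (\<Sum>i<length l. if l ! i = v then t i else 0)"
        using t l by (simp add: affine_simplex_def)
      thus "(if f v = w then affine_simplex l t v else 0) =
          (\<Sum>i<length l. if l ! i = v then (if f (l ! i) = w then t i else 0) else 0)"
        by (cases "f v = w") (auto intro!: sum.cong sum.neutral[symmetric])
    qed
    also have "\<dots> = (\<Sum>i<length l. if f (l ! i) = w then t i else 0)"
      using sum_indicator_nth[of l "\<lambda>i. if f (l ! i) = w then t i else 0"] by simp
    also have "\<dots> = affine_simplex (map f l) t w" using t l by (simp add: affine_simplex_def)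
    finally show ?thesis .
  qed
  hence *: "realization_map f (affine_simplex l t) = affine_simplex (map f l) t"
    if "t \<in> standard_simplex p" for t using that by blast
  have "simplex_map p (realization_map f) (affine_simplex l) = affine_simplex (map f l)"
  proof
    fix t show "simplex_map p (realization_map f) (affine_simplex l) t = affine_simplex (map f l) t"
      using * l by (cases "t \<in> standard_simplex p") (simp_all add: simplex_map_def, simp add: affine_simplex_def)
  qed
  thus ?case by simp
qed (simp_all add: realize_diff chain_map_diff frag_extend_diff)

section \<open>Bykovskii's presentation\<close>

text \<open>Subgroups are sets in an additive type rather than group records, so that congruences
  can be handled by ordinary algebra. The predicate serves for sublattices as well as for subgroups
  of chains.\<close>

definition subgrp :: "'v::ab_group_add set \<Rightarrow> bool" where
  "subgrp U \<longleftrightarrow> 0 \<in> U \<and> (\<forall>x\<in>U. \<forall>y\<in>U. x - y \<in> U)"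

lemma subgrp_0: "subgrp U \<Longrightarrow> 0 \<in> U"
  and subgrp_diff: "subgrp U \<Longrightarrow> x \<in> U \<Longrightarrow> y \<in> U \<Longrightarrow> x - y \<in> U"
  by (auto simp: subgrp_def)

lemma subgrp_minus: "subgrp U \<Longrightarrow> x \<in> U \<Longrightarrow> - x \<in> U"
  by (metis subgrp_0 subgrp_diff diff_0)

lemma subgrp_add: "subgrp U \<Longrightarrow> x \<in> U \<Longrightarrow> y \<in> U \<Longrightarrow> x + y \<in> U"
  by (metis subgrp_minus subgrp_diff diff_minus_eq_add)

lemma subgrp_sum: "subgrp U \<Longrightarrow> (\<And>i. i \<in> I \<Longrightarrow> f i \<in> U) \<Longrightarrow> sum f I \<in> U"
  by (induction I rule: infinite_finite_induct) (auto simp: subgrp_0 subgrp_add)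

lemma subgrp_of_int:
  fixes x :: "'v::comm_ring_1"
  assumes "subgrp U" "x \<in> U" shows "of_int m * x \<in> U"
proof (induction m rule: int_induct[where k = 0])
  case base thus ?case using assms by (simp add: subgrp_0)
next
  case (step1 i) thus ?case using subgrp_add[OF assms(1)] assms(2) by (simp add: algebra_simps)
next
  case (step2 i) thus ?case using subgrp_diff[OF assms(1)] assms(2) by (simp add: algebra_simps)
qed

lemma subgrp_frag_cmul: "subgrp S \<Longrightarrow> a \<in> S \<Longrightarrow> frag_cmul m a \<in> S" for a :: "'a \<Rightarrow>\<^sub>0 int"
  by (rule frag_closure_minus_cmul) (auto simp: subgrp_0 subgrp_diff)

lemma subgrp_frag_extend:
  assumes "subgrp S" "\<And>x. x \<in> keys z \<Longrightarrow> f x \<in> S" shows "frag_extend f z \<in> S"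
  unfolding frag_extend_def using assms by (intro subgrp_sum subgrp_frag_cmul) auto

text \<open>The ring structure of the type is a device for writing integer multiples as products
  with \<open>of_int\<close>.\<close>

definition adj :: "'v::comm_ring_1 set \<Rightarrow> 'v \<Rightarrow> 'v set" where
  "adj U v = {u + of_int m * v | u m. u \<in> U}"

lemma adjI: "u \<in> U \<Longrightarrow> u + of_int m * v \<in> adj U v"
  by (auto simp: adj_def)

lemma subgrp_adj: assumes "subgrp U" shows "subgrp (adj U v)"
  unfolding subgrp_def
proof (intro conjI ballI)
  show "0 \<in> adj U v" using adjI[of 0 U 0 v] assms by (simp add: subgrp_0)
  fix x y assume "x \<in> adj U v" "y \<in> adj U v"
  then obtain u m u' m' where "x = u + of_int m * v" "y = u' + of_int m' * v" "u \<in> U" "u' \<in> U"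
    by (auto simp: adj_def)
  thus "x - y \<in> adj U v" using adjI[of "u - u'" U "m - m'" v] assms
    by (simp add: subgrp_diff algebra_simps)
qed

lemma adj_subset: "U \<subseteq> adj U v"
  using adjI[of _ U 0 v] by auto

lemma adj_self: "subgrp U \<Longrightarrow> v \<in> adj U v"
  using adjI[of 0 U 1 v] by (simp add: subgrp_0)

lemma adj_least: "subgrp L \<Longrightarrow> U \<subseteq> L \<Longrightarrow> v \<in> L \<Longrightarrow> adj U v \<subseteq> L"
  by (auto simp: adj_def intro!: subgrp_add subgrp_of_int)

lemma adj_commute: "adj (adj U x) y = adj (adj U y) x"
proof -
  have "adj (adj U x) y \<subseteq> adj (adj U y) x" for x y
  proof
    fix z assume "z \<in> adj (adj U x) y"
    then obtain u m k where "u \<in> U" "z = (u + of_int m * x) + of_int k * y"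
      unfolding adj_def by blast
    moreover have "(u + of_int m * x) + of_int k * y = (u + of_int k * y) + of_int m * x"
      by (simp only: ac_simps)
    ultimately show "z \<in> adj (adj U y) x" using adjI[OF adjI[of u U k y], of m x] by simp
  qed
  thus ?thesis by (intro equalityI)
qed

section \<open>Bases of a lattice modulo a subgroup, up to sign and translation\<close>

text \<open>Up to sign and translation by \<open>U\<close>, i.e. generating the same subgroup modulo \<open>U\<close>.\<close>

definition same_line :: "'v::comm_ring_1 set \<Rightarrow> 'v \<Rightarrow> 'v \<Rightarrow> bool" where
  "same_line U x y \<longleftrightarrow> subgrp U \<and> (y - x \<in> U \<or> y + x \<in> U)"

lemma same_line_refl: "subgrp U \<Longrightarrow> same_line U x x"
  by (simp add: same_line_def subgrp_0)

lemma same_line_sym: "same_line U x y \<Longrightarrow> same_line U y x"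
  unfolding same_line_def using subgrp_minus[of U "y - x"] by (simp add: add.commute[of x y]) blast

lemma same_line_mono: "same_line U x y \<Longrightarrow> subgrp W \<Longrightarrow> U \<subseteq> W \<Longrightarrow> same_line W x y"
  by (auto simp: same_line_def)

lemma same_line_adj: "same_line U x y \<Longrightarrow> same_line (adj U v) x y"
  by (meson same_line_mono adj_subset subgrp_adj same_line_def)

lemma same_lineE:
  assumes "same_line U x y"
  obtains e u where "e = 1 \<or> e = (-1::int)" "u \<in> U" "y = of_int e * x + u"
proof -
  from assms consider "y - x \<in> U" | "y + x \<in> U" by (auto simp: same_line_def)
  thus thesis
  proof cases
    case 1 thus ?thesis using that[of 1 "y - x"] by simp
  next
    case 2 thus ?thesis using that[of "-1" "y + x"] by simp
  qed
qed

lemma adj_same_line_subset: assumes "same_line U x y" shows "adj U y \<subseteq> adj U x"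
proof -
  obtain e u where "u \<in> U" "y = of_int e * x + u" using same_lineE[OF assms] by metis
  hence "y \<in> adj U x" using adjI[of u U e x] by (simp only: add.commute)
  thus ?thesis using assms by (intro adj_least subgrp_adj adj_subset) (auto simp: same_line_def)
qed

lemma adj_same_line: "same_line U x y \<Longrightarrow> adj U x = adj U y"
  by (meson adj_same_line_subset same_line_sym subset_antisym)

text \<open>Stated vector by vector, so that an induction removes the first vector v and continues
  over \<open>adj U v\<close>; this is the passage to the link of a line. Spanning and independence
  in the usual form are recovered in \<open>rel_basis_iff\<close>.\<close>

fun rel_basis :: "'v::comm_ring_1 set \<Rightarrow> 'v set \<Rightarrow> 'v list \<Rightarrow> bool" where
  "rel_basis L U [] \<longleftrightarrow> U = L"
| "rel_basis L U (v # us) \<longleftrightarrow> v \<in> L \<and> (\<forall>m. of_int m * v \<in> U \<longrightarrow> m = 0) \<and> rel_basis L (adj U v) us"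

lemma same_line_free:
  assumes "same_line U x y" "\<forall>m. of_int m * x \<in> U \<longrightarrow> m = 0"
  shows "\<forall>m. of_int m * y \<in> U \<longrightarrow> m = 0"
proof (intro allI impI)
  fix m assume m: "of_int m * y \<in> U"
  obtain e u where e: "e = 1 \<or> e = (-1::int)" "u \<in> U" "y = of_int e * x + u" using same_lineE[OF assms(1)] by metis
  have U: "subgrp U" using assms(1) by (simp add: same_line_def)
  have "of_int (m * e) * x = of_int m * y - of_int m * u" using e(3) by (simp add: algebra_simps)
  hence "of_int (m * e) * x \<in> U" using m e(2) U by (simp add: subgrp_diff subgrp_of_int)
  hence "m * e = 0" using assms(2) by blast
  thus "m = 0" using e(1) by auto
qed

lemma rel_basis_same_line:
  assumes "list_all2 (same_line U) xs ys" "subgrp U" "U \<subseteq> L" "subgrp L"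
  shows "rel_basis L U xs \<Longrightarrow> rel_basis L U ys"
  using assms(1-3)
proof (induction xs arbitrary: U ys)
  case (Cons x xs)
  then obtain y ys' where ys: "ys = y # ys'" "same_line U x y" "list_all2 (same_line U) xs ys'"
    by (auto simp: list_all2_Cons1)
  have x: "x \<in> L" using Cons.prems by simp
  obtain e u where e: "u \<in> U" "y = of_int e * x + u" using same_lineE[OF ys(2)] by metis
  have yL: "y \<in> L" using e x Cons.prems assms(4) by (auto intro!: subgrp_add subgrp_of_int)
  have "list_all2 (same_line (adj U x)) xs ys'"
    using ys(3) by (rule list_all2_mono) (rule same_line_adj)
  moreover have "rel_basis L (adj U x) xs" "subgrp (adj U x)" "adj U x \<subseteq> L"
    using Cons.prems x assms(4) by (auto simp: subgrp_adj adj_least)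
  ultimately have "rel_basis L (adj U x) ys'" using Cons.IH by blast
  thus ?case
    using ys yL same_line_free[OF ys(2)] adj_same_line[OF ys(2)] Cons.prems by simp
qed simp

text \<open>Independence survives the exchange: a multiple of x in \<open>adj U y\<close> involves y
  with coefficient 0, by independence of y over \<open>adj U x\<close>.\<close>

lemma rel_basis_swap_front:
  assumes U: "subgrp U" and r: "rel_basis L U (x # y # r)"
  shows "rel_basis L U (y # x # r)"
proof -
  have x: "\<And>m. of_int m * x \<in> U \<Longrightarrow> m = 0" and y: "\<And>m. of_int m * y \<in> adj U x \<Longrightarrow> m = 0"
    using r by auto
  have "m = 0" if m: "of_int m * x \<in> adj U y" for m
  proof -
    obtain u k where u: "u \<in> U" "of_int m * x = u + of_int k * y" using m unfolding adj_def by blast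
    hence "of_int k * y = - u + of_int m * x" by (simp add: algebra_simps)
    hence "of_int k * y \<in> adj U x" using u(1) U by (metis adjI subgrp_minus)
    hence "k = 0" by (rule y)
    thus "m = 0" using u x by simp
  qed
  thus ?thesis using r y adj_subset[of U x] adj_commute[of U x y] by auto
qed

lemma rel_basis_append_cong:
  assumes "\<And>W. subgrp W \<Longrightarrow> rel_basis L W r \<Longrightarrow> rel_basis L W r'" "subgrp U"
  shows "rel_basis L U (a @ r) \<Longrightarrow> rel_basis L U (a @ r')"
  using assms(2) by (induction a arbitrary: U) (auto simp: assms(1) subgrp_adj)

lemma rel_basis_swap:
  "subgrp U \<Longrightarrow> rel_basis L U (a @ x # y # b) \<Longrightarrow> rel_basis L U (a @ y # x # b)"
  using rel_basis_append_cong[of L "x # y # b" "y # x # b" U a] rel_basis_swap_front by blast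

lemma rel_basis_move_front:
  "subgrp U \<Longrightarrow> rel_basis L U (a @ x # b) \<Longrightarrow> rel_basis L U (x # a @ b)"
proof (induction a arbitrary: U)
  case (Cons y a)
  have "rel_basis L (adj U y) (a @ x # b)" using Cons.prems by simp
  from Cons.IH[OF subgrp_adj[OF Cons.prems(1)] this]
  have "rel_basis L U (y # x # a @ b)" using Cons.prems by simp
  thus ?case using rel_basis_swap_front[OF Cons.prems(1), of L y x "a @ b"] by simp
qed simp

lemma rel_basis_move_back:
  "subgrp U \<Longrightarrow> rel_basis L U (x # a @ b) \<Longrightarrow> rel_basis L U (a @ x # b)"
proof (induction a arbitrary: U)
  case (Cons y a)
  have r: "rel_basis L U (y # x # a @ b)" using rel_basis_swap_front[OF Cons.prems(1), of L x y "a @ b"] Cons.prems(2)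
    unfolding append_Cons by blast
  hence "rel_basis L (adj U y) (a @ x # b)" using Cons.IH[OF subgrp_adj[OF Cons.prems(1)], of y] by simp
  thus ?case using r by simp
qed simp

lemma rel_basis_subset: "rel_basis L U xs \<Longrightarrow> set xs \<subseteq> L"
  by (induction xs arbitrary: U) auto

lemma rel_basis_three:
  assumes "subgrp U" "U \<subseteq> L" "subgrp L" "rel_basis L U (x # y # r)"
  shows "rel_basis L U (y # (- x - y) # r)" "rel_basis L U ((- x - y) # x # r)"
proof -
  have L: "x \<in> L" "y \<in> L" using rel_basis_subset[OF assms(4)] by auto
  have s: "same_line (adj U y) x (- x - y)" for x y
    using subgrp_minus[OF subgrp_adj adj_self] assms(1) by (auto simp: same_line_def subgrp_adj)
  have l: "list_all2 (same_line (adj U y)) (x # r) ((- x - y) # r)" for x y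
    using s assms(1) by (auto intro: list.rel_refl same_line_refl subgrp_adj)
  have "rel_basis L U (y # x # r)" using rel_basis_swap_front assms by blast
  thus "rel_basis L U (y # (- x - y) # r)"
    using rel_basis_same_line[OF l[where x=x and y=y] subgrp_adj[OF assms(1)] adj_least[OF assms(3,2) L(2)] assms(3)] by simp
  have "rel_basis L U (x # (- y - x) # r)"
    using rel_basis_same_line[OF l[where x=y and y=x] subgrp_adj[OF assms(1)] adj_least[OF assms(3,2) L(1)] assms(3)] assms(4) by simp
  thus "rel_basis L U ((- x - y) # x # r)"
    using rel_basis_swap_front[OF assms(1)] by (metis diff_conv_add_uminus add.commute)
qed

text \<open>A quotient with a basis is torsion-free: the claim holds over \<open>adj U v\<close> by
  induction, and the remaining multiple of v is excluded by independence.\<close>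

lemma rel_basis_torsion:
  assumes "rel_basis L U xs" "x \<in> L" "of_int m * x \<in> U" "m \<noteq> 0" "subgrp U"
  shows "x \<in> U"
  using assms
proof (induction xs arbitrary: U)
  case (Cons v us)
  hence "x \<in> adj U v" using adj_subset[of U v] subgrp_adj[of U v] by auto
  then obtain u k where u: "u \<in> U" "x = u + of_int k * v" by (auto simp: adj_def)
  have "of_int (m * k) * v = of_int m * x - of_int m * u" using u(2) by (simp add: algebra_simps)
  hence "of_int (m * k) * v \<in> U" using Cons.prems u(1) by (simp add: subgrp_diff subgrp_of_int)
  hence "m * k = 0" using Cons.prems(1) by (metis rel_basis.simps(2))
  thus ?case using u Cons.prems by simp
qed simp

section \<open>Apartment classes and the identities they satisfy\<close>

definition cons_map :: "'u \<Rightarrow> ('u list \<Rightarrow>\<^sub>0 int) \<Rightarrow> ('u list \<Rightarrow>\<^sub>0 int)" where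
  "cons_map W = frag_extend (\<lambda>l. frag_of (W # l))"

lemma cons_map_simps [simp]:
  "cons_map W 0 = 0" "cons_map W (a + b) = cons_map W a + cons_map W b"
  "cons_map W (a - b) = cons_map W a - cons_map W b" "cons_map W (- a) = - cons_map W a"
  "cons_map W (frag_cmul m a) = frag_cmul m (cons_map W a)" "cons_map W (frag_of l) = frag_of (W # l)"
  by (simp_all add: cons_map_def frag_extend_add frag_extend_diff frag_extend_minus frag_extend_cmul)

text \<open>The class of the apartment spanned by \<open>xs\<close>, as an alternating sum of full flags: the first
  member of a flag is \<open>J U x\<close> for some \<open>x\<close> in the frame, where \<open>J U x\<close> is to be read as the join
  of the subspace \<open>U\<close> and the line of \<open>x\<close>.\<close>

function apartment :: "('u \<Rightarrow> 'v \<Rightarrow> 'u) \<Rightarrow> 'u \<Rightarrow> 'v list \<Rightarrow> ('u list \<Rightarrow>\<^sub>0 int)" where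
  "apartment J U xs = (if xs = [] then frag_of [] else
     (\<Sum>i<length xs. frag_cmul ((-1) ^ i)
        (cons_map (J U (xs ! i)) (apartment J (J U (xs ! i)) (delete_nth i xs)))))"
  by auto
termination
  by (relation "measure (\<lambda>(J, U, xs). length xs)") (auto simp: length_delete_nth)

declare apartment.simps [simp del]

lemma apartment_Nil [simp]: "apartment J U [] = frag_of []"
  by (simp add: apartment.simps)

lemma apartment_nonempty: "xs \<noteq> [] \<Longrightarrow> apartment J U xs = (\<Sum>i<length xs. frag_cmul ((-1) ^ i)
    (cons_map (J U (xs ! i)) (apartment J (J U (xs ! i)) (delete_nth i xs))))"
  by (subst apartment.simps) simp

lemma delete_nth_append_left: "k < length a \<Longrightarrow> delete_nth k (a @ b) = delete_nth k a @ b"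
  by (simp add: delete_nth_def)

lemma sum_split_append:
  fixes f :: "nat \<Rightarrow> 'a::comm_monoid_add"
  shows "(\<Sum>i<m + k. f i) = (\<Sum>i<m. f i) + (\<Sum>i<k. f (m + i))"
  by (induction k) (simp_all add: add.assoc)

lemma frag_cmul_minus_distrib: "frag_cmul m (- a) = - frag_cmul m a"
  by (metis add.inverse_inverse frag_cmul_minus_one minus_frag_cmul frag_cmul_cmul mult.commute mult_minus1)

text \<open>Free abelian groups have no 2-torsion; this finishes a sign-reversing pairing of
  terms.\<close>

lemma frag_eq_uminus: "x = - x \<Longrightarrow> x = 0" for x :: "'b \<Rightarrow>\<^sub>0 int"
proof -
  assume "x = - x"
  hence "Poly_Mapping.lookup x i = - Poly_Mapping.lookup x i" for i by (metis lookup_uminus)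
  thus "x = 0" by (intro poly_mapping_eqI) simp
qed

lemma apartment_split:
  "apartment J U (a @ x # y # b) =
    (\<Sum>i<length a. frag_cmul ((-1) ^ i) (cons_map (J U (a ! i)) (apartment J (J U (a ! i)) (delete_nth i a @ x # y # b))))
    + (frag_cmul ((-1) ^ length a) (cons_map (J U x) (apartment J (J U x) (a @ y # b)))
      - frag_cmul ((-1) ^ length a) (cons_map (J U y) (apartment J (J U y) (a @ x # b))))
    + (\<Sum>i<length b. frag_cmul ((-1) ^ (length a + i)) (cons_map (J U (b ! i)) (apartment J (J U (b ! i)) (a @ x # y # delete_nth i b))))"
proof -
  let ?F = "\<lambda>i. frag_cmul ((-1) ^ i) (cons_map (J U ((a @ x # y # b) ! i)) (apartment J (J U ((a @ x # y # b) ! i)) (delete_nth i (a @ x # y # b))))"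
  have d: "delete_nth (length a + (2 + i)) (a @ x # y # b) = a @ x # y # delete_nth i b"
    "delete_nth (length a) (a @ x # y # b) = a @ y # b"
    "delete_nth (length a + 1) (a @ x # y # b) = a @ x # b" for i
    by (simp_all add: delete_nth_def numeral_2_eq_2 numeral_3_eq_3)
  have nS: "(a @ x # y # b) ! Suc (length a) = y" by (simp add: nth_append)
  have n: "(a @ x # y # b) ! (length a + (2 + i)) = b ! i" "(a @ x # y # b) ! (length a) = x"
     "(a @ x # y # b) ! (length a + 1) = y" for i
    by (simp_all add: nth_append)
  have "apartment J U (a @ x # y # b) = (\<Sum>i<length a + (2 + length b). ?F i)"
    by (subst apartment_nonempty) simp_all
  also have "\<dots> = (\<Sum>i<length a. ?F i) + (?F (length a) + ?F (length a + 1) + (\<Sum>i<length b. ?F (length a + (2 + i))))"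
    unfolding sum_split_append by (simp add: numeral_2_eq_2 nS)
  finally show ?thesis
    unfolding d n by (simp add: nth_append delete_nth_append_left add.assoc)
qed

lemma frag_cmul_diff2: "frag_cmul m (a - b) = frag_cmul m a - frag_cmul m b"
  using frag_cmul_distrib2[of m a "- b"] by (simp add: frag_cmul_minus_distrib del: minus_frag_cmul)

text \<open>In the expansion, the terms whose first line is x or y trade places with opposite signs;
  the others contain the pair further inside and change sign by induction.\<close>

lemma apartment_swap:
  assumes J: "\<And>U x y. J (J U x) y = J (J U y) x"
  shows "apartment J U (a @ x # y # b) = - apartment J U (a @ y # x # b)"
proof (induction "length a + length b" arbitrary: a b U rule: less_induct)
  case less
  have 1: "apartment J (J U (a ! i)) (delete_nth i a @ x # y # b) = - apartment J (J U (a ! i)) (delete_nth i a @ y # x # b)"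
    if "i < length a" for i
    using that less[of "delete_nth i a" b "J U (a ! i)"] by (simp add: length_delete_nth)
  have 2: "apartment J (J U (b ! i)) (a @ x # y # delete_nth i b) = - apartment J (J U (b ! i)) (a @ y # x # delete_nth i b)"
    if "i < length b" for i
    using that less[of a "delete_nth i b" "J U (b ! i)"] by (simp add: length_delete_nth)
  show ?case
    unfolding apartment_split[of J U a x y] apartment_split[of J U a y x]
    using 1 2 by (simp add: frag_cmul_minus_distrib sum_negf del: minus_frag_cmul)
qed

text \<open>E relates vectors that have the same join with U and keeps relating them when U grows.
  For \<open>same_line\<close> this makes the class depend only on the lines of the frame.\<close>

lemma apartment_cong:
  assumes "\<And>U x y. E U x y \<Longrightarrow> J U x = J U y" "\<And>U v x y. E U x y \<Longrightarrow> E (J U v) x y"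
  shows "list_all2 (E U) xs ys \<Longrightarrow> apartment J U xs = apartment J U ys"
proof (induction "length xs" arbitrary: U xs ys)
  case 0 thus ?case by simp
next
  case (Suc n)
  hence len: "length ys = length xs" "xs \<noteq> []" "ys \<noteq> []" by (auto dest: list_all2_lengthD)
  have "apartment J (J U (xs ! i)) (delete_nth i xs) = apartment J (J U (xs ! i)) (delete_nth i ys)"
    if i: "i < length xs" for i
  proof (rule Suc.hyps(1))
    show "n = length (delete_nth i xs)" using Suc.hyps(2) i by (simp add: length_delete_nth)
    have "list_all2 (E U) (delete_nth i xs) (delete_nth i ys)"
      unfolding delete_nth_def using Suc.prems len by (intro list_all2_appendI list_all2_takeI list_all2_dropI)
    thus "list_all2 (E (J U (xs ! i))) (delete_nth i xs) (delete_nth i ys)"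
      using assms(2) by (rule list_all2_mono)
  qed
  moreover have "J U (xs ! i) = J U (ys ! i)" if "i < length xs" for i
    using Suc.prems that assms(1) by (meson list_all2_nthD)
  ultimately show ?case
    using len by (simp add: apartment_nonempty)
qed

text \<open>Naturality of the construction, used twice: for the passage from sublattices to rational
  subspaces, and for the action of a matrix. The invariant I restricts the places where the joins
  have to correspond.\<close>

lemma apartment_map:
  assumes "\<And>U x. I U \<Longrightarrow> x \<in> A \<Longrightarrow> I (J U x) \<and> \<phi> (J U x) = J' (\<phi> U) (\<psi> x)"
  shows "I U \<Longrightarrow> set xs \<subseteq> A \<Longrightarrow>
    frag_map (map \<phi>) (apartment J U xs) = apartment J' (\<phi> U) (map \<psi> xs)"
proof (induction "length xs" arbitrary: U xs)
  case 0 thus ?case by simp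
next
  case (Suc n)
  hence ne: "xs \<noteq> []" by auto
  have c: "frag_map (map \<phi>) (cons_map W a) = cons_map (\<phi> W) (frag_map (map \<phi>) a)" for W a
    unfolding cons_map_def
    using frag_extend_compose[of "\<lambda>l. frag_of (map \<phi> l)" "\<lambda>l. W # l" a]
      frag_extend_compose[of "\<lambda>l. frag_of (\<phi> W # l)" "map \<phi>" a] by (simp add: o_def)
  have d: "map \<psi> (delete_nth i xs) = delete_nth i (map \<psi> xs)" for i
    by (simp add: delete_nth_def take_map drop_map)
  have "frag_map (map \<phi>) (apartment J (J U (xs ! i)) (delete_nth i xs)) =
     apartment J' (J' (\<phi> U) (\<psi> (xs ! i))) (delete_nth i (map \<psi> xs))" if i: "i < length xs" for i
  proof -
    have x: "xs ! i \<in> A" using Suc.prems(2) i by auto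
    have "n = length (delete_nth i xs)" "set (delete_nth i xs) \<subseteq> A"
      using Suc.hyps(2) Suc.prems(2) i set_delete_nth[of i xs] by (auto simp: length_delete_nth)
    thus ?thesis using Suc.hyps(1)[of "delete_nth i xs" "J U (xs ! i)"] assms[OF Suc.prems(1) x] d by simp
  qed
  moreover have "\<phi> (J U (xs ! i)) = J' (\<phi> U) (\<psi> (xs ! i))" if "i < length xs" for i
    using assms[OF Suc.prems(1), of "xs ! i"] subsetD[OF Suc.prems(2) nth_mem[OF that]] by blast
  ultimately show ?case
    using ne by (simp add: apartment_nonempty frag_extend_sum frag_extend_cmul c)
qed

lemma delete_delete:
  assumes "i \<le> j" "Suc j < length xs"
  shows "delete_nth j (delete_nth i xs) = delete_nth i (delete_nth (Suc j) xs)"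
  using assms by (intro nth_equalityI) (auto simp: nth_delete_nth length_delete_nth)

lemma delete_nth_0_cons_map: "frag_map (delete_nth 0) (cons_map W a) = a"
  unfolding cons_map_def
  using frag_extend_compose[of "\<lambda>l. frag_of (delete_nth 0 l)" "\<lambda>l. W # l" a] frag_expansion[of a]
  by (simp add: o_def)

lemma delete_nth_Suc_cons_map:
  "frag_map (delete_nth (Suc i)) (cons_map W a) =
   cons_map W (frag_map (delete_nth i) a)"
  unfolding cons_map_def
  using frag_extend_compose[of "\<lambda>l. frag_of (delete_nth (Suc i) l)" "\<lambda>l. W # l" a]
     frag_extend_compose[of "\<lambda>l. frag_of (W # l)" "delete_nth i" a] by (simp add: o_def)

text \<open>The codimension-one faces of the apartment cancel in pairs.\<close>

lemma apartment_cyclic: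
  assumes J: "\<And>U x y. J (J U x) y = J (J U y) x"
  shows "Suc i < length xs \<Longrightarrow> frag_map (delete_nth i) (apartment J U xs) = 0"
proof (induction i arbitrary: U xs)
  case (Suc i)
  hence "xs \<noteq> []" by auto
  moreover have "frag_map (delete_nth i) (apartment J (J U (xs ! j)) (delete_nth j xs)) = 0"
    if "j < length xs" for j using Suc that by (simp add: length_delete_nth)
  ultimately show ?case
    by (simp add: apartment_nonempty frag_extend_sum frag_extend_cmul delete_nth_Suc_cons_map)
next
  case 0
  define n where "n = length xs"
  have n: "xs \<noteq> []" "n \<ge> 2" using 0 by (auto simp: n_def)
  \<comment> \<open>The term of the double expansion in which the j-th vector is chosen first and
    the k-th second. Once the first subspace is forgotten it depends only on the set of the two
    indices, while its sign changes under their exchange, since deleting the earlier vector shifts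
    the position of the later one.\<close>
  define g where "g j k = cons_map (J (J U (xs ! j)) (xs ! k))
     (apartment J (J (J U (xs ! j)) (xs ! k)) (if k < j then delete_nth k (delete_nth j xs) else delete_nth (k - 1) (delete_nth j xs)))" for j k
  define F where "F = (\<lambda>(j, k). if k = j then 0 else frag_cmul ((-1) ^ (j + (if k < j then k else k - 1))) (g j k))"
  have g_sym: "g j k = g k j" if "j < k" "k < n" for j k
    using that delete_delete[of j "k - 1" xs] J[of U "xs ! j" "xs ! k"] by (simp add: g_def n_def)
  have inner: "apartment J (J U (xs ! j)) (delete_nth j xs) =
     (\<Sum>k\<in>{..<n} - {j}. frag_cmul ((-1) ^ (if k < j then k else k - 1)) (g j k))" if j: "j < n" for j
  proof -
    let ?h = "\<lambda>k. if k < j then k else Suc k"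
    have inj: "inj_on ?h {..<n - 1}" by (auto simp: inj_on_def split: if_splits)
    have img: "?h ` {..<n - 1} = {..<n} - {j}"
    proof -
      have "i \<in> ?h ` {..<n - 1}" if "i < n" "i \<noteq> j" for i
        using that j by (intro image_eqI[of _ _ "if i < j then i else i - 1"]) auto
      thus ?thesis using j by auto
    qed
    have ne: "delete_nth j xs \<noteq> []" using j n length_delete_nth[of j xs] by (auto simp: n_def)
    have l: "length (delete_nth j xs) = n - 1" using j by (simp add: n_def length_delete_nth)
    show ?thesis
      unfolding img[symmetric] sum.reindex[OF inj] apartment_nonempty[OF ne] l
      using j by (intro sum.cong) (auto simp: g_def n_def nth_delete_nth)
  qed
  have "frag_map (delete_nth 0) (apartment J U xs) =
     (\<Sum>j<n. frag_cmul ((-1) ^ j) (apartment J (J U (xs ! j)) (delete_nth j xs)))"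
    using n by (simp add: apartment_nonempty frag_extend_sum frag_extend_cmul delete_nth_0_cons_map n_def)
  also have "\<dots> = (\<Sum>j<n. \<Sum>k\<in>{..<n} - {j}. frag_cmul ((-1) ^ (j + (if k < j then k else k - 1))) (g j k))"
    using inner by (simp add: frag_cmul_sum power_add)
  also have "\<dots> = (\<Sum>j<n. \<Sum>k<n. if k = j then 0 else frag_cmul ((-1) ^ (j + (if k < j then k else k - 1))) (g j k))"
    by (intro sum.cong refl sum.mono_neutral_cong_left) auto
  also have "\<dots> = (\<Sum>p\<in>{..<n} \<times> {..<n}. F p)"
    unfolding F_def by (simp add: sum.cartesian_product)
  also have "\<dots> = 0"
  proof (rule frag_eq_uminus)
    have "(\<Sum>p\<in>{..<n} \<times> {..<n}. F p) = (\<Sum>p\<in>{..<n} \<times> {..<n}. - F p)"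
    proof (rule sum.reindex_bij_witness[of _ prod.swap prod.swap])
      fix p assume p: "p \<in> {..<n} \<times> {..<n}"
      obtain j k where jk: "p = (j, k)" by force
      have s: "(-1::int) ^ (a + b) = - ((-1) ^ (b + (a - 1)))" if "0 < a" for a b :: nat
        using that by (cases a) (simp_all add: add.commute)
      show "- F (prod.swap p) = F p"
      proof (cases j k rule: linorder_cases)
        case less
        thus ?thesis using p jk g_sym[of j k] s[of k j] by (simp add: F_def add.commute)
      next
        case greater
        thus ?thesis using p jk g_sym[of k j] s[of j k] by (simp add: F_def add.commute)
      qed (use jk in \<open>simp add: F_def\<close>)
    qed auto
    thus "(\<Sum>p\<in>{..<n} \<times> {..<n}. F p) = - (\<Sum>p\<in>{..<n} \<times> {..<n}. F p)"
      by (simp add: sum_negf)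
  qed
  finally show ?case .
qed

lemma adj_three_lines:
  assumes "subgrp U"
  shows "list_all2 (same_line (adj U x)) (y # r) ((- x - y) # r)"
    "list_all2 (same_line (adj U x)) ((- x - y) # r) (y # r)"
proof -
  have "same_line (adj U x) y (- x - y)"
    using subgrp_minus[OF subgrp_adj adj_self] assms by (auto simp: same_line_def subgrp_adj)
  thus "list_all2 (same_line (adj U x)) (y # r) ((- x - y) # r)" "list_all2 (same_line (adj U x)) ((- x - y) # r) (y # r)"
    using same_line_sym assms by (auto intro!: list.rel_refl same_line_refl subgrp_adj)
qed

lemma apartment_same_line:
  "list_all2 (same_line U) xs ys \<Longrightarrow> apartment adj U xs = apartment adj U ys"
  by (rule apartment_cong[where E = same_line]) (auto simp: adj_same_line same_line_adj)

text \<open>Modulo any one of x, y, -x-y the other two span the same line, so the six leading terms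
  cancel in pairs; the terms starting with a vector of r vanish together by induction.\<close>

lemma apartment_three:
  assumes "subgrp U"
  shows "apartment adj U (x # y # r) + apartment adj U (y # (- x - y) # r) + apartment adj U ((- x - y) # x # r) = 0"
  using assms
proof (induction "length r" arbitrary: r U rule: less_induct)
  case less
  let ?z = "- x - y"
  have z: "- y - x = ?z" "- ?z - x = y" by simp_all
  have e: "apartment adj (adj U x) (y # r) = apartment adj (adj U x) (?z # r)"
    "apartment adj (adj U y) (x # r) = apartment adj (adj U y) (?z # r)"
    "apartment adj (adj U ?z) (x # r) = apartment adj (adj U ?z) (y # r)"
    using apartment_same_line[OF adj_three_lines(1)[OF less(2), of x y r]]
      apartment_same_line[OF adj_three_lines(1)[OF less(2), of y x r]]
      apartment_same_line[OF adj_three_lines(1)[OF less(2), of ?z x r]] unfolding z by simp_all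
  let ?G = "\<lambda>x y. \<Sum>i<length r. frag_cmul ((-1) ^ i) (cons_map (adj U (r ! i)) (apartment adj (adj U (r ! i)) (x # y # delete_nth i r)))"
  have sp: "apartment adj U (x # y # r) = (cons_map (adj U x) (apartment adj (adj U x) (y # r))
      - cons_map (adj U y) (apartment adj (adj U y) (x # r))) + ?G x y" for x y
    using apartment_split[where a = "[]" and b = r and J = adj and U = U and x = x and y = y] by simp
  have "?G x y + ?G y ?z + ?G ?z x = (\<Sum>i<length r. frag_cmul ((-1) ^ i) (cons_map (adj U (r ! i))
     (apartment adj (adj U (r ! i)) (x # y # delete_nth i r) + apartment adj (adj U (r ! i)) (y # ?z # delete_nth i r)
      + apartment adj (adj U (r ! i)) (?z # x # delete_nth i r))))"
    by (simp add: sum.distrib frag_cmul_distrib2)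
  also have "\<dots> = 0"
  proof (rule sum.neutral, rule ballI)
    fix i assume "i \<in> {..<length r}"
    hence "length (delete_nth i r) < length r" by (simp add: length_delete_nth)
    from less(1)[OF this subgrp_adj[OF less(2)], of "r ! i"]
    show "frag_cmul ((-1) ^ i) (cons_map (adj U (r ! i))
     (apartment adj (adj U (r ! i)) (x # y # delete_nth i r) + apartment adj (adj U (r ! i)) (y # ?z # delete_nth i r)
      + apartment adj (adj U (r ! i)) (?z # x # delete_nth i r))) = 0" by simp
  qed
  finally have g: "?G x y + ?G y ?z + ?G ?z x = 0" .
  have "apartment adj U (x # y # r) + apartment adj U (y # ?z # r) + apartment adj U (?z # x # r) = ?G x y + ?G y ?z + ?G ?z x"
    unfolding sp[of x y] sp[of y ?z] sp[of ?z x] e by simp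
  thus ?case using g by simp
qed

section \<open>Relations between frames and their derived forms\<close>

definition frames :: "'v::comm_ring_1 set \<Rightarrow> nat \<Rightarrow> 'v set \<Rightarrow> 'v list set" where
  "frames L n U = {xs. rel_basis L U xs \<and> length xs = n}"

text \<open>Sign changes and the three-term relation are imposed only at the front; exchanges carry
  them to every position, as \<open>line_at\<close> and \<open>three_at\<close> show. Over {0} the
  rule \<open>line\<close> amounts to a change of sign; over larger U it also allows translations,
  which is what the link of a line requires.\<close>

inductive_set frame_relations :: "'v::comm_ring_1 set \<Rightarrow> nat \<Rightarrow> 'v set \<Rightarrow> ('v list \<Rightarrow>\<^sub>0 int) set"
  for L n U where
  zero: "0 \<in> frame_relations L n U"
| diff: "a \<in> frame_relations L n U \<Longrightarrow> b \<in> frame_relations L n U \<Longrightarrow> a - b \<in> frame_relations L n U"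
| swap: "a @ x # y # b \<in> frames L n U \<Longrightarrow> frag_of (a @ x # y # b) + frag_of (a @ y # x # b) \<in> frame_relations L n U"
| line: "x # r \<in> frames L n U \<Longrightarrow> same_line U x x' \<Longrightarrow> frag_of (x # r) - frag_of (x' # r) \<in> frame_relations L n U"
| three: "x # y # r \<in> frames L n U \<Longrightarrow>
    frag_of (x # y # r) + frag_of (y # (- x - y) # r) + frag_of ((- x - y) # x # r) \<in> frame_relations L n U"

lemma subgrp_relations: "subgrp (frame_relations L n U)"
  by (auto simp: subgrp_def frame_relations.zero frame_relations.diff)

lemma apartment_relations:
  assumes "w \<in> frame_relations L n U" "subgrp U"
  shows "frag_extend (apartment adj U) w = 0"
  using assms(1)
proof induction
  case (swap a x y b)
  thus ?case using apartment_swap[of adj U a x y b, OF adj_commute] by (simp add: frag_extend_add)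
next
  case (line x r x')
  hence "apartment adj U (x # r) = apartment adj U (x' # r)"
    by (intro apartment_same_line) (auto intro!: list.rel_refl same_line_refl assms)
  thus ?case by (simp add: frag_extend_diff)
next
  case (three x y r)
  thus ?case using apartment_three[OF assms(2)] by (simp add: frag_extend_add)
qed (simp_all add: frag_extend_diff)

locale lattice_pair =
  fixes L U :: "'v::comm_ring_1 set"
  assumes L: "subgrp L" and U: "subgrp U" and UL: "U \<subseteq> L"
begin

abbreviation "\<R> n \<equiv> frame_relations L n U"

lemmas R_sub = subgrp_relations[of L _ U]

lemma frames_move: "a @ x # b \<in> frames L n U \<Longrightarrow> x # a @ b \<in> frames L n U"
  using rel_basis_move_front[OF U] by (auto simp: frames_def)

lemma frames_move_back: "x # a @ b \<in> frames L n U \<Longrightarrow> a @ x # b \<in> frames L n U"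
  using rel_basis_move_back[OF U] by (auto simp: frames_def)

lemma move:
  "a @ x # b \<in> frames L n U \<Longrightarrow> frag_of (a @ x # b) - frag_cmul ((-1) ^ length a) (frag_of (x # a @ b)) \<in> \<R> n"
proof (induction a arbitrary: b rule: rev_induct)
  case Nil thus ?case by (simp add: frame_relations.zero)
next
  case (snoc y a)
  have f: "a @ y # x # b \<in> frames L n U" using snoc.prems by simp
  hence f': "a @ x # y # b \<in> frames L n U" using rel_basis_swap[OF U] by (auto simp: frames_def)
  have 1: "frag_of (a @ y # x # b) + frag_of (a @ x # y # b) \<in> \<R> n" using f by (rule frame_relations.swap)
  have 2: "frag_of (a @ x # y # b) - frag_cmul ((-1) ^ length a) (frag_of (x # a @ y # b)) \<in> \<R> n"
    using snoc.IH[OF f'] .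
  from subgrp_diff[OF R_sub 1 2] show ?case
    by (simp add: algebra_simps minus_frag_cmul[symmetric] del: minus_frag_cmul)
qed

lemma list_same_line_frames:
  "list_all2 (same_line U) xs ys \<Longrightarrow> xs \<in> frames L n U \<Longrightarrow> ys \<in> frames L n U"
  using rel_basis_same_line[of U xs ys L] U UL L by (auto simp: frames_def dest: list_all2_lengthD)

lemma line_at:
  assumes "a @ x # b \<in> frames L n U" "same_line U x x'"
  shows "frag_of (a @ x # b) - frag_of (a @ x' # b) \<in> \<R> n"
proof -
  let ?s = "frag_cmul ((-1) ^ length a)"
  have f: "a @ x' # b \<in> frames L n U"
    by (rule list_same_line_frames[OF _ assms(1)])
       (use assms(2) U in \<open>auto intro!: list_all2_appendI list.rel_refl same_line_refl\<close>)
  have 1: "frag_of (a @ x # b) - ?s (frag_of (x # a @ b)) \<in> \<R> n" using move[OF assms(1)] .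
  have 2: "frag_of (a @ x' # b) - ?s (frag_of (x' # a @ b)) \<in> \<R> n" using move[OF f] .
  have "frag_of (x # a @ b) - frag_of (x' # a @ b) \<in> \<R> n"
    using frame_relations.line[OF frames_move[OF assms(1)] assms(2)] .
  hence 3: "?s (frag_of (x # a @ b) - frag_of (x' # a @ b)) \<in> \<R> n" by (rule subgrp_frag_cmul[OF R_sub])
  from subgrp_add[OF R_sub subgrp_diff[OF R_sub 1 2] 3] show ?thesis
    by (simp add: frag_cmul_diff2 algebra_simps)
qed

lemma lines_at:
  "list_all2 (same_line U) r r' \<Longrightarrow> a @ r \<in> frames L n U \<Longrightarrow> frag_of (a @ r) - frag_of (a @ r') \<in> \<R> n"
proof (induction r r' arbitrary: a rule: list_all2_induct)
  case Nil thus ?case by (simp add: frame_relations.zero)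
next
  case (Cons x r x' r')
  have 1: "frag_of (a @ x # r) - frag_of (a @ x' # r) \<in> \<R> n" using line_at Cons by blast
  have "a @ x' # r \<in> frames L n U"
    by (rule list_same_line_frames[OF _ Cons.prems])
       (use Cons.hyps U in \<open>auto intro!: list_all2_appendI list.rel_refl same_line_refl\<close>)
  hence 2: "frag_of ((a @ [x']) @ r) - frag_of ((a @ [x']) @ r') \<in> \<R> n" by (intro Cons.IH) simp
  from subgrp_add[OF R_sub 1 2] show ?case by (simp add: algebra_simps)
qed

lemma same_line_minus: "same_line U x (- x)"
  using U by (simp add: same_line_def subgrp_0)

lemma three_at:
  assumes f: "a @ x # y # r \<in> frames L n U"
  shows "frag_of (a @ x # y # r) + frag_of (a @ y # (- x - y) # r) + frag_of (a @ (- x - y) # x # r) \<in> \<R> n"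
  using assms
proof (induction a arbitrary: r rule: rev_induct)
  case Nil thus ?case by (simp add: frame_relations.three)
next
  case (snoc v a)
  have m: "frag_of (a @ v # x # y # r) - frag_of (a @ x # y # v # r) \<in> \<R> n" if "a @ v # x # y # r \<in> frames L n U" for x y
  proof -
    have 1: "frag_of (a @ v # x # y # r) + frag_of (a @ x # v # y # r) \<in> \<R> n" using that by (rule frame_relations.swap)
    have "(a @ [x]) @ v # y # r \<in> frames L n U" using rel_basis_swap[OF U] that by (auto simp: frames_def)
    hence 2: "frag_of ((a @ [x]) @ v # y # r) + frag_of ((a @ [x]) @ y # v # r) \<in> \<R> n"
      by (rule frame_relations.swap)
    from subgrp_diff[OF R_sub 1 2] show ?thesis by (simp add: algebra_simps)
  qed
  have fr: "(a @ [v]) @ x # y # r \<in> frames L n U" using snoc.prems .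
  have f3: "a @ v # y # (- x - y) # r \<in> frames L n U" "a @ v # (- x - y) # x # r \<in> frames L n U"
  proof -
    have *: "rel_basis L U (c @ y # (- x - y) # r) \<and> rel_basis L U (c @ (- x - y) # x # r)"
      if "rel_basis L U (c @ x # y # r)" "subgrp U" "U \<subseteq> L" for c and U
      using that by (induction c arbitrary: U) (auto simp: rel_basis_three L subgrp_adj adj_least simp del: rel_basis.simps(2)
         simp: rel_basis.simps(2)[of L _ _ "_ @ _"])
    show "a @ v # y # (- x - y) # r \<in> frames L n U" "a @ v # (- x - y) # x # r \<in> frames L n U"
      using *[of U "a @ [v]"] fr U UL by (auto simp: frames_def)
  qed
  have "a @ x # y # v # r \<in> frames L n U"
    using fr rel_basis_swap[OF U, of L a v x "y # r"] rel_basis_swap[OF U, of L "a @ [x]" v y r] by (auto simp: frames_def)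
  hence 4: "frag_of (a @ x # y # v # r) + frag_of (a @ y # (- x - y) # v # r) + frag_of (a @ (- x - y) # x # v # r) \<in> \<R> n"
    by (rule snoc.IH)
  have fr': "a @ v # x # y # r \<in> frames L n U" using fr by simp
  from subgrp_add[OF R_sub subgrp_add[OF R_sub subgrp_add[OF R_sub m[OF fr'] m[OF f3(1)]] m[OF f3(2)]] 4]
  show ?case by (simp add: algebra_simps)
qed

text \<open>The working form [x, y] = [x, x + y] + [x + y, y] of the three-term relation. With y - x
  in place of y it exchanges a vector for a difference, the basic step for lowering heights.\<close>

lemma three_sum_at:
  assumes f: "a @ x # y # r \<in> frames L n U"
  shows "frag_of (a @ x # y # r) - frag_of (a @ x # (x + y) # r) - frag_of (a @ (x + y) # y # r) \<in> \<R> n"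
    "a @ x # (x + y) # r \<in> frames L n U" "a @ (x + y) # y # r \<in> frames L n U"
proof -
  let ?z = "- x - y"
  have s: "same_line U ?z (x + y)" using U by (simp add: same_line_def subgrp_0)
  have *: "rel_basis L U (c @ y # ?z # r) \<and> rel_basis L U (c @ ?z # x # r)"
    if "rel_basis L U (c @ x # y # r)" "subgrp U" "U \<subseteq> L" for c and U
    using that by (induction c arbitrary: U) (auto simp: rel_basis_three L subgrp_adj adj_least simp del: rel_basis.simps(2)
         simp: rel_basis.simps(2)[of L _ _ "_ @ _"])
  have f1: "(a @ [y]) @ ?z # r \<in> frames L n U" and f2: "a @ ?z # x # r \<in> frames L n U"
    using *[of U a] f U UL by (auto simp: frames_def)
  have ll: "list_all2 (same_line U) (c @ ?z # b) (c @ (x + y) # b)" for c b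
    using s U by (auto intro!: list_all2_appendI list.rel_refl same_line_refl)
  have g1: "a @ y # (x + y) # r \<in> frames L n U" using list_same_line_frames[OF ll f1] by simp
  have g2: "a @ (x + y) # x # r \<in> frames L n U" using list_same_line_frames[OF ll f2] .
  show "a @ x # (x + y) # r \<in> frames L n U" "a @ (x + y) # y # r \<in> frames L n U"
    using g1 g2 rel_basis_swap[OF U] by (auto simp: frames_def)
  have 0: "frag_of (a @ x # y # r) + frag_of (a @ y # ?z # r) + frag_of (a @ ?z # x # r) \<in> \<R> n" by (rule three_at[OF f])
  have 1: "frag_of (a @ y # ?z # r) - frag_of (a @ y # (x + y) # r) \<in> \<R> n" using line_at[OF f1 s] by simp
  have 2: "frag_of (a @ ?z # x # r) - frag_of (a @ (x + y) # x # r) \<in> \<R> n" using line_at[OF f2 s] .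
  have 3: "frag_of (a @ y # (x + y) # r) + frag_of (a @ (x + y) # y # r) \<in> \<R> n" by (rule frame_relations.swap[OF g1])
  have 4: "frag_of (a @ (x + y) # x # r) + frag_of (a @ x # (x + y) # r) \<in> \<R> n" by (rule frame_relations.swap[OF g2])
  from subgrp_diff[OF R_sub subgrp_diff[OF R_sub subgrp_diff[OF R_sub subgrp_diff[OF R_sub 0 1] 2] 3] 4]
  show "frag_of (a @ x # y # r) - frag_of (a @ x # (x + y) # r) - frag_of (a @ (x + y) # y # r) \<in> \<R> n"
    by (simp add: algebra_simps)
qed

end

section \<open>Heights, and completeness of the relations\<close>

lemma height_exists:
  assumes "subgrp L" "subgrp U" "U \<subseteq> L" "rel_basis L U xs" "xs \<noteq> []"
  obtains h :: "'v::comm_ring_1 \<Rightarrow> int" where "\<And>x y. x \<in> L \<Longrightarrow> y \<in> L \<Longrightarrow> h (x + y) = h x + h y"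
    "\<And>u. u \<in> U \<Longrightarrow> h u = 0" "\<exists>y\<in>L. h y \<noteq> 0"
proof -
  have "\<exists>h :: 'v \<Rightarrow> int. (\<forall>x\<in>L. \<forall>y\<in>L. h (x + y) = h x + h y) \<and> (\<forall>u\<in>U. h u = 0) \<and> (\<exists>y\<in>L. h y \<noteq> 0)"
    using assms(2-5)
  proof (induction xs arbitrary: U)
    case (Cons v us)
    show ?case
    proof (cases "us = []")
      case False
      then obtain h :: "'v \<Rightarrow> int" where "\<forall>x\<in>L. \<forall>y\<in>L. h (x + y) = h x + h y" "\<forall>u\<in>adj U v. h u = 0" "\<exists>y\<in>L. h y \<noteq> 0"
        using Cons.IH[of "adj U v"] Cons.prems assms(1) by (auto simp: subgrp_adj adj_least)
      thus ?thesis using adj_subset[of U v] by blast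
    next
      case True
      hence L: "adj U v = L" and v: "v \<in> L" "\<And>m. of_int m * v \<in> U \<Longrightarrow> m = 0" using Cons.prems by auto
      \<comment> \<open>The coordinate of the last basis vector; the recursion has absorbed all
        earlier vectors into U, on which it vanishes.\<close>
      define h where "h = (\<lambda>x. THE m. x - of_int m * v \<in> U)"
      have h: "h x = m" if "x - of_int m * v \<in> U" for x m
        unfolding h_def
      proof (rule the_equality)
        fix k assume "x - of_int k * v \<in> U"
        from subgrp_diff[OF Cons.prems(1) this that] have "of_int (m - k) * v \<in> U" by (simp add: algebra_simps)
        thus "k = m" using v(2)[of "m - k"] by simp
      qed (rule that)
      have hL: "x - of_int (h x) * v \<in> U" if xL: "x \<in> L" for x
      proof -
        obtain u m where "u \<in> U" "x = u + of_int m * v" using xL L unfolding adj_def by blast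
        hence "x - of_int m * v \<in> U" by simp
        thus ?thesis using h by simp
      qed
      have "h (x + y) = h x + h y" if "x \<in> L" "y \<in> L" for x y
        by (rule h) (use subgrp_add[OF Cons.prems(1) hL[OF that(1)] hL[OF that(2)]] in \<open>simp add: algebra_simps\<close>)
      moreover have "h u = 0" if "u \<in> U" for u by (rule h) (use that in simp)
      moreover have "h v = 1" by (rule h) (use subgrp_0[OF Cons.prems(1)] in simp)
      ultimately show ?thesis using v(1) by (metis zero_neq_one)
    qed
  qed simp
  thus thesis using that by blast
qed

text \<open>The part of a chain in the link of the vertex W. It sorts the flags of apartments by
  their first member and gives access to the induction on the rank.\<close>

definition link_part :: "'u \<Rightarrow> ('u list \<Rightarrow>\<^sub>0 int) \<Rightarrow> ('u list \<Rightarrow>\<^sub>0 int)" where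
  "link_part W = frag_extend (\<lambda>l. if l \<noteq> [] \<and> hd l = W then frag_of (tl l) else 0)"

lemma link_part_simps [simp]:
  "link_part W 0 = 0" "link_part W (a + b) = link_part W a + link_part W b"
  "link_part W (a - b) = link_part W a - link_part W b" "link_part W (- a) = - link_part W a"
  "link_part W (frag_cmul m a) = frag_cmul m (link_part W a)"
  by (simp_all add: link_part_def frag_extend_add frag_extend_diff frag_extend_minus frag_extend_cmul)

lemma link_part_sum: "link_part W (sum f I) = (\<Sum>i\<in>I. link_part W (f i))"
  by (induction I rule: infinite_finite_induct) auto

lemma link_part_cons_map: "link_part W (cons_map V a) = (if V = W then a else 0)"
  unfolding link_part_def cons_map_def
  using frag_extend_compose[of "\<lambda>l. if l \<noteq> [] \<and> hd l = W then frag_of (tl l) else 0" "\<lambda>l. V # l" a] frag_expansion[of a]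
  by (simp add: o_def frag_extend_eq_0)

lemma frag_extend_sum_fun: "frag_extend (\<lambda>l. \<Sum>i\<in>I. f i l) a = (\<Sum>i\<in>I. frag_extend (f i) a)"
  unfolding frag_extend_def by (simp add: frag_cmul_sum sum.swap[of _ I])

lemma frag_extend_diff_fun: "frag_extend (\<lambda>l. f l - g l) a = frag_extend f a - frag_extend g a"
  unfolding frag_extend_def by (simp add: frag_cmul_diff2 sum_subtractf)

lemma frames_Cons:
  "v # us \<in> frames L (Suc m) U \<longleftrightarrow> v \<in> L \<and> (\<forall>k. of_int k * v \<in> U \<longrightarrow> k = 0) \<and> us \<in> frames L m (adj U v)"
  by (auto simp: frames_def)

locale height = lattice_pair L U for L U :: "'v::comm_ring_1 set" +
  fixes h :: "'v \<Rightarrow> int"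
  assumes h_add: "x \<in> L \<Longrightarrow> y \<in> L \<Longrightarrow> h (x + y) = h x + h y" and h_U: "u \<in> U \<Longrightarrow> h u = 0"
begin

lemma h_diff: "x \<in> L \<Longrightarrow> y \<in> L \<Longrightarrow> h (x - y) = h x - h y"
  using h_add[of "x - y" y] subgrp_diff[OF L] by simp

lemma h_minus: "x \<in> L \<Longrightarrow> h (- x) = - h x"
  using h_diff[of 0 x] h_U[of 0] subgrp_0[OF L] subgrp_0[OF U] by simp

lemma h_of_int: assumes "x \<in> L" shows "h (of_int m * x) = m * h x"
proof (induction m rule: int_induct[where k = 0])
  case base thus ?case using h_U[of 0] subgrp_0[OF U] by simp
next
  case (step1 i) thus ?case using h_add[OF subgrp_of_int[OF L assms, of i] assms] by (simp add: algebra_simps)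
next
  case (step2 i) thus ?case using h_diff[OF subgrp_of_int[OF L assms, of i] assms] by (simp add: algebra_simps)
qed

lemma h_adj: "u \<in> U \<Longrightarrow> v \<in> L \<Longrightarrow> h (u + of_int m * v) = m * h v"
  using h_add[of u "of_int m * v"] h_of_int[of v m] h_U[of u] UL subgrp_of_int[OF L] by auto

lemma h_zero: "rel_basis L V xs \<Longrightarrow> V \<subseteq> L \<Longrightarrow> \<forall>u\<in>V. h u = 0 \<Longrightarrow> \<forall>x\<in>set xs. h x = 0 \<Longrightarrow> \<forall>y\<in>L. h y = 0"
proof (induction xs arbitrary: V)
  case (Cons v us)
  have "h (u + of_int m * v) = 0" if "u \<in> V" for u m
    using h_add[of u "of_int m * v"] h_of_int[of v m] Cons.prems that subgrp_of_int[OF L, of v] by auto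
  hence "\<forall>u\<in>adj V v. h u = 0" by (auto simp: adj_def)
  moreover have "adj V v \<subseteq> L" using Cons.prems L by (intro adj_least) auto
  ultimately show ?case using Cons by auto
qed simp

text \<open>If the two lines agreed, h u would be a multiple of N and hence 0, and h v a multiple of
  h u. Thus the link of a line of height N receives nothing from frames of smaller height.\<close>

lemma h_adj_eq:
  assumes "v \<in> L" "u \<in> L" "h v = N" "N > 0" "\<bar>h u\<bar> < N" shows "adj U u \<noteq> adj U v"
proof
  assume eq: "adj U u = adj U v"
  obtain a m where "a \<in> U" "u = a + of_int m * v" using adj_self[OF U, of u] unfolding eq by (auto simp: adj_def)
  hence "h u = m * N" using h_adj assms by simp
  hence "\<bar>m\<bar> * N < 1 * N" using assms by (simp add: abs_mult)
  hence "h u = 0" using \<open>h u = m * N\<close> assms(4) mult_less_cancel_right_pos[of N "\<bar>m\<bar>" 1] by simp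
  obtain b k where "b \<in> U" "v = b + of_int k * u" using adj_self[OF U, of v] unfolding eq[symmetric] by (auto simp: adj_def)
  hence "h v = k * h u" using h_adj assms by simp
  thus False using \<open>h u = 0\<close> assms by simp
qed

definition low :: "nat \<Rightarrow> int \<Rightarrow> 'v list set" where
  "low n N = {xs \<in> frames L n U. \<forall>x\<in>set xs. \<bar>h x\<bar> < N}"

definition low_span :: "nat \<Rightarrow> int \<Rightarrow> ('v list \<Rightarrow>\<^sub>0 int) set" where
  "low_span n N = {w. \<exists>b. keys b \<subseteq> low n N \<and> w - b \<in> \<R> n}"

lemma subgrp_low_span: "subgrp (low_span n N)"
  unfolding subgrp_def
proof (intro conjI ballI)
  show "0 \<in> low_span n N" unfolding low_span_def using frame_relations.zero by (auto intro!: exI[of _ 0])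
  fix x y assume "x \<in> low_span n N" "y \<in> low_span n N"
  then obtain a b where ab: "keys a \<subseteq> low n N" "keys b \<subseteq> low n N" "x - a \<in> \<R> n" "y - b \<in> \<R> n"
    by (auto simp: low_span_def)
  have "x - y - (a - b) = (x - a) - (y - b)" by simp
  hence "x - y - (a - b) \<in> \<R> n" using frame_relations.diff[OF ab(3,4)] by metis
  thus "x - y \<in> low_span n N" unfolding low_span_def using keys_diff_subset[OF ab(1,2)] by blast
qed

lemma low_span_R: "w \<in> \<R> n \<Longrightarrow> w \<in> low_span n N"
  unfolding low_span_def by (auto intro!: exI[of _ 0])

lemma low_span_of: "xs \<in> low n N \<Longrightarrow> frag_of xs \<in> low_span n N"
  unfolding low_span_def using frame_relations.zero by (auto intro!: exI[of _ "frag_of xs"])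

lemmas low_add = subgrp_add[OF subgrp_low_span] and low_diff = subgrp_diff[OF subgrp_low_span]

lemma frames_L: "xs \<in> frames L n U \<Longrightarrow> x \<in> set xs \<Longrightarrow> x \<in> L"
  using rel_basis_subset by (auto simp: frames_def)

lemma frames_translate:
  assumes "v # a @ x # r \<in> frames L n U" shows "v # a @ (x + of_int m * v) # r \<in> frames L n U"
proof -
  obtain k where n: "n = Suc k" using assms by (cases n) (auto simp: frames_def)
  have W: "a @ x # r \<in> frames L k (adj U v)" and v: "v \<in> L" using assms by (simp_all add: n frames_Cons)
  interpret W: lattice_pair L "adj U v" by unfold_locales (auto simp: L U subgrp_adj adj_least UL v)
  have "same_line (adj U v) x (x + of_int m * v)"
    using adjI[of 0 U m v] subgrp_0[OF U] U by (simp add: same_line_def subgrp_adj)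
  hence "list_all2 (same_line (adj U v)) (a @ x # r) (a @ (x + of_int m * v) # r)"
    by (auto intro!: list_all2_appendI list.rel_refl same_line_refl subgrp_adj U)
  thus ?thesis using W.list_same_line_frames[OF _ W] assms by (simp add: n frames_Cons)
qed

text \<open>The three-term relation gives [v, x - v] = [v, x] + [x, x - v], and in the last frame
  all heights are below N in absolute value.\<close>

lemma shift_front:
  assumes f: "v # x # r \<in> frames L n U" and v: "h v = N" and x: "0 < h x" "h x < N" and r: "\<forall>y\<in>set r. \<bar>h y\<bar> < N"
  shows "frag_of (v # x # r) - frag_of (v # (x - v) # r) \<in> low_span n N"
proof -
  have f': "v # (x - v) # r \<in> frames L n U" using frames_translate[of v "[]" x r n "-1"] f by simp
  have LL: "v \<in> L" "x \<in> L" using frames_L[OF f] by auto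
  have "x # (x - v) # r \<in> frames L n U" using three_sum_at(3)[of "[]" v "x - v" r n] f' by simp
  hence "x # (x - v) # r \<in> low n N" using x v r LL by (auto simp: low_def h_diff)
  moreover have "frag_of (v # (x - v) # r) - frag_of (v # x # r) - frag_of (x # (x - v) # r) \<in> \<R> n"
    using three_sum_at(1)[of "[]" v "x - v" r n] f' by simp
  ultimately have "- (frag_of (v # (x - v) # r) - frag_of (v # x # r) - frag_of (x # (x - v) # r) + frag_of (x # (x - v) # r)) \<in> low_span n N"
    by (intro subgrp_minus[OF subgrp_low_span] low_add low_span_R low_span_of)
  thus ?thesis by simp
qed

lemma shift_at:
  assumes f: "v # a @ x # r \<in> frames L n U" and v: "h v = N" and x: "0 < h x" "h x < N"
    and r: "\<forall>y\<in>set a. \<bar>h y\<bar> < N" "\<forall>y\<in>set r. \<bar>h y\<bar> < N"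
  shows "frag_of (v # a @ x # r) - frag_of (v # a @ (x - v) # r) \<in> low_span n N"
proof -
  have mv: "frag_of (v # a @ y # r) - frag_cmul ((-1) ^ length a) (frag_of (v # y # a @ r)) \<in> \<R> n \<and> v # y # a @ r \<in> frames L n U"
    if "v # a @ y # r \<in> frames L n U" for y
  proof -
    have g1: "frag_of ((v # a) @ y # r) - frag_cmul ((-1) ^ length (v # a)) (frag_of (y # (v # a) @ r)) \<in> \<R> n"
      using move[of "v # a" y r n] that by simp
    have g2: "y # v # a @ r \<in> frames L n U" using frames_move[of "v # a" y r n] that by simp
    have g3: "frag_of (y # v # a @ r) + frag_of (v # y # a @ r) \<in> \<R> n"
      using frame_relations.swap[of "[]" y v "a @ r" L n U] g2 by simp
    have "v # y # a @ r \<in> frames L n U" using frames_move_back[of y "[v]" "a @ r" n] g2 by simp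
    moreover from subgrp_diff[OF R_sub g1 subgrp_frag_cmul[OF R_sub g3, of "(-1) ^ length a"]]
    have "frag_of (v # a @ y # r) - frag_cmul ((-1) ^ length a) (frag_of (v # y # a @ r)) \<in> \<R> n"
      by (simp add: frag_cmul_distrib2 algebra_simps minus_frag_cmul[symmetric] del: minus_frag_cmul)
    ultimately show ?thesis by blast
  qed
  have f': "v # a @ (x - v) # r \<in> frames L n U" using frames_translate[of v a x r n "-1"] f by simp
  have "frag_of (v # x # a @ r) - frag_of (v # (x - v) # a @ r) \<in> low_span n N"
    using mv[OF f] v x r by (intro shift_front) auto
  hence "frag_cmul ((-1) ^ length a) (frag_of (v # x # a @ r) - frag_of (v # (x - v) # a @ r)) \<in> low_span n N"
    by (rule subgrp_frag_cmul[OF subgrp_low_span])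
  from low_diff[OF low_add[OF low_span_R[OF mv[OF f, THEN conjunct1]] this] low_span_R[OF mv[OF f', THEN conjunct1]]]
  show ?thesis by (simp add: frag_cmul_diff2 minus_frag_cmul[symmetric] del: minus_frag_cmul)
qed

text \<open>Division with remainder by the height of v: for h v > 0 this is the representative of x
  modulo v whose height is the remainder.\<close>

definition lift :: "'v \<Rightarrow> 'v \<Rightarrow> 'v" where
  "lift v x = x - of_int (h x div h v) * v"

lemma lift_L: "x \<in> L \<Longrightarrow> v \<in> L \<Longrightarrow> lift v x \<in> L"
  unfolding lift_def by (intro subgrp_diff[OF L] subgrp_of_int[OF L])

lemma h_lift: "x \<in> L \<Longrightarrow> v \<in> L \<Longrightarrow> h (lift v x) = h x mod h v"
  unfolding lift_def by (simp add: h_diff h_of_int subgrp_of_int[OF L] minus_div_mult_eq_mod)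

lemma lift_frames:
  assumes "us \<in> frames L m (adj U v)" "v \<in> L" "\<forall>k. of_int k * v \<in> U \<longrightarrow> k = 0"
  shows "v # map (lift v) us \<in> frames L (Suc m) U"
proof -
  interpret W: lattice_pair L "adj U v" by unfold_locales (auto simp: L U subgrp_adj adj_least UL assms)
  have "same_line (adj U v) x (lift v x)" for x
    using adjI[of 0 U "- (h x div h v)" v] subgrp_0[OF U] U by (simp add: same_line_def subgrp_adj lift_def)
  hence "list_all2 (same_line (adj U v)) us (map (lift v) us)"
    by (simp add: list_all2_map2 list.rel_refl)
  thus ?thesis using W.list_same_line_frames[OF _ assms(1)] assms by (simp add: frames_Cons)
qed

text \<open>Lifting does not carry relations to relations, because remainders are not additive. Each
  defect is repaired by replacing some vectors x by x - v, and by \<open>shift_front\<close> this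
  costs only frames of smaller height.\<close>

lemma lift_relations:
  assumes w: "w \<in> frame_relations L m (adj U v)" and v: "v \<in> L" "\<forall>k. of_int k * v \<in> U \<longrightarrow> k = 0"
    and N: "h v = N" "N > 0"
  shows "frag_extend (\<lambda>us. frag_of (v # map (lift v) us)) w \<in> low_span (Suc m) N"
  using w
proof induction
  case zero thus ?case using subgrp_0[OF subgrp_low_span] by simp
next
  case (diff a b) thus ?case using low_diff by (simp add: frag_extend_diff)
next
  case (swap a x y b)
  have "(v # map (lift v) a) @ lift v x # lift v y # map (lift v) b \<in> frames L (Suc m) U"
    using lift_frames[OF swap v] by simp
  from frame_relations.swap[OF this] show ?case by (simp add: frag_extend_add low_span_R)
next
  case (line x r x')
  have f: "v # lift v x # map (lift v) r \<in> frames L (Suc m) U" using lift_frames[OF line(1) v] by simp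
  have xL: "x \<in> L" using line(1) rel_basis_subset by (auto simp: frames_def)
  have rL: "\<forall>y\<in>set r. y \<in> L" using line(1) rel_basis_subset by (auto simp: frames_def)
  have rl: "\<forall>y\<in>set (map (lift v) r). \<bar>h y\<bar> < N" using rL v(1) N by (auto simp: h_lift)
  from line(2) consider "x' - x \<in> adj U v" | "x' + x \<in> adj U v" by (auto simp: same_line_def)
  hence "frag_of (v # lift v x # map (lift v) r) - frag_of (v # lift v x' # map (lift v) r) \<in> low_span (Suc m) N"
  proof cases
    case 1
    then obtain u k where u: "u \<in> U" "x' = x + (u + of_int k * v)" by (auto simp: adj_def algebra_simps)
    have "u + of_int k * v \<in> L" using u(1) UL v(1) by (auto intro!: subgrp_add[OF L] subgrp_of_int[OF L])
    hence "h x' = h x + k * N" using h_add[OF xL] h_adj[OF u(1) v(1)] N u(2) by simp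
    hence "h x' div N = h x div N + k" using N by simp
    hence "lift v x' = lift v x + u" using N u(2) by (simp add: lift_def algebra_simps)
    hence "same_line U (lift v x) (lift v x')" using u(1) U by (simp add: same_line_def)
    thus ?thesis using line_at[of "[v]" "lift v x" "map (lift v) r" "Suc m" "lift v x'"] f by (simp add: low_span_R)
  next
    case 2
    then obtain u k where "u \<in> U" "x' + x = u + of_int k * v" by (auto simp: adj_def)
    hence u: "u \<in> U" "x' = (u + of_int k * v) - x" by (auto simp: algebra_simps)
    have "u + of_int k * v \<in> L" using u(1) UL v(1) by (auto intro!: subgrp_add[OF L] subgrp_of_int[OF L])
    hence hx': "h x' = k * N - h x" using h_diff[OF _ xL] h_adj[OF u(1) v(1)] N u(2) by simp
    show ?thesis
    \<comment> \<open>Negation sends a nonzero remainder to its complement in N. Up to U, the lift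
      of x' is minus the lift of x if the remainder is 0, and v minus the lift of x otherwise; in
      the second case one shift by v is needed.\<close>
    proof (cases "h x mod N = 0")
      case True
      hence "h x' div N = k - h x div N" using hx' N by (simp add: mod_eq_0_iff_dvd div_diff)
      hence "lift v x' = x' - of_int (k - h x div N) * v" by (simp only: lift_def N(1))
      also have "\<dots> = u - lift v x" unfolding u(2) lift_def N(1) by (simp add: algebra_simps)
      finally have "lift v x' = u - lift v x" .
      hence "same_line U (lift v x) (lift v x')" using u(1) U by (simp add: same_line_def)
      thus ?thesis using line_at[of "[v]" "lift v x" "map (lift v) r" "Suc m" "lift v x'"] f by (simp add: low_span_R)
    next
      case False
      have "h x' = (- h x) + k * N" using hx' by simp
      moreover have "((- h x) + k * N) div N = k + (- h x) div N" by (rule div_mult_self1) (use N in simp)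
      ultimately have "h x' div N = k + (- h x) div N" by (simp only:)
      moreover have "(- h x) div N = - (h x div N) - 1" using False N by (simp add: zdiv_zminus1_eq_if)
      ultimately have "h x' div N = k - h x div N - 1" by simp
      hence "lift v x' = x' - of_int (k - h x div N - 1) * v" by (simp only: lift_def N(1))
      also have "\<dots> = u - (lift v x - v)" unfolding u(2) lift_def N(1) by (simp add: algebra_simps)
      finally have "lift v x' = u - (lift v x - v)" .
      hence sl: "same_line U (lift v x - v) (lift v x')" using u(1) U by (simp add: same_line_def)
      have f': "v # (lift v x - v) # map (lift v) r \<in> frames L (Suc m) U"
        using frames_translate[of v "[]" "lift v x" "map (lift v) r" "Suc m" "-1"] f by simp
      have 1: "frag_of (v # (lift v x - v) # map (lift v) r) - frag_of (v # lift v x' # map (lift v) r) \<in> low_span (Suc m) N"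
        using line_at[of "[v]" "lift v x - v" "map (lift v) r" "Suc m" "lift v x'"] f' sl by (simp add: low_span_R)
      have "0 < h x mod N" using False pos_mod_sign[of N "h x"] N by linarith
      hence "0 < h (lift v x)" "h (lift v x) < N" using False N h_lift[OF xL v(1)] pos_mod_sign[of N "h x"] pos_mod_bound[of N "h x"] by simp_all
      hence 2: "frag_of (v # lift v x # map (lift v) r) - frag_of (v # (lift v x - v) # map (lift v) r) \<in> low_span (Suc m) N"
        using shift_front[OF f N(1)] rl by blast
      from low_add[OF 1 2] show ?thesis by simp
    qed
  qed
  thus ?case by (simp add: frag_extend_diff)
next
  case (three x y r)
  let ?z = "- x - y" and ?r = "map (lift v) r"
  let ?X = "lift v x" and ?Y = "lift v y" and ?Z = "lift v ?z"
  interpret W: lattice_pair L "adj U v" by unfold_locales (auto simp: L U subgrp_adj adj_least UL v)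
  have xyL: "x \<in> L" "y \<in> L" and rL: "\<forall>y\<in>set r. y \<in> L" using three rel_basis_subset by (auto simp: frames_def)
  have zL: "?z \<in> L" using xyL by (intro subgrp_diff[OF L] subgrp_minus[OF L])
  have rl: "\<forall>y\<in>set ?r. \<bar>h y\<bar> < N" using rL v(1) N by (auto simp: h_lift)
  have XL: "?X \<in> L" "?Y \<in> L" "?Z \<in> L" using xyL zL v(1) lift_L by auto
  define a b c where "a = h ?X" and "b = h ?Y" and "c = h ?Z"
  have rng: "0 \<le> a" "a < N" "0 \<le> b" "b < N" "0 \<le> c" "c < N"
    using N xyL zL v(1) by (auto simp: a_def b_def c_def h_lift)
  \<comment> \<open>The three lifts sum to k v with k in {0, 1, 2}, since their heights are
    remainders modulo N. Subtracting v from k of the lifts, all of positive height, restores the sum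
    zero.\<close>
  define k where "k = - (h x div N) - (h y div N) - (h ?z div N)"
  have sumv: "?X + ?Y + ?Z = of_int k * v" unfolding k_def lift_def N(1) by (simp add: algebra_simps)
  hence "a + b + c = k * N"
    using h_of_int[OF v(1), of k] h_add[OF XL(1,2)] h_add[OF subgrp_add[OF L XL(1,2)] XL(3)] N by (simp add: a_def b_def c_def)
  hence "0 \<le> k * N" "k * N < 3 * N" using rng by linarith+
  hence k: "k = 0 \<or> k = 1 \<or> k = 2" using N(2) by (auto simp: zero_le_mult_iff mult_less_cancel_right)
  have "\<exists>e1 e2 e3. {e1, e2, e3} \<subseteq> {0, 1::int} \<and> e1 + e2 + e3 = k \<and> (e1 = 1 \<longrightarrow> 0 < a) \<and> (e2 = 1 \<longrightarrow> 0 < b) \<and> (e3 = 1 \<longrightarrow> 0 < c)"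
  proof -
    consider "k = 0" | "k = 1" "0 < c" | "k = 1" "0 < a" | "k = 2" "0 < a" "0 < b"
      using k rng \<open>a + b + c = k * N\<close> N(2) by fastforce
    thus ?thesis
    proof cases
      case 1 thus ?thesis by (intro exI[of _ 0]) simp
    next
      case 2 thus ?thesis by (intro exI[of _ 0] exI[of _ 1]) simp
    next
      case 3 thus ?thesis by (intro exI[of _ 1] exI[of _ 0]) simp
    next
      case 4
      show ?thesis by (rule exI[of _ 1], rule exI[of _ 1], rule exI[of _ 0]) (use 4 in simp)
    qed
  qed
  then obtain e1 e2 e3 where e: "e1 = 0 \<or> e1 = (1::int)" "e2 = 0 \<or> e2 = (1::int)" "e3 = 0 \<or> e3 = (1::int)" "e1 + e2 + e3 = k"
     "e1 = 1 \<longrightarrow> 0 < a" "e2 = 1 \<longrightarrow> 0 < b" "e3 = 1 \<longrightarrow> 0 < c" by auto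
  have sh: "frag_of (v # p # q # ?r) - frag_of (v # (p - of_int d * v) # (q - of_int d' * v) # ?r) \<in> low_span (Suc m) N"
    if f: "v # p # q # ?r \<in> frames L (Suc m) U" and d: "d = 0 \<or> d = (1::int)" "d' = 0 \<or> d' = (1::int)"
      "0 \<le> h p" "h p < N" "0 \<le> h q" "h q < N" "d = 1 \<longrightarrow> 0 < h p" "d' = 1 \<longrightarrow> 0 < h q" for p q d d'
  proof -
    have 1: "frag_of (v # p # q # ?r) - frag_of (v # (p - of_int d * v) # q # ?r) \<in> low_span (Suc m) N"
    proof (cases "d = 1")
      case True thus ?thesis using shift_front[OF f N(1)] d rl by auto
    qed (use d subgrp_0[OF subgrp_low_span] in auto)
    have f': "v # [p - of_int d * v] @ q # ?r \<in> frames L (Suc m) U"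
      using frames_translate[of v "[]" p "q # ?r" "Suc m" "- d"] f by simp
    have pL: "p \<in> L" using frames_L[OF f] by auto
    have hp: "\<bar>h (p - of_int d * v)\<bar> < N"
      using d N pL v(1) by (auto simp: h_diff)
    have 2: "frag_of (v # (p - of_int d * v) # q # ?r) - frag_of (v # (p - of_int d * v) # (q - of_int d' * v) # ?r) \<in> low_span (Suc m) N"
    proof (cases "d' = 1")
      case True
      hence "0 < h q" using d(8) by simp
      moreover have "\<forall>y\<in>set [p - of_int d * v]. \<bar>h y\<bar> < N" using hp by simp
      ultimately have "frag_of (v # [p - of_int d * v] @ q # ?r) - frag_of (v # [p - of_int d * v] @ (q - v) # ?r) \<in> low_span (Suc m) N"
        using shift_at[OF f' N(1)] d(6) rl by blast
      thus ?thesis using True by simp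
    qed (use d subgrp_0[OF subgrp_low_span] in auto)
    from low_add[OF 1 2] show ?thesis by simp
  qed
  have F: "v # ?X # ?Y # ?r \<in> frames L (Suc m) U" using lift_frames[OF three v] by simp
  have G: "y # ?z # r \<in> frames L m (adj U v)" "?z # x # r \<in> frames L m (adj U v)"
  proof -
    have rb: "rel_basis L (adj U v) (x # y # r)" and len: "length (x # y # r) = m"
      using three unfolding frames_def mem_Collect_eq by blast+
    show "y # ?z # r \<in> frames L m (adj U v)" "?z # x # r \<in> frames L m (adj U v)"
      unfolding frames_def mem_Collect_eq using rel_basis_three[OF W.U W.UL L rb] len by (metis length_Cons)+
  qed
  have F2: "v # ?Y # ?Z # ?r \<in> frames L (Suc m) U" "v # ?Z # ?X # ?r \<in> frames L (Suc m) U"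
    using lift_frames[OF G(1) v] lift_frames[OF G(2) v] by simp_all
  define X' Y' Z' where "X' = ?X - of_int e1 * v" and "Y' = ?Y - of_int e2 * v" and "Z' = ?Z - of_int e3 * v"
  have "X' + Y' + Z' = of_int k * v - of_int (e1 + e2 + e3) * v"
    unfolding X'_def Y'_def Z'_def sumv[symmetric] by (simp add: algebra_simps)
  hence "X' + Y' + Z' = 0" unfolding e(4) by simp
  moreover have "Z' = (X' + Y' + Z') - X' - Y'" by simp
  ultimately have Z': "Z' = - X' - Y'" by simp
  have "v # X' # Y' # ?r \<in> frames L (Suc m) U"
    using frames_translate[of v "[X']" ?Y ?r "Suc m" "- e2"] frames_translate[of v "[]" ?X "?Y # ?r" "Suc m" "- e1"] F
    by (simp add: X'_def Y'_def)
  hence T: "frag_of (v # X' # Y' # ?r) + frag_of (v # Y' # Z' # ?r) + frag_of (v # Z' # X' # ?r) \<in> low_span (Suc m) N"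
    using three_at[of "[v]" X' Y' ?r "Suc m"] Z' low_span_R by simp
  have 1: "frag_of (v # ?X # ?Y # ?r) - frag_of (v # X' # Y' # ?r) \<in> low_span (Suc m) N"
    unfolding X'_def Y'_def by (rule sh[OF F]) (use e rng in \<open>auto simp: a_def b_def c_def\<close>)
  have 2: "frag_of (v # ?Y # ?Z # ?r) - frag_of (v # Y' # Z' # ?r) \<in> low_span (Suc m) N"
    unfolding Z'_def Y'_def by (rule sh[OF F2(1)]) (use e rng in \<open>auto simp: a_def b_def c_def\<close>)
  have 3: "frag_of (v # ?Z # ?X # ?r) - frag_of (v # Z' # X' # ?r) \<in> low_span (Suc m) N"
    unfolding Z'_def X'_def by (rule sh[OF F2(2)]) (use e rng in \<open>auto simp: a_def b_def c_def\<close>)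
  from low_add[OF low_add[OF low_add[OF 1 2] 3] T]
  show ?case by (simp add: frag_extend_add algebra_simps)
qed

end

section \<open>Reduction to frames with a single vector of maximal height\<close>

context height begin

text \<open>The normal form at level N: one vector v of height N at the front, and the others
  already reduced, so that \<open>lift v\<close> fixes them.\<close>

definition single_high :: "nat \<Rightarrow> int \<Rightarrow> 'v list set" where
  "single_high n N = {v # us | v us. v # us \<in> frames L n U \<and> h v = N \<and> (\<forall>u\<in>set us. 0 \<le> h u \<and> h u < N)}"

definition reduced :: "nat \<Rightarrow> int \<Rightarrow> ('v list \<Rightarrow>\<^sub>0 int) set" where
  "reduced n N = {w. \<exists>a. keys a \<subseteq> single_high n N \<and> w - a \<in> low_span n N}"

lemma subgrp_reduced: "subgrp (reduced n N)"
  unfolding subgrp_def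
proof (intro conjI ballI)
  show "0 \<in> reduced n N" unfolding reduced_def using subgrp_0[OF subgrp_low_span] by (auto intro!: exI[of _ 0])
  fix x y assume "x \<in> reduced n N" "y \<in> reduced n N"
  then obtain a b where ab: "keys a \<subseteq> single_high n N" "keys b \<subseteq> single_high n N" "x - a \<in> low_span n N" "y - b \<in> low_span n N"
    by (auto simp: reduced_def)
  have "x - y - (a - b) = (x - a) - (y - b)" by simp
  hence "x - y - (a - b) \<in> low_span n N" using low_diff[OF ab(3,4)] by metis
  thus "x - y \<in> reduced n N" unfolding reduced_def using keys_diff_subset[OF ab(1,2)] by blast
qed

lemma low_span_reduced: "w \<in> low_span n N \<Longrightarrow> w \<in> reduced n N"
  unfolding reduced_def by (auto intro!: exI[of _ 0])

lemma single_high_reduced: "xs \<in> single_high n N \<Longrightarrow> frag_of xs \<in> reduced n N"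
  unfolding reduced_def using subgrp_0[OF subgrp_low_span] by (auto intro!: exI[of _ "frag_of xs"])

lemma reduced_cong: "a - b \<in> \<R> n \<Longrightarrow> b \<in> reduced n N \<Longrightarrow> a \<in> reduced n N"
  using subgrp_add[OF subgrp_reduced low_span_reduced[OF low_span_R]] by fastforce

lemma high_to_front:
  assumes "xs \<in> frames L n U" "x0 \<in> set xs" "\<bar>h x0\<bar> = N" "N > 0"
  obtains v a b where "xs = a @ x0 # b" "h v = N" "v # a @ b \<in> frames L n U"
    "frag_of (v # a @ b) \<in> reduced n N \<Longrightarrow> frag_of xs \<in> reduced n N" "v = x0 \<or> v = - x0"
proof -
  obtain a b where ab: "xs = a @ x0 # b" using assms(2) by (meson split_list)
  define v where "v = (if h x0 = N then x0 else - x0)"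
  have "x0 \<in> L" using assms frames_L by blast
  hence hv: "h v = N" using assms(3,4) by (auto simp: v_def h_minus)
  have f: "x0 # a @ b \<in> frames L n U" using frames_move assms(1) ab by blast
  have sl: "same_line U x0 v" using same_line_minus same_line_refl[OF U] by (simp add: v_def)
  have f': "v # a @ b \<in> frames L n U"
    by (rule list_same_line_frames[OF _ f]) (use sl U in \<open>auto intro!: list.rel_refl same_line_refl\<close>)
  have "frag_of xs \<in> reduced n N" if "frag_of (v # a @ b) \<in> reduced n N"
  proof -
    have "frag_of (x0 # a @ b) \<in> reduced n N"
      using reduced_cong[OF frame_relations.line[OF f sl] that] .
    hence "frag_cmul ((-1) ^ length a) (frag_of (x0 # a @ b)) \<in> reduced n N" by (rule subgrp_frag_cmul[OF subgrp_reduced])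
    thus ?thesis using reduced_cong move assms(1) ab by blast
  qed
  thus thesis using that ab hv f' by (auto simp: v_def)
qed

text \<open>Two vectors u, w of height N are separated by [u, w] = [u, w - u] - [w, w - u]; since w
  - u has height 0, both frames on the right have fewer high vectors. When one is left, sign changes
  make the other heights nonnegative.\<close>

lemma reduction:
  assumes N: "N > 0"
  shows "xs \<in> frames L n U \<Longrightarrow> \<forall>x\<in>set xs. \<bar>h x\<bar> \<le> N \<Longrightarrow> frag_of xs \<in> reduced n N"
proof (induction "length (filter (\<lambda>x. \<bar>h x\<bar> = N) xs)" arbitrary: xs rule: less_induct)
  case less
  note f = less.prems(1) and le = less.prems(2)
  show ?case
  proof (cases "\<exists>x\<in>set xs. \<bar>h x\<bar> = N")
    case False
    hence "xs \<in> low n N" using f le by (force simp: low_def)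
    thus ?thesis by (intro low_span_reduced low_span_of)
  next
    case True
    then obtain x0 where x0: "x0 \<in> set xs" "\<bar>h x0\<bar> = N" by blast
    obtain v a b where v: "xs = a @ x0 # b" "h v = N" "v # a @ b \<in> frames L n U"
      "frag_of (v # a @ b) \<in> reduced n N \<Longrightarrow> frag_of xs \<in> reduced n N"
      using high_to_front[OF f x0 N] by metis
    let ?r = "a @ b"
    have ler: "\<forall>x\<in>set ?r. \<bar>h x\<bar> \<le> N" using le v(1) by auto
    have "frag_of (v # ?r) \<in> reduced n N"
    proof (cases "\<exists>x\<in>set ?r. \<bar>h x\<bar> = N")
      case False
      define s where "s = (\<lambda>x. if h x < 0 then - x else x)"
      have rL: "x \<in> L" if "x \<in> set ?r" for x using frames_L[OF v(3)] that by auto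
      have "same_line U x (s x)" for x using same_line_minus same_line_refl[OF U] by (simp add: s_def)
      hence l: "list_all2 (same_line U) ?r (map s ?r)" by (simp add: list_all2_map2 list.rel_refl del: map_append)
      have 1: "frag_of ([v] @ ?r) - frag_of ([v] @ map s ?r) \<in> \<R> n" by (rule lines_at[OF l]) (use v(3) in simp)
      have "list_all2 (same_line U) (v # ?r) (v # map s ?r)" using l same_line_refl[OF U] by simp
      hence "v # map s ?r \<in> frames L n U" using list_same_line_frames v(3) by blast
      moreover have "0 \<le> h u \<and> h u < N" if u: "u \<in> set (map s ?r)" for u
      proof -
        obtain x where x: "x \<in> set ?r" "u = s x" using u unfolding set_map by blast
        hence "\<bar>h x\<bar> < N" using False ler by (metis order_le_imp_less_or_eq)
        thus ?thesis using x rL by (auto simp: s_def h_minus)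
      qed
      ultimately have "v # map s ?r \<in> single_high n N" using v(2) unfolding single_high_def by blast
      thus ?thesis using reduced_cong 1 single_high_reduced by (metis append_Cons append_Nil)
    next
      case True
      then obtain y0 where y0: "y0 \<in> set ?r" "\<bar>h y0\<bar> = N" by blast
      have y0': "y0 \<in> set (v # ?r)" using y0 by simp
      obtain w a' b' where w: "v # ?r = a' @ y0 # b'" "h w = N" "w # a' @ b' \<in> frames L n U"
        "frag_of (w # a' @ b') \<in> reduced n N \<Longrightarrow> frag_of (v # ?r) \<in> reduced n N"
        using high_to_front[OF v(3) y0' y0(2) N] by metis
      have cnt: "length (filter (\<lambda>x. \<bar>h x\<bar> = N) (w # a' @ b')) = length (filter (\<lambda>x. \<bar>h x\<bar> = N) xs)"
      proof -
        have "length (filter (\<lambda>x. \<bar>h x\<bar> = N) (w # a' @ b')) = length (filter (\<lambda>x. \<bar>h x\<bar> = N) (v # ?r))"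
          unfolding w(1) using w(2) y0(2) N by simp
        also have "\<dots> = length (filter (\<lambda>x. \<bar>h x\<bar> = N) xs)" unfolding v(1) using v(2) x0(2) N by simp
        finally show ?thesis .
      qed
      have le': "\<forall>x\<in>set (w # a' @ b'). \<bar>h x\<bar> \<le> N"
      proof -
        have "set (a' @ b') \<subseteq> set (v # ?r)" unfolding w(1) by auto
        thus ?thesis using ler v(2) w(2) N by auto
      qed
      have "\<exists>u\<in>set (a' @ b'). \<bar>h u\<bar> = N"
      proof -
        have "length (filter (\<lambda>x. \<bar>h x\<bar> = N) (v # ?r)) \<ge> 2"
          using y0 v(2) N by (auto simp: Suc_le_eq filter_empty_conv)
        hence "filter (\<lambda>x. \<bar>h x\<bar> = N) (a' @ b') \<noteq> []" unfolding w(1) using y0(2) by auto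
        thus ?thesis by (auto simp: filter_empty_conv)
      qed
      then obtain u0 where u0: "u0 \<in> set (a' @ b')" "\<bar>h u0\<bar> = N" by blast
      obtain c d where cd: "a' @ b' = c @ u0 # d" using u0(1) by (meson split_list)
      define u where "u = (if h u0 = N then u0 else - u0)"
      have "u0 \<in> L" using frames_L[OF w(3)] u0(1) by simp
      hence hu: "h u = N" using u0(2) N by (auto simp: u_def h_minus)
      have sl: "same_line U u0 u" using same_line_minus same_line_refl[OF U] by (simp add: u_def)
      have g: "(w # c) @ u0 # d \<in> frames L n U" using w(3) cd by simp
      have m1: "frag_of ((w # c) @ u0 # d) - frag_cmul ((-1) ^ length (w # c)) (frag_of (u0 # (w # c) @ d)) \<in> \<R> n"
        by (rule move[OF g])
      have g1: "u0 # (w # c) @ d \<in> frames L n U" by (rule frames_move[OF g])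
      have g2: "u # w # c @ d \<in> frames L n U"
        by (rule list_same_line_frames[OF _ g1]) (use sl U in \<open>auto intro!: list.rel_refl same_line_refl\<close>)
      have m2: "frag_of (u0 # (w # c) @ d) - frag_of (u # (w # c) @ d) \<in> \<R> n"
        by (rule frame_relations.line[OF g1 sl])
      have g3: "u # (w - u) # c @ d \<in> frames L n U" using frames_translate[of u "[]" w "c @ d" n "-1"] g2 by simp
      have m3: "frag_of (u # (w - u) # c @ d) - frag_of (u # w # c @ d) - frag_of (w # (w - u) # c @ d) \<in> \<R> n"
        and g4: "w # (w - u) # c @ d \<in> frames L n U"
        using three_sum_at[of "[]" u "w - u" "c @ d" n] g3 by simp_all
      have wuL: "w \<in> L" "u \<in> L" using frames_L[OF g2] by auto
      have small: "frag_of (p # (w - u) # c @ d) \<in> reduced n N" if "h p = N" "p # (w - u) # c @ d \<in> frames L n U" for p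
      proof (rule less.hyps)
        show "p # (w - u) # c @ d \<in> frames L n U" by (rule that(2))
        show "\<forall>x\<in>set (p # (w - u) # c @ d). \<bar>h x\<bar> \<le> N"
          using le' that(1) wuL hu w(2) N unfolding cd by (auto simp: h_diff)
        show "length (filter (\<lambda>x. \<bar>h x\<bar> = N) (p # (w - u) # c @ d)) < length (filter (\<lambda>x. \<bar>h x\<bar> = N) xs)"
          unfolding cnt[symmetric] cd using that(1) wuL hu w(2) N u0(2) by (simp add: h_diff)
      qed
      have "frag_of (u # w # c @ d) \<in> reduced n N"
      proof -
        from subgrp_diff[OF subgrp_reduced subgrp_diff[OF subgrp_reduced small[OF hu g3] small[OF w(2) g4]]
            low_span_reduced[OF low_span_R[OF m3]]]
        show ?thesis by simp
      qed
      hence "frag_of (u0 # (w # c) @ d) \<in> reduced n N" using reduced_cong[OF m2] by simp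
      hence "frag_of ((w # c) @ u0 # d) \<in> reduced n N"
        by (rule reduced_cong[OF m1 subgrp_frag_cmul[OF subgrp_reduced]])
      hence "frag_of (w # a' @ b') \<in> reduced n N" using cd by simp
      thus ?thesis by (rule w(4))
    qed
    thus ?thesis by (rule v(4))
  qed
qed

lemma link_part_apartment_none:
  assumes "xs \<noteq> []" "\<And>x. x \<in> set xs \<Longrightarrow> adj U x \<noteq> W"
  shows "link_part W (apartment adj U xs) = 0"
  using assms by (simp add: apartment_nonempty link_part_sum link_part_cons_map)

lemma link_part_apartment:
  assumes "\<And>x. x \<in> set us \<Longrightarrow> adj U x \<noteq> adj U v"
  shows "link_part (adj U v) (apartment adj U (v # us)) = apartment adj (adj U v) us"
  using assms
  by (simp add: apartment_nonempty link_part_sum link_part_cons_map sum.lessThan_Suc_shift del: sum.lessThan_Suc)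

lemma low_no_link:
  assumes "xs \<in> low (Suc m) N" "v \<in> L" "h v = N" "N > 0"
  shows "link_part (adj U v) (apartment adj U xs) = 0"
proof (rule link_part_apartment_none)
  show "xs \<noteq> []" using assms(1) by (auto simp: low_def frames_def)
  fix x assume x: "x \<in> set xs"
  hence "x \<in> L" "\<bar>h x\<bar> < N" using assms(1) frames_L by (auto simp: low_def)
  thus "adj U x \<noteq> adj U v" using h_adj_eq assms by blast
qed

text \<open>For a line W of height N, only the normal forms that start with W contribute to the link
  at W. As the whole apartment chain vanishes, so does this link; the induction hypothesis turns it
  into relations of lower rank, and \<open>lift_relations\<close> into frames of smaller
  height.\<close>

lemma high_step:
  assumes IH: "\<And>v z. v \<in> L \<Longrightarrow> keys z \<subseteq> frames L m (adj U v) \<Longrightarrow> frag_extend (apartment adj (adj U v)) z = 0 \<Longrightarrow>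
      z \<in> frame_relations L m (adj U v)"
    and N: "N > 0" and z: "keys z \<subseteq> frames L (Suc m) U" "\<And>xs. xs \<in> keys z \<Longrightarrow> \<forall>x\<in>set xs. \<bar>h x\<bar> \<le> N"
    and z0: "frag_extend (apartment adj U) z = 0"
  shows "z \<in> low_span (Suc m) N"
proof -
  let ?n = "Suc m"
  have "frag_extend frag_of z \<in> reduced ?n N"
    by (rule subgrp_frag_extend[OF subgrp_reduced], rule reduction[OF N]) (use z in auto)
  then obtain a where a: "keys a \<subseteq> single_high ?n N" "z - a \<in> low_span ?n N"
    unfolding frag_expansion[of z, symmetric] by (auto simp: reduced_def)
  then obtain b where b: "keys b \<subseteq> low ?n N" "z - a - b \<in> \<R> ?n" by (auto simp: low_span_def)
  have "frag_extend (apartment adj U) (z - a - b) = 0" by (rule apartment_relations[OF b(2) U])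
  hence ab: "frag_extend (apartment adj U) a = - frag_extend (apartment adj U) b"
    using z0 by (simp add: frag_extend_diff eq_neg_iff_add_eq_0 neg_eq_iff_add_eq_0)
  define part where "part W = frag_extend (\<lambda>l. if adj U (hd l) = W then frag_of l else 0) a" for W
  have lp: "link_part W (frag_extend f c) = frag_extend (\<lambda>l. link_part W (f l)) c"
    for W and f :: "'v list \<Rightarrow> 'v set list \<Rightarrow>\<^sub>0 int" and c
    unfolding frag_extend_def by (simp add: link_part_sum)
  have part: "part W \<in> low_span ?n N" if W: "W \<in> (\<lambda>l. adj U (hd l)) ` keys a" for W
  proof -
    obtain l0 where l0: "l0 \<in> keys a" "W = adj U (hd l0)" using W by blast
    define v where "v = hd l0"
    have s0: "v # tl l0 \<in> frames L ?n U" "h v = N" using l0 a(1) unfolding v_def single_high_def by auto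
    have Wv: "W = adj U v" using l0 by (simp add: v_def)
    have vL: "v \<in> L" "\<forall>k. of_int k * v \<in> U \<longrightarrow> k = 0" using s0(1) by (simp_all add: frames_Cons)
    define zW where "zW = frag_extend (\<lambda>l. if adj U (hd l) = W then frag_of (tl l) else 0) a"
    have zW: "keys zW \<subseteq> frames L m W"
      unfolding zW_def
    proof (rule keys_frag_extend_subset[OF a(1)])
      fix l assume "l \<in> single_high ?n N"
      thus "keys (if adj U (hd l) = W then frag_of (tl l) else 0) \<subseteq> frames L m W"
        by (auto simp: single_high_def frames_Cons)
    qed
    have "link_part W (frag_extend (apartment adj U) a) = frag_extend (apartment adj W) zW"
    proof -
      have "link_part W (apartment adj U l) = (if adj U (hd l) = W then apartment adj W (tl l) else 0)" if lk: "l \<in> keys a" for l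
      proof -
        obtain v' us where l: "l = v' # us" "v' # us \<in> frames L ?n U" "h v' = N" "\<forall>u\<in>set us. 0 \<le> h u \<and> h u < N"
          using subsetD[OF a(1) lk] unfolding single_high_def by blast
        have us: "adj U x \<noteq> adj U v''" if "x \<in> set us" "v'' \<in> L" "h v'' = N" for x v''
          using h_adj_eq[OF that(2) _ that(3) N, of x] l(4) that(1) frames_L[OF l(2)] by auto
        have v'L: "v' \<in> L" using frames_L[OF l(2)] by simp
        show ?thesis
        proof (cases "adj U v' = W")
          case True thus ?thesis using link_part_apartment[of us v'] us[OF _ v'L l(3)] l(1) by auto
        next
          case False
          hence "link_part W (apartment adj U l) = 0"
            using l(1) us[OF _ vL(1) s0(2)] Wv by (intro link_part_apartment_none) auto
          thus ?thesis using False l(1) by simp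
        qed
      qed
      hence "link_part W (frag_extend (apartment adj U) a) = frag_extend (\<lambda>l. if adj U (hd l) = W then apartment adj W (tl l) else 0) a"
        unfolding lp by (rule frag_extend_eq)
      also have "\<dots> = frag_extend (apartment adj W) zW"
        unfolding zW_def frag_extend_def[of _ a] frag_extend_sum[OF finite_keys]
        by (auto simp: frag_extend_cmul intro!: sum.cong)
      finally show ?thesis .
    qed
    moreover have "link_part W (frag_extend (apartment adj U) b) = 0"
      unfolding lp Wv using b(1) low_no_link[OF _ vL(1) s0(2) N] by (intro frag_extend_eq_0) auto
    ultimately have "frag_extend (apartment adj W) zW = 0" using ab by simp
    hence "zW \<in> frame_relations L m (adj U v)" using IH[OF vL(1)] zW Wv by simp
    hence 1: "frag_extend (\<lambda>us. frag_of (v # map (lift v) us)) zW \<in> low_span ?n N"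
      using lift_relations vL s0(2) N by blast
    have "frag_extend (\<lambda>us. frag_of (v # map (lift v) us)) zW = frag_extend (\<lambda>l. if adj U (hd l) = W then frag_of (v # tl l) else 0) a"
    proof -
      have "frag_extend (\<lambda>us. frag_of (v # map (lift v) us)) zW =
         frag_extend (\<lambda>l. if adj U (hd l) = W then frag_of (v # map (lift v) (tl l)) else 0) a"
        unfolding zW_def frag_extend_def[of _ a] frag_extend_sum[OF finite_keys]
        by (auto simp: frag_extend_cmul intro!: sum.cong)
      also have "\<dots> = frag_extend (\<lambda>l. if adj U (hd l) = W then frag_of (v # tl l) else 0) a"
      proof (rule frag_extend_eq)
        fix l assume "l \<in> keys a"
        hence "\<forall>u\<in>set (tl l). 0 \<le> h u \<and> h u < N" using a(1) by (auto simp: single_high_def)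
        hence "map (lift v) (tl l) = tl l" using s0(2) by (intro map_idI) (simp add: lift_def)
        thus "(if adj U (hd l) = W then frag_of (v # map (lift v) (tl l)) else 0) = (if adj U (hd l) = W then frag_of (v # tl l) else 0)" by simp
      qed
      finally show ?thesis .
    qed
    \<comment> \<open>Vectors that generate W modulo U and have the same height N differ by an
      element of U, so every front vector can be replaced by the chosen v.\<close>
    moreover have "frag_extend (\<lambda>l. if adj U (hd l) = W then frag_of (v # tl l) else 0) a - part W \<in> \<R> ?n"
    proof -
      have "frag_extend (\<lambda>l. (if adj U (hd l) = W then frag_of (v # tl l) else 0) - (if adj U (hd l) = W then frag_of l else 0)) a \<in> \<R> ?n"
      proof (rule subgrp_frag_extend[OF R_sub])
        fix l assume "l \<in> keys a"
        then obtain v' us where l: "l = v' # us" "v' # us \<in> frames L ?n U" "h v' = N" using a(1) by (auto simp: single_high_def)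
        have "frag_of (v' # us) - frag_of (v # us) \<in> \<R> ?n" if eq: "adj U v' = W"
        proof (rule frame_relations.line[OF l(2)])
          have v'L: "v' \<in> L" using frames_L[OF l(2)] by simp
          have "v \<in> adj U v'" using adj_self[OF U, of v] Wv eq by simp
          then obtain u k where u: "u \<in> U" "v = u + of_int k * v'" unfolding adj_def by blast
          hence "k = 1" using h_adj[OF u(1) v'L, of k] s0(2) l(3) N by simp
          thus "same_line U v' v" using u U by (simp add: same_line_def)
        qed
        hence "adj U v' = W \<Longrightarrow> - (frag_of (v' # us) - frag_of (v # us)) \<in> \<R> ?n" by (rule subgrp_minus[OF R_sub])
        thus "(if adj U (hd l) = W then frag_of (v # tl l) else 0) - (if adj U (hd l) = W then frag_of l else 0) \<in> \<R> ?n"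
          using l(1) frame_relations.zero by auto
      qed
      thus ?thesis unfolding frag_extend_diff_fun part_def .
    qed
    ultimately show ?thesis using low_diff[OF 1 low_span_R] by fastforce
  qed
  have "a = (\<Sum>W\<in>(\<lambda>l. adj U (hd l)) ` keys a. part W)"
  proof -
    have "frag_extend frag_of a = frag_extend (\<lambda>l. \<Sum>W\<in>(\<lambda>l. adj U (hd l)) ` keys a. if adj U (hd l) = W then frag_of l else 0) a"
      by (rule frag_extend_eq) (simp add: sum.delta)
    thus ?thesis unfolding frag_extend_sum_fun part_def frag_expansion[of a, symmetric] .
  qed
  hence "a \<in> low_span ?n N" using part subgrp_sum[OF subgrp_low_span] by metis
  thus ?thesis using low_add[OF a(2)] by fastforce
qed

text \<open>Descent on N. It ends at N = 1, where all vectors of a frame would have height 0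
  although h is not identically 0 on L.\<close>

lemma low_relations:
  assumes IH: "\<And>v z. v \<in> L \<Longrightarrow> keys z \<subseteq> frames L m (adj U v) \<Longrightarrow> frag_extend (apartment adj (adj U v)) z = 0 \<Longrightarrow>
      z \<in> frame_relations L m (adj U v)" and h: "\<exists>y\<in>L. h y \<noteq> 0"
  shows "keys z \<subseteq> low (Suc m) (int N) \<Longrightarrow> frag_extend (apartment adj U) z = 0 \<Longrightarrow> z \<in> \<R> (Suc m)"
proof (induction N arbitrary: z)
  case 0
  have "low (Suc m) 0 = {}" by (auto simp: low_def frames_def length_Suc_conv)
  thus ?case using 0 frame_relations.zero by (simp add: keys_eq_empty)
next
  case (Suc N)
  show ?case
  proof (cases "N = 0")
    case True
    have "low (Suc m) 1 = {}" using h_zero[of U] h h_U UL by (auto simp: low_def frames_def)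
    thus ?thesis using Suc True frame_relations.zero by (simp add: keys_eq_empty)
  next
    case False
    have "z \<in> low_span (Suc m) (int N)"
    proof (rule high_step[OF IH])
      fix xs assume "xs \<in> keys z"
      hence "xs \<in> low (Suc m) (int (Suc N))" using Suc.prems(1) by blast
      thus "\<forall>x\<in>set xs. \<bar>h x\<bar> \<le> int N" by (force simp: low_def)
    qed (use False Suc.prems in \<open>auto simp: low_def\<close>)
    then obtain b where b: "keys b \<subseteq> low (Suc m) (int N)" "z - b \<in> \<R> (Suc m)" by (auto simp: low_span_def)
    have "frag_extend (apartment adj U) b = 0"
      using apartment_relations[OF b(2) U] Suc.prems by (simp add: frag_extend_diff)
    hence "b \<in> \<R> (Suc m)" using Suc.IH b(1) by blast
    thus ?thesis using subgrp_add[OF R_sub b(2)] by fastforce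
  qed
qed

end

text \<open>A chain involves finitely many vectors, so some N bounds their heights and the descent
  can start. The links at its steps are governed by L modulo \<open>adj U v\<close>, of rank one
  less.\<close>

theorem frame_relations_complete:
  assumes "subgrp L" "subgrp U" "U \<subseteq> L" "keys z \<subseteq> frames L n U" "frag_extend (apartment adj U) z = 0"
  shows "z \<in> frame_relations L n U"
  using assms(2-5)
proof (induction n arbitrary: U z)
  case 0
  show ?case
  proof (cases "keys z = {}")
    case False
    have "frag_extend (apartment adj U) z = frag_cmul (Poly_Mapping.lookup z []) (frag_of [])"
    proof -
      have "keys z \<subseteq> {[]}" using 0 by (auto simp: frames_def)
      hence "frag_extend (apartment adj U) z = (\<Sum>i\<in>{[]}. frag_cmul (Poly_Mapping.lookup z i) (apartment adj U i))"
        unfolding frag_extend_def by (intro sum.mono_neutral_left) (auto simp: in_keys_iff)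
      thus ?thesis by simp
    qed
    hence "Poly_Mapping.lookup z [] = 0" using 0 by simp
    moreover have "keys z \<subseteq> {[]}" using 0 by (auto simp: frames_def)
    ultimately show ?thesis using False by (metis in_keys_iff insertI1 subset_singletonD)
  qed (use frame_relations.zero in \<open>simp add: keys_eq_empty\<close>)
next
  case (Suc m)
  show ?case
  proof (cases "keys z = {}")
    case False
    then obtain xs where "xs \<in> frames L (Suc m) U" using Suc.prems by blast
    hence "rel_basis L U xs" "xs \<noteq> []" by (auto simp: frames_def)
    then obtain h :: "'a \<Rightarrow> int" where hh: "height L U h" and h3: "\<exists>y\<in>L. h y \<noteq> 0"
    proof (rule height_exists[OF assms(1) Suc.prems(1,2)])
      fix h :: "'a \<Rightarrow> int"
      assume "\<And>x y. x \<in> L \<Longrightarrow> y \<in> L \<Longrightarrow> h (x + y) = h x + h y" "\<And>u. u \<in> U \<Longrightarrow> h u = 0" "\<exists>y\<in>L. h y \<noteq> 0"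
      moreover from this have "height L U h" using assms(1) Suc.prems by unfold_locales auto
      ultimately show thesis using that by blast
    qed
    interpret height L U h by (rule hh)
    define N where "N = nat (Max (insert 0 (\<Union>xs\<in>keys z. (\<lambda>x. \<bar>h x\<bar>) ` set xs)) + 1)"
    have "\<bar>h x\<bar> < int N" if "xs \<in> keys z" "x \<in> set xs" for xs x
    proof -
      have fin: "finite (insert 0 (\<Union>xs\<in>keys z. (\<lambda>x. \<bar>h x\<bar>) ` set xs))" by simp
      have "\<bar>h x\<bar> \<le> Max (insert 0 (\<Union>xs\<in>keys z. (\<lambda>x. \<bar>h x\<bar>) ` set xs))"
        using that by (intro Max_ge[OF fin]) auto
      thus ?thesis by (simp add: N_def)
    qed
    hence "keys z \<subseteq> low (Suc m) (int N)" using Suc.prems by (auto simp: low_def)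
    moreover have "w \<in> frame_relations L m (adj U v)"
      if "v \<in> L" "keys w \<subseteq> frames L m (adj U v)" "frag_extend (apartment adj (adj U v)) w = 0" for v w
      using Suc.IH[of "adj U v" w] that Suc.prems assms(1) by (simp add: subgrp_adj adj_least)
    ultimately show ?thesis using low_relations h3 Suc.prems by blast
  qed (use frame_relations.zero in \<open>simp add: keys_eq_empty\<close>)
qed

section \<open>Full flags, cyclic chains, and generation by apartments\<close>

fun flag_of :: "'v::comm_ring_1 set \<Rightarrow> 'v list \<Rightarrow> 'v set list" where
  "flag_of U [] = []"
| "flag_of U (v # us) = adj U v # flag_of (adj U v) us"

definition full_flags :: "'v::comm_ring_1 set \<Rightarrow> nat \<Rightarrow> 'v set \<Rightarrow> 'v set list set" where
  "full_flags L n U = flag_of U ` frames L n U"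

text \<open>Each face has to vanish separately, not just the alternating sum; for maximal flags the
  two conditions agree. The last member of a full flag is L itself and is never deleted.\<close>

definition cyclic :: "nat \<Rightarrow> ('u list \<Rightarrow>\<^sub>0 int) \<Rightarrow> bool" where
  "cyclic n \<phi> \<longleftrightarrow> (\<forall>i. Suc i < n \<longrightarrow> frag_map (delete_nth i) \<phi> = 0)"

lemma length_flag_of [simp]: "length (flag_of U xs) = length xs"
  by (induction xs arbitrary: U) auto

lemma flag_of_nth_subset:
  "subgrp L \<Longrightarrow> U \<subseteq> L \<Longrightarrow> set xs \<subseteq> L \<Longrightarrow> i < length xs \<Longrightarrow> flag_of U xs ! i \<subseteq> L"
  by (induction xs arbitrary: U i) (auto simp: adj_least nth_Cons split: nat.split)

lemma flag_of_Suc: "Suc i < length xs \<Longrightarrow> flag_of U xs ! Suc i = adj (flag_of U xs ! i) (xs ! Suc i)"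
proof (induction xs arbitrary: U i)
  case (Cons x xs)
  thus ?case by (cases xs; cases i) auto
qed simp

lemma flag_of_last: "rel_basis L U xs \<Longrightarrow> xs \<noteq> [] \<Longrightarrow> flag_of U xs ! (length xs - 1) = L"
proof (induction xs arbitrary: U)
  case (Cons x xs) thus ?case by (cases xs) auto
qed simp

lemma full_flags_Cons:
  "adj U v # l \<in> full_flags L (Suc n) U" if "l \<in> full_flags L n (adj U v)" "v \<in> L" "\<forall>k. of_int k * v \<in> U \<longrightarrow> k = 0"
  using that unfolding full_flags_def by (force simp: frames_Cons intro: image_eqI[of _ _ "v # us" for us])

lemma keys_cons_map: "keys (cons_map W a) \<subseteq> (#) W ` keys a"
  unfolding cons_map_def using keys_frag_extend[of "\<lambda>l. frag_of (W # l)" a] by (auto simp: keys_frag_of)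

context lattice_pair begin

lemma frames_nth_front: "xs \<in> frames L n U \<Longrightarrow> i < length xs \<Longrightarrow> xs ! i # delete_nth i xs \<in> frames L n U"
  unfolding delete_nth_def using frames_move[of "take i xs" "xs ! i" "drop (Suc i) xs" n]
  by (simp add: id_take_nth_drop[symmetric])

end

lemma keys_apartment:
  assumes "subgrp L"
  shows "subgrp U \<Longrightarrow> U \<subseteq> L \<Longrightarrow> xs \<in> frames L n U \<Longrightarrow> keys (apartment adj U xs) \<subseteq> full_flags L n U"
proof (induction n arbitrary: U xs)
  case 0
  thus ?case by (auto simp: frames_def full_flags_def keys_frag_of)
next
  case (Suc n)
  interpret lattice_pair L U by unfold_locales (use assms Suc in auto)
  have ne: "xs \<noteq> []" using Suc.prems by (auto simp: frames_def)
  show ?case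
    unfolding apartment_nonempty[OF ne]
  proof (intro keys_sum_subset keys_cmul_subset)
    fix i assume "i \<in> {..<length xs}"
    hence f: "xs ! i # delete_nth i xs \<in> frames L (Suc n) U" using frames_nth_front[OF Suc.prems(3)] by simp
    hence k: "keys (apartment adj (adj U (xs ! i)) (delete_nth i xs)) \<subseteq> full_flags L n (adj U (xs ! i))"
      using Suc.prems assms by (intro Suc.IH) (auto simp: frames_Cons subgrp_adj adj_least)
    have "adj U (xs ! i) # l \<in> full_flags L (Suc n) U" if "l \<in> full_flags L n (adj U (xs ! i))" for l
      using full_flags_Cons[OF that] f by (simp add: frames_Cons)
    hence "(#) (adj U (xs ! i)) ` full_flags L n (adj U (xs ! i)) \<subseteq> full_flags L (Suc n) U" by blast
    thus "keys (cons_map (adj U (xs ! i)) (apartment adj (adj U (xs ! i)) (delete_nth i xs))) \<subseteq> full_flags L (Suc n) U"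
      by (rule order_trans[OF order_trans[OF keys_cons_map image_mono[OF k]]])
  qed
qed

lemma cyclic_apartment: "cyclic (length xs) (apartment adj U xs)"
  unfolding cyclic_def using apartment_cyclic[of adj, OF adj_commute] by blast

lemma cyclic_diff: "cyclic n a \<Longrightarrow> cyclic n b \<Longrightarrow> cyclic n (a - b)"
  by (simp add: cyclic_def frag_extend_diff)

lemma frag_extend_frag_extend: "frag_extend f (frag_extend g c) = frag_extend (\<lambda>x. frag_extend f (g x)) c"
  unfolding frag_extend_def[of g] frag_extend_sum[OF finite_keys] by (simp add: frag_extend_cmul frag_extend_def[of _ c])

lemma cyclic_frag_extend: "(\<And>x. x \<in> keys z \<Longrightarrow> cyclic n (f x)) \<Longrightarrow> cyclic n (frag_extend f z)"
  unfolding cyclic_def by (simp add: frag_extend_frag_extend frag_extend_eq_0)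

text \<open>Deleting a later member of a flag commutes with passing to the link of its first
  member.\<close>

lemma cyclic_link_part:
  assumes "[] \<notin> keys \<phi>" "cyclic (Suc n) \<phi>"
  shows "cyclic n (link_part W \<phi>)"
  unfolding cyclic_def
proof (intro allI impI)
  fix i assume "Suc i < n"
  hence "link_part W (frag_map (delete_nth (Suc i)) \<phi>) = 0" using assms(2) by (simp add: cyclic_def)
  moreover have "link_part W (frag_map (delete_nth (Suc i)) \<phi>) = frag_map (delete_nth i) (link_part W \<phi>)"
    unfolding link_part_def frag_extend_frag_extend
  proof (rule frag_extend_eq)
    fix l assume "l \<in> keys \<phi>"
    then obtain x l' where "l = x # l'" using assms(1) by (cases l) auto
    thus "frag_extend (\<lambda>l. if l \<noteq> [] \<and> hd l = W then frag_of (tl l) else 0) (frag_of (delete_nth (Suc i) l)) =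
      frag_map (delete_nth i) (if l \<noteq> [] \<and> hd l = W then frag_of (tl l) else 0)" by simp
  qed
  ultimately show "frag_map (delete_nth i) (link_part W \<phi>) = 0" by simp
qed

lemma subgrp_keys: "subgrp {x :: 'b \<Rightarrow>\<^sub>0 int. keys x \<subseteq> A}"
  unfolding subgrp_def by (simp add: keys_diff_subset)

context height begin

text \<open>Consecutive members differ by one vector x. If the larger one leaves the kernel of h
  then h x is nonzero, so the smaller one is exactly where h vanishes and is determined by its
  successor.\<close>

lemma full_flags_ker_step:
  assumes l: "l \<in> full_flags L n U" and i: "Suc i < n" and k: "\<forall>y\<in>l ! i. h y = 0" and nk: "\<not> (\<forall>y\<in>l ! Suc i. h y = 0)"
  shows "l ! i = {y \<in> l ! Suc i. h y = 0}"
proof -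
  obtain xs where xs: "xs \<in> frames L n U" "l = flag_of U xs" using l by (auto simp: full_flags_def)
  hence len: "length xs = n" and sL: "set xs \<subseteq> L" by (auto simp: frames_def dest: rel_basis_subset)
  define x where "x = xs ! Suc i"
  have S: "l ! Suc i = adj (l ! i) x" using flag_of_Suc[of i xs U] i len xs(2) by (simp add: x_def)
  have xL: "x \<in> L" using sL i len by (auto simp: x_def)
  have lL: "l ! i \<subseteq> L" using flag_of_nth_subset[OF L UL sL, of i] i len xs(2) by simp
  have hf: "h (f + of_int m * x) = m * h x" if "f \<in> l ! i" for f m
    using h_add[of f "of_int m * x"] h_of_int[OF xL, of m] k that lL subgrp_of_int[OF L xL] by auto
  have "h x \<noteq> 0"
  proof
    assume "h x = 0"
    hence "\<forall>y\<in>l ! Suc i. h y = 0" unfolding S adj_def using hf by auto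
    thus False using nk by blast
  qed
  thus ?thesis unfolding S using hf k adj_subset[of "l ! i" x] by (auto simp: adj_def)
qed

text \<open>Take the first place i + 1 at which a flag of the support leaves the kernel. Its member
  i is determined by member i + 1, so no other flag of the support shares its i-th face, and the
  face cannot cancel. Hence no flag of the support leaves the kernel, although the last member L is
  not contained in it.\<close>

lemma ker_cycle_zero:
  assumes \<phi>: "keys \<phi> \<subseteq> full_flags L n U" and n: "n > 0" and cyc: "cyclic n \<phi>" and h: "\<exists>y\<in>L. h y \<noteq> 0"
    and 0: "\<And>l. l \<in> keys \<phi> \<Longrightarrow> \<forall>y\<in>l ! 0. h y = 0"
  shows "\<phi> = 0"
proof -
  have K: "\<forall>l\<in>keys \<phi>. \<forall>y\<in>l ! i. h y = 0" if "i < n" for i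
    using that
  proof (induction i)
    case (Suc i)
    show ?case
    proof (rule ballI, rule ccontr)
      fix l assume l: "l \<in> keys \<phi>" and nk: "\<not> (\<forall>y\<in>l ! Suc i. h y = 0)"
      have len: "length l' = n" if "l' \<in> keys \<phi>" for l' using that \<phi> by (auto simp: full_flags_def frames_def)
      have uniq: "l' = l" if l': "l' \<in> keys \<phi>" "delete_nth i l' = delete_nth i l" for l'
      proof -
        have nth: "l' ! j = l ! j" if "j \<noteq> i" "j < n" for j
        proof (cases "j < i")
          case True
          hence "delete_nth i l' ! j = l' ! j" "delete_nth i l ! j = l ! j"
            using len[OF l] len[OF l'(1)] Suc.prems by (auto simp: nth_delete_nth)
          thus ?thesis using l'(2) by simp
        next
          case False
          hence "delete_nth i l' ! (j - 1) = l' ! j" "delete_nth i l ! (j - 1) = l ! j"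
            using that len[OF l] len[OF l'(1)] Suc.prems by (auto simp: nth_delete_nth)
          thus ?thesis using l'(2) by simp
        qed
        have S: "l' ! Suc i = l ! Suc i" using nth[of "Suc i"] Suc.prems by simp
        have "l ! i = {y \<in> l ! Suc i. h y = 0}"
          using full_flags_ker_step[of l n i] l \<phi> Suc nk by auto
        moreover have "l' ! i = {y \<in> l' ! Suc i. h y = 0}"
          using full_flags_ker_step[of l' n i] l'(1) \<phi> Suc nk S by auto
        ultimately have "l' ! i = l ! i" using S by simp
        hence "l' ! j = l ! j" if "j < n" for j using nth that by (cases "j = i") auto
        thus ?thesis using len[OF l] len[OF l'(1)] by (intro nth_equalityI) auto
      qed
      have "0 = Poly_Mapping.lookup (frag_map (delete_nth i) \<phi>) (delete_nth i l)"
        using cyc Suc.prems by (simp add: cyclic_def)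
      also have "\<dots> = (\<Sum>l'\<in>keys \<phi>. Poly_Mapping.lookup \<phi> l' * (if delete_nth i l = delete_nth i l' then 1 else 0))"
        unfolding frag_extend_def by (simp add: lookup_sum)
      also have "\<dots> = (\<Sum>l'\<in>{l}. Poly_Mapping.lookup \<phi> l' * (if delete_nth i l = delete_nth i l' then 1 else 0))"
      proof (rule sum.mono_neutral_right)
        show "\<forall>l'\<in>keys \<phi> - {l}. Poly_Mapping.lookup \<phi> l' * (if delete_nth i l = delete_nth i l' then 1 else 0) = 0"
        proof
          fix l' assume l': "l' \<in> keys \<phi> - {l}"
          have "delete_nth i l \<noteq> delete_nth i l'"
          proof
            assume "delete_nth i l = delete_nth i l'"
            hence "l' = l" using uniq[of l'] l' by simp
            thus False using l' by simp
          qed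
          thus "Poly_Mapping.lookup \<phi> l' * (if delete_nth i l = delete_nth i l' then 1 else 0) = 0" by simp
        qed
      qed (use l in simp_all)
      also have "\<dots> = Poly_Mapping.lookup \<phi> l" by simp
      finally show False using l by (simp add: in_keys_iff)
    qed
  qed (use 0 in simp)
  have *: "\<forall>l\<in>keys \<phi>. \<forall>y\<in>l ! (n - 1). h y = 0" using K[of "n - 1"] n by simp
  have "l ! (n - 1) = L" if lk: "l \<in> keys \<phi>" for l
  proof -
    obtain xs where "xs \<in> frames L n U" "l = flag_of U xs" using lk \<phi> by (auto simp: full_flags_def)
    thus ?thesis using flag_of_last[of L U xs] n by (auto simp: frames_def)
  qed
  hence "keys \<phi> = {}" using * h by auto
  thus ?thesis by (simp add: keys_eq_empty)
qed

definition low_flags :: "nat \<Rightarrow> nat \<Rightarrow> 'v set list set" where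
  "low_flags n N = {flag_of U (v # us) | v us. v # us \<in> frames L n U \<and> \<bar>h v\<bar> < int N}"

lemma same_adj_minus: "adj U (- v) = adj U v"
  by (rule adj_same_line) (use same_line_sym[OF same_line_minus] in simp)

text \<open>For each first line W of height N, the link of the cycle is by induction a combination
  of apartments. Prefixing v to the remainders of their vectors gives apartments that have the same
  link at W and whose other flags start below height N; subtracting them lowers the level.\<close>

lemma generation_step:
  assumes IH: "\<And>v \<psi>. v \<in> L \<Longrightarrow> keys \<psi> \<subseteq> full_flags L m (adj U v) \<Longrightarrow> cyclic m \<psi> \<Longrightarrow>
      \<exists>z. keys z \<subseteq> frames L m (adj U v) \<and> frag_extend (apartment adj (adj U v)) z = \<psi>"
    and h: "\<exists>y\<in>L. h y \<noteq> 0"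
  shows "keys \<phi> \<subseteq> low_flags (Suc m) N \<Longrightarrow> cyclic (Suc m) \<phi> \<Longrightarrow>
     \<exists>z. keys z \<subseteq> frames L (Suc m) U \<and> frag_extend (apartment adj U) z = \<phi>"
proof (induction N arbitrary: \<phi>)
  case 0
  hence "keys \<phi> = {}" by (auto simp: low_flags_def)
  thus ?case by (intro exI[of _ 0]) (simp add: keys_eq_empty)
next
  case (Suc N)
  have lf: "low_flags (Suc m) k \<subseteq> full_flags L (Suc m) U" for k
    unfolding low_flags_def full_flags_def by blast
  show ?case
  proof (cases "N = 0")
    case True
    have "\<phi> = 0"
    proof (rule ker_cycle_zero[of _ "Suc m"])
      show "keys \<phi> \<subseteq> full_flags L (Suc m) U" using Suc.prems lf by blast
      fix l assume "l \<in> keys \<phi>"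
      hence "l \<in> low_flags (Suc m) (Suc 0)" using Suc.prems True by blast
      then obtain v us where v: "l = flag_of U (v # us)" "v # us \<in> frames L (Suc m) U" "h v = 0" by (auto simp: low_flags_def)
      hence "v \<in> L" by (simp add: frames_Cons)
      thus "\<forall>y\<in>l ! 0. h y = 0" using v h_adj by (auto simp: adj_def)
    qed (use Suc.prems h in auto)
    thus ?thesis by (intro exI[of _ 0]) simp
  next
    case False
    \<comment> \<open>The sign of v is normalized so that its height is N and not -N, because
      \<open>lift v\<close> needs a positive divisor.\<close>
    let ?good = "\<lambda>W v. W = adj U v \<and> v \<in> L \<and> (\<forall>k. of_int k * v \<in> U \<longrightarrow> k = 0) \<and> h v = int N"
    define T where "T = {W \<in> hd ` keys \<phi>. \<exists>v. ?good W v}"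
    have finT: "finite T" by (simp add: T_def)
    have "\<forall>W\<in>T. \<exists>v. ?good W v" by (simp add: T_def)
    from bchoice[OF this] obtain vv where vvT: "\<forall>W\<in>T. ?good W (vv W)" ..
    note vv = bspec[OF vvT]
    let ?G = "{x :: 'v set list \<Rightarrow>\<^sub>0 int. keys x \<subseteq> low_flags (Suc m) N}"
    have G: "subgrp ?G" by (rule subgrp_keys)
    have ne: "[] \<notin> keys \<phi>" using Suc.prems by (auto simp: low_flags_def)
    have "\<exists>z. keys z \<subseteq> frames L (Suc m) U \<and> cons_map W (link_part W \<phi>) - frag_extend (apartment adj U) z \<in> ?G"
      if W: "W \<in> T" for W
    proof -
      define v where "v = vv W"
      have v: "W = adj U v" "v \<in> L" "\<forall>k. of_int k * v \<in> U \<longrightarrow> k = 0" "h v = int N" using vv[OF W] by (auto simp: v_def)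
      have "keys (link_part W \<phi>) \<subseteq> full_flags L m (adj U v)"
        unfolding link_part_def
      proof (rule keys_frag_extend_subset[OF Suc.prems(1)])
        fix l assume "l \<in> low_flags (Suc m) (Suc N)"
        thus "keys (if l \<noteq> [] \<and> hd l = W then frag_of (tl l) else 0) \<subseteq> full_flags L m (adj U v)"
          using v(1) by (auto simp: low_flags_def full_flags_def frames_Cons)
      qed
      then obtain z where z: "keys z \<subseteq> frames L m (adj U v)" "frag_extend (apartment adj (adj U v)) z = link_part W \<phi>"
        using IH[OF v(2)] cyclic_link_part[OF ne Suc.prems(2)] by blast
      define z' where "z' = frag_extend (\<lambda>us. frag_of (v # map (lift v) us)) z"
      have k1: "keys z' \<subseteq> frames L (Suc m) U"
        unfolding z'_def by (rule keys_frag_extend_subset[OF z(1)]) (use lift_frames v in \<open>simp add: keys_frag_of\<close>)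
      have e1: "cons_map W (link_part W \<phi>) - frag_extend (apartment adj U) z' =
         frag_extend (\<lambda>us. cons_map W (apartment adj (adj U v) us) - apartment adj U (v # map (lift v) us)) z"
        unfolding z'_def z(2)[symmetric] frag_extend_frag_extend frag_extend_diff_fun
        by (simp add: cons_map_def frag_extend_frag_extend)
      have "\<dots> \<in> ?G"
      proof (rule subgrp_frag_extend[OF G])
        fix us assume us: "us \<in> keys z"
        let ?us = "map (lift v) us"
        have f: "v # ?us \<in> frames L (Suc m) U" using lift_frames z(1) us v by blast
        have "same_line (adj U v) x (lift v x)" for x
          using adjI[of 0 U "- (h x div h v)" v] subgrp_0[OF U] U by (simp add: same_line_def subgrp_adj lift_def)
        hence "apartment adj (adj U v) us = apartment adj (adj U v) ?us"
          by (intro apartment_same_line) (simp add: list_all2_map2 list.rel_refl)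
        \<comment> \<open>The leading term of the expansion cancels; in each remaining term the
          first line is that of a lifted vector, whose height is a remainder modulo N.\<close>
        hence "cons_map W (apartment adj (adj U v) us) - apartment adj U (v # ?us) =
           - (\<Sum>i<length ?us. frag_cmul ((-1) ^ Suc i) (cons_map (adj U (?us ! i)) (apartment adj (adj U (?us ! i)) (delete_nth (Suc i) (v # ?us)))))"
          unfolding v(1) by (simp only: apartment_nonempty[of "v # ?us"] list.distinct not_False_eq_True sum.lessThan_Suc_shift length_Cons
            nth_Cons_0 nth_Cons_Suc delete_nth_0 power_0 frag_cmul_one) simp
        also have "\<dots> \<in> ?G"
        proof (rule subgrp_minus[OF G], rule subgrp_sum[OF G], rule subgrp_frag_cmul[OF G])
          fix i assume i: "i \<in> {..<length ?us}"
          let ?x = "?us ! i" and ?d = "delete_nth (Suc i) (v # ?us)"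
          have g: "?x # ?d \<in> frames L (Suc m) U" using frames_nth_front[OF f, of "Suc i"] i by simp
          have "us ! i \<in> L" using us z(1) i by (auto simp: frames_def dest!: rel_basis_subset nth_mem)
          hence hx: "\<bar>h ?x\<bar> < int N" using i h_lift[OF _ v(2)] v(4) False by simp
          have "keys (apartment adj (adj U ?x) ?d) \<subseteq> full_flags L m (adj U ?x)"
            using g L UL U by (intro keys_apartment) (auto simp: frames_Cons subgrp_adj adj_least)
          moreover have "adj U ?x # l \<in> low_flags (Suc m) N" if ll: "l \<in> full_flags L m (adj U ?x)" for l
          proof -
            obtain ys where ys: "ys \<in> frames L m (adj U ?x)" "l = flag_of (adj U ?x) ys" using ll unfolding full_flags_def by blast
            hence "?x # ys \<in> frames L (Suc m) U" using g by (simp add: frames_Cons)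
            thus ?thesis using hx ys(2) unfolding low_flags_def mem_Collect_eq
              by (intro exI[of _ ?x] exI[of _ ys]) simp
          qed
          ultimately have "(#) (adj U ?x) ` keys (apartment adj (adj U ?x) ?d) \<subseteq> low_flags (Suc m) N" by blast
          thus "cons_map (adj U ?x) (apartment adj (adj U ?x) ?d) \<in> ?G"
            unfolding mem_Collect_eq by (rule order_trans[OF keys_cons_map])
        qed
        finally show "cons_map W (apartment adj (adj U v) us) - apartment adj U (v # ?us) \<in> ?G" .
      qed
      hence "cons_map W (link_part W \<phi>) - frag_extend (apartment adj U) z' \<in> ?G" unfolding e1 .
      with k1 show ?thesis by (intro exI[of _ z'] conjI)
    qed
    then obtain zz where zz: "\<And>W. W \<in> T \<Longrightarrow> keys (zz W) \<subseteq> frames L (Suc m) U"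
      "\<And>W. W \<in> T \<Longrightarrow> cons_map W (link_part W \<phi>) - frag_extend (apartment adj U) (zz W) \<in> ?G" by metis
    define z where "z = sum zz T"
    have zk: "keys z \<subseteq> frames L (Suc m) U" unfolding z_def by (rule keys_sum_subset) (rule zz(1))
    have 1: "\<phi> - (\<Sum>W\<in>T. cons_map W (link_part W \<phi>)) \<in> ?G"
    proof -
      have "frag_extend (\<lambda>l. frag_of l - (\<Sum>W\<in>T. if l \<noteq> [] \<and> hd l = W then frag_of (W # tl l) else 0)) \<phi> \<in> ?G"
      proof (rule subgrp_frag_extend[OF G])
        fix l assume l: "l \<in> keys \<phi>"
        then obtain v us where v: "l = flag_of U (v # us)" "v # us \<in> frames L (Suc m) U" "\<bar>h v\<bar> < int (Suc N)"
          using Suc.prems(1) unfolding low_flags_def by blast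
        have lne: "l \<noteq> []" "hd l = adj U v" "hd l # tl l = l" using v(1) by auto
        have s: "(\<Sum>W\<in>T. if l \<noteq> [] \<and> hd l = W then frag_of (W # tl l) else 0) = (if hd l \<in> T then frag_of l else 0)"
          using lne finT by (simp add: sum.delta)
        show "frag_of l - (\<Sum>W\<in>T. if l \<noteq> [] \<and> hd l = W then frag_of (W # tl l) else 0) \<in> ?G"
        proof (cases "hd l \<in> T")
          case True thus ?thesis unfolding s by simp
        next
          case F: False
          have vL: "v \<in> L" "\<forall>k. of_int k * v \<in> U \<longrightarrow> k = 0" using v(2) by (simp_all add: frames_Cons)
          have "h v \<noteq> int N" using F l lne vL unfolding T_def by blast
          moreover have "h v \<noteq> - int N"
          proof
            assume "h v = - int N"
            moreover have "of_int k * (- v) \<in> U \<Longrightarrow> k = 0" for k using vL(2)[rule_format, of "- k"] by simp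
            ultimately have "?good (hd l) (- v)" using vL(1) lne(2) same_adj_minus h_minus subgrp_minus[OF L] by simp
            thus False using F l unfolding T_def by blast
          qed
          ultimately have "l \<in> low_flags (Suc m) N" using v unfolding low_flags_def by force
          thus ?thesis unfolding s using F by simp
        qed
      qed
      thus ?thesis
        unfolding frag_extend_diff_fun frag_extend_sum_fun frag_expansion[of \<phi>, symmetric]
        by (simp add: link_part_def cons_map_def frag_extend_frag_extend if_distrib cong: if_cong)
    qed
    have 2: "(\<Sum>W\<in>T. cons_map W (link_part W \<phi>)) - frag_extend (apartment adj U) z \<in> ?G"
    proof -
      have "(\<Sum>W\<in>T. cons_map W (link_part W \<phi>) - frag_extend (apartment adj U) (zz W)) \<in> ?G"
        by (rule subgrp_sum[OF G]) (rule zz(2))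
      thus ?thesis by (simp add: z_def frag_extend_sum[OF finT] sum_subtractf)
    qed
    have 3: "\<phi> - frag_extend (apartment adj U) z \<in> ?G" using subgrp_add[OF G 1 2] by simp
    have "cyclic (Suc m) (frag_extend (apartment adj U) z)"
    proof (rule cyclic_frag_extend)
      fix xs assume "xs \<in> keys z"
      hence "length xs = Suc m" using zk by (auto simp: frames_def)
      thus "cyclic (Suc m) (apartment adj U xs)" using cyclic_apartment[of xs U] by simp
    qed
    then obtain w where "keys w \<subseteq> frames L (Suc m) U" "frag_extend (apartment adj U) w = \<phi> - frag_extend (apartment adj U) z"
      using Suc.IH[of "\<phi> - frag_extend (apartment adj U) z"] 3 cyclic_diff[OF Suc.prems(2)] by blast
    thus ?thesis using zk by (intro exI[of _ "w + z"]) (simp add: keys_add_subset frag_extend_add)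
  qed
qed

end

theorem apartments_generate:
  assumes "subgrp L" "subgrp U" "U \<subseteq> L" "keys \<phi> \<subseteq> full_flags L n U" "cyclic n \<phi>"
  obtains z where "keys z \<subseteq> frames L n U" "frag_extend (apartment adj U) z = \<phi>"
proof -
  have "\<exists>z. keys z \<subseteq> frames L n U \<and> frag_extend (apartment adj U) z = \<phi>"
    using assms(2-5)
  proof (induction n arbitrary: U \<phi>)
    case 0
    let ?z = "frag_cmul (Poly_Mapping.lookup \<phi> []) (frag_of [])"
    have k: "keys \<phi> \<subseteq> {[]}" using 0 by (auto simp: full_flags_def frames_def)
    have "keys ?z \<subseteq> frames L 0 U"
    proof (cases "Poly_Mapping.lookup \<phi> [] = 0")
      case False
      hence "[] \<in> full_flags L 0 U" using 0 by (auto simp: in_keys_iff)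
      hence "[] \<in> frames L 0 U" by (auto simp: full_flags_def frames_def)
      thus ?thesis by (intro keys_cmul_subset) simp
    qed simp
    moreover have "frag_extend (apartment adj U) ?z = \<phi>"
    proof (rule poly_mapping_eqI)
      fix l show "Poly_Mapping.lookup (frag_extend (apartment adj U) ?z) l = Poly_Mapping.lookup \<phi> l"
        using k by (cases "l = []") (auto simp: frag_extend_cmul in_keys_iff)
    qed
    ultimately show ?case by blast
  next
    case (Suc m)
    show ?case
    proof (cases "keys \<phi> = {}")
      case True thus ?thesis by (intro exI[of _ 0]) (simp add: keys_eq_empty)
    next
      case False
      then obtain xs where "xs \<in> frames L (Suc m) U" using Suc.prems by (fastforce simp: full_flags_def)
      hence "rel_basis L U xs" "xs \<noteq> []" by (auto simp: frames_def)
      then obtain h :: "'a \<Rightarrow> int" where hh: "height L U h" and h3: "\<exists>y\<in>L. h y \<noteq> 0"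
      proof (rule height_exists[OF assms(1) Suc.prems(1,2)])
        fix h :: "'a \<Rightarrow> int"
        assume "\<And>x y. x \<in> L \<Longrightarrow> y \<in> L \<Longrightarrow> h (x + y) = h x + h y" "\<And>u. u \<in> U \<Longrightarrow> h u = 0" "\<exists>y\<in>L. h y \<noteq> 0"
        moreover from this have "height L U h" using assms(1) Suc.prems by unfold_locales auto
        ultimately show thesis using that by blast
      qed
      interpret height L U h by (rule hh)
      have "\<forall>l\<in>keys \<phi>. \<exists>xs. xs \<in> frames L (Suc m) U \<and> flag_of U xs = l"
        using Suc.prems(3) unfolding full_flags_def by blast
      from bchoice[OF this] obtain f where fa: "\<forall>l\<in>keys \<phi>. f l \<in> frames L (Suc m) U \<and> flag_of U (f l) = l" ..
      note f = bspec[OF fa]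
      define N where "N = nat (Max (insert 0 ((\<lambda>l. \<bar>h (hd (f l))\<bar>) ` keys \<phi>)) + 1)"
      have low: "keys \<phi> \<subseteq> low_flags (Suc m) N"
      proof
        fix l assume l: "l \<in> keys \<phi>"
        obtain v us where v: "f l = v # us" using f[OF l] by (cases "f l") (auto simp: frames_def)
        have "\<bar>h v\<bar> \<le> Max (insert 0 ((\<lambda>l. \<bar>h (hd (f l))\<bar>) ` keys \<phi>))"
          by (rule Max_ge) (use l v in \<open>auto intro!: image_eqI[of _ _ l]\<close>)
        hence "\<bar>h v\<bar> < int N" by (simp add: N_def)
        thus "l \<in> low_flags (Suc m) N" using f[OF l] v unfolding low_flags_def mem_Collect_eq by metis
      qed
      have IH: "\<exists>z. keys z \<subseteq> frames L m (adj U v) \<and> frag_extend (apartment adj (adj U v)) z = \<psi>"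
        if "v \<in> L" "keys \<psi> \<subseteq> full_flags L m (adj U v)" "cyclic m \<psi>" for v \<psi>
        using Suc.IH[of "adj U v" \<psi>] that Suc.prems assms(1) by (simp add: subgrp_adj adj_least)
      show ?thesis by (rule generation_step[OF IH h3 low Suc.prems(4)])
    qed
  qed
  thus thesis using that by blast
qed

section \<open>Saturated sublattices and their maximal chains\<close>

definition pure :: "'v::comm_ring_1 set \<Rightarrow> 'v set \<Rightarrow> bool" where
  "pure L P \<longleftrightarrow> subgrp P \<and> P \<subseteq> L \<and> (\<forall>x\<in>L. \<forall>m::int. m \<noteq> 0 \<longrightarrow> of_int m * x \<in> P \<longrightarrow> x \<in> P)"

fun pure_chain :: "'v::comm_ring_1 set \<Rightarrow> 'v set \<Rightarrow> 'v set list \<Rightarrow> bool" where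
  "pure_chain L U [] \<longleftrightarrow> True"
| "pure_chain L U (F # Fs) \<longleftrightarrow> U \<subset> F \<and> pure L F \<and> pure_chain L F Fs"

text \<open>Euclid's algorithm on the coefficients of \<open>x\<close>.\<close>

lemma euclid_basis:
  assumes U: "subgrp U" "U \<subseteq> L" and L: "subgrp L"
  shows "rel_basis L U (a # b # r) \<Longrightarrow> x = u + of_int d * a + of_int c * b \<Longrightarrow> d \<noteq> 0 \<or> c \<noteq> 0 \<Longrightarrow>
    \<exists>y b' e. rel_basis L U (y # b' # r) \<and> x = u + of_int e * y \<and> e \<noteq> 0"
proof (induction "nat (\<bar>d\<bar> + \<bar>c\<bar>)" arbitrary: a b d c rule: less_induct)
  case less
  have tr: "rel_basis L U (a # (b + of_int s * a) # r)" if rb: "rel_basis L U (a # b # r)" for a b s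
  proof -
    have aL: "a \<in> L" using rb by simp
    have "same_line (adj U a) b (b + of_int s * a)"
      using adjI[of 0 U s a] subgrp_0[OF U(1)] U(1) by (simp add: same_line_def subgrp_adj)
    hence "list_all2 (same_line (adj U a)) (b # r) ((b + of_int s * a) # r)"
      using U(1) by (auto intro!: list.rel_refl same_line_refl subgrp_adj)
    from rel_basis_same_line[OF this subgrp_adj[OF U(1)] adj_least[OF L U(2) aL] L] rb show ?thesis by simp
  qed
  show ?case
  proof (cases "c = 0")
    case True
    thus ?thesis using less.prems by (intro exI[of _ a] exI[of _ b] exI[of _ d]) auto
  next
    case c: False
    show ?thesis
    proof (cases "d = 0")
      case True
      thus ?thesis using less.prems c rel_basis_swap_front[OF U(1) less.prems(1)]
        by (intro exI[of _ b] exI[of _ a] exI[of _ c]) auto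
    next
      case d: False
      define s where "s = (if (d > 0) = (c > 0) then 1 else (-1::int))"
      show ?thesis
      proof (cases "\<bar>c\<bar> \<le> \<bar>d\<bar>")
        case True
        have "nat (\<bar>d - s * c\<bar> + \<bar>c\<bar>) < nat (\<bar>d\<bar> + \<bar>c\<bar>)" using c d True by (auto simp: s_def)
        moreover have "x = u + of_int (d - s * c) * a + of_int c * (b + of_int s * a)"
          using less.prems(2) by (simp add: algebra_simps)
        ultimately show ?thesis using less.hyps[OF _ tr[OF less.prems(1)], of "d - s * c" c s] c by blast
      next
        case False
        have r: "rel_basis L U ((a + of_int s * b) # b # r)"
          using rel_basis_swap_front[OF U(1) tr[OF rel_basis_swap_front[OF U(1) less.prems(1)]]] .
        have "nat (\<bar>d\<bar> + \<bar>c - s * d\<bar>) < nat (\<bar>d\<bar> + \<bar>c\<bar>)" using c d False by (auto simp: s_def)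
        moreover have "x = u + of_int d * (a + of_int s * b) + of_int (c - s * d) * b"
          using less.prems(2) by (simp add: algebra_simps)
        ultimately show ?thesis using less.hyps[OF _ r, of d "c - s * d"] d by blast
      qed
    qed
  qed
qed

text \<open>Euclid's algorithm gathers the coordinates of x, two at a time, in a single basis vector
  at the front.\<close>

lemma adapted_basis:
  assumes "subgrp L"
  shows "subgrp U \<Longrightarrow> U \<subseteq> L \<Longrightarrow> rel_basis L U ys \<Longrightarrow> x \<in> L \<Longrightarrow> x \<notin> U \<Longrightarrow>
    \<exists>y us e. rel_basis L U (y # us) \<and> length (y # us) = length ys \<and> x - of_int e * y \<in> U \<and> e \<noteq> 0"
proof (induction ys arbitrary: U)
  case (Cons y1 ys)
  let ?W = "adj U y1"
  have y1: "y1 \<in> L" using Cons.prems by simp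
  show ?case
  proof (cases "x \<in> ?W")
    case True
    then obtain u e where "u \<in> U" "x = u + of_int e * y1" unfolding adj_def by blast
    moreover from this have "e \<noteq> 0" using Cons.prems(5) by auto
    ultimately show ?thesis using Cons.prems(3) by (intro exI[of _ y1] exI[of _ ys] exI[of _ e]) auto
  next
    case False
    then obtain y us e where y: "rel_basis L ?W (y # us)" "length (y # us) = length ys" "x - of_int e * y \<in> ?W" "e \<noteq> 0"
      using Cons.IH[of ?W] Cons.prems assms y1 by (auto simp: subgrp_adj adj_least)
    obtain u d where u: "u \<in> U" "x - of_int e * y = u + of_int d * y1" using y(3) unfolding adj_def by blast
    have "rel_basis L U (y1 # y # us)" using y(1) Cons.prems(3) by simp
    moreover have "x = u + of_int d * y1 + of_int e * y" using u(2) by (simp add: algebra_simps)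
    ultimately obtain z b' f where "rel_basis L U (z # b' # us)" "x = u + of_int f * z" "f \<noteq> 0"
      using euclid_basis[OF Cons.prems(1,2) assms] y(4) by blast
    thus ?thesis using y(2) u(1) by (intro exI[of _ z] exI[of _ "b' # us"] exI[of _ f]) auto
  qed
qed simp

text \<open>An element x of F outside U is, modulo U, a nonzero multiple of a suitable first basis
  vector y; saturation then puts y itself into F.\<close>

lemma pure_chain_step:
  assumes L: "subgrp L" and U: "subgrp U" "U \<subseteq> L" and ys: "rel_basis L U ys" and F: "U \<subset> F" "pure L F"
  obtains y us where "rel_basis L U (y # us)" "length (y # us) = length ys" "adj U y \<subseteq> F"
proof -
  obtain x where x: "x \<in> F" "x \<notin> U" using F(1) by blast
  hence xL: "x \<in> L" using F(2) by (auto simp: pure_def)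
  obtain y us e where y: "rel_basis L U (y # us)" "length (y # us) = length ys" "x - of_int e * y \<in> U" "e \<noteq> 0"
    using adapted_basis[OF L U ys xL x(2)] by blast
  have sF: "subgrp F" using F(2) by (simp add: pure_def)
  have "x - (x - of_int e * y) \<in> F" using subgrp_diff[OF sF x(1)] y(3) F(1) by blast
  hence "of_int e * y \<in> F" by simp
  hence "y \<in> F" using F(2) y(1,4) by (auto simp: pure_def)
  hence "adj U y \<subseteq> F" using F(1) sF by (intro adj_least) auto
  thus thesis using that y by blast
qed

text \<open>If \<open>adj U y\<close> is strictly smaller than the first member, the whole chain
  still lies above it, so a rank is spent without using up a member. Equality of the lengths
  excludes this case, which is how \<open>pure_chain_full\<close> identifies the members.\<close>

lemma pure_chain_length:
  assumes L: "subgrp L"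
  shows "subgrp U \<Longrightarrow> U \<subseteq> L \<Longrightarrow> rel_basis L U ys \<Longrightarrow> pure_chain L U Fs \<Longrightarrow> length Fs \<le> length ys"
proof (induction "length ys" arbitrary: U ys Fs)
  case 0
  hence "U = L" by simp
  thus ?case using 0 by (cases Fs) (auto simp: pure_def)
next
  case (Suc n)
  show ?case
  proof (cases Fs)
    case (Cons F Gs)
    then obtain y us where y: "rel_basis L U (y # us)" "length (y # us) = length ys" "adj U y \<subseteq> F"
      using pure_chain_step[OF L Suc.prems(1-3)] Suc.prems(4) by (metis pure_chain.simps(2))
    have W: "subgrp (adj U y)" "adj U y \<subseteq> L" "rel_basis L (adj U y) us" "n = length us"
      using y Suc.prems L Suc.hyps(2) by (auto simp: subgrp_adj adj_least)
    show ?thesis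
    proof (cases "adj U y = F")
      case True
      hence "length Gs \<le> length us" using Suc.hyps(1)[OF W(4,1-3)] Suc.prems(4) Cons by simp
      thus ?thesis using y(2) Cons by simp
    next
      case False
      hence "pure_chain L (adj U y) Fs" using Suc.prems(4) Cons y(3) by auto
      hence "length Fs \<le> length us" using Suc.hyps(1)[OF W(4,1-3)] by simp
      thus ?thesis using y(2) by simp
    qed
  qed simp
qed

lemma pure_chain_full:
  assumes L: "subgrp L"
  shows "subgrp U \<Longrightarrow> U \<subseteq> L \<Longrightarrow> rel_basis L U ys \<Longrightarrow> pure_chain L U Fs \<Longrightarrow> length Fs = length ys \<Longrightarrow>
    Fs \<in> full_flags L (length ys) U"
proof (induction "length ys" arbitrary: U ys Fs)
  case 0
  thus ?case by (auto simp: full_flags_def frames_def intro!: image_eqI[of _ _ "[]"])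
next
  case (Suc n)
  then obtain F Gs where Fs: "Fs = F # Gs" by (cases Fs) auto
  then obtain y us where y: "rel_basis L U (y # us)" "length (y # us) = length ys" "adj U y \<subseteq> F"
    using pure_chain_step[OF L Suc.prems(1-3)] Suc.prems(4) by (metis pure_chain.simps(2))
  have W: "subgrp (adj U y)" "adj U y \<subseteq> L" "rel_basis L (adj U y) us" "n = length us"
    using y Suc.prems L Suc.hyps(2) by (auto simp: subgrp_adj adj_least)
  have "adj U y = F"
  proof (rule ccontr)
    assume "adj U y \<noteq> F"
    hence "pure_chain L (adj U y) Fs" using Suc.prems(4) Fs y(3) by auto
    hence "length Fs \<le> length us" using pure_chain_length[OF L W(1-3)] by blast
    thus False using y(2) Suc.prems(5) by simp
  qed
  hence "Gs \<in> full_flags L n (adj U y)"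
    using Suc.hyps(1)[OF W(4,1-3), of Gs] Suc.prems(4,5) Fs y(2) W(4) by simp
  hence "adj U y # Gs \<in> full_flags L (Suc n) U" using full_flags_Cons[of Gs L n U y] y(1) by simp
  thus ?case using \<open>adj U y = F\<close> Fs Suc.hyps(2) by simp
qed

lemma full_flags_pure_chain:
  assumes L: "subgrp L"
  shows "subgrp U \<Longrightarrow> U \<subseteq> L \<Longrightarrow> rel_basis L U xs \<Longrightarrow> pure_chain L U (flag_of U xs)"
proof (induction xs arbitrary: U)
  case (Cons x xs)
  let ?W = "adj U x"
  have W: "subgrp ?W" "?W \<subseteq> L" "rel_basis L ?W xs" using Cons.prems L by (auto simp: subgrp_adj adj_least)
  have "x \<notin> U" using Cons.prems(3) by (auto dest: spec[of _ 1])
  hence "U \<subset> ?W" using adj_subset[of U x] adj_self[OF Cons.prems(1), of x] by blast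
  moreover have "pure L ?W" unfolding pure_def using W rel_basis_torsion[OF W(3) _ _ _ W(1)] by blast
  ultimately show ?case using Cons.IH[OF W] by simp
qed simp

section \<open>Apartments of the Tits building\<close>

text \<open>The lattice of rank \<open>n\<close> is encoded as the integer polynomials of degree less than \<open>n\<close>, so that
  lattices of all ranks live in one type of class \<open>comm_ring_1\<close>.\<close>

definition int_lattice :: "nat \<Rightarrow> int poly set" where
  "int_lattice n = {p. \<forall>i\<ge>n. coeff p i = 0}"

definition pol :: "nat \<Rightarrow> (nat \<Rightarrow> int) \<Rightarrow> int poly" where
  "pol n f = (\<Sum>i<n. Polynomial.monom (f i) i)"

lemma coeff_pol [simp]: "coeff (pol n f) i = (if i < n then f i else 0)"
  by (simp add: pol_def coeff_sum)

lemma pol_in_lattice [simp]: "pol n f \<in> int_lattice n"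
  by (simp add: int_lattice_def)

lemma coeff_of_int_mult [simp]: "coeff (of_int m * p) i = m * coeff p i" for p :: "int poly"
  by (simp add: of_int_poly)

lemma lattice_eqI: "p \<in> int_lattice n \<Longrightarrow> q \<in> int_lattice n \<Longrightarrow> (\<And>i. i < n \<Longrightarrow> coeff p i = coeff q i) \<Longrightarrow> p = q"
proof (rule poly_eqI)
  fix i assume a: "p \<in> int_lattice n" "q \<in> int_lattice n" "\<And>i. i < n \<Longrightarrow> coeff p i = coeff q i"
  show "coeff p i = coeff q i"
    using a(1,2) a(3)[of i] by (cases "i < n") (auto simp: int_lattice_def)
qed

lemma subgrp_int_lattice: "subgrp (int_lattice n)"
  by (simp add: subgrp_def int_lattice_def)

definition rvec :: "nat \<Rightarrow> int poly \<Rightarrow> rat Matrix.vec" where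
  "rvec n p = Matrix.vec n (\<lambda>i. of_int (coeff p i))"

lemma rvec_carrier [simp]: "rvec n p \<in> carrier_vec n" and dim_rvec [simp]: "dim_vec (rvec n p) = n"
  and rvec_index [simp]: "i < n \<Longrightarrow> rvec n p $ i = of_int (coeff p i)"
  by (simp_all add: rvec_def)

definition is_sub :: "nat \<Rightarrow> rat Matrix.vec set \<Rightarrow> bool" where
  "is_sub n W \<longleftrightarrow> W \<subseteq> carrier_vec n \<and> 0\<^sub>v n \<in> W \<and> (\<forall>x\<in>W. \<forall>y\<in>W. x + y \<in> W) \<and> (\<forall>c. \<forall>x\<in>W. c \<cdot>\<^sub>v x \<in> W)"

lemma subspace_iff: "VectorSpace.subspace class_ring W (module_vec TYPE(rat) n) \<longleftrightarrow> is_sub n W"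
proof -
  interpret vec_space "TYPE(rat)" n .
  have vs: "vectorspace class_ring (module_vec TYPE(rat) n)" by (rule vec_vs)
  hence m: "module class_ring (module_vec TYPE(rat) n)" by (simp add: vectorspace_def)
  show ?thesis
    using vs m unfolding VectorSpace.subspace_def LinearCombinations.submodule_def is_sub_def
    by (auto simp: module_vec_simps class_ring_simps)
qed

lemma tits_building_iff: "W \<in> tits_building n \<longleftrightarrow> is_sub n W \<and> W \<noteq> {0\<^sub>v n} \<and> W \<noteq> carrier_vec n"
  by (simp add: tits_building_def subspace_iff)

text \<open>Together with \<open>rspan\<close> this is the bijection between rational subspaces and
  pure sublattices. In \<open>rspan\<close> the span is expressed by clearing denominators instead
  of by linear combinations.\<close>

definition lat_of :: "nat \<Rightarrow> rat Matrix.vec set \<Rightarrow> int poly set" where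
  "lat_of n W = {p \<in> int_lattice n. rvec n p \<in> W}"

definition rspan :: "nat \<Rightarrow> int poly set \<Rightarrow> rat Matrix.vec set" where
  "rspan n P = {v \<in> carrier_vec n. \<exists>m::int. m \<noteq> 0 \<and> (\<exists>p\<in>P. of_int m \<cdot>\<^sub>v v = rvec n p)}"

definition join_line :: "rat Matrix.vec set \<Rightarrow> rat Matrix.vec \<Rightarrow> rat Matrix.vec set" where
  "join_line W v = {w + c \<cdot>\<^sub>v v | w c. w \<in> W}"

lemma clear_denominators:
  assumes "v \<in> carrier_vec n"
  obtains m :: int and p where "m \<noteq> 0" "p \<in> int_lattice n" "of_int m \<cdot>\<^sub>v v = rvec n p"
proof -
  have "\<exists>m::int. m \<noteq> 0 \<and> (\<forall>i<k. \<exists>a::int. of_int m * v $ i = of_int a)" for k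
  proof (induction k)
    case (Suc k)
    then obtain m :: int where m: "m \<noteq> 0" "\<forall>i<k. \<exists>a::int. of_int m * v $ i = of_int a" by blast
    obtain a b :: int where ab: "v $ k = of_int a / of_int b" "b \<noteq> 0" by (metis Rat_cases Fract_of_int_quotient less_irrefl)
    have "\<exists>c::int. of_int (m * b) * v $ i = of_int c" if i: "i < Suc k" for i
    proof (cases "i = k")
      case True
      hence "of_int (m * b) * v $ i = of_int (m * a)" using ab by simp
      thus ?thesis by blast
    next
      case False
      then obtain c :: int where "of_int m * v $ i = of_int c" using m(2) i by (metis less_SucE)
      hence "of_int (m * b) * v $ i = of_int (c * b)" by simp
      thus ?thesis by blast
    qed
    thus ?case using m(1) ab(2) by (intro exI[of _ "m * b"]) auto
  qed (intro exI[of _ 1], simp)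
  then obtain m :: int where m: "m \<noteq> 0" "\<forall>i<n. \<exists>a::int. of_int m * v $ i = of_int a" by blast
  then obtain a where a: "\<And>i. i < n \<Longrightarrow> of_int m * v $ i = of_int (a i)" by metis
  have "of_int m \<cdot>\<^sub>v v = rvec n (pol n a)" using a assms by (intro eq_vecI) auto
  thus thesis using that m(1) pol_in_lattice by blast
qed

lemma rvec_add: "rvec n (p + q) = rvec n p + rvec n q" by (intro eq_vecI) auto
lemma rvec_of_int: "rvec n (of_int m * p) = of_int m \<cdot>\<^sub>v rvec n p" by (intro eq_vecI) auto
lemma rvec_0: "rvec n 0 = 0\<^sub>v n" by (intro eq_vecI) auto

lemma pure_lat_of:
  assumes "is_sub n W" shows "pure (int_lattice n) (lat_of n W)"
proof -
  have W: "W \<subseteq> carrier_vec n" "0\<^sub>v n \<in> W" "\<And>x y. x \<in> W \<Longrightarrow> y \<in> W \<Longrightarrow> x + y \<in> W" "\<And>c x. x \<in> W \<Longrightarrow> c \<cdot>\<^sub>v x \<in> W"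
    using assms by (auto simp: is_sub_def)
  have "subgrp (lat_of n W)"
    unfolding subgrp_def
  proof (intro conjI ballI)
    show "0 \<in> lat_of n W" using W(2) by (simp add: lat_of_def rvec_0 subgrp_0[OF subgrp_int_lattice])
    fix x y assume "x \<in> lat_of n W" "y \<in> lat_of n W"
    hence x: "x \<in> int_lattice n" "y \<in> int_lattice n" "rvec n x \<in> W" "rvec n y \<in> W" by (auto simp: lat_of_def)
    have "rvec n (x - y) = rvec n x + (-1) \<cdot>\<^sub>v rvec n y" by (intro eq_vecI) auto
    thus "x - y \<in> lat_of n W" using x W(3,4) subgrp_diff[OF subgrp_int_lattice] by (simp add: lat_of_def)
  qed
  moreover have "x \<in> lat_of n W" if x: "x \<in> int_lattice n" "m \<noteq> 0" "of_int m * x \<in> lat_of n W" for x and m :: int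
  proof -
    have "of_int m \<cdot>\<^sub>v rvec n x \<in> W" using x(3) by (simp add: lat_of_def rvec_of_int)
    hence "(1 / of_int m) \<cdot>\<^sub>v (of_int m \<cdot>\<^sub>v rvec n x) \<in> W" by (rule W(4))
    moreover have "(1 / of_int m) \<cdot>\<^sub>v (of_int m \<cdot>\<^sub>v rvec n x) = rvec n x" using x(2) by (intro eq_vecI) auto
    ultimately show ?thesis using x(1) by (simp add: lat_of_def)
  qed
  ultimately show ?thesis unfolding pure_def by (auto simp: lat_of_def)
qed

lemma rspan_lat_of:
  assumes "is_sub n W" shows "rspan n (lat_of n W) = W"
proof
  have W: "W \<subseteq> carrier_vec n" "\<And>c x. x \<in> W \<Longrightarrow> c \<cdot>\<^sub>v x \<in> W"
    using assms by (auto simp: is_sub_def)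
  show "rspan n (lat_of n W) \<subseteq> W"
  proof
    fix v assume "v \<in> rspan n (lat_of n W)"
    then obtain m :: int and p where v: "v \<in> carrier_vec n" "m \<noteq> 0" "p \<in> lat_of n W" "of_int m \<cdot>\<^sub>v v = rvec n p"
      by (auto simp: rspan_def)
    have "(1 / of_int m) \<cdot>\<^sub>v rvec n p \<in> W" using W(2) v(3) by (simp add: lat_of_def)
    moreover have "(1 / of_int m) \<cdot>\<^sub>v rvec n p = v" unfolding v(4)[symmetric] using v(1,2) by (intro eq_vecI) auto
    ultimately show "v \<in> W" by simp
  qed
  show "W \<subseteq> rspan n (lat_of n W)"
  proof
    fix v assume v: "v \<in> W"
    hence vc: "v \<in> carrier_vec n" using W(1) by blast
    obtain m :: int and p where "m \<noteq> 0" "p \<in> int_lattice n" "of_int m \<cdot>\<^sub>v v = rvec n p"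
      using clear_denominators[OF vc] .
    thus "v \<in> rspan n (lat_of n W)" using vc W(2)[OF v, of "of_int m"] unfolding rspan_def lat_of_def by auto
  qed
qed

lemma lat_of_rspan:
  assumes "pure (int_lattice n) P" shows "lat_of n (rspan n P) = P"
proof
  have P: "P \<subseteq> int_lattice n" using assms by (simp add: pure_def)
  show "P \<subseteq> lat_of n (rspan n P)"
  proof
    fix p assume p: "p \<in> P"
    have "of_int 1 \<cdot>\<^sub>v rvec n p = rvec n p" by simp
    thus "p \<in> lat_of n (rspan n P)" using p P unfolding lat_of_def rspan_def by (auto intro!: exI[of _ 1])
  qed
  show "lat_of n (rspan n P) \<subseteq> P"
  proof
    fix p assume "p \<in> lat_of n (rspan n P)"
    then obtain m :: int and q where m: "p \<in> int_lattice n" "m \<noteq> 0" "q \<in> P" "of_int m \<cdot>\<^sub>v rvec n p = rvec n q"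
      by (auto simp: lat_of_def rspan_def)
    have "of_int m * p = q"
    proof (rule lattice_eqI[of _ n])
      show "of_int m * p \<in> int_lattice n" using m(1) by (rule subgrp_of_int[OF subgrp_int_lattice])
      show "q \<in> int_lattice n" using m(3) P by blast
      fix i assume i: "i < n"
      have "(of_int m \<cdot>\<^sub>v rvec n p) $ i = rvec n q $ i" using m(4) by simp
      hence "(of_int (m * coeff p i) :: rat) = of_int (coeff q i)" using i by simp
      thus "coeff (of_int m * p) i = coeff q i" unfolding of_int_eq_iff by simp
    qed
    thus "p \<in> P" using assms m unfolding pure_def by blast
  qed
qed

lemma is_sub_rspan:
  assumes "subgrp P" "P \<subseteq> int_lattice n" shows "is_sub n (rspan n P)"
  unfolding is_sub_def
proof (intro conjI ballI allI)
  show "rspan n P \<subseteq> carrier_vec n" by (auto simp: rspan_def)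
  show "0\<^sub>v n \<in> rspan n P" unfolding rspan_def using subgrp_0[OF assms(1)] by (auto intro!: exI[of _ 1] bexI[of _ 0] simp: rvec_0)
  fix x assume "x \<in> rspan n P"
  then obtain m :: int and p where x: "x \<in> carrier_vec n" "m \<noteq> 0" "p \<in> P" "of_int m \<cdot>\<^sub>v x = rvec n p" by (auto simp: rspan_def)
  show "x + y \<in> rspan n P" if y: "y \<in> rspan n P" for y
  proof -
    obtain k :: int and q where y: "y \<in> carrier_vec n" "k \<noteq> 0" "q \<in> P" "of_int k \<cdot>\<^sub>v y = rvec n q" using y by (auto simp: rspan_def)
    have "of_int (m * k) \<cdot>\<^sub>v (x + y) = of_int k \<cdot>\<^sub>v (of_int m \<cdot>\<^sub>v x) + of_int m \<cdot>\<^sub>v (of_int k \<cdot>\<^sub>v y)"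
      using x(1) y(1) by (intro eq_vecI) (auto simp: algebra_simps)
    also have "\<dots> = rvec n (of_int k * p + of_int m * q)" unfolding x(4) y(4) by (simp add: rvec_add rvec_of_int)
    finally have "of_int (m * k) \<cdot>\<^sub>v (x + y) = rvec n (of_int k * p + of_int m * q)" .
    moreover have "of_int k * p + of_int m * q \<in> P" using x(3) y(3) assms by (intro subgrp_add subgrp_of_int)
    ultimately show ?thesis using x(1,2) y(1,2) unfolding rspan_def mem_Collect_eq by (metis add_carrier_vec mult_eq_0_iff)
  qed
  fix c :: rat
  obtain a b :: int where ab: "c = of_int a / of_int b" "b \<noteq> 0" by (metis Rat_cases Fract_of_int_quotient less_irrefl)
  have "of_int (m * b) \<cdot>\<^sub>v (c \<cdot>\<^sub>v x) = of_int a \<cdot>\<^sub>v (of_int m \<cdot>\<^sub>v x)"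
    using x(1) ab by (intro eq_vecI) (auto simp: algebra_simps)
  also have "\<dots> = rvec n (of_int a * p)" unfolding x(4) by (simp add: rvec_of_int)
  finally show "c \<cdot>\<^sub>v x \<in> rspan n P"
    using x(1-3) ab(2) subgrp_of_int[OF assms(1) x(3)] unfolding rspan_def mem_Collect_eq by (metis smult_carrier_vec mult_eq_0_iff)
qed

text \<open>The correspondence takes joins to joins, so apartments of sublattices become apartments
  of subspaces.\<close>

lemma rspan_adj:
  assumes P: "subgrp P" "P \<subseteq> int_lattice n" and x: "x \<in> int_lattice n"
  shows "rspan n (adj P x) = join_line (rspan n P) (rvec n x)"
proof
  show "rspan n (adj P x) \<subseteq> join_line (rspan n P) (rvec n x)"
  proof
    fix v assume "v \<in> rspan n (adj P x)"
    then obtain m :: int and u k where v: "v \<in> carrier_vec n" "m \<noteq> 0" "u \<in> P" "of_int m \<cdot>\<^sub>v v = rvec n (u + of_int k * x)"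
      unfolding rspan_def adj_def by blast
    have c: "of_int m * v $ i = of_int (coeff u i) + of_int k * of_int (coeff x i)" if "i < n" for i
      using arg_cong[OF v(4), of "\<lambda>w. w $ i"] that v(1) by simp
    let ?w = "(1 / of_int m) \<cdot>\<^sub>v rvec n u"
    have "of_int m \<cdot>\<^sub>v ?w = rvec n u" using v(2) by (intro eq_vecI) auto
    hence "?w \<in> rspan n P" using v(2,3) unfolding rspan_def by (auto intro!: exI[of _ m])
    moreover have "v = ?w + (of_int k / of_int m) \<cdot>\<^sub>v rvec n x"
      using v(1,2) c by (intro eq_vecI) (auto simp: field_simps)
    ultimately show "v \<in> join_line (rspan n P) (rvec n x)" unfolding join_line_def by blast
  qed
  have sub: "is_sub n (rspan n (adj P x))"
    by (rule is_sub_rspan) (use P x in \<open>auto simp: subgrp_adj adj_least subgrp_int_lattice\<close>)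
  have "rspan n P \<subseteq> rspan n (adj P x)" using adj_subset[of P x] unfolding rspan_def by blast
  moreover have "rvec n x \<in> rspan n (adj P x)"
    using adj_self[OF P(1), of x] unfolding rspan_def by (auto intro!: exI[of _ 1])
  ultimately show "join_line (rspan n P) (rvec n x) \<subseteq> rspan n (adj P x)"
    using sub unfolding is_sub_def join_line_def by blast
qed

lemma rspan_0: "rspan n {0} = {0\<^sub>v n}"
proof -
  have "v = 0\<^sub>v n" if "v \<in> carrier_vec n" "m \<noteq> 0" "of_int m \<cdot>\<^sub>v v = rvec n 0" for v and m :: int
  proof (rule eq_vecI)
    fix i assume "i < dim_vec (0\<^sub>v n :: rat Matrix.vec)"
    thus "v $ i = (0\<^sub>v n :: rat Matrix.vec) $ i" using arg_cong[OF that(3), of "\<lambda>w. w $ i"] that(1,2) by simp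
  qed (use that in simp)
  moreover have "0\<^sub>v n \<in> rspan n {0}" using is_sub_rspan[of "{0}" n] by (simp add: is_sub_def subgrp_def int_lattice_def)
  ultimately show ?thesis by (auto simp: rspan_def)
qed

lemma rspan_lattice: "rspan n (int_lattice n) = carrier_vec n"
  using clear_denominators unfolding rspan_def by (auto, metis)

lemma pure_lattice: "pure (int_lattice n) (int_lattice n)"
  by (auto simp: pure_def subgrp_int_lattice)

lemma pure_zero: "pure (int_lattice n) {0}"
  by (auto simp: pure_def subgrp_def int_lattice_def)

lemma rspan_inj: "pure (int_lattice n) P \<Longrightarrow> pure (int_lattice n) Q \<Longrightarrow> rspan n P = rspan n Q \<Longrightarrow> P = Q"
  by (metis lat_of_rspan)

lemma rspan_mono: "P \<subseteq> Q \<Longrightarrow> rspan n P \<subseteq> rspan n Q"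
  unfolding rspan_def by blast

text \<open>Links the recursive notion of basis with spanning and independence, the form in which
  columns of matrices are handled. The first coefficient is split off with \<open>case_nat\<close>:
  it is the multiple of x hidden in membership in \<open>adj U x\<close>.\<close>

lemma rel_basis_iff:
  assumes L: "subgrp L"
  shows "subgrp U \<Longrightarrow> U \<subseteq> L \<Longrightarrow> rel_basis L U xs \<longleftrightarrow> set xs \<subseteq> L \<and>
    (\<forall>y\<in>L. \<exists>c. y - (\<Sum>i<length xs. of_int (c i) * xs ! i) \<in> U) \<and>
    (\<forall>c. (\<Sum>i<length xs. of_int (c i) * xs ! i) \<in> U \<longrightarrow> (\<forall>i<length xs. c i = 0))"
proof (induction xs arbitrary: U)
  case Nil
  thus ?case by auto
next
  case (Cons x xs)
  let ?S = "\<lambda>c. \<Sum>i<length xs. of_int (c i) * xs ! i"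
  have sum: "(\<Sum>i<length (x # xs). of_int (c i) * (x # xs) ! i) = of_int (c 0) * x + ?S (\<lambda>i. c (Suc i))" for c
    by (simp add: sum.lessThan_Suc_shift del: sum.lessThan_Suc)
  show ?case
  proof
    assume r: "rel_basis L U (x # xs)"
    hence x: "x \<in> L" "\<And>m. of_int m * x \<in> U \<Longrightarrow> m = 0" and r': "rel_basis L (adj U x) xs" by auto
    have W: "subgrp (adj U x)" "adj U x \<subseteq> L" using Cons.prems L x by (auto simp: subgrp_adj adj_least)
    have IH: "set xs \<subseteq> L" "\<And>y. y \<in> L \<Longrightarrow> \<exists>c. y - ?S c \<in> adj U x"
      "\<And>c. ?S c \<in> adj U x \<Longrightarrow> \<forall>i<length xs. c i = 0" using Cons.IH[OF W] r' by auto
    have "\<exists>c. y - (\<Sum>i<length (x # xs). of_int (c i) * (x # xs) ! i) \<in> U" if "y \<in> L" for y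
    proof -
      obtain c where "y - ?S c \<in> adj U x" using IH(2)[OF \<open>y \<in> L\<close>] by blast
      then obtain u m where "u \<in> U" "y - ?S c = u + of_int m * x" unfolding adj_def by blast
      hence "y - (of_int m * x + ?S c) \<in> U" by (simp add: algebra_simps)
      thus ?thesis unfolding sum by (intro exI[of _ "case_nat m c"]) simp
    qed
    moreover have "\<forall>i<length (x # xs). c i = 0" if "(\<Sum>i<length (x # xs). of_int (c i) * (x # xs) ! i) \<in> U" for c
    proof -
      have s: "of_int (c 0) * x + ?S (\<lambda>i. c (Suc i)) \<in> U" using that unfolding sum .
      hence "(of_int (c 0) * x + ?S (\<lambda>i. c (Suc i))) + of_int (- c 0) * x \<in> adj U x" by (rule adjI)
      hence "?S (\<lambda>i. c (Suc i)) \<in> adj U x" by simp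
      hence z: "\<forall>i<length xs. c (Suc i) = 0" by (rule IH(3))
      hence "?S (\<lambda>i. c (Suc i)) = 0" by simp
      hence "c 0 = 0" using s x(2) by simp
      thus ?thesis using z by (metis length_Cons not0_implies_Suc Suc_less_eq)
    qed
    ultimately show "set (x # xs) \<subseteq> L \<and> (\<forall>y\<in>L. \<exists>c. y - (\<Sum>i<length (x # xs). of_int (c i) * (x # xs) ! i) \<in> U) \<and>
      (\<forall>c. (\<Sum>i<length (x # xs). of_int (c i) * (x # xs) ! i) \<in> U \<longrightarrow> (\<forall>i<length (x # xs). c i = 0))"
      using x(1) IH(1) by auto
  next
    assume r: "set (x # xs) \<subseteq> L \<and> (\<forall>y\<in>L. \<exists>c. y - (\<Sum>i<length (x # xs). of_int (c i) * (x # xs) ! i) \<in> U) \<and>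
      (\<forall>c. (\<Sum>i<length (x # xs). of_int (c i) * (x # xs) ! i) \<in> U \<longrightarrow> (\<forall>i<length (x # xs). c i = 0))"
    hence xL: "x \<in> L" by simp
    have W: "subgrp (adj U x)" "adj U x \<subseteq> L" using Cons.prems L xL by (auto simp: subgrp_adj adj_least)
    have ind: "\<forall>i<length (x # xs). c i = 0" if "of_int (c 0) * x + ?S (\<lambda>i. c (Suc i)) \<in> U" for c
      using r that unfolding sum[symmetric] by blast
    have "m = 0" if "of_int m * x \<in> U" for m
      using ind[of "case_nat m (\<lambda>_. 0)"] that by (auto dest: spec[of _ 0])
    moreover have "rel_basis L (adj U x) xs"
      unfolding Cons.IH[OF W]
    proof (intro conjI ballI allI impI)
      show "set xs \<subseteq> L" using r by simp
      fix y assume "y \<in> L"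
      then obtain c where "y - (of_int (c 0) * x + ?S (\<lambda>i. c (Suc i))) \<in> U" using r unfolding sum by auto
      from adjI[OF this, of "c 0" x] have "y - ?S (\<lambda>i. c (Suc i)) \<in> adj U x" by (simp add: algebra_simps)
      thus "\<exists>c. y - ?S c \<in> adj U x" by (intro exI[of _ "\<lambda>i. c (Suc i)"])
    next
      fix c i assume S: "?S c \<in> adj U x" and i: "i < length xs"
      then obtain u m where "u \<in> U" "?S c = u + of_int m * x" unfolding adj_def by blast
      hence "of_int (case_nat (- m) c 0) * x + ?S (\<lambda>i. case_nat (- m) c (Suc i)) \<in> U" by simp
      from ind[OF this] i show "c i = 0" by (auto dest: spec[of _ "Suc i"])
    qed
    ultimately show "rel_basis L U (x # xs)" using xL by simp
  qed
qed

section \<open>Integral frames as invertible matrices\<close>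

definition mat_cols :: "nat \<Rightarrow> int mat \<Rightarrow> int poly list" where
  "mat_cols n g = map (\<lambda>j. pol n (\<lambda>i. g $$ (i, j))) [0..<n]"

definition mat_of_list :: "nat \<Rightarrow> int poly list \<Rightarrow> int mat" where
  "mat_of_list n xs = mat n n (\<lambda>(i, j). coeff (xs ! j) i)"

lemma length_mat_cols [simp]: "length (mat_cols n g) = n"
  by (simp add: mat_cols_def)

lemma mat_cols_nth [simp]: "j < n \<Longrightarrow> mat_cols n g ! j = pol n (\<lambda>i. g $$ (i, j))"
  by (simp add: mat_cols_def)

lemma mat_of_list_cols: "g \<in> carrier_mat n n \<Longrightarrow> mat_of_list n (mat_cols n g) = g"
  by (intro eq_matI) (auto simp: mat_of_list_def)

lemma mat_cols_of_list: "length xs = n \<Longrightarrow> set xs \<subseteq> int_lattice n \<Longrightarrow> mat_cols n (mat_of_list n xs) = xs"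
proof (rule nth_equalityI)
  assume a: "length xs = n" "set xs \<subseteq> int_lattice n"
  fix j assume "j < length (mat_cols n (mat_of_list n xs))"
  hence j: "j < n" by simp
  hence "xs ! j \<in> int_lattice n" using a by auto
  thus "mat_cols n (mat_of_list n xs) ! j = xs ! j" using j by (intro lattice_eqI[of _ n]) (auto simp: mat_of_list_def)
qed simp

abbreviation GL :: "nat \<Rightarrow> int mat set" where
  "GL n \<equiv> carrier (GL_int n)"

lemma GL_int_iff: "g \<in> GL n \<longleftrightarrow> g \<in> carrier_mat n n \<and> (\<exists>h\<in>carrier_mat n n. h * g = 1\<^sub>m n \<and> g * h = 1\<^sub>m n)"
  by (auto simp: GL_int_def units_of_def Units_def ring_mat_simps)

lemma mat_cols_comb:
  assumes "g \<in> carrier_mat n n"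
  shows "(\<Sum>i<n. of_int (c i) * mat_cols n g ! i) = pol n (\<lambda>k. (g *\<^sub>v Matrix.vec n c) $ k)"
proof (rule poly_eqI)
  fix k
  have "coeff (\<Sum>i<n. of_int (c i) * mat_cols n g ! i) k = (\<Sum>i<n. c i * (if k < n then g $$ (k, i) else 0))"
    by (simp add: coeff_sum)
  moreover have "(g *\<^sub>v Matrix.vec n c) $ k = (\<Sum>i<n. c i * g $$ (k, i))" if "k < n"
    using assms that by (simp add: scalar_prod_def lessThan_atLeast0 mult.commute)
  ultimately show "coeff (\<Sum>i<n. of_int (c i) * mat_cols n g ! i) k = coeff (pol n (\<lambda>k. (g *\<^sub>v Matrix.vec n c) $ k)) k"
    by auto
qed

lemma subgrp_zero: "subgrp {0}"
  by (simp add: subgrp_def)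

lemma zero_subset_lattice: "{0} \<subseteq> int_lattice n"
  by (simp add: subgrp_0[OF subgrp_int_lattice])

lemmas zero_in_lattice = subgrp_int_lattice subgrp_zero zero_subset_lattice

lemma mat_cols_frames:
  assumes "g \<in> GL n" shows "mat_cols n g \<in> frames (int_lattice n) n {0}"
proof -
  obtain h where gh: "g \<in> carrier_mat n n" "h \<in> carrier_mat n n" "h * g = 1\<^sub>m n" "g * h = 1\<^sub>m n"
    using assms by (auto simp: GL_int_iff)
  have "rel_basis (int_lattice n) {0} (mat_cols n g)"
    unfolding rel_basis_iff[OF zero_in_lattice] length_mat_cols mat_cols_comb[OF gh(1)]
  proof (intro conjI ballI allI impI)
    show "set (mat_cols n g) \<subseteq> int_lattice n" by (auto simp: mat_cols_def)
    fix y assume y: "y \<in> int_lattice n"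
    define c where "c = (\<lambda>i. (h *\<^sub>v Matrix.vec n (coeff y)) $ i)"
    have "Matrix.vec n c = h *\<^sub>v Matrix.vec n (coeff y)" using gh(2) by (intro eq_vecI) (auto simp: c_def)
    hence "g *\<^sub>v Matrix.vec n c = Matrix.vec n (coeff y)"
      using gh by (simp add: assoc_mult_mat_vec[symmetric, of _ n n _ n])
    hence "pol n (\<lambda>k. (g *\<^sub>v Matrix.vec n c) $ k) = y" using y by (intro lattice_eqI[of _ n]) auto
    thus "\<exists>c. y - pol n (\<lambda>k. (g *\<^sub>v Matrix.vec n c) $ k) \<in> {0}" by auto
  next
    fix c i assume c: "pol n (\<lambda>k. (g *\<^sub>v Matrix.vec n c) $ k) \<in> {0}" and i: "i < n"
    have "g *\<^sub>v Matrix.vec n c = 0\<^sub>v n"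
    proof (rule eq_vecI)
      fix k assume "k < dim_vec (0\<^sub>v n :: int Matrix.vec)"
      hence k: "k < n" by simp
      have "coeff (pol n (\<lambda>k. (g *\<^sub>v Matrix.vec n c) $ k)) k = 0" using c by simp
      hence "(g *\<^sub>v Matrix.vec n c) $ k = 0" using k unfolding coeff_pol by simp
      thus "(g *\<^sub>v Matrix.vec n c) $ k = 0\<^sub>v n $ k" using k by simp
    qed (use gh in simp)
    hence "h *\<^sub>v (g *\<^sub>v Matrix.vec n c) = h *\<^sub>v 0\<^sub>v n" by (rule arg_cong)
    also have "\<dots> = 0\<^sub>v n" using gh(2) by (intro eq_vecI) (auto simp: scalar_prod_def)
    finally have "h *\<^sub>v (g *\<^sub>v Matrix.vec n c) = 0\<^sub>v n" .
    hence "Matrix.vec n c = 0\<^sub>v n" using gh by (simp add: assoc_mult_mat_vec[symmetric, of _ n n _ n])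
    thus "c i = 0" using i by (metis index_vec index_zero_vec(1))
  qed
  thus ?thesis by (simp add: frames_def)
qed

lemma mult_mat_unit_vec:
  fixes A :: "'a::comm_ring_1 mat"
  assumes "A \<in> carrier_mat m n" "j < n"
  shows "A *\<^sub>v unit_vec n j = col A j"
  using assms by (intro eq_vecI) auto

text \<open>Spanning yields a right inverse column by column. It is also a left inverse C: the
  matrix g annihilates the columns of C g - 1, and its own columns are independent.\<close>

lemma frames_mat:
  assumes "xs \<in> frames (int_lattice n) n {0}" shows "mat_of_list n xs \<in> GL n" "mat_cols n (mat_of_list n xs) = xs"
proof -
  have rb: "rel_basis (int_lattice n) {0} xs" and len: "length xs = n" using assms by (auto simp: frames_def)
  let ?g = "mat_of_list n xs"
  have g: "?g \<in> carrier_mat n n" by (simp add: mat_of_list_def)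
  have sub: "set xs \<subseteq> int_lattice n" using rel_basis_subset[OF rb] .
  show mc: "mat_cols n ?g = xs" by (rule mat_cols_of_list[OF len sub])
  have span: "\<And>y. y \<in> int_lattice n \<Longrightarrow> \<exists>c. y = pol n (\<lambda>k. (?g *\<^sub>v Matrix.vec n c) $ k)"
    and ind: "\<And>c. pol n (\<lambda>k. (?g *\<^sub>v Matrix.vec n c) $ k) = 0 \<Longrightarrow> \<forall>i<n. c i = 0"
    using rb len mat_cols_comb[OF g] mc
    unfolding rel_basis_iff[OF zero_in_lattice] by auto
  have "\<exists>c. \<forall>k<n. (?g *\<^sub>v Matrix.vec n c) $ k = (if k = j then 1 else 0)" for j
  proof -
    obtain c where "pol n (\<lambda>k. if k = j then 1 else 0) = pol n (\<lambda>k. (?g *\<^sub>v Matrix.vec n c) $ k)" using span[OF pol_in_lattice] by blast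
    hence e: "coeff (pol n (\<lambda>k. if k = j then 1 else 0)) k = coeff (pol n (\<lambda>k. (?g *\<^sub>v Matrix.vec n c) $ k)) k" for k by simp
    have "(?g *\<^sub>v Matrix.vec n c) $ k = (if k = j then 1 else 0)" if "k < n" for k
      using e[of k] that unfolding coeff_pol by simp
    thus ?thesis by blast
  qed
  then obtain c where c: "\<And>j k. k < n \<Longrightarrow> (?g *\<^sub>v Matrix.vec n (c j)) $ k = (if k = j then 1 else 0)" by metis
  let ?C = "mat n n (\<lambda>(i, j). c j i)"
  have C: "?C \<in> carrier_mat n n" by simp
  have colC: "col ?C j = Matrix.vec n (c j)" if "j < n" for j using that by (intro eq_vecI) auto
  have gC: "?g * ?C = 1\<^sub>m n"
  proof (rule eq_matI)
    fix k j assume "k < dim_row (1\<^sub>m n :: int mat)" "j < dim_col (1\<^sub>m n :: int mat)"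
    thus "(?g * ?C) $$ (k, j) = 1\<^sub>m n $$ (k, j)" using c[of k j] colC[of j] g by auto
  qed (use g in auto)
  have "?C * ?g = 1\<^sub>m n"
  proof (rule eq_matI)
    fix i j assume "i < dim_row (1\<^sub>m n :: int mat)" "j < dim_col (1\<^sub>m n :: int mat)"
    hence ij: "i < n" "j < n" by auto
    let ?v = "col (?C * ?g) j - unit_vec n j"
    have Cg: "?C * ?g \<in> carrier_mat n n" using C g by (rule mult_carrier_mat)
    hence v2: "col (?C * ?g) j \<in> carrier_vec n" using ij(2) by (rule col_carrier_vec[rotated])
    hence v: "?v \<in> carrier_vec n" "col (?C * ?g) j \<in> carrier_vec n" by simp_all
    have "?g *\<^sub>v col (?C * ?g) j = col (?g * (?C * ?g)) j" using col_mult2[OF g Cg ij(2)] by simp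
    also have "?g * (?C * ?g) = (?g * ?C) * ?g" using assoc_mult_mat[OF g C g] by simp
    also have "\<dots> = ?g" unfolding gC using g by simp
    also have "col ?g j = ?g *\<^sub>v unit_vec n j" using mult_mat_unit_vec[OF g ij(2)] by simp
    finally have "?g *\<^sub>v ?v = 0\<^sub>v n" using g v by (simp add: mult_minus_distrib_mat_vec[of _ n n])
    moreover have "Matrix.vec n (\<lambda>i. ?v $ i) = ?v" using v by (intro eq_vecI) auto
    ultimately have "pol n (\<lambda>k. (?g *\<^sub>v Matrix.vec n (\<lambda>i. ?v $ i)) $ k) = 0" by (intro poly_eqI) auto
    hence "?v $ i = 0" using ind[of "\<lambda>i. ?v $ i"] ij by blast
    thus "(?C * ?g) $$ (i, j) = 1\<^sub>m n $$ (i, j)" using ij C g by (simp add: unit_vec_def)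
  qed (use g in auto)
  thus "?g \<in> GL n" using g C gC unfolding GL_int_iff by blast
qed

lemma mat_cols_mult:
  assumes "g \<in> carrier_mat n n" "w \<in> carrier_mat n n" "j < n"
  shows "mat_cols n (g * w) ! j = (\<Sum>i<n. of_int (w $$ (i, j)) * mat_cols n g ! i)"
proof -
  have "Matrix.vec n (\<lambda>i. w $$ (i, j)) = col w j" using assms by (intro eq_vecI) auto
  thus ?thesis unfolding mat_cols_comb[OF assms(1)] using assms by (intro poly_eqI) auto
qed

text \<open>The last member spans the whole space and is not a vertex of the building. It is the
  same for all full flags of positive rank, so dropping it loses nothing.\<close>

definition truncate :: "nat \<Rightarrow> int poly set list \<Rightarrow> rat Matrix.vec set list" where
  "truncate n l = butlast (map (rspan n) l)"

definition apartment_class :: "nat \<Rightarrow> int mat \<Rightarrow> rat Matrix.vec set list \<Rightarrow>\<^sub>0 int" where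
  "apartment_class n g = frag_map (truncate n) (apartment adj {0} (mat_cols n g))"

section \<open>Maximal flags of the building and its top-dimensional cycles\<close>

lemma pure_chain_iff:
  "pure_chain L U Fs \<longleftrightarrow> sorted_wrt (\<subset>) (U # Fs) \<and> (\<forall>F\<in>set Fs. pure L F)"
proof (induction Fs arbitrary: U)
  case (Cons F Fs)
  have "U \<subset> F \<and> sorted_wrt (\<subset>) (F # Fs) \<longleftrightarrow> sorted_wrt (\<subset>) (U # F # Fs)"
    by (auto simp: sorted_wrt2_simps(2)[of "(\<subset>)"] intro: psubset_trans)
  thus ?case using Cons.IH[of F] by auto
qed simp

lemma last_flag_of: "rel_basis L U xs \<Longrightarrow> xs \<noteq> [] \<Longrightarrow> last (flag_of U xs) = L"
proof (induction xs arbitrary: U)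
  case (Cons x xs)
  thus ?case by (cases xs) auto
qed simp

lemma full_flagsD:
  assumes "l \<in> full_flags (int_lattice n) n {0}"
  shows "length l = n" "sorted_wrt (\<subset>) ({0} # l)" "\<And>P. P \<in> set l \<Longrightarrow> pure (int_lattice n) P"
    "n > 0 \<Longrightarrow> last l = int_lattice n"
proof -
  obtain xs where xs: "l = flag_of {0} xs" "rel_basis (int_lattice n) {0} xs" "length xs = n"
    using assms by (auto simp: full_flags_def frames_def)
  have "pure_chain (int_lattice n) {0} l"
    unfolding xs(1) by (rule full_flags_pure_chain[OF zero_in_lattice xs(2)])
  thus "sorted_wrt (\<subset>) ({0} # l)" "\<And>P. P \<in> set l \<Longrightarrow> pure (int_lattice n) P"
    unfolding pure_chain_iff by blast+
  show "length l = n" using xs by simp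
  show "n > 0 \<Longrightarrow> last l = int_lattice n" using xs last_flag_of[OF xs(2)] by auto
qed

lemma lattice_basis: "rel_basis (int_lattice n) {0} (mat_cols n (1\<^sub>m n))"
proof -
  have "1\<^sub>m n \<in> GL n" unfolding GL_int_iff by (auto intro!: bexI[of _ "1\<^sub>m n"])
  thus ?thesis using mat_cols_frames[of "1\<^sub>m n" n] by (simp add: frames_def)
qed

lemma pure_chain_lattice_length: "pure_chain (int_lattice n) {0} Fs \<Longrightarrow> length Fs \<le> n"
  using pure_chain_length[OF zero_in_lattice lattice_basis] by simp

lemma pure_chain_lattice_full: "pure_chain (int_lattice n) {0} Fs \<Longrightarrow> length Fs = n \<Longrightarrow> Fs \<in> full_flags (int_lattice n) n {0}"
  using pure_chain_full[OF zero_in_lattice lattice_basis] by simp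

lemma rspan_strict_mono: "pure (int_lattice n) P \<Longrightarrow> pure (int_lattice n) Q \<Longrightarrow> P \<subset> Q \<Longrightarrow> rspan n P \<subset> rspan n Q"
  by (metis psubset_eq rspan_mono rspan_inj)

lemma lat_of_strict_mono: "is_sub n V \<Longrightarrow> is_sub n W \<Longrightarrow> V \<subset> W \<Longrightarrow> lat_of n V \<subset> lat_of n W"
proof -
  assume a: "is_sub n V" "is_sub n W" "V \<subset> W"
  have "lat_of n V \<subseteq> lat_of n W" using a(3) unfolding lat_of_def by blast
  moreover have "lat_of n V \<noteq> lat_of n W" by (metis a psubset_eq rspan_lat_of)
  ultimately show ?thesis by blast
qed

lemma truncate_flags:
  assumes n: "n \<ge> 2" and l: "l \<in> full_flags (int_lattice n) n {0}"
  shows "truncate n l \<in> flags (n - 2) (tits_building n)"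
    and "map (lat_of n) (truncate n l) @ [int_lattice n] = l"
proof -
  note f = full_flagsD[OF l]
  have ne: "l \<noteq> []" using f(1) n by auto
  have "last l = int_lattice n" using f(4) n by simp
  hence bl: "l = butlast l @ [int_lattice n]" using append_butlast_last_id[OF ne] by simp
  have t: "truncate n l = map (rspan n) (butlast l)" by (simp add: truncate_def map_butlast)
  have pb: "pure (int_lattice n) P" if "P \<in> set (butlast l)" for P using f(3) in_set_butlastD[OF that] .
  have "sorted_wrt (\<subset>) ({0} # butlast l @ [int_lattice n])" using f(2) bl by simp
  hence s: "sorted_wrt (\<subset>) (butlast l)" "\<And>P. P \<in> set (butlast l) \<Longrightarrow> {0} \<subset> P \<and> P \<subset> int_lattice n"
    by (auto simp: sorted_wrt_append)
  have "sorted_wrt (\<subset>) (truncate n l)"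
    unfolding t sorted_wrt_map by (rule sorted_wrt_mono_rel[OF _ s(1)]) (use rspan_strict_mono pb in blast)
  moreover have "rspan n P \<in> tits_building n" if P: "P \<in> set (butlast l)" for P
  proof -
    have "subgrp P" "P \<subseteq> int_lattice n" using pb[OF P] by (auto simp: pure_def)
    moreover have "rspan n P \<noteq> {0\<^sub>v n}" using rspan_inj[OF pb[OF P] pure_zero] rspan_0[of n] s(2)[OF P] by auto
    moreover have "rspan n P \<noteq> carrier_vec n" using rspan_inj[OF pb[OF P] pure_lattice] rspan_lattice[of n] s(2)[OF P] by auto
    ultimately show ?thesis unfolding tits_building_iff using is_sub_rspan by blast
  qed
  ultimately show "truncate n l \<in> flags (n - 2) (tits_building n)"
    using n f(1) unfolding flags_def t by auto
  have "map (lat_of n) (truncate n l) = butlast l"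
    unfolding t map_map by (rule map_idI) (use lat_of_rspan pb in auto)
  thus "map (lat_of n) (truncate n l) @ [int_lattice n] = l" using bl by simp
qed

text \<open>Placed between 0 and the full lattice, a flag of subspaces becomes a strict chain of
  pure sublattices, and the rank bounds its length. This is the source of the dimension of the
  building.\<close>

lemma building_chain_pure:
  assumes l: "l \<in> flags p (tits_building n)"
  shows "pure_chain (int_lattice n) {0} (map (lat_of n) l @ [int_lattice n])"
proof -
  have lt: "\<And>W. W \<in> set l \<Longrightarrow> is_sub n W \<and> W \<noteq> {0\<^sub>v n} \<and> W \<noteq> carrier_vec n" and s: "sorted_wrt (\<subset>) l"
    using l by (auto simp: flags_def tits_building_iff)
  have "sorted_wrt (\<subset>) (map (lat_of n) l)"
    unfolding sorted_wrt_map by (rule sorted_wrt_mono_rel[OF _ s]) (use lat_of_strict_mono lt in blast)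
  moreover have "{0} \<subset> lat_of n W \<and> lat_of n W \<subset> int_lattice n" if W: "W \<in> set l" for W
  proof -
    have p: "pure (int_lattice n) (lat_of n W)" using pure_lat_of lt[OF W] by blast
    hence "subgrp (lat_of n W)" "lat_of n W \<subseteq> int_lattice n" by (auto simp: pure_def)
    moreover have "lat_of n W \<noteq> {0}" "lat_of n W \<noteq> int_lattice n"
      using rspan_lat_of[of n W] lt[OF W] rspan_0[of n] rspan_lattice[of n] by auto
    ultimately show ?thesis using subgrp_0 by blast
  qed
  moreover have "l \<noteq> []" using l by (auto simp: flags_def)
  hence "hd l \<in> set l" by simp
  hence "{0} \<subset> int_lattice n" using calculation(2) by blast
  ultimately show ?thesis
    unfolding pure_chain_iff using pure_lat_of lt pure_lattice by (auto simp: sorted_wrt_append)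
qed

lemma flags_building_empty: assumes "p + 1 \<ge> n" shows "flags p (tits_building n) = {}"
proof (rule ccontr)
  assume "flags p (tits_building n) \<noteq> {}"
  then obtain l where l: "l \<in> flags p (tits_building n)" by blast
  thus False using pure_chain_lattice_length[OF building_chain_pure[OF l]] assms by (simp add: flags_def)
qed

lemma untruncate:
  assumes n: "n \<ge> 2" and l: "l \<in> flags (n - 2) (tits_building n)"
  shows "map (lat_of n) l @ [int_lattice n] \<in> full_flags (int_lattice n) n {0}"
    and "truncate n (map (lat_of n) l @ [int_lattice n]) = l"
proof -
  show "map (lat_of n) l @ [int_lattice n] \<in> full_flags (int_lattice n) n {0}"
    by (rule pure_chain_lattice_full[OF building_chain_pure[OF l]]) (use l n in \<open>auto simp: flags_def\<close>)
  have "is_sub n W" if "W \<in> set l" for W using l that by (auto simp: flags_def tits_building_iff)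
  hence "map (rspan n) (map (lat_of n) l) = l" unfolding map_map by (intro map_idI) (simp add: rspan_lat_of)
  thus "truncate n (map (lat_of n) l @ [int_lattice n]) = l" by (simp add: truncate_def)
qed

lemma inj_on_truncate: "n \<ge> 2 \<Longrightarrow> inj_on (truncate n) (full_flags (int_lattice n) n {0})"
  by (rule inj_on_inverseI[of _ "\<lambda>l. map (lat_of n) l @ [int_lattice n]"]) (rule truncate_flags(2))

lemma frag_extend_cmul_fun: "frag_extend (\<lambda>l. frag_cmul m (f l)) a = frag_cmul m (frag_extend f a)"
  by (simp add: frag_extend_def frag_cmul_sum mult.commute)

text \<open>In a poset without flags of length \<open>p + 2\<close>, the position of the deleted element of a maximal
  flag can be read off from the remaining flag, so the faces in different positions cannot cancel.\<close>

lemma maximal_flags_cycle: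
  assumes P: "flags (Suc p) P = {}" and z: "keys z \<subseteq> flags p P" "flag_boundary p z = 0" and p: "p > 0" and k: "k \<le> p"
  shows "frag_map (delete_nth k) z = 0"
proof -
  \<comment> \<open>If face j of l equals face i of l' with j < i, the two flags can be spliced: l
    up to position j + 1, then l' after position j, where the two meet in a common member. The
    result has one member too many.\<close>
  have aux: False if l: "l \<in> flags p P" "l' \<in> flags p P" "j < i" "i \<le> p" "delete_nth j l = delete_nth i l'" for l l' i j
  proof -
    have len: "length l = Suc p" "length l' = Suc p" using l by (auto simp: flags_def)
    have "l ! Suc j = l' ! j"
      using arg_cong[OF l(5), of "\<lambda>a. a ! j"] len l(3,4) by (simp add: nth_delete_nth)
    let ?m = "take (Suc (Suc j)) l @ drop (Suc j) l'"
    have "sorted_wrt (\<subset>) l" "sorted_wrt (\<subset>) l'" "set l \<subseteq> P" "set l' \<subseteq> P" using l by (auto simp: flags_def)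
    note s = this
    have "x \<subset> y" if x: "x \<in> set (take (Suc (Suc j)) l)" and y: "y \<in> set (drop (Suc j) l')" for x y
    proof -
      obtain a where a: "a < Suc (Suc j)" "a < length l" "x = l ! a" using x by (auto simp: in_set_conv_nth)
      obtain b where "b < length (drop (Suc j) l')" "y = drop (Suc j) l' ! b" using y unfolding in_set_conv_nth by blast
      hence b: "Suc j + b < length l'" "y = l' ! (Suc j + b)" by auto
      have "x \<subseteq> l ! Suc j"
        using sorted_wrt_nth_less[OF s(1), of a "Suc j"] a len l(3,4) by (cases "a = Suc j") auto
      moreover have "l' ! j \<subset> y" using sorted_wrt_nth_less[OF s(2), of j "Suc j + b"] b by simp
      ultimately show ?thesis using \<open>l ! Suc j = l' ! j\<close> by auto
    qed
    hence "sorted_wrt (\<subset>) ?m" unfolding sorted_wrt_append using s(1,2) sorted_wrt_take sorted_wrt_drop by blast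
    moreover have "set ?m \<subseteq> P" using s(3,4) set_take_subset set_drop_subset by (metis Un_subset_iff set_append subset_trans)
    moreover have "length ?m = Suc (Suc p)" using len l(3,4) by simp
    ultimately have "?m \<in> flags (Suc p) P" by (simp add: flags_def)
    thus False using P by simp
  qed
  let ?S = "\<lambda>k. frag_map (delete_nth k) z"
  have kS: "keys (?S k) \<subseteq> delete_nth k ` flags p P" for k
    by (rule keys_frag_extend_subset[OF z(1)]) (simp add: keys_frag_of)
  have bd: "flag_boundary p z = (\<Sum>k\<le>p. frag_cmul ((-1) ^ k) (?S k))"
    unfolding flag_boundary_def using p
    by (simp add: frag_extend_sum_fun frag_extend_cmul_fun del: sum.atMost_Suc)
  show ?thesis
  proof (rule ccontr)
    assume "?S k \<noteq> 0"
    then obtain x where x: "x \<in> keys (?S k)" by fastforce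
    have o: "x \<notin> keys (?S i)" if "i \<le> p" "i \<noteq> k" for i
    proof
      assume "x \<in> keys (?S i)"
      then obtain l l' where "l \<in> flags p P" "l' \<in> flags p P" "delete_nth k l = delete_nth i l'"
        using kS[of i] kS[of k] x by blast
      thus False using aux[of l l' k i] aux[of l' l i k] that k by (cases i k rule: linorder_cases) auto
    qed
    have "0 = Poly_Mapping.lookup (\<Sum>i\<le>p. frag_cmul ((-1) ^ i) (?S i)) x"
      using z(2) bd by simp
    also have "\<dots> = (\<Sum>i\<le>p. (-1) ^ i * Poly_Mapping.lookup (?S i) x)"
      by (simp add: lookup_sum del: sum.atMost_Suc)
    also have "\<dots> = (\<Sum>i\<le>p. if i = k then (-1) ^ k * Poly_Mapping.lookup (?S k) x else 0)"
      by (rule sum.cong[OF refl]) (use o in \<open>auto simp: in_keys_iff\<close>)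
    also have "\<dots> = (-1) ^ k * Poly_Mapping.lookup (?S k) x" using k by (simp del: sum.atMost_Suc)
    finally show False using x by (auto simp: in_keys_iff)
  qed
qed

lemma apartment_class_keys:
  assumes "n \<ge> 2" "g \<in> GL n"
  shows "keys (apartment_class n g) \<subseteq> flags (n - 2) (tits_building n)"
  unfolding apartment_class_def
proof (rule keys_frag_extend_subset)
  show "keys (apartment adj {0} (mat_cols n g)) \<subseteq> full_flags (int_lattice n) n {0}"
    by (rule keys_apartment[OF zero_in_lattice mat_cols_frames[OF assms(2)]])
qed (use truncate_flags(1)[OF assms(1)] in \<open>simp add: keys_frag_of\<close>)

lemma delete_nth_butlast: "Suc k < length l \<Longrightarrow> delete_nth k (butlast l) = butlast (delete_nth k l)"
  by (simp add: delete_nth_def butlast_append take_butlast drop_butlast)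

lemma delete_nth_map: "delete_nth k (map f l) = map f (delete_nth k l)"
  by (simp add: delete_nth_def take_map drop_map)

lemma apartment_class_cycle:
  assumes "n \<ge> 2" "g \<in> GL n"
  shows "flag_boundary (n - 2) (apartment_class n g) = 0"
proof (cases "n - 2")
  case (Suc m)
  let ?A = "apartment adj {0} (mat_cols n g)"
  have k: "keys ?A \<subseteq> full_flags (int_lattice n) n {0}"
    by (rule keys_apartment[OF zero_in_lattice mat_cols_frames[OF assms(2)]])
  have "frag_map (delete_nth k) (apartment_class n g) = 0" if "k \<le> n - 2" for k
  proof -
    have "frag_map (delete_nth k) (apartment_class n g) = frag_extend (\<lambda>l. frag_of (delete_nth k (truncate n l))) ?A"
      unfolding apartment_class_def frag_extend_frag_extend by simp
    also have "\<dots> = frag_extend (\<lambda>l. frag_of (truncate n (delete_nth k l))) ?A"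
    proof (rule frag_extend_eq)
      fix l assume "l \<in> keys ?A"
      hence "length l = n" using k full_flagsD(1) by blast
      thus "frag_of (delete_nth k (truncate n l)) = frag_of (truncate n (delete_nth k l))"
        using that assms(1) by (simp add: truncate_def delete_nth_butlast delete_nth_map)
    qed
    also have "\<dots> = frag_map (truncate n) (frag_map (delete_nth k) ?A)"
      unfolding frag_extend_frag_extend by simp
    also have "frag_map (delete_nth k) ?A = 0"
      using cyclic_apartment[of "mat_cols n g" "{0}"] that assms(1) by (simp add: cyclic_def)
    finally show ?thesis by simp
  qed
  thus ?thesis
    using Suc by (simp add: flag_boundary_def frag_extend_sum_fun frag_extend_cmul_fun del: sum.atMost_Suc)
qed (simp add: flag_boundary_def)

text \<open>By \<open>maximal_flags_cycle\<close> the single faces of a top-dimensional cycle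
  vanish, so appending the full lattice gives a cyclic chain of full flags. That step needs flags
  with at least two members, hence n \<ge> 3.\<close>

theorem apartment_classes_generate:
  assumes n: "n \<ge> 3" and z: "keys z \<subseteq> flags (n - 2) (tits_building n)" "flag_boundary (n - 2) z = 0"
  obtains y where "keys y \<subseteq> GL n" "frag_extend (apartment_class n) y = z"
proof -
  let ?L = "int_lattice n"
  let ?\<phi> = "frag_extend (\<lambda>l. frag_of (map (lat_of n) l @ [?L])) z"
  have "keys ?\<phi> \<subseteq> full_flags ?L n {0}"
    by (rule keys_frag_extend_subset[OF z(1)]) (use n untruncate(1) in \<open>simp add: keys_frag_of\<close>)
  moreover have "cyclic n ?\<phi>"
    unfolding cyclic_def
  proof (intro allI impI)
    fix k assume k: "Suc k < n"
    have "frag_map (delete_nth k) ?\<phi> = frag_extend (\<lambda>l. frag_of (delete_nth k (map (lat_of n) l @ [?L]))) z"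
      unfolding frag_extend_frag_extend by simp
    also have "\<dots> = frag_extend (\<lambda>l. frag_of (map (lat_of n) (delete_nth k l) @ [?L])) z"
    proof (rule frag_extend_eq)
      fix l assume "l \<in> keys z"
      hence "length l = n - 1" using z(1) n by (auto simp: flags_def)
      hence "delete_nth k (map (lat_of n) l @ [?L]) = map (lat_of n) (delete_nth k l) @ [?L]"
        using k by (simp add: delete_nth_def take_map drop_map)
      thus "frag_of (delete_nth k (map (lat_of n) l @ [?L])) = frag_of (map (lat_of n) (delete_nth k l) @ [?L])" by simp
    qed
    also have "\<dots> = frag_extend (\<lambda>l. frag_of (map (lat_of n) l @ [?L])) (frag_map (delete_nth k) z)"
      unfolding frag_extend_frag_extend by simp
    also have "frag_map (delete_nth k) z = 0"
      by (rule maximal_flags_cycle[OF flags_building_empty z]) (use n k in auto)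
    finally show "frag_map (delete_nth k) ?\<phi> = 0" by simp
  qed
  ultimately obtain x where x: "keys x \<subseteq> frames ?L n {0}" "frag_extend (apartment adj {0}) x = ?\<phi>"
    using apartments_generate[OF zero_in_lattice] by blast
  let ?y = "frag_map (mat_of_list n) x"
  have "keys ?y \<subseteq> GL n"
    by (rule keys_frag_extend_subset[OF x(1)]) (use frames_mat(1) in \<open>simp add: keys_frag_of\<close>)
  moreover have "frag_extend (apartment_class n) ?y = z"
  proof -
    have "frag_extend (apartment_class n) ?y = frag_extend (\<lambda>xs. apartment_class n (mat_of_list n xs)) x"
      unfolding frag_extend_frag_extend by simp
    also have "\<dots> = frag_extend (\<lambda>xs. frag_map (truncate n) (apartment adj {0} xs)) x"
      unfolding apartment_class_def by (rule frag_extend_eq) (use x(1) frames_mat(2) in force)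
    also have "\<dots> = frag_map (truncate n) ?\<phi>"
      unfolding x(2)[symmetric] frag_extend_frag_extend ..
    also have "\<dots> = frag_extend (\<lambda>l. frag_of (truncate n (map (lat_of n) l @ [?L]))) z"
      unfolding frag_extend_frag_extend by simp
    also have "\<dots> = frag_extend frag_of z"
      by (rule frag_extend_eq) (use z(1) n untruncate(2) in force)
    finally show ?thesis by (simp flip: frag_expansion)
  qed
  ultimately show thesis by (rule that)
qed

section \<open>Signed permutations, the rotation, and apartment classes\<close>

definition signed_perm :: "nat \<Rightarrow> (nat \<Rightarrow> nat) \<Rightarrow> (nat \<Rightarrow> int) \<Rightarrow> int mat" where
  "signed_perm n \<pi> s = mat n n (\<lambda>(i, j). if i = \<pi> j then s j else 0)"

text \<open>\<open>e\<^sub>0 \<mapsto> e\<^sub>1 \<mapsto> - e\<^sub>0 - e\<^sub>1 \<mapsto> e\<^sub>0\<close>\<close>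

definition rotation3 :: "nat \<Rightarrow> int mat" where
  "rotation3 n = mat n n (\<lambda>(i, j). if j = 0 then if i = 1 then 1 else 0
     else if j = 1 then if i \<le> 1 then - 1 else 0 else if i = j then 1 else 0)"

abbreviation adjacent_swap :: "nat \<Rightarrow> nat \<Rightarrow> nat" where
  "adjacent_swap i \<equiv> Transposition.transpose i (Suc i)"

lemma signed_perm_carrier [simp]: "signed_perm n \<pi> s \<in> carrier_mat n n"
  and rotation3_carrier [simp]: "rotation3 n \<in> carrier_mat n n"
  by (simp_all add: signed_perm_def rotation3_def)

lemma set_mat_cols: "set (mat_cols n g) \<subseteq> int_lattice n"
  by (auto simp: mat_cols_def)

text \<open>Right multiplication changes the frame inside its apartment or its plane, while the
  group acts by left multiplication; all relations are therefore right multiplications and are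
  compatible with the action.\<close>

lemma mat_cols_signed_perm:
  assumes "g \<in> carrier_mat n n" "j < n" "\<pi> j < n"
  shows "mat_cols n (g * signed_perm n \<pi> s) ! j = of_int (s j) * mat_cols n g ! \<pi> j"
proof -
  have "mat_cols n (g * signed_perm n \<pi> s) ! j = (\<Sum>i<n. of_int (signed_perm n \<pi> s $$ (i, j)) * mat_cols n g ! i)"
    by (rule mat_cols_mult) (use assms in auto)
  also have "\<dots> = (\<Sum>i<n. if i = \<pi> j then of_int (s j) * mat_cols n g ! \<pi> j else 0)"
    by (rule sum.cong[OF refl]) (use assms in \<open>auto simp: signed_perm_def\<close>)
  also have "\<dots> = of_int (s j) * mat_cols n g ! \<pi> j" using assms by simp
  finally show ?thesis .
qed

lemma mat_cols_rotation3:
  assumes g: "g \<in> carrier_mat n n" and j: "j < n" and n: "n \<ge> 2"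
  shows "mat_cols n (g * rotation3 n) ! j = (if j = 0 then mat_cols n g ! 1
    else if j = 1 then - mat_cols n g ! 0 - mat_cols n g ! 1 else mat_cols n g ! j)"
proof -
  have *: "mat_cols n (g * rotation3 n) ! j = (\<Sum>i<n. of_int (rotation3 n $$ (i, j)) * mat_cols n g ! i)"
    by (rule mat_cols_mult) (use assms in auto)
  consider "j = 0" | "j = 1" | "j \<ge> 2" by linarith
  thus ?thesis
  proof cases
    case 1
    hence "(\<Sum>i<n. of_int (rotation3 n $$ (i, j)) * mat_cols n g ! i) = (\<Sum>i<n. if i = 1 then mat_cols n g ! 1 else 0)"
      by (intro sum.cong[OF refl]) (use n in \<open>auto simp: rotation3_def\<close>)
    thus ?thesis using * 1 n by simp
  next
    case 2
    have "(\<Sum>i<n. of_int (rotation3 n $$ (i, j)) * mat_cols n g ! i)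
      = (\<Sum>i<n. (if i = 0 then - mat_cols n g ! 0 else 0) + (if i = 1 then - mat_cols n g ! 1 else 0))"
      by (intro sum.cong[OF refl]) (use n 2 in \<open>auto simp: rotation3_def\<close>)
    also have "\<dots> = - mat_cols n g ! 0 - mat_cols n g ! 1" using n by (simp add: sum.distrib)
    finally show ?thesis using * 2 by simp
  next
    case 3
    hence "(\<Sum>i<n. of_int (rotation3 n $$ (i, j)) * mat_cols n g ! i) = (\<Sum>i<n. if i = j then mat_cols n g ! j else 0)"
      by (intro sum.cong[OF refl]) (use n j in \<open>auto simp: rotation3_def\<close>)
    thus ?thesis using * 3 j by simp
  qed
qed

lemma same_line_signed: "subgrp U \<Longrightarrow> s = 1 \<or> s = - 1 \<Longrightarrow> same_line U x (of_int s * x)"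
  by (auto simp: same_line_def subgrp_0)

lemma apartment_class_signed_perm:
  assumes g: "g \<in> carrier_mat n n" and \<pi>: "\<And>j. j < n \<Longrightarrow> \<pi> j < n" and s: "\<And>j. j < n \<Longrightarrow> s j = 1 \<or> s j = - 1"
  shows "apartment adj {0} (mat_cols n (g * signed_perm n \<pi> s)) = apartment adj {0} (map (\<lambda>j. mat_cols n g ! \<pi> j) [0..<n])"
proof (rule apartment_same_line[symmetric], rule list_all2_all_nthI)
  fix j assume "j < length (map (\<lambda>j. mat_cols n g ! \<pi> j) [0..<n])"
  hence j: "j < n" by simp
  show "same_line {0} (map (\<lambda>j. mat_cols n g ! \<pi> j) [0..<n] ! j) (mat_cols n (g * signed_perm n \<pi> s) ! j)"
    using mat_cols_signed_perm[of g n j \<pi> s] g j \<pi>[OF j] same_line_signed[OF subgrp_zero s[OF j]] by (simp del: mat_cols_nth)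
qed simp

lemma apartment_class_diag:
  assumes "g \<in> carrier_mat n n" "\<And>j. j < n \<Longrightarrow> s j = 1 \<or> s j = - 1"
  shows "apartment_class n (g * signed_perm n id s) = apartment_class n g"
proof -
  have "map (\<lambda>j. mat_cols n g ! id j) [0..<n] = mat_cols n g" by (intro nth_equalityI) auto
  thus ?thesis unfolding apartment_class_def using apartment_class_signed_perm[of g n id s] assms by simp
qed

lemma list_split2: "Suc i < length l \<Longrightarrow> l = take i l @ l ! i # l ! Suc i # drop (Suc (Suc i)) l"
  by (metis Cons_nth_drop_Suc Suc_lessD append_take_drop_id)

lemma nth_append_swap:
  "j < length a + length b + 2 \<Longrightarrow>
   (a @ y # x # b) ! j = (a @ x # y # b) ! adjacent_swap (length a) j"
  by (auto simp: Transposition.transpose_def nth_append nth_Cons' not_less)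

lemma transpose_less: "Suc i < n \<Longrightarrow> j < n \<Longrightarrow> adjacent_swap i j < n"
  by (auto simp: Transposition.transpose_def)

lemma apartment_class_swap:
  assumes g: "g \<in> carrier_mat n n" and i: "Suc i < n" and s: "\<And>j. j < n \<Longrightarrow> s j = 1 \<or> s j = - 1"
  shows "apartment_class n (g * signed_perm n (adjacent_swap i) s) = - apartment_class n g"
proof -
  let ?l = "mat_cols n g"
  define a where "a = take i ?l"
  define b where "b = drop (Suc (Suc i)) ?l"
  define x where "x = ?l ! i"
  define y where "y = ?l ! Suc i"
  have l: "?l = a @ x # y # b" unfolding a_def b_def x_def y_def by (rule list_split2) (use i in simp)
  have a: "length a = i" using i by (simp add: a_def)
  have ab: "length a + length b + 2 = n" using i by (simp add: a_def b_def)
  have "map (\<lambda>j. ?l ! adjacent_swap i j) [0..<n] = a @ y # x # b"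
    by (rule nth_equalityI) (use ab a l nth_append_swap[of _ a b y x] in auto)
  hence "apartment adj {0} (mat_cols n (g * signed_perm n (adjacent_swap i) s)) = apartment adj {0} (a @ y # x # b)"
    using apartment_class_signed_perm[OF g transpose_less[OF i] s] by simp
  also have "\<dots> = - apartment adj {0} ?l" unfolding l by (rule apartment_swap[of adj, OF adj_commute])
  finally show ?thesis by (simp add: apartment_class_def frag_extend_minus)
qed

lemma mat_cols_three:
  assumes g: "g \<in> carrier_mat n n" and n: "n \<ge> 2" and l: "mat_cols n g = x # y # r"
  shows "mat_cols n (g * rotation3 n) = y # (- x - y) # r"
proof (rule nth_equalityI)
  have len: "length r = n - 2" using arg_cong[OF l, of length] by simp
  show "length (mat_cols n (g * rotation3 n)) = length (y # (- x - y) # r)" using len n by simp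
  fix j assume "j < length (mat_cols n (g * rotation3 n))"
  hence j: "j < n" by simp
  show "mat_cols n (g * rotation3 n) ! j = (y # (- x - y) # r) ! j"
    unfolding mat_cols_rotation3[OF g j n] l by (auto simp: nth_Cons')
qed

lemma apartment_class_rotation3:
  assumes g: "g \<in> carrier_mat n n" and n: "n \<ge> 2"
  shows "apartment_class n g + apartment_class n (g * rotation3 n) + apartment_class n (g * rotation3 n * rotation3 n) = 0"
proof -
  let ?r = "rotation3 n"
  obtain x y r where l: "mat_cols n g = x # y # r" using n length_mat_cols[of n g]
    by (metis One_nat_def Suc_le_length_iff numeral_2_eq_2)
  have l1: "mat_cols n (g * ?r) = y # (- x - y) # r" by (rule mat_cols_three[OF g n l])
  have "mat_cols n (g * ?r * ?r) = (- x - y) # (- y - (- x - y)) # r" by (rule mat_cols_three[OF _ n l1]) (use g in simp)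
  hence "mat_cols n (g * ?r * ?r) = (- x - y) # x # r" by simp
  thus ?thesis
    unfolding apartment_class_def frag_extend_add[symmetric] l l1 using apartment_three[OF subgrp_zero, of x y r] by simp
qed

text \<open>The action is given on rational subspaces, so the class is rewritten with joins of these
  before equivariance is proved.\<close>

lemma apartment_class_rational:
  "apartment_class n g = frag_map butlast (apartment join_line {0\<^sub>v n} (map (rvec n) (mat_cols n g)))"
proof -
  have "frag_map (map (rspan n)) (apartment adj {0} (mat_cols n g))
    = apartment join_line (rspan n {0}) (map (rvec n) (mat_cols n g))"
    by (rule apartment_map[where I = "\<lambda>P. subgrp P \<and> P \<subseteq> int_lattice n" and A = "int_lattice n"])
      (auto simp: rspan_adj subgrp_adj adj_least subgrp_int_lattice subgrp_zero subgrp_0 set_mat_cols[THEN subsetD])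
  thus ?thesis unfolding apartment_class_def truncate_def rspan_0 by (metis (no_types, lifting) ext frag_extend_frag_extend frag_extend_of)
qed

lemma building_action_join:
  assumes A: "A \<in> carrier_mat n n" and W: "W \<subseteq> carrier_vec n" and v: "v \<in> carrier_vec n"
  shows "building_action A (join_line W v) = join_line (building_action A W) (map_mat rat_of_int A *\<^sub>v v)"
proof -
  let ?A = "map_mat rat_of_int A"
  have "?A *\<^sub>v (w + c \<cdot>\<^sub>v v) = ?A *\<^sub>v w + c \<cdot>\<^sub>v (?A *\<^sub>v v)" if "w \<in> W" for w c
  proof -
    have w: "w \<in> carrier_vec n" using that W by blast
    have A': "?A \<in> carrier_mat n n" using A by simp
    show ?thesis using mult_add_distrib_mat_vec[OF A' w, of "c \<cdot>\<^sub>v v"] mult_mat_vec[OF A' v, of c] v by simp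
  qed
  hence e: "{?A *\<^sub>v (w + c \<cdot>\<^sub>v v) | w c. w \<in> W} = {?A *\<^sub>v w + c \<cdot>\<^sub>v (?A *\<^sub>v v) | w c. w \<in> W}" by (metis (no_types, lifting))
  have "building_action A (join_line W v) = {?A *\<^sub>v (w + c \<cdot>\<^sub>v v) | w c. w \<in> W}" unfolding building_action_def join_line_def by auto
  also have "\<dots> = join_line (building_action A W) (?A *\<^sub>v v)" unfolding e building_action_def join_line_def by auto
  finally show ?thesis .
qed

lemma apartment_class_act:
  assumes A: "A \<in> carrier_mat n n" and g: "g \<in> carrier_mat n n"
  shows "frag_map (map (building_action A)) (apartment_class n g) = apartment_class n (A * g)"
proof -
  let ?A = "map_mat rat_of_int A"
  have A': "?A \<in> carrier_mat n n" using A by simp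
  have join_c: "join_line W v \<subseteq> carrier_vec n" if "W \<subseteq> carrier_vec n" "v \<in> carrier_vec n" for W and v :: "rat Matrix.vec"
    using that unfolding join_line_def by auto
  have "frag_map (map (building_action A)) (apartment join_line {0\<^sub>v n} (map (rvec n) (mat_cols n g)))
    = apartment join_line (building_action A {0\<^sub>v n}) (map ((*\<^sub>v) ?A) (map (rvec n) (mat_cols n g)))"
    by (rule apartment_map[where I = "\<lambda>W. W \<subseteq> carrier_vec n" and A = "carrier_vec n"])
      (use A join_c building_action_join in auto)
  also have "building_action A {0\<^sub>v n} = {0\<^sub>v n}"
  proof -
    have "?A *\<^sub>v 0\<^sub>v n = 0\<^sub>v n" using A' by (intro eq_vecI) (auto simp: scalar_prod_def)
    thus ?thesis by (simp add: building_action_def)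
  qed
  also have "map ((*\<^sub>v) ?A) (map (rvec n) (mat_cols n g)) = map (rvec n) (mat_cols n (A * g))"
  proof (rule nth_equalityI)
    fix j assume "j < length (map ((*\<^sub>v) ?A) (map (rvec n) (mat_cols n g)))"
    hence j: "j < n" by simp
    have "?A *\<^sub>v rvec n (mat_cols n g ! j) = rvec n (mat_cols n (A * g) ! j)"
    proof (rule eq_vecI)
      fix i assume "i < dim_vec (rvec n (mat_cols n (A * g) ! j))"
      hence i: "i < n" by simp
      show "(?A *\<^sub>v rvec n (mat_cols n g ! j)) $ i = rvec n (mat_cols n (A * g) ! j) $ i"
        using i j A g by (simp add: scalar_prod_def)
    qed (use A in simp)
    thus "map ((*\<^sub>v) ?A) (map (rvec n) (mat_cols n g)) ! j = map (rvec n) (mat_cols n (A * g)) ! j" using j by simp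
  qed simp
  finally have "frag_map (map (building_action A)) (apartment join_line {0\<^sub>v n} (map (rvec n) (mat_cols n g)))
    = apartment join_line {0\<^sub>v n} (map (rvec n) (mat_cols n (A * g)))" .
  thus ?thesis
    unfolding apartment_class_rational[of n "A * g"] apartment_class_rational[of n g]
    by (metis (no_types, lifting) ext frag_extend_frag_extend frag_extend_of map_butlast)
qed

text \<open>Injectivity of truncation and completeness of the frame relations reduce a relation
  among apartment classes to the generating ones; with frames read as matrices, these are right
  multiplications by a transposition, a sign and the rotation. S takes the place of zero in the
  target of f.\<close>

theorem apartment_class_kernel:
  assumes n: "n \<ge> 2" and y: "keys y \<subseteq> GL n" "frag_extend (apartment_class n) y = 0"
    and S: "subgrp S"
    and swap: "\<And>g i. g \<in> GL n \<Longrightarrow> Suc i < n \<Longrightarrow>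
      f g + f (g * signed_perm n (adjacent_swap i) (\<lambda>_. 1)) \<in> S"
    and sign: "\<And>g. g \<in> GL n \<Longrightarrow> f g - f (g * signed_perm n id (\<lambda>j. if j = 0 then - 1 else 1)) \<in> S"
    and three: "\<And>g. g \<in> GL n \<Longrightarrow> f g + f (g * rotation3 n) + f (g * rotation3 n * rotation3 n) \<in> S"
  shows "frag_extend f y \<in> S"
proof -
  let ?L = "int_lattice n"
  let ?x = "frag_map (mat_cols n) y"
  have kx: "keys ?x \<subseteq> frames ?L n {0}"
    by (rule keys_frag_extend_subset[OF y(1)]) (use mat_cols_frames in \<open>simp add: keys_frag_of\<close>)
  have "frag_map (truncate n) (frag_extend (apartment adj {0}) ?x) = frag_extend (apartment_class n) y"
    unfolding frag_extend_frag_extend apartment_class_def by (simp add: frag_extend_frag_extend)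
  hence "frag_map (truncate n) (frag_extend (apartment adj {0}) ?x) = 0" using y(2) by simp
  moreover have "keys (frag_extend (apartment adj {0}) ?x) \<subseteq> full_flags ?L n {0}"
    by (rule keys_frag_extend_subset[OF kx]) (rule keys_apartment[OF zero_in_lattice])
  ultimately have "frag_extend (apartment adj {0}) ?x = 0"
    using frag_extend_inj_eq_0[OF inj_on_truncate[OF n]] by blast
  hence x: "?x \<in> frame_relations ?L n {0}"
    by (rule frame_relations_complete[OF zero_in_lattice kx])
  let ?f = "\<lambda>xs. f (mat_of_list n xs)"
  have *: "frag_extend ?f w \<in> S" if "w \<in> frame_relations ?L n {0}" for w
    using that
  proof induction
    case zero
    show ?case using S by (simp add: subgrp_def)
  next
    case (diff a b)
    thus ?case using S by (simp add: subgrp_def frag_extend_diff)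
  next
    case (swap a x y b)
    let ?g = "mat_of_list n (a @ x # y # b)"
    let ?P = "signed_perm n (adjacent_swap (length a)) (\<lambda>_. 1)"
    have g: "?g \<in> GL n" "mat_cols n ?g = a @ x # y # b" using frames_mat[OF swap] by auto
    have gm: "?g \<in> carrier_mat n n" using g(1) by (simp add: GL_int_iff)
    have n: "n = length a + length b + 2" using swap by (simp add: frames_def)
    have "mat_cols n (?g * ?P) = a @ y # x # b"
    proof (rule nth_equalityI)
      fix j assume "j < length (mat_cols n (?g * ?P))"
      hence j: "j < n" by simp
      have "adjacent_swap (length a) j < n" by (rule transpose_less) (use n j in auto)
      thus "mat_cols n (?g * ?P) ! j = (a @ y # x # b) ! j"
        using mat_cols_signed_perm[OF gm j, of "adjacent_swap (length a)"] g(2) nth_append_swap[of j a b y x] j n by (simp del: mat_cols_nth)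
    qed (use n in simp)
    hence "mat_of_list n (a @ y # x # b) = ?g * ?P" using mat_of_list_cols[of "?g * ?P" n] gm by simp
    thus ?case using assms(5)[OF g(1), of "length a"] n by (simp add: frag_extend_add)
  next
    case (line x r x')
    let ?g = "mat_of_list n (x # r)"
    have g: "?g \<in> GL n" "mat_cols n ?g = x # r" using frames_mat[OF line(1)] by auto
    have gm: "?g \<in> carrier_mat n n" using g(1) by (simp add: GL_int_iff)
    have n: "n = Suc (length r)" using line by (simp add: frames_def)
    have "x' = x \<or> x' = - x" using line(2) by (auto simp: same_line_def add_eq_0_iff2)
    thus ?case
    proof
      assume "x' = - x"
      let ?D = "signed_perm n id (\<lambda>j. if j = 0 then - 1 else 1)"
      have "mat_cols n (?g * ?D) = - x # r"
      proof (rule nth_equalityI)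
        fix j assume "j < length (mat_cols n (?g * ?D))"
        hence j: "j < n" by simp
        thus "mat_cols n (?g * ?D) ! j = (- x # r) ! j"
          using mat_cols_signed_perm[OF gm j, of id] g(2) by (auto simp: nth_Cons')
      qed (use n in simp)
      hence "mat_of_list n (- x # r) = ?g * ?D" using mat_of_list_cols[of "?g * ?D" n] gm by simp
      thus ?thesis using sign[OF g(1)] \<open>x' = - x\<close> by (simp add: frag_extend_diff)
    qed (use S in \<open>simp add: subgrp_def\<close>)
  next
    case (three x y r)
    let ?g = "mat_of_list n (x # y # r)"
    let ?r = "rotation3 n"
    have g: "?g \<in> GL n" "mat_cols n ?g = x # y # r" using frames_mat[OF three] by auto
    have gm: "?g \<in> carrier_mat n n" using g(1) by (simp add: GL_int_iff)
    have l1: "mat_cols n (?g * ?r) = y # (- x - y) # r" by (rule mat_cols_three[OF gm n g(2)])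
    have "mat_cols n (?g * ?r * ?r) = (- x - y) # (- y - (- x - y)) # r" by (rule mat_cols_three[OF _ n l1]) (use gm in simp)
    hence "mat_cols n (?g * ?r * ?r) = (- x - y) # x # r" by simp
    moreover have "?g * ?r \<in> carrier_mat n n" "?g * ?r * ?r \<in> carrier_mat n n"
      using gm by (auto intro!: mult_carrier_mat[of _ n n])
    ultimately have "mat_of_list n ((- x - y) # x # r) = ?g * ?r * ?r" "mat_of_list n (y # (- x - y) # r) = ?g * ?r"
      using mat_of_list_cols[of "?g * ?r * ?r" n] mat_of_list_cols[of "?g * ?r" n] l1 by auto
    thus ?case using assms(7)[OF g(1)] by (simp add: frag_extend_add)
  qed
  have "frag_extend f y = frag_extend ?f ?x"
    unfolding frag_extend_frag_extend frag_extend_of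
    by (rule frag_extend_eq) (use y(1) mat_of_list_cols in \<open>force simp: GL_int_iff\<close>)
  thus ?thesis using *[OF x] by simp
qed

section \<open>The Steinberg module\<close>

abbreviation building_space :: "nat \<Rightarrow> (rat Matrix.vec set \<Rightarrow> real) topology" where
  "building_space n \<equiv> geometric_realization (tits_building n)"

definition steinberg_class :: "nat \<Rightarrow> (int mat \<Rightarrow>\<^sub>0 int) \<Rightarrow> (rat Matrix.vec set \<Rightarrow> real) chain set" where
  "steinberg_class n y = homologous_rel_set (n - 2) (building_space n) {} (realize (frag_extend (apartment_class n) y))"

text \<open>For n \<ge> 3 the degree n - 2 is positive, where reduced and ordinary homology
  agree.\<close>

lemma steinberg_eq:
  assumes "n \<ge> 3" shows "steinberg n = homology_group (int (n - 2)) (building_space n)"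
proof -
  have "int n - 2 = int (n - 2)" "int (n - 2) \<noteq> 0" using assms by auto
  thus ?thesis unfolding steinberg_def using un_reduced_homology_group by metis
qed

lemma comm_group_steinberg: "n \<ge> 3 \<Longrightarrow> comm_group (steinberg n)"
  by (simp add: steinberg_eq)

lemma steinberg_chain_keys:
  assumes "n \<ge> 3" "keys y \<subseteq> GL n"
  shows "keys (frag_extend (apartment_class n) y) \<subseteq> flags (n - 2) (tits_building n)"
  by (rule keys_frag_extend_subset[OF assms(2)]) (use assms(1) apartment_class_keys in simp)

lemma steinberg_chain_cycle:
  assumes n: "n \<ge> 3" and y: "keys y \<subseteq> GL n"
  shows "singular_relcycle (n - 2) (building_space n) {} (realize (frag_extend (apartment_class n) y))"
proof -
  have "flag_boundary (n - 2) (frag_extend (apartment_class n) y) = 0"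
  proof -
    have "flag_boundary (n - 2) (frag_extend (apartment_class n) y) = frag_extend (\<lambda>g. flag_boundary (n - 2) (apartment_class n g)) y"
      using n by (simp add: flag_boundary_def frag_extend_frag_extend)
    also have "\<dots> = 0"
      by (rule frag_extend_eq_0) (use y n apartment_class_cycle in auto)
    finally show ?thesis .
  qed
  hence "chain_boundary (n - 2) (realize (frag_extend (apartment_class n) y)) = 0"
    using chain_boundary_realize[OF steinberg_chain_keys[OF n y]] by (simp add: realize_0)
  thus ?thesis using realize_chain[OF steinberg_chain_keys[OF n y]] by (simp add: singular_cycle)
qed

lemma steinberg_class_carrier:
  "n \<ge> 3 \<Longrightarrow> keys y \<subseteq> GL n \<Longrightarrow> steinberg_class n y \<in> carrier (steinberg n)"
  unfolding steinberg_eq carrier_relative_homology_group steinberg_class_def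
  using steinberg_chain_cycle by blast

text \<open>The product of homology classes is the elementwise sum of two cosets of boundaries,
  which has to be recognized as the coset of the sum.\<close>

lemma steinberg_class_add:
  assumes "n \<ge> 3" "keys y \<subseteq> GL n" "keys y' \<subseteq> GL n"
  shows "steinberg_class n (y + y') = steinberg_class n y \<otimes>\<^bsub>steinberg n\<^esub> steinberg_class n y'"
proof -
  let ?h = "homologous_rel (n - 2) (building_space n) {}"
  have "(\<Union>r\<in>{r. ?h a r}. \<Union>s\<in>{s. ?h b s}. {r + s}) = {r. ?h (a + b) r}" for a b
  proof
    show "(\<Union>r\<in>{r. ?h a r}. \<Union>s\<in>{s. ?h b s}. {r + s}) \<subseteq> {r. ?h (a + b) r}"
      using homologous_rel_add by force
    show "{r. ?h (a + b) r} \<subseteq> (\<Union>r\<in>{r. ?h a r}. \<Union>s\<in>{s. ?h b s}. {r + s})"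
    proof
      fix r assume "r \<in> {r. ?h (a + b) r}"
      hence "?h b (r - a)" by (simp add: homologous_rel_def algebra_simps)
      moreover have "?h a a" by (rule homologous_rel_refl)
      ultimately show "r \<in> (\<Union>r\<in>{r. ?h a r}. \<Union>s\<in>{s. ?h b s}. {r + s})"
        by (intro UN_I[of a] UN_I[of "r - a"]) auto
    qed
  qed
  thus ?thesis
    unfolding steinberg_eq[OF assms(1)] mult_relative_homology_group steinberg_class_def
    by (simp add: frag_extend_add realize_add)
qed

lemma steinberg_class_surj:
  assumes n: "n \<ge> 3" and m: "m \<in> carrier (steinberg n)"
  obtains y where "keys y \<subseteq> GL n" "m = steinberg_class n y"
proof -
  obtain c where c: "singular_relcycle (n - 2) (building_space n) {} c" "m = homologous_rel_set (n - 2) (building_space n) {} c"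
    using m unfolding steinberg_eq[OF n] carrier_relative_homology_group by blast
  obtain z where z: "keys z \<subseteq> flags (n - 2) (tits_building n)" "singular_relboundary (n - 2) (building_space n) {} (c - realize z)"
    using simplicial_surjective[OF c(1)] .
  have h: "homologous_rel (n - 2) (building_space n) {} c (realize z)"
    using z(2) by (simp add: homologous_rel_def)
  hence eq: "m = homologous_rel_set (n - 2) (building_space n) {} (realize z)"
    unfolding c(2) homologous_rel_set_eq .
  have "singular_relcycle (n - 2) (building_space n) {} (realize z)"
    using c(1) homologous_rel_singular_relcycle[OF h] by simp
  hence "flag_boundary (n - 2) z = 0"
    using flag_boundary_eq_0[OF z(1)] by (simp add: singular_cycle)
  then obtain y where "keys y \<subseteq> GL n" "frag_extend (apartment_class n) y = z"
    using apartment_classes_generate[OF n z(1)] by blast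
  thus thesis using that eq unfolding steinberg_class_def by blast
qed

text \<open>The building has no flags of dimension n - 1, so a top-dimensional flag cycle that
  bounds is 0 as a chain. Relations between homology classes are thus relations between the
  apartment chains themselves.\<close>

lemma steinberg_class_eq_one:
  assumes n: "n \<ge> 3" and y: "keys y \<subseteq> GL n" and one: "steinberg_class n y = \<one>\<^bsub>steinberg n\<^esub>"
  shows "frag_extend (apartment_class n) y = 0"
proof -
  have "singular_relboundary (n - 2) (building_space n) {} (realize (frag_extend (apartment_class n) y))"
    using one unfolding steinberg_eq[OF n] one_relative_homology_group steinberg_class_def homologous_rel_set_eq_relboundary .
  then obtain w where w: "keys w \<subseteq> flags (Suc (n - 2)) (tits_building n)" "flag_boundary (Suc (n - 2)) w = frag_extend (apartment_class n) y"
    using simplicial_injective[OF steinberg_chain_keys[OF n y]] by blast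
  have "flags (Suc (n - 2)) (tits_building n) = {}" by (rule flags_building_empty) (use n in simp)
  hence "w = 0" using w(1) by simp
  thus ?thesis using w(2) by (simp add: flag_boundary_def)
qed

section \<open>The action on the building and on apartment classes\<close>

lemma building_action_is_sub:
  assumes A: "A \<in> carrier_mat n n" and W: "is_sub n W" shows "is_sub n (building_action A W)"
proof -
  let ?A = "map_mat rat_of_int A"
  have A': "?A \<in> carrier_mat n n" using A by simp
  have W': "W \<subseteq> carrier_vec n" "0\<^sub>v n \<in> W" "\<And>x y. x \<in> W \<Longrightarrow> y \<in> W \<Longrightarrow> x + y \<in> W" "\<And>c x. x \<in> W \<Longrightarrow> c \<cdot>\<^sub>v x \<in> W"
    using W by (auto simp: is_sub_def)
  show ?thesis
    unfolding is_sub_def building_action_def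
  proof (intro conjI ballI allI)
    show "(*\<^sub>v) ?A ` W \<subseteq> carrier_vec n" using A' W'(1) mult_mat_vec_carrier by blast
    have "?A *\<^sub>v 0\<^sub>v n = 0\<^sub>v n" using A' by (intro eq_vecI) (auto simp: scalar_prod_def)
    thus "0\<^sub>v n \<in> (*\<^sub>v) ?A ` W" using W'(2) by (metis imageI)
    fix x assume "x \<in> (*\<^sub>v) ?A ` W"
    then obtain v where v: "v \<in> W" "x = ?A *\<^sub>v v" by blast
    have vc: "v \<in> carrier_vec n" using v W' by blast
    show "c \<cdot>\<^sub>v x \<in> (*\<^sub>v) ?A ` W" for c
      using mult_mat_vec[OF A' vc, of c] W'(4)[OF v(1), of c] v(2) by (metis imageI)
    fix y assume "y \<in> (*\<^sub>v) ?A ` W"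
    then obtain w where w: "w \<in> W" "y = ?A *\<^sub>v w" by blast
    have wc: "w \<in> carrier_vec n" using w W' by blast
    show "x + y \<in> (*\<^sub>v) ?A ` W"
      using mult_add_distrib_mat_vec[OF A' vc wc] W'(3)[OF v(1) w(1)] v(2) w(2) by (metis imageI)
  qed
qed

lemma building_action_mult:
  assumes "A \<in> carrier_mat n n" "B \<in> carrier_mat n n" "W \<subseteq> carrier_vec n"
  shows "building_action A (building_action B W) = building_action (A * B) W"
proof -
  have *: "map_mat rat_of_int A * map_mat rat_of_int B = map_mat rat_of_int (A * B)"
    by (rule of_int_hom.mat_hom_mult[symmetric]) (use assms in auto)
  have "map_mat rat_of_int A *\<^sub>v (map_mat rat_of_int B *\<^sub>v v) = map_mat rat_of_int (A * B) *\<^sub>v v" if "v \<in> W" for v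
    unfolding *[symmetric] by (rule assoc_mult_mat_vec[symmetric, of _ n n _ n]) (use assms that in auto)
  thus ?thesis unfolding building_action_def image_image by (metis (no_types, lifting) image_cong)
qed

lemma building_action_one: "W \<subseteq> carrier_vec n \<Longrightarrow> building_action (1\<^sub>m n) W = W"
proof -
  assume W: "W \<subseteq> carrier_vec n"
  have "map_mat rat_of_int (1\<^sub>m n) = 1\<^sub>m n" by (intro eq_matI) auto
  hence "map_mat rat_of_int (1\<^sub>m n) *\<^sub>v v = v" if "v \<in> W" for v using that W by auto
  thus ?thesis unfolding building_action_def by simp
qed

lemma building_action_building:
  assumes A: "A \<in> GL n" and W: "W \<in> tits_building n"
  shows "building_action A W \<in> tits_building n"
proof -
  obtain B where AB: "A \<in> carrier_mat n n" "B \<in> carrier_mat n n" "B * A = 1\<^sub>m n" "A * B = 1\<^sub>m n"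
    using A by (auto simp: GL_int_iff)
  have W': "is_sub n W" "W \<noteq> {0\<^sub>v n}" "W \<noteq> carrier_vec n" "W \<subseteq> carrier_vec n"
    using W by (auto simp: tits_building_iff is_sub_def)
  have undo: "building_action B (building_action A W) = W"
    unfolding building_action_mult[OF AB(2,1) W'(4)] AB(3) by (rule building_action_one[OF W'(4)])
  have triv: "building_action C {0\<^sub>v n} = {0\<^sub>v n}" if "C \<in> carrier_mat n n" for C
  proof -
    have "map_mat rat_of_int C *\<^sub>v 0\<^sub>v n = 0\<^sub>v n" using that by (intro eq_vecI) (auto simp: scalar_prod_def)
    thus ?thesis by (simp add: building_action_def)
  qed
  have full: "building_action B (carrier_vec n) = carrier_vec n"
  proof
    have Bc: "map_mat rat_of_int B \<in> carrier_mat n n" using AB(2) by simp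
    show "building_action B (carrier_vec n) \<subseteq> carrier_vec n"
      using mult_mat_vec_carrier[OF Bc] unfolding building_action_def by blast
    have Ac: "map_mat rat_of_int A \<in> carrier_mat n n" using AB(1) by simp
    have "building_action A (carrier_vec n) \<subseteq> carrier_vec n"
      using mult_mat_vec_carrier[OF Ac] unfolding building_action_def by blast
    hence "building_action B (building_action A (carrier_vec n)) \<subseteq> building_action B (carrier_vec n)"
      unfolding building_action_def by (rule image_mono)
    thus "carrier_vec n \<subseteq> building_action B (carrier_vec n)"
      unfolding building_action_mult[OF AB(2,1) order_refl] AB(3) building_action_one[OF order_refl] .
  qed
  have "building_action A W \<noteq> {0\<^sub>v n}" using undo triv[OF AB(2)] W'(2) by metis
  moreover have "building_action A W \<noteq> carrier_vec n" using undo full W'(3) by metis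
  ultimately show ?thesis unfolding tits_building_iff using building_action_is_sub[OF AB(1) W'(1)] by blast
qed

definition translate :: "int mat \<Rightarrow> (int mat \<Rightarrow>\<^sub>0 int) \<Rightarrow> (int mat \<Rightarrow>\<^sub>0 int)" where
  "translate A = frag_extend (\<lambda>g. frag_of (A * g))"

lemma GL_int_mult: "A \<in> GL n \<Longrightarrow> B \<in> GL n \<Longrightarrow> A * B \<in> GL n"
proof -
  assume "A \<in> GL n" "B \<in> GL n"
  then obtain A' B' where m: "A \<in> carrier_mat n n" "A' \<in> carrier_mat n n" "A' * A = 1\<^sub>m n" "A * A' = 1\<^sub>m n"
    "B \<in> carrier_mat n n" "B' \<in> carrier_mat n n" "B' * B = 1\<^sub>m n" "B * B' = 1\<^sub>m n" by (auto simp: GL_int_iff)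
  have a: "C * D * (E * F) = C * (D * E) * F" if "C \<in> carrier_mat n n" "D \<in> carrier_mat n n" "E \<in> carrier_mat n n" "F \<in> carrier_mat n n"
    for C D E F :: "int mat"
    using that assoc_mult_mat[of "C * D" n n E n F n] assoc_mult_mat[of C n n D n E n] by (simp add: mult_carrier_mat[of _ n n])
  have "(B' * A') * (A * B) = 1\<^sub>m n" "(A * B) * (B' * A') = 1\<^sub>m n"
    using m by (simp_all add: a)
  thus ?thesis unfolding GL_int_iff using m by (intro conjI bexI[of _ "B' * A'"] mult_carrier_mat[of _ n n])
qed

lemma translate_keys:
  assumes "A \<in> GL n" "keys y \<subseteq> GL n"
  shows "keys (translate A y) \<subseteq> GL n"
  unfolding translate_def by (rule keys_frag_extend_subset[OF assms(2)]) (use GL_int_mult assms in \<open>simp add: keys_frag_of\<close>)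

lemma steinberg_action_class:
  assumes n: "n \<ge> 3" and A: "A \<in> GL n" and y: "keys y \<subseteq> GL n"
  shows "steinberg_action n A (steinberg_class n y) = steinberg_class n (translate A y)"
proof -
  let ?c = "frag_extend (apartment_class n) y"
  have n2: "int n - 2 = int (n - 2)" using n by auto
  have cont: "continuous_map (building_space n) (building_space n) (realization_map (building_action A))"
    by (rule continuous_realization_map) (use building_action_building[OF A] in \<open>auto simp: building_action_def\<close>)
  have "steinberg_action n A (steinberg_class n y)
    = homologous_rel_set (n - 2) (building_space n) {} (chain_map (n - 2) (realization_map (building_action A)) (realize ?c))"
    unfolding steinberg_action_def steinberg_class_def n2
    by (rule hom_induced_chain_map[OF cont _ steinberg_chain_cycle[OF n y]]) simp
  also have "chain_map (n - 2) (realization_map (building_action A)) (realize ?c)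
    = realize (frag_map (map (building_action A)) ?c)"
    by (rule chain_map_realization[OF steinberg_chain_keys[OF n y]])
  also have "frag_map (map (building_action A)) ?c = frag_extend (\<lambda>g. apartment_class n (A * g)) y"
    unfolding frag_extend_frag_extend
  proof (rule frag_extend_eq)
    fix g assume "g \<in> keys y"
    hence "g \<in> GL n" using y by blast
    hence "A \<in> carrier_mat n n" "g \<in> carrier_mat n n" using A by (simp_all add: GL_int_iff)
    thus "frag_map (map (building_action A)) (apartment_class n g) = apartment_class n (A * g)"
      by (rule apartment_class_act)
  qed
  also have "\<dots> = frag_extend (apartment_class n) (translate A y)"
    unfolding translate_def frag_extend_frag_extend by simp
  finally show ?thesis by (simp add: steinberg_class_def)
qed

section \<open>Cocycles on apartment classes\<close>

lemma signed_perm_eqI: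
  "(\<And>j. j < n \<Longrightarrow> \<pi> j = \<pi>' j \<and> s j = s' j) \<Longrightarrow> signed_perm n \<pi> s = signed_perm n \<pi>' s'"
  by (intro eq_matI) (auto simp: signed_perm_def)

lemma signed_perm_mult:
  assumes "\<And>j. j < n \<Longrightarrow> \<rho> j < n"
  shows "signed_perm n \<pi> s * signed_perm n \<rho> t = signed_perm n (\<lambda>j. \<pi> (\<rho> j)) (\<lambda>j. s (\<rho> j) * t j)"
proof (rule eq_matI)
  fix i j assume "i < dim_row (signed_perm n (\<lambda>j. \<pi> (\<rho> j)) (\<lambda>j. s (\<rho> j) * t j))"
    "j < dim_col (signed_perm n (\<lambda>j. \<pi> (\<rho> j)) (\<lambda>j. s (\<rho> j) * t j))"
  hence ij: "i < n" "j < n" by (simp_all add: signed_perm_def)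
  have "(signed_perm n \<pi> s * signed_perm n \<rho> t) $$ (i, j) = (\<Sum>k<n. signed_perm n \<pi> s $$ (i, k) * signed_perm n \<rho> t $$ (k, j))"
    using ij by (simp add: signed_perm_def scalar_prod_def lessThan_atLeast0)
  also have "\<dots> = (\<Sum>k<n. if k = \<rho> j then (if i = \<pi> (\<rho> j) then s (\<rho> j) * t j else 0) else 0)"
    by (rule sum.cong[OF refl]) (use ij in \<open>auto simp: signed_perm_def\<close>)
  also have "\<dots> = (if i = \<pi> (\<rho> j) then s (\<rho> j) * t j else 0)" using assms[OF ij(2)] by simp
  finally show "(signed_perm n \<pi> s * signed_perm n \<rho> t) $$ (i, j) = signed_perm n (\<lambda>j. \<pi> (\<rho> j)) (\<lambda>j. s (\<rho> j) * t j) $$ (i, j)"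
    using ij by (simp add: signed_perm_def)
qed (simp_all add: signed_perm_def)

lemma signed_perm_one: "signed_perm n id (\<lambda>_. 1) = 1\<^sub>m n"
  by (intro eq_matI) (auto simp: signed_perm_def)

text \<open>One sign is reversed to give determinant 1, so that these representatives of the
  transpositions lie in SL.\<close>

definition weyl :: "nat \<Rightarrow> nat \<Rightarrow> int mat" where
  "weyl n i = signed_perm n (adjacent_swap i) (\<lambda>j. if j = Suc i then - 1 else 1)"

lemma weyl_carrier [simp]: "weyl n i \<in> carrier_mat n n"
  by (simp add: weyl_def)

lemma det_weyl: assumes "Suc i < n" shows "Determinant.det (weyl n i) = 1"
proof -
  have "weyl n i = multrow i (- 1) (swaprows i (Suc i) (1\<^sub>m n))"
    by (rule eq_matI) (use assms in \<open>auto simp: weyl_def signed_perm_def Transposition.transpose_def\<close>)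
  moreover have "Determinant.det (multrow i (- 1) (swaprows i (Suc i) (1\<^sub>m n :: int mat))) = 1"
    using assms by (subst det_multrow[of _ n], simp, simp, subst det_swaprows[of _ n], auto)
  ultimately show ?thesis by simp
qed

lemma det_rotation3: assumes "n \<ge> 2" shows "Determinant.det (rotation3 n) = 1"
proof -
  have "rotation3 n = addrow 1 1 0 (weyl n 0)"
    by (rule eq_matI) (use assms in \<open>auto simp: weyl_def rotation3_def signed_perm_def Transposition.transpose_def\<close>)
  moreover have "Determinant.det (addrow 1 1 0 (weyl n 0)) = Determinant.det (weyl n 0)"
    by (rule det_addrow[of _ n]) (use assms in auto)
  ultimately show ?thesis using det_weyl[of 0 n] assms by simp
qed

text \<open>Read off on the columns: x, y, -x-y are permuted cyclically.\<close>

lemma rotation3_cube: assumes n: "n \<ge> 2" shows "rotation3 n * rotation3 n * rotation3 n = 1\<^sub>m n"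
proof -
  let ?r = "rotation3 n"
  have c: "?r \<in> carrier_mat n n" "?r * ?r \<in> carrier_mat n n" "?r * ?r * ?r \<in> carrier_mat n n"
    by (auto intro!: mult_carrier_mat[of _ n n])
  obtain x y r where l: "mat_cols n (1\<^sub>m n) = x # y # r" using n length_mat_cols[of n "1\<^sub>m n"]
    by (metis One_nat_def Suc_le_length_iff numeral_2_eq_2)
  have 1: "1\<^sub>m n * ?r = ?r" by (rule left_mult_one_mat[OF c(1)])
  have "mat_cols n ?r = y # (- x - y) # r" using mat_cols_three[OF one_carrier_mat n l] unfolding 1 .
  from mat_cols_three[OF c(1) n this] have "mat_cols n (?r * ?r) = (- x - y) # x # r" by simp
  from mat_cols_three[OF c(2) n this] have "mat_cols n (?r * ?r * ?r) = mat_cols n (1\<^sub>m n)" unfolding l by simp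
  thus ?thesis using mat_of_list_cols[OF c(3)] mat_of_list_cols[OF one_carrier_mat, of n] by metis
qed

text \<open>A signed permutation that fixes the first two lines with a common sign acts on their
  span as a scalar and permutes the other lines among themselves, where the rotation is
  trivial.\<close>

lemma signed_perm_rotation3:
  assumes n: "n \<ge> 2" and \<pi>: "\<And>j. j < n \<Longrightarrow> \<pi> j < n" "\<pi> 0 = 0" "\<pi> 1 = 1" "\<And>j. j < n \<Longrightarrow> j \<ge> 2 \<Longrightarrow> \<pi> j \<ge> 2" and s: "s 0 = s 1"
  shows "signed_perm n \<pi> s * rotation3 n = rotation3 n * signed_perm n \<pi> s"
proof -
  let ?w = "signed_perm n \<pi> s" and ?r = "rotation3 n"
  have 1: "1\<^sub>m n * ?w = ?w" "1\<^sub>m n * ?r = ?r"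
    by (rule left_mult_one_mat[of _ n n], simp)+
  let ?e = "\<lambda>j. mat_cols n (1\<^sub>m n) ! j"
  have w: "mat_cols n ?w ! j = of_int (s j) * ?e (\<pi> j)" if "j < n" for j
    using mat_cols_signed_perm[of "1\<^sub>m n" n j \<pi> s] that \<pi>(1) 1 by simp
  have r: "mat_cols n ?r ! j = (if j = 0 then ?e 1 else if j = 1 then - ?e 0 - ?e 1 else ?e j)" if "j < n" for j
    using mat_cols_rotation3[of "1\<^sub>m n" n j] that n 1 by simp
  have "mat_cols n (?w * ?r) ! j = mat_cols n (?r * ?w) ! j" if j: "j < n" for j
  proof -
    have c1: "mat_cols n (?r * ?w) ! j = of_int (s j) * mat_cols n ?r ! \<pi> j"
      by (rule mat_cols_signed_perm) (use j \<pi>(1) in auto)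
    have c2: "mat_cols n (?w * ?r) ! j = (if j = 0 then mat_cols n ?w ! 1 else if j = 1 then - mat_cols n ?w ! 0 - mat_cols n ?w ! 1 else mat_cols n ?w ! j)"
      by (rule mat_cols_rotation3) (use j n in auto)
    show ?thesis
    proof (cases "j = 1")
      case True
      have "- (of_int (s 1) * ?e 0) - of_int (s 1) * ?e 1 = of_int (s 1) * (- ?e 0 - ?e 1)"
        by (simp add: ring_distribs)
      thus ?thesis using c1 c2 w[of 0] w[of 1] r[of 1] \<pi>(2,3) s n True by (simp del: mat_cols_nth)
    next
      case False
      thus ?thesis
        using c1 c2 w[of 1] w[of j] r[of "\<pi> j"] \<pi>(1)[of j] \<pi>(2,3) \<pi>(4)[of j] s n j
        by (cases "j = 0") (auto simp del: mat_cols_nth)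
    qed
  qed
  hence "mat_cols n (?w * ?r) = mat_cols n (?r * ?w)" by (intro nth_equalityI) auto
  moreover have "?w * ?r \<in> carrier_mat n n" "?r * ?w \<in> carrier_mat n n" by (auto intro!: mult_carrier_mat[of _ n n])
  ultimately show ?thesis using mat_of_list_cols by metis
qed

lemma weyl_commute:
  assumes "Suc i < n" "Suc j < n" "i + 2 \<le> j" shows "weyl n i * weyl n j = weyl n j * weyl n i"
  unfolding weyl_def
  by (subst (1 2) signed_perm_mult) (use assms in \<open>auto simp: Transposition.transpose_def intro!: signed_perm_eqI\<close>)

lemma weyl_braid:
  assumes "Suc (Suc i) < n"
  shows "weyl n i * weyl n (Suc i) * weyl n i = weyl n (Suc i) * weyl n i * weyl n (Suc i)"
proof -
  have t: "adjacent_swap i j < n" "adjacent_swap (Suc i) j < n" if "j < n" for j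
    using assms that by (auto simp: Transposition.transpose_def)
  have m: "signed_perm n \<pi> s * signed_perm n (adjacent_swap k) t =
      signed_perm n (\<lambda>j. \<pi> (adjacent_swap k j)) (\<lambda>j. s (adjacent_swap k j) * t j)"
    if "k = i \<or> k = Suc i" for \<pi> s t k
    by (rule signed_perm_mult) (use t that in blast)
  show ?thesis
    unfolding weyl_def m[of i, simplified] m[of "Suc i", simplified]
    by (rule signed_perm_eqI) (use assms in \<open>auto simp: Transposition.transpose_def\<close>)
qed

text \<open>The sign sits in the last column, away from the first two when n \<ge> 3, so that the
  reflection commutes with the rotation.\<close>

definition reflection :: "nat \<Rightarrow> int mat" where
  "reflection n = signed_perm n id (\<lambda>j. if j = n - 1 then - 1 else 1)"

abbreviation signs :: "nat \<Rightarrow> (nat \<Rightarrow> int) \<Rightarrow> bool" where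
  "signs n s \<equiv> \<forall>j<n. s j = 1 \<or> s j = - 1"

lemma subgrp_comb: "subgrp S \<Longrightarrow> a \<in> S \<Longrightarrow> b \<in> S \<Longrightarrow> z = a - b \<Longrightarrow> z \<in> S"
  and subgrp_comb_plus: "subgrp S \<Longrightarrow> a \<in> S \<Longrightarrow> b \<in> S \<Longrightarrow> z = a + b \<Longrightarrow> z \<in> S"
  by (simp_all add: subgrp_diff subgrp_add)

text \<open>\<open>\<beta> a g\<close> stands for the one-chain ([a] tensored with a fixed
  coefficient)[g], read modulo N. The assumption \<open>cocycle\<close> comes from the boundary of
  m[g|h] with m = [g a], for which g^-1 m = [a]; the last three assumptions are the relations
  between apartment classes. The group G lies between SL and GL, so that both are covered.\<close>

locale arithmetic_cocycle = group G for G :: "int mat monoid" (structure) +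
  fixes n :: nat and \<beta> :: "int mat \<Rightarrow> int mat \<Rightarrow> 'f::ab_group_add" and N :: "'f set"
  assumes n: "6 \<le> n"
    and mult: "g \<otimes> h = g * h" and one: "\<one> = 1\<^sub>m n"
    and G_GL: "carrier G \<subseteq> GL n"
    and SL_G: "\<And>A. A \<in> carrier_mat n n \<Longrightarrow> Determinant.det A = 1 \<Longrightarrow> A \<in> carrier G"
    and reflection_G: "\<And>g. g \<in> GL n \<Longrightarrow> g \<notin> carrier G \<Longrightarrow> g * reflection n \<in> carrier G"
    and N: "subgrp N"
    and cocycle: "\<And>a g h. a \<in> GL n \<Longrightarrow> g \<in> carrier G \<Longrightarrow> h \<in> carrier G \<Longrightarrow>
      \<beta> (g * a) (g * h) - \<beta> (g * a) g - \<beta> a h \<in> N"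
    and diag: "\<And>a g s. a \<in> GL n \<Longrightarrow> g \<in> carrier G \<Longrightarrow> signs n s \<Longrightarrow>
      \<beta> (a * signed_perm n id s) g - \<beta> a g \<in> N"
    and swap: "\<And>a g s i. a \<in> GL n \<Longrightarrow> g \<in> carrier G \<Longrightarrow> signs n s \<Longrightarrow> Suc i < n \<Longrightarrow>
      \<beta> (a * signed_perm n (adjacent_swap i) s) g + \<beta> a g \<in> N"
    and three: "\<And>a g. a \<in> GL n \<Longrightarrow> g \<in> carrier G \<Longrightarrow>
      \<beta> a g + \<beta> (a * rotation3 n) g + \<beta> (a * rotation3 n * rotation3 n) g \<in> N"
begin

abbreviation "r \<equiv> rotation3 n"
abbreviation "I \<equiv> 1\<^sub>m n :: int mat"
abbreviation "\<xi> w \<equiv> \<beta> I w"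
abbreviation "W \<equiv> weyl n"

lemmas N_diff = subgrp_comb[OF N] and N_add = subgrp_comb_plus[OF N]
lemmas N_0 = subgrp_0[OF N]

lemma N_minus: "a \<in> N \<Longrightarrow> z = - a \<Longrightarrow> z \<in> N"
  using N_diff[OF N_0, of a z] by simp

lemma G_mat: "g \<in> carrier G \<Longrightarrow> g \<in> carrier_mat n n" and G_GL': "g \<in> carrier G \<Longrightarrow> g \<in> GL n"
  using G_GL by (auto simp: GL_int_iff)

lemma I_G: "I \<in> carrier G" and I_GL: "I \<in> GL n"
  using one_closed G_GL unfolding one by auto

lemma G_mult: "g \<in> carrier G \<Longrightarrow> h \<in> carrier G \<Longrightarrow> g * h \<in> carrier G"
  using m_closed unfolding mult .

lemma G_assoc: "g \<in> carrier_mat n n \<Longrightarrow> h \<in> carrier_mat n n \<Longrightarrow> k \<in> carrier_mat n n \<Longrightarrow> g * h * k = g * (h * k)"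
  for g h k :: "int mat"
  by (rule assoc_mult_mat)

lemma G_inv: "g \<in> carrier G \<Longrightarrow> inv g * g = I" "g \<in> carrier G \<Longrightarrow> g * inv g = I"
  using l_inv[of g] r_inv[of g] by (simp_all add: one mult)

lemma I_mult: "g \<in> carrier_mat n n \<Longrightarrow> I * g = g" "g \<in> carrier_mat n n \<Longrightarrow> g * I = g"
  by (simp_all add: left_mult_one_mat right_mult_one_mat)

lemma r_G: "r \<in> carrier G" and r_cube: "r * r * r = I" "r * (r * r) = I"
proof -
  show "r \<in> carrier G" by (rule SL_G) (use det_rotation3 n in auto)
  show 1: "r * r * r = I" by (rule rotation3_cube) (use n in simp)
  thus "r * (r * r) = I" using assoc_mult_mat[of r n n r n r n] by simp
qed

lemma W_G: "Suc i < n \<Longrightarrow> W i \<in> carrier G"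
  by (rule SL_G) (use det_weyl in auto)

section \<open>Values of the cocycle on signed permutations\<close>

lemma at_one: "a \<in> GL n \<Longrightarrow> \<beta> a I \<in> N"
proof -
  assume a: "a \<in> GL n"
  have "\<beta> (I * a) (I * I) - \<beta> (I * a) I - \<beta> a I \<in> N" by (rule cocycle[OF a I_G I_G])
  moreover have "I * a = a" using a by (intro I_mult) (simp add: GL_int_iff)
  moreover have "I * I = I" by (intro I_mult) simp
  ultimately have "\<beta> a I - \<beta> a I - \<beta> a I \<in> N" by simp
  thus ?thesis by (rule N_minus) simp
qed

text \<open>A diagonal w fixes the class of the identity frame, so \<beta> at w agrees with \<xi>,
  and the cocycle identity becomes additivity.\<close>

lemma even_mult:
  assumes "w \<in> carrier G" "h \<in> carrier G" "w = signed_perm n id s" "signs n s"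
  shows "\<xi> (w * h) - \<xi> w - \<xi> h \<in> N"
proof -
  have wI: "w * I = w" "I * w = w" using G_mat[OF assms(1)] I_mult by auto
  have 1: "\<beta> w (w * h) - \<beta> w w - \<xi> h \<in> N" using cocycle[OF I_GL assms(1,2)] unfolding wI .
  have d: "\<beta> w k - \<xi> k \<in> N" if "k \<in> carrier G" for k
    using diag[OF I_GL that assms(4)] unfolding assms(3)[symmetric] wI .
  have 2: "\<beta> w w - \<xi> w \<in> N" by (rule d[OF assms(1)])
  have 3: "\<beta> w (w * h) - \<xi> (w * h) \<in> N" by (rule d) (use G_mult assms in blast)
  show ?thesis by (rule N_diff[OF N_add[OF 1 2 refl] 3]) simp
qed

lemma odd_mult:
  assumes "w \<in> carrier G" "h \<in> carrier G" "w = signed_perm n (adjacent_swap i) s" "signs n s" "Suc i < n"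
  shows "\<xi> (w * h) - \<xi> w + \<xi> h \<in> N"
proof -
  have wI: "w * I = w" "I * w = w" using G_mat[OF assms(1)] I_mult by auto
  have 1: "\<beta> w (w * h) - \<beta> w w - \<xi> h \<in> N" using cocycle[OF I_GL assms(1,2)] unfolding wI .
  have d: "\<beta> w k + \<xi> k \<in> N" if "k \<in> carrier G" for k
    using swap[OF I_GL that assms(4,5)] unfolding assms(3)[symmetric] wI .
  have 2: "\<beta> w w + \<xi> w \<in> N" by (rule d[OF assms(1)])
  have 3: "\<beta> w (w * h) + \<xi> (w * h) \<in> N" by (rule d) (use G_mult assms in blast)
  show ?thesis by (rule N_diff[OF 3 N_add[OF 1 2 refl]]) (simp add: algebra_simps)
qed

lemma W_mult: "Suc i < n \<Longrightarrow> h \<in> carrier G \<Longrightarrow> \<xi> (W i * h) - \<xi> (W i) + \<xi> h \<in> N"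
  by (rule odd_mult[OF W_G]) (auto simp: weyl_def)

definition "Y = \<xi> r + \<xi> (r * r)"

lemma rr_G: "r * r \<in> carrier G" by (intro G_mult r_G)

text \<open>Since r has order three, the frame r^2 is moved to the identity frame by r, and the
  frame r by r^2. The cocycle identity therefore expresses \<xi> (r h) and \<xi> (r^2 h) through
  \<beta> at the rotated frames, which the three-term relation ties to \<xi> h.\<close>

lemma rotation_cocycle:
  assumes h: "h \<in> carrier G"
  shows "\<xi> (r * h) - \<xi> r - \<beta> (r * r) h \<in> N" "\<xi> (r * r * h) - \<xi> (r * r) - \<beta> r h \<in> N"
    "\<xi> h + \<beta> r h + \<beta> (r * r) h \<in> N"
proof -
  show "\<xi> (r * h) - \<xi> r - \<beta> (r * r) h \<in> N"
    using cocycle[OF G_GL'[OF rr_G] r_G h] unfolding r_cube .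
  show "\<xi> (r * r * h) - \<xi> (r * r) - \<beta> r h \<in> N"
    using cocycle[OF G_GL'[OF r_G] rr_G h] unfolding r_cube .
  show "\<xi> h + \<beta> r h + \<beta> (r * r) h \<in> N"
    using three[OF I_GL h] unfolding I_mult(1)[OF G_mat[OF r_G]] .
qed

lemma commuting_square: "w \<in> carrier G \<Longrightarrow> w * r = r * w \<Longrightarrow> w * (r * r) = r * r * w"
proof -
  assume w: "w \<in> carrier G" and c: "w * r = r * w"
  note wm = G_mat[OF w] and rm = G_mat[OF r_G]
  have "w * (r * r) = w * r * r" using G_assoc[OF wm rm rm] by simp
  also have "\<dots> = r * w * r" unfolding c ..
  also have "\<dots> = r * (w * r)" by (rule G_assoc[OF rm wm rm])
  also have "\<dots> = r * r * w" unfolding c using G_assoc[OF rm rm wm] by simp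
  finally show ?thesis .
qed

text \<open>Comparing the cocycle on \<open>W i * r\<close> and \<open>r * W i\<close> evaluates it at the two rotated classes; the
  sum over the three rotations of the base class vanishes.\<close>

lemma odd_commuting:
  assumes i: "Suc i < n" and c: "W i * r = r * W i"
  shows "\<xi> (W i) + \<xi> (W i) + \<xi> (W i) - (Y + Y) \<in> N"
proof -
  have w: "W i \<in> carrier G" by (rule W_G[OF i])
  note p = rotation_cocycle[OF w]
  have 1: "\<xi> (W i) - \<xi> r - \<xi> r - \<beta> (r * r) (W i) \<in> N"
    by (rule N_diff[OF p(1) W_mult[OF i r_G, unfolded c]]) (simp add: algebra_simps)
  have 2: "\<xi> (W i) - \<xi> (r * r) - \<xi> (r * r) - \<beta> r (W i) \<in> N"
    by (rule N_diff[OF p(2) W_mult[OF i rr_G, unfolded commuting_square[OF w c]]]) (simp add: algebra_simps)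
  show ?thesis by (rule N_add[OF N_add[OF 1 2 refl] p(3)]) (simp add: Y_def algebra_simps)
qed

lemma triple: "a + a + a \<in> N \<Longrightarrow> a + a \<in> N \<Longrightarrow> a \<in> N"
  by (rule N_diff[of "a + a + a" "a + a"]) auto

lemma signed_perm_id_square: "signs n s \<Longrightarrow> signed_perm n id s * signed_perm n id s = I"
  by (subst signed_perm_mult) (auto simp: signed_perm_one[symmetric] intro!: signed_perm_eqI)

text \<open>Commuting d past r and r^2 identifies \<xi> d with its values at the two rotated frames,
  so the three-term relation gives 3 \<xi> d = 0; from d^2 = 1 comes 2 \<xi> d = 0.\<close>

lemma diag_equal:
  assumes d: "signed_perm n id s \<in> carrier G" and s: "signs n s" and eq: "s 0 = s 1"
  shows "\<xi> (signed_perm n id s) \<in> N"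
proof -
  let ?d = "signed_perm n id s"
  have c: "?d * r = r * ?d" by (rule signed_perm_rotation3) (use n eq in auto)
  note p = rotation_cocycle[OF d]
  have 1: "\<xi> ?d - \<beta> (r * r) ?d \<in> N"
    by (rule N_diff[OF p(1) even_mult[OF d r_G refl s, unfolded c]]) (simp add: algebra_simps)
  have 2: "\<xi> ?d - \<beta> r ?d \<in> N"
    by (rule N_diff[OF p(2) even_mult[OF d rr_G refl s, unfolded commuting_square[OF d c]]]) (simp add: algebra_simps)
  have 3: "\<xi> ?d + \<xi> ?d + \<xi> ?d \<in> N" by (rule N_add[OF N_add[OF 1 2 refl] p(3)]) (simp add: algebra_simps)
  have "\<xi> I - \<xi> ?d - \<xi> ?d \<in> N" using even_mult[OF d d refl s] unfolding signed_perm_id_square[OF s] .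
  from N_diff[OF at_one[OF I_GL] this] have "\<xi> ?d + \<xi> ?d \<in> N" by (simp add: algebra_simps)
  with 3 show ?thesis by (rule triple)
qed

lemma inv_mult_G: "A \<in> carrier G \<Longrightarrow> B \<in> carrier_mat n n \<Longrightarrow> A * B \<in> carrier G \<Longrightarrow> B \<in> carrier G"
proof -
  assume a: "A \<in> carrier G" "B \<in> carrier_mat n n" "A * B \<in> carrier G"
  have "inv A * (A * B) = inv A * A * B" using G_assoc[OF G_mat G_mat a(2), of "inv A" A] a(1) by simp
  also have "\<dots> = B" using G_inv(1)[OF a(1)] I_mult a(2) by simp
  finally show ?thesis using G_mult[of "inv A" "A * B"] a by simp
qed

text \<open>In d W = W d' the left side is evaluated additively and the right side with a minus
  sign, so \<xi> d = - \<xi> d', and vanishing passes between sign patterns that differ by an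
  exchange.\<close>

lemma diag_conj:
  assumes d: "signed_perm n id s \<in> carrier G" and s: "signs n s" and i: "Suc i < n"
    and x: "signed_perm n id (\<lambda>j. s (adjacent_swap i j)) \<in> carrier G \<Longrightarrow>
      \<xi> (signed_perm n id (\<lambda>j. s (adjacent_swap i j))) \<in> N"
  shows "\<xi> (signed_perm n id s) \<in> N"
proof -
  let ?d = "signed_perm n id s"
  let ?d' = "signed_perm n id (\<lambda>j. s (adjacent_swap i j))"
  have c: "?d * W i = W i * ?d'"
    unfolding weyl_def
    by (subst (1 2) signed_perm_mult) (use i in \<open>auto simp: transpose_less mult.commute intro!: signed_perm_eqI\<close>)
  have "?d * W i \<in> carrier G" by (intro G_mult d W_G[OF i])
  hence d': "?d' \<in> carrier G" unfolding c by (rule inv_mult_G[OF W_G[OF i] signed_perm_carrier])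
  have 1: "\<xi> (W i * ?d') - \<xi> ?d - \<xi> (W i) \<in> N" using even_mult[OF d W_G[OF i] refl s] unfolding c .
  have 2: "\<xi> ?d + \<xi> ?d' \<in> N" by (rule N_diff[OF W_mult[OF i d'] 1]) (simp add: algebra_simps)
  show ?thesis by (rule N_diff[OF 2 x[OF d']]) simp
qed

text \<open>Among three signs two agree, and exchanges of neighbours bring an equal pair to the
  first two positions.\<close>

lemma diag_zero:
  assumes d: "signed_perm n id s \<in> carrier G" and s: "signs n s"
  shows "\<xi> (signed_perm n id s) \<in> N"
proof -
  have *: "\<xi> (signed_perm n id s') \<in> N" if "signed_perm n id s' \<in> carrier G" "signs n s'" "s' 0 = s' 1 \<or> s' 0 = s' 2" for s'
  proof (cases "s' 0 = s' 1")
    case True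
    thus ?thesis using diag_equal that by blast
  next
    case False
    show ?thesis
      by (rule diag_conj[OF that(1,2), of 1], use n in simp, rule diag_equal)
        (use that n False in \<open>auto simp: Transposition.transpose_def numeral_2_eq_2\<close>)
  qed
  consider "s 0 = s 1 \<or> s 0 = s 2" | "s 1 = s 2" using s[rule_format, of 0] s[rule_format, of 1] s[rule_format, of 2] n by force
  thus ?thesis
  proof cases
    case 2
    show ?thesis
      by (rule diag_conj[OF d s, of 0], use n in simp, rule *)
        (use 2 s n in \<open>auto simp: Transposition.transpose_def numeral_2_eq_2\<close>)
  qed (rule *[OF d s])
qed

text \<open>All signed versions of a transposition differ from \<open>W i\<close> by a diagonal
  factor on the right, which contributes nothing.\<close>

lemma odd_value:
  assumes w: "signed_perm n (adjacent_swap i) s \<in> carrier G" and s: "signs n s" and i: "Suc i < n"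
  shows "\<xi> (signed_perm n (adjacent_swap i) s) - \<xi> (W i) \<in> N"
proof -
  let ?t = "\<lambda>j. s j * (if j = Suc i then - 1 else 1)"
  have e: "signed_perm n (adjacent_swap i) s = W i * signed_perm n id ?t"
    unfolding weyl_def by (subst signed_perm_mult) (auto intro!: signed_perm_eqI)
  have t: "signs n ?t" using s by auto
  have d: "signed_perm n id ?t \<in> carrier G" by (rule inv_mult_G[OF W_G[OF i]]) (use w e in auto)
  show ?thesis unfolding e by (rule N_diff[OF W_mult[OF i d] diag_zero[OF d t]]) (simp add: algebra_simps)
qed

lemma W_far:
  assumes "Suc i < n" "Suc j < n" "i + 2 \<le> j"
  shows "\<xi> (W i) - \<xi> (W j) + (\<xi> (W i) - \<xi> (W j)) \<in> N"
proof -
  have 1: "\<xi> (W i * W j) - \<xi> (W i) + \<xi> (W j) \<in> N" by (rule W_mult[OF assms(1) W_G[OF assms(2)]])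
  have 2: "\<xi> (W i * W j) - \<xi> (W j) + \<xi> (W i) \<in> N" using W_mult[OF assms(2) W_G[OF assms(1)]] weyl_commute[OF assms] by simp
  show ?thesis by (rule N_diff[OF 2 1]) (simp add: algebra_simps)
qed

text \<open>The alternating rule gives 2 \<xi> (W k) - \<xi> (W l) as the value on W k * W l * W k;
  comparing the two sides of the braid relation triples the difference.\<close>

lemma W_near:
  assumes "Suc (Suc i) < n"
  shows "\<xi> (W i) - \<xi> (W (Suc i)) + (\<xi> (W i) - \<xi> (W (Suc i))) + (\<xi> (W i) - \<xi> (W (Suc i))) \<in> N"
proof -
  have i: "Suc i < n" and G: "W i \<in> carrier G" "W (Suc i) \<in> carrier G" using W_G assms by auto
  have *: "\<xi> (W k * W l * W k) - \<xi> (W k) + \<xi> (W l) - \<xi> (W k) \<in> N" if "Suc k < n" "Suc l < n" for k l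
  proof -
    have G: "W k \<in> carrier G" "W l \<in> carrier G" using W_G that by auto
    have "W k * W l * W k = W k * (W l * W k)" by (rule G_assoc) auto
    hence 1: "\<xi> (W k * W l * W k) - \<xi> (W k) + \<xi> (W l * W k) \<in> N" using W_mult[OF that(1) G_mult[OF G(2,1)]] by simp
    show ?thesis by (rule N_diff[OF 1 W_mult[OF that(2) G(1)]]) (simp add: algebra_simps)
  qed
  show ?thesis
    by (rule N_diff[OF *[OF assms i, folded weyl_braid[OF assms]] *[OF i assms]]) (simp add: algebra_simps)
qed

text \<open>The tripled differences telescope along neighbours, so they vanish for distant pairs
  too, where the doubled difference is already known to vanish.\<close>

lemma W_three_times:
  assumes "Suc i < n" "Suc j < n"
  shows "\<xi> (W i) - \<xi> (W j) + (\<xi> (W i) - \<xi> (W j)) + (\<xi> (W i) - \<xi> (W j)) \<in> N"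
proof -
  have up: "\<xi> (W 0) - \<xi> (W j) + (\<xi> (W 0) - \<xi> (W j)) + (\<xi> (W 0) - \<xi> (W j)) \<in> N" if "Suc j < n" for j
    using that
  proof (induction j)
    case (Suc j)
    hence j: "Suc j < n" by simp
    show ?case by (rule N_add[OF Suc.IH[OF j] W_near[OF Suc.prems]]) (simp add: algebra_simps)
  qed (simp add: N_0)
  show ?thesis by (rule N_diff[OF up[OF assms(2)] up[OF assms(1)]]) (simp add: algebra_simps)
qed

lemma W_far_equal: "Suc i < n \<Longrightarrow> Suc j < n \<Longrightarrow> i + 2 \<le> j \<Longrightarrow> \<xi> (W i) - \<xi> (W j) \<in> N"
  using W_far W_three_times triple by blast

lemma N_sym: "a - b \<in> N \<Longrightarrow> b - a \<in> N" and N_trans: "a - b \<in> N \<Longrightarrow> b - c \<in> N \<Longrightarrow> a - c \<in> N"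
  by (rule N_minus, assumption, simp) (rule N_add, assumption+, simp)

text \<open>The graph joining indices that are at least two apart is connected.\<close>

lemma W_equal: assumes i: "Suc i < n" shows "\<xi> (W i) - \<xi> (W 2) \<in> N"
proof -
  have b: "Suc 0 < n" "Suc 1 < n" "Suc 2 < n" "Suc 3 < n" "Suc 4 < n" using n by auto
  note f = W_far_equal
  consider "i = 0" | "i = 1" | "i = 2" | "i = 3" | "i \<ge> 4" by linarith
  thus ?thesis
  proof cases
    case 1 thus ?thesis using f[OF b(1,3)] by simp
  next
    case 2
    have "\<xi> (W 1) - \<xi> (W 4) \<in> N" "\<xi> (W 2) - \<xi> (W 4) \<in> N" using f[OF b(2,5)] f[OF b(3,5)] by auto
    thus ?thesis unfolding 2 using N_trans[OF _ N_sym] by blast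
  next
    case 4
    have "\<xi> (W 0) - \<xi> (W 3) \<in> N" "\<xi> (W 0) - \<xi> (W 2) \<in> N" using f[OF b(1,4)] f[OF b(1,3)] by auto
    thus ?thesis unfolding 4 using N_trans[OF N_sym] by blast
  next
    case 5 thus ?thesis using N_sym[OF f[OF b(3) i]] by simp
  qed (simp add: N_0)
qed

text \<open>An explicit integral combination of values of \<beta>. It is therefore additive in the
  cocycle, which later gives additivity in the coefficient.\<close>

definition "t = \<xi> (W 2) - \<xi> r - \<xi> (r * r)"

text \<open>Both expressions equal 3 \<xi> (W 2) - 2 Y. This lies in N by
  \<open>odd_commuting\<close>, since W 2 does not touch the first two coordinates.\<close>

lemma t_relations: "\<xi> (W 2) + t + t \<in> N" "Y + t + t + t \<in> N"
proof -
  have "Suc 2 < n" using n by simp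
  moreover have "W 2 * r = r * W 2"
    unfolding weyl_def by (rule signed_perm_rotation3) (use n in \<open>auto simp: Transposition.transpose_def\<close>)
  ultimately have *: "\<xi> (W 2) + \<xi> (W 2) + \<xi> (W 2) - (Y + Y) \<in> N" by (rule odd_commuting)
  show "\<xi> (W 2) + t + t \<in> N" by (rule N_add[OF * N_0]) (simp add: t_def Y_def algebra_simps)
  show "Y + t + t + t \<in> N" by (rule N_add[OF * N_0]) (simp add: t_def Y_def algebra_simps)
qed

section \<open>The shifted cocycle and the primitive on matrices\<close>

lemma odd_total:
  assumes w: "signed_perm n (adjacent_swap i) s \<in> carrier G" and s: "signs n s" and i: "Suc i < n"
  shows "\<xi> (signed_perm n (adjacent_swap i) s) + t + t \<in> N"
  by (rule N_add[OF N_trans[OF odd_value[OF assms] W_equal[OF i]] t_relations(1)]) (simp add: algebra_simps)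

lemma odd_shift:
  assumes w: "signed_perm n (adjacent_swap i) s \<in> carrier G" and s: "signs n s" and i: "Suc i < n"
    and k: "k \<in> carrier G"
  shows "\<xi> (signed_perm n (adjacent_swap i) s * k) + t + (\<xi> k + t) \<in> N"
  by (rule N_add[OF odd_mult[OF w k refl s i] odd_total[OF w s i]]) (simp add: algebra_simps)

lemma even_shift:
  assumes w: "signed_perm n id s \<in> carrier G" and s: "signs n s" and k: "k \<in> carrier G"
  shows "\<xi> (signed_perm n id s * k) - \<xi> k \<in> N"
  by (rule N_add[OF even_mult[OF w k refl s] diag_zero[OF w s]]) simp

text \<open>In the sum of the cocycle identities for r k and r^2 k, the values at the rotated frames
  cancel against the three-term relation; what remains is Y, and 3 t compensates it.\<close>

lemma rotation_shift:
  assumes k: "k \<in> carrier G"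
  shows "\<xi> (r * r * k) + t + (\<xi> (r * k) + t) + (\<xi> k + t) \<in> N"
proof -
  have 1: "\<xi> I - \<xi> r - \<beta> (r * r) (r * r) \<in> N" using rotation_cocycle(1)[OF rr_G] unfolding r_cube .
  have 2: "\<xi> I - \<xi> (r * r) - \<beta> r r \<in> N" using rotation_cocycle(2)[OF r_G] unfolding r_cube .
  note c = rotation_cocycle[OF k]
  have "\<xi> (r * r * k) - \<xi> (r * r) - \<beta> r k + (\<xi> (r * k) - \<xi> r - \<beta> (r * r) k) + (\<xi> k + \<beta> r k + \<beta> (r * r) k) \<in> N"
    by (rule N_add[OF N_add[OF c(2,1) refl] c(3) refl])
  from N_add[OF this t_relations(2)] show ?thesis by (simp add: Y_def algebra_simps)
qed

text \<open>The correction by a reflection treats all groups between \<open>SL\<close> and \<open>GL\<close> uniformly; it does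
  not change the apartment class.\<close>

definition base :: "int mat \<Rightarrow> int mat" where
  "base a = (if a \<in> carrier G then a else a * reflection n)"

text \<open>The equation m[g] = U(g^-1 m) - U(m) for m = [a] and g = a, together with the cocycle
  identity for a and a^-1, forces U([a]) = \<xi> (a^-1) + U([1]); the free constant is t.\<close>

definition primitive :: "int mat \<Rightarrow> 'f" where
  "primitive a = \<xi> (inv (base a)) + t"

lemma base_G: "a \<in> GL n \<Longrightarrow> base a \<in> carrier G"
  by (simp add: base_def reflection_G)

lemma base_signed:
  assumes "a \<in> GL n"
  obtains u where "signs n u" "base a = a * signed_perm n id u"
proof (cases "a \<in> carrier G")
  case True
  have "a * I = a" using G_mat[OF True] by (rule I_mult)
  thus ?thesis using True that[of "\<lambda>_. 1"] by (simp add: base_def signed_perm_one)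
next
  case False
  thus ?thesis using that[of "\<lambda>j. if j = n - 1 then - 1 else 1"] by (simp add: base_def reflection_def)
qed

lemma inv_shift:
  assumes A: "A \<in> carrier G" and w: "w \<in> carrier_mat n n" and B: "B \<in> carrier G" "A * w = B"
  shows "w \<in> carrier G" "inv A = w * inv B"
proof -
  show wG: "w \<in> carrier G" by (rule inv_mult_G[OF A w]) (use B in simp)
  have "inv B = inv w \<otimes> inv A" unfolding B(2)[symmetric] mult[symmetric] by (rule inv_mult_group[OF A wG])
  hence "w \<otimes> inv B = w \<otimes> inv w \<otimes> inv A" using m_assoc[of w "inv w" "inv A"] A wG by simp
  thus "inv A = w * inv B" using A wG by (simp add: mult[symmetric])
qed

lemma sandwich:
  assumes a: "a \<in> carrier_mat n n" and w: "w \<in> carrier_mat n n" and u: "signs n u"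
  shows "a * signed_perm n id u * (signed_perm n id u * w * signed_perm n id v) = a * w * signed_perm n id v"
proof -
  let ?u = "signed_perm n id u" and ?v = "signed_perm n id v"
  have "a * ?u * (?u * w * ?v) = a * ((?u * ?u) * w) * ?v"
    using a w by (simp add: assoc_mult_mat[of _ n n _ n _ n] mult_carrier_mat[of _ n n])
  thus ?thesis unfolding signed_perm_id_square[OF u] I_mult(1)[OF w] .
qed

lemma primitive_swap:
  assumes a: "a \<in> GL n" and i: "Suc i < n"
  shows "primitive a + primitive (a * signed_perm n (adjacent_swap i) (\<lambda>_. 1)) \<in> N"
proof -
  let ?p = "adjacent_swap i"
  let ?P = "signed_perm n ?p (\<lambda>_. 1)"
  have m: "a \<in> carrier_mat n n" using a by (simp add: GL_int_iff)
  have P: "?P \<in> GL n"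
  proof -
    have "?P * ?P = I"
      by (subst signed_perm_mult) (use i in \<open>auto simp: transpose_less signed_perm_one[symmetric] intro!: signed_perm_eqI\<close>)
    thus ?thesis unfolding GL_int_iff by (auto intro!: bexI[of _ ?P])
  qed
  have aP: "a * ?P \<in> GL n" by (rule GL_int_mult[OF a P])
  obtain u where u: "signs n u" "base a = a * signed_perm n id u" by (rule base_signed[OF a])
  obtain v where v: "signs n v" "base (a * ?P) = a * ?P * signed_perm n id v" by (rule base_signed[OF aP])
  \<comment> \<open>The group elements chosen for a and for a P differ on the right by this signed
    transposition; the corrections by reflections only affect its signs.\<close>
  let ?w = "signed_perm n id u * ?P * signed_perm n id v"
  have w: "?w = signed_perm n ?p (\<lambda>j. u (?p j) * v j)"
    by (subst signed_perm_mult, use i in \<open>simp add: transpose_less\<close>, subst signed_perm_mult, simp) (simp add: id_def)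
  have s: "signs n (\<lambda>j. u (?p j) * v j)" using u(1) v(1) transpose_less[OF i] by (metis mult_1 mult_1_right minus_mult_minus)
  have e: "base a * ?w = base (a * ?P)" unfolding u(2) v(2) by (rule sandwich[OF m _ u(1)]) simp
  have wm: "?w \<in> carrier_mat n n" unfolding w by simp
  note sh = inv_shift[OF base_G[OF a] wm base_G[OF aP] e]
  show ?thesis
    unfolding primitive_def sh(2)
    using odd_shift[OF sh(1)[unfolded w] s i, of "inv (base (a * ?P))"] base_G[OF aP] unfolding w by simp
qed

lemma primitive_diag:
  assumes a: "a \<in> GL n" and z: "signs n z"
  shows "primitive a - primitive (a * signed_perm n id z) \<in> N"
proof -
  let ?P = "signed_perm n id z"
  have m: "a \<in> carrier_mat n n" using a by (simp add: GL_int_iff)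
  have P: "?P \<in> GL n"
    using signed_perm_id_square[OF z] unfolding GL_int_iff by (auto intro!: bexI[of _ ?P])
  have aP: "a * ?P \<in> GL n" by (rule GL_int_mult[OF a P])
  obtain u where u: "signs n u" "base a = a * signed_perm n id u" by (rule base_signed[OF a])
  obtain v where v: "signs n v" "base (a * ?P) = a * ?P * signed_perm n id v" by (rule base_signed[OF aP])
  let ?w = "signed_perm n id u * ?P * signed_perm n id v"
  have w: "?w = signed_perm n id (\<lambda>j. u j * z j * v j)"
    by (subst signed_perm_mult, simp, subst signed_perm_mult, simp) (simp add: id_def)
  have s: "signs n (\<lambda>j. u j * z j * v j)" using u(1) v(1) z by (metis mult_1 mult_1_right minus_mult_minus)
  have e: "base a * ?w = base (a * ?P)" unfolding u(2) v(2) by (rule sandwich[OF m _ u(1)]) simp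
  have wm: "?w \<in> carrier_mat n n" unfolding w by simp
  note sh = inv_shift[OF base_G[OF a] wm base_G[OF aP] e]
  show ?thesis
    unfolding primitive_def sh(2)
    using even_shift[OF sh(1)[unfolded w] s, of "inv (base (a * ?P))"] base_G[OF aP] unfolding w by simp
qed

text \<open>Membership in G is unchanged by r, and the reflection commutes with r, so the correction
  can be made before or after the rotation.\<close>

lemma base_rotation:
  assumes a: "a \<in> GL n" shows "base a * r = base (a * r)"
proof -
  have m: "a \<in> carrier_mat n n" using a by (simp add: GL_int_iff)
  have rm: "r \<in> carrier_mat n n" by simp
  have "a * r \<in> carrier G \<longleftrightarrow> a \<in> carrier G"
  proof
    assume "a * r \<in> carrier G"
    hence "a * r * (r * r) \<in> carrier G" using rr_G by (rule G_mult)
    moreover have "a * r * (r * r) = a * (r * (r * r))" by (rule G_assoc[OF m rm G_mat[OF rr_G]])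
    ultimately show "a \<in> carrier G" unfolding r_cube I_mult(2)[OF m] by simp
  qed (rule G_mult[OF _ r_G])
  moreover have "a * reflection n * r = a * r * reflection n"
  proof -
    have "reflection n * r = r * reflection n"
      unfolding reflection_def by (rule signed_perm_rotation3) (use n in auto)
    moreover have "reflection n \<in> carrier_mat n n" by (simp add: reflection_def)
    ultimately show ?thesis using G_assoc[OF m _ rm, of "reflection n"] G_assoc[OF m rm, of "reflection n"] by simp
  qed
  ultimately show ?thesis by (simp add: base_def)
qed

lemma primitive_three:
  assumes a: "a \<in> GL n"
  shows "primitive a + primitive (a * r) + primitive (a * r * r) \<in> N"
proof -
  have ar: "a * r \<in> GL n" by (rule GL_int_mult[OF a G_GL'[OF r_G]])
  have arr: "a * r * r \<in> GL n" by (rule GL_int_mult[OF ar G_GL'[OF r_G]])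
  let ?k = "inv (base (a * r * r))"
  have k: "?k \<in> carrier G" using base_G[OF arr] by simp
  have 1: "inv (base (a * r)) = r * ?k" by (rule inv_shift(2)[OF base_G[OF ar] _ base_G[OF arr] base_rotation[OF ar]]) simp
  have "inv (base a) = r * inv (base (a * r))" by (rule inv_shift(2)[OF base_G[OF a] _ base_G[OF ar] base_rotation[OF a]]) simp
  hence 2: "inv (base a) = r * r * ?k" unfolding 1 using G_assoc[OF _ _ G_mat[OF k], of r r] by simp
  show ?thesis unfolding primitive_def 1 2 by (rule rotation_shift[OF k])
qed

text \<open>Left multiplication by G commutes with \<open>base\<close>. The cocycle identity for
  (base a)^-1 and h^-1 makes the change of the primitive from a to h a equal to the value at a on
  h^-1, which is minus the value at h a on h.\<close>

lemma primitive_coboundary: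
  assumes a: "a \<in> GL n" and h: "h \<in> carrier G"
  shows "\<beta> (h * a) h - (primitive a - primitive (h * a)) \<in> N"
proof -
  have ha: "h * a \<in> GL n" by (rule GL_int_mult[OF G_GL'[OF h] a])
  have m: "a \<in> carrier_mat n n" "h \<in> carrier_mat n n" using a G_mat[OF h] by (simp_all add: GL_int_iff)
  have mem: "h * a \<in> carrier G \<longleftrightarrow> a \<in> carrier G"
    using inv_mult_G[OF h m(1)] G_mult[OF h] by blast
  have "h * a * reflection n = h * (a * reflection n)"
    by (rule G_assoc[OF m(2,1)]) (simp add: reflection_def)
  hence b: "base (h * a) = h * base a" using mem by (simp add: base_def)
  let ?A = "base a"
  have A: "?A \<in> carrier G" by (rule base_G[OF a])
  have ih: "inv h \<in> carrier G" "inv ?A \<in> carrier G" using h A by simp_all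
  obtain u where u: "signs n u" "?A = a * signed_perm n id u" by (rule base_signed[OF a])
  have "inv (base (h * a)) = inv ?A * inv h" unfolding b using inv_mult_group[OF h A] by (simp add: mult)
  hence p: "primitive (h * a) = \<xi> (inv ?A * inv h) + t" by (simp add: primitive_def)
  have 1: "\<xi> (inv ?A * inv h) - \<xi> (inv ?A) - \<beta> ?A (inv h) \<in> N"
    using cocycle[OF G_GL'[OF A] ih(2,1)] unfolding G_inv(1)[OF A] .
  have 2: "\<beta> ?A (inv h) - \<beta> a (inv h) \<in> N" unfolding u(2) by (rule diag[OF a ih(1) u(1)])
  have 3: "\<beta> (h * a) I - \<beta> (h * a) h - \<beta> a (inv h) \<in> N"
    using cocycle[OF a h ih(1)] unfolding G_inv(2)[OF h] .
  have 4: "\<beta> (h * a) h + \<beta> a (inv h) \<in> N" by (rule N_diff[OF at_one[OF ha] 3]) (simp add: algebra_simps)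
  have 5: "\<xi> (inv ?A * inv h) - \<xi> (inv ?A) - \<beta> a (inv h) \<in> N" by (rule N_add[OF 1 2]) simp
  show ?thesis unfolding p by (rule N_add[OF 4 5]) (simp add: primitive_def algebra_simps)
qed

end

section \<open>First group homology\<close>

lemma (in comm_group) hom_int_power: "\<phi> \<in> hom H G \<Longrightarrow> (\<lambda>x. \<phi> x [^] (k::int)) \<in> hom H G"
  by (auto simp: hom_def Pi_iff int_pow_mult_distrib m_comm)

lemma (in comm_group) hom_finprod_fun:
  assumes "group H" "finite T" "\<And>i. i \<in> T \<Longrightarrow> \<phi> i \<in> hom H G"
  shows "(\<lambda>x. finprod G (\<lambda>i. \<phi> i x) T) \<in> hom H G"
  using assms(2,3)
proof (induction T rule: finite_induct)
  case empty
  thus ?case by (simp add: hom_def)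
next
  case (insert j T)
  have c: "\<phi> i x \<in> carrier G" if "i \<in> insert j T" "x \<in> carrier H" for i x
    using insert.prems that by (auto simp: hom_def)
  have "(\<lambda>x. \<phi> j x \<otimes> finprod G (\<lambda>i. \<phi> i x) T) \<in> hom H G"
    using insert.IH insert.prems[of j] insert.prems by (auto simp: hom_def Pi_iff m_ac)
  moreover have "finprod G (\<lambda>i. \<phi> i x) (insert j T) = \<phi> j x \<otimes> finprod G (\<lambda>i. \<phi> i x) T" if "x \<in> carrier H" for x
    using insert.hyps c that by (intro finprod_insert) auto
  ultimately show ?case using group.is_monoid[OF assms(1)] by (auto simp: hom_def Pi_iff monoid.m_closed)
qed

lemma (in comm_monoid) gfinprod_singleton: "x \<in> carrier G \<Longrightarrow> gfinprod G (\<lambda>_. x) {i} = x"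
  by (subst gfinprod_eq_finprod) auto

lemma (in comm_group) finprod_alternating:
  assumes f: "\<And>i. f i \<in> carrier G"
  shows "finprod G (\<lambda>i. f i [^] ((- 1 :: int) ^ i)) {..1::nat} = f 0 \<otimes> inv (f 1)"
    "finprod G (\<lambda>i. f i [^] ((- 1 :: int) ^ i)) {..2::nat} = f 0 \<otimes> inv (f 1) \<otimes> f 2"
proof -
  have c: "(\<lambda>i. f i [^] ((- 1 :: int) ^ i)) \<in> T \<rightarrow> carrier G" for T using f by auto
  have p: "f k [^] (1::int) = f k" "f k [^] (- 1 :: int) = inv (f k)" for k
    using f[of k] by (simp_all add: int_pow_neg)
  show 1: "finprod G (\<lambda>i. f i [^] ((- 1 :: int) ^ i)) {..1::nat} = f 0 \<otimes> inv (f 1)"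
    using finprod_Suc[OF c, of 0] finprod_0[OF c] f p by (simp add: m_comm)
  have "finprod G (\<lambda>i. f i [^] ((- 1 :: int) ^ i)) {..Suc 1} = f 2 \<otimes> finprod G (\<lambda>i. f i [^] ((- 1 :: int) ^ i)) {..1::nat}"
    using finprod_Suc[OF c, of 1] p(1)[of 2] by (simp add: numeral_2_eq_2)
  thus "finprod G (\<lambda>i. f i [^] ((- 1 :: int) ^ i)) {..2::nat} = f 0 \<otimes> inv (f 1) \<otimes> f 2"
    unfolding 1 using f by (simp add: m_comm numeral_2_eq_2)
qed

lemma comm_group_sum_group:
  assumes "comm_group M" shows "comm_group (sum_group T (\<lambda>_. M))"
proof -
  interpret M: comm_group M by fact
  show ?thesis
    by (rule group.group_comm_groupI) (auto simp: carrier_sum_group M.m_comm PiE_iff intro!: restrict_ext)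
qed

locale bar_module = G: group G + M: comm_group M
  for G :: "('g, 'x) monoid_scheme" (structure) and M :: "('m, 'y) monoid_scheme" and act :: "'g \<Rightarrow> 'm \<Rightarrow> 'm" +
  assumes act_hom: "\<And>g. g \<in> carrier G \<Longrightarrow> act g \<in> hom M M"
begin

abbreviation "bar \<equiv> bar_chain_group G M"

lemma comm_group_bar: "comm_group (bar q)"
  unfolding bar_chain_group_def by (rule comm_group_sum_group) (rule M.comm_group_axioms)

lemma group_bar: "group (bar q)"
  using comm_group_bar by (simp add: comm_group_def)

lemma carrier_bar: "carrier (bar q) = {c \<in> bar_tuples G q \<rightarrow>\<^sub>E carrier M. finite {gs \<in> bar_tuples G q. c gs \<noteq> \<one>\<^bsub>M\<^esub>}}"
  unfolding bar_chain_group_def by (rule carrier_sum_group) (rule M.is_group)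

lemma bar_elem_hom:
  assumes "gs \<in> bar_tuples G q" shows "(\<lambda>m. bar_elem G M q m gs) \<in> hom M (bar q)"
proof (rule homI)
  fix m m' assume m: "m \<in> carrier M" "m' \<in> carrier M"
  have "finite {hs \<in> bar_tuples G q. bar_elem G M q m gs hs \<noteq> \<one>\<^bsub>M\<^esub>}"
    by (rule finite_subset[of _ "{gs}"]) (auto simp: bar_elem_def)
  thus "bar_elem G M q m gs \<in> carrier (bar q)"
    using m(1) by (auto simp: carrier_bar bar_elem_def)
  show "bar_elem G M q (m \<otimes>\<^bsub>M\<^esub> m') gs = bar_elem G M q m gs \<otimes>\<^bsub>bar q\<^esub> bar_elem G M q m' gs"
    unfolding bar_chain_group_def mult_sum_group bar_elem_def by (rule restrict_ext) auto
qed

lemma bar_face_hom: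
  assumes gs: "gs \<in> bar_tuples G q" and q: "q > 0" and i: "i \<le> q"
  shows "(\<lambda>m. bar_face G M act q i m gs) \<in> hom M (bar (q - 1))"
proof -
  have len: "length gs = q" and sub: "set gs \<subseteq> carrier G" using gs by (auto simp: bar_tuples_def)
  consider "i = 0" | "0 < i" "i < q" | "i = q" "i > 0" using i by linarith
  thus ?thesis
  proof cases
    case 1
    have ne: "gs \<noteq> []" using len q by auto
    hence "hd gs \<in> carrier G" using sub by (meson list.set_sel(1) subsetD)
    hence a: "act (inv (hd gs)) \<in> hom M M" by (intro act_hom) simp
    have "tl gs \<in> bar_tuples G (q - 1)" using len sub ne by (auto simp: bar_tuples_def dest: list.set_sel(2))
    from hom_compose[OF a bar_elem_hom[OF this]] show ?thesis using 1 by (simp add: bar_face_def o_def)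
  next
    case 2
    have "gs ! (i - 1) \<in> carrier G" "gs ! i \<in> carrier G" using 2 len sub by (auto simp: subset_iff)
    hence "take (i - 1) gs @ [gs ! (i - 1) \<otimes> gs ! i] @ drop (i + 1) gs \<in> bar_tuples G (q - 1)"
      using 2 len sub set_take_subset[of "i - 1" gs] set_drop_subset[of "i + 1" gs] by (auto simp: bar_tuples_def)
    from bar_elem_hom[OF this] show ?thesis using 2 by (simp add: bar_face_def)
  next
    case 3
    have "butlast gs \<in> bar_tuples G (q - 1)" using len sub by (auto simp: bar_tuples_def dest: in_set_butlastD)
    from bar_elem_hom[OF this] show ?thesis using 3 by (simp add: bar_face_def)
  qed
qed

text \<open>The boundary of an elementary chain m[g_1|...|g_q]. It is a homomorphism in m, from
  which the boundary on the direct sum is assembled.\<close>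

definition face_sum :: "nat \<Rightarrow> 'g list \<Rightarrow> 'm \<Rightarrow> 'g list \<Rightarrow> 'm" where
  "face_sum q gs m = finprod (bar (q - 1)) (\<lambda>i. bar_face G M act q i m gs [^]\<^bsub>bar (q - 1)\<^esub> ((- 1 :: int) ^ i)) {..q}"

lemma face_sum_hom: "gs \<in> bar_tuples G q \<Longrightarrow> q > 0 \<Longrightarrow> face_sum q gs \<in> hom M (bar (q - 1))"
  unfolding face_sum_def
  by (intro comm_group.hom_finprod_fun[OF comm_group_bar] comm_group.hom_int_power[OF comm_group_bar] bar_face_hom M.is_group) auto

lemma bar_boundary_face_sum: "bar_boundary G M act q c = gfinprod (bar (q - 1)) (\<lambda>gs. face_sum q gs (c gs)) (bar_tuples G q)"
  by (simp add: bar_boundary_def face_sum_def)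

lemma bar_boundary_hom: "q > 0 \<Longrightarrow> bar_boundary G M act q \<in> hom (bar q) (bar (q - 1))"
  unfolding bar_boundary_face_sum[abs_def]
  using comm_group.hom_group_sum[OF comm_group_bar, of "bar_tuples G q" "face_sum q" "\<lambda>_. M" "q - 1"] face_sum_hom M.is_group
  by (simp add: bar_chain_group_def[of G M q])

lemma face_sum_one: "gs \<in> bar_tuples G q \<Longrightarrow> q > 0 \<Longrightarrow> face_sum q gs \<one>\<^bsub>M\<^esub> = \<one>\<^bsub>bar (q - 1)\<^esub>"
  using hom_one[OF face_sum_hom] M.is_group group_bar by blast

lemma bar_boundary_elem:
  assumes gs: "gs \<in> bar_tuples G q" and q: "q > 0" and m: "m \<in> carrier M"
  shows "bar_boundary G M act q (bar_elem G M q m gs) = face_sum q gs m"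
proof -
  interpret B: comm_group "bar (q - 1)" by (rule comm_group_bar)
  have c: "face_sum q hs x \<in> carrier (bar (q - 1))" if "hs \<in> bar_tuples G q" "x \<in> carrier M" for hs x
    using face_sum_hom[OF that(1) q] that(2) by (auto simp: hom_def)
  have "bar_boundary G M act q (bar_elem G M q m gs) = gfinprod (bar (q - 1)) (\<lambda>hs. face_sum q gs m) {gs}"
    unfolding bar_boundary_face_sum
  proof (rule B.gfinprod_mono_neutral_cong_right)
    show "(\<lambda>hs. face_sum q hs (bar_elem G M q m gs hs)) \<in> bar_tuples G q \<rightarrow> carrier (bar (q - 1))"
      using c m by (auto simp: bar_elem_def)
  qed (use gs q face_sum_one in \<open>auto simp: bar_elem_def\<close>)
  also have "\<dots> = face_sum q gs m" by (rule B.gfinprod_singleton[OF c[OF gs m]])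
  finally show ?thesis .
qed

lemma face_sum_two:
  assumes g: "g \<in> carrier G" "h \<in> carrier G" and m: "m \<in> carrier M"
  shows "face_sum 2 [g, h] m = bar_elem G M 1 (act (inv g) m) [h] \<otimes>\<^bsub>bar 1\<^esub> inv\<^bsub>bar 1\<^esub> bar_elem G M 1 m [g \<otimes> h] \<otimes>\<^bsub>bar 1\<^esub> bar_elem G M 1 m [g]"
proof -
  interpret B: comm_group "bar 1" by (rule comm_group_bar)
  have gs: "[g, h] \<in> bar_tuples G 2" using g by (simp add: bar_tuples_def)
  have f: "bar_face G M act 2 0 m [g, h] = bar_elem G M 1 (act (inv g) m) [h]"
    "bar_face G M act 2 1 m [g, h] = bar_elem G M 1 m [g \<otimes> h]"
    "bar_face G M act 2 2 m [g, h] = bar_elem G M 1 m [g]"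
    by (simp_all add: bar_face_def)
  \<comment> \<open>Indices above 2 get the neutral element, because
    \<open>finprod_alternating\<close> asks for a function whose values all lie in the
    group.\<close>
  let ?f = "\<lambda>i. if i \<le> 2 then bar_face G M act 2 i m [g, h] else \<one>\<^bsub>bar 1\<^esub>"
  have c: "?f i \<in> carrier (bar 1)" for i
    using bar_face_hom[OF gs _, of i] m B.one_closed by (auto simp: hom_def Pi_iff)
  have two: "(2::nat) - 1 = 1" by simp
  have "face_sum 2 [g, h] m = finprod (bar 1) (\<lambda>i. ?f i [^]\<^bsub>bar 1\<^esub> ((- 1 :: int) ^ i)) {..2}"
    unfolding face_sum_def two
    by (rule B.finprod_cong') (use B.int_pow_closed[OF c] in auto)
  thus ?thesis unfolding B.finprod_alternating(2)[OF c] by (simp add: f[simplified])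
qed

lemma face_sum_one_cycle:
  assumes g: "g \<in> carrier G" and m: "m \<in> carrier M"
  shows "face_sum 1 [g] m [] = act (inv g) m \<otimes>\<^bsub>M\<^esub> inv\<^bsub>M\<^esub> m"
proof -
  interpret B: comm_group "bar 0" by (rule comm_group_bar)
  have gs: "[g] \<in> bar_tuples G 1" using g by (simp add: bar_tuples_def)
  let ?f = "\<lambda>i. if i \<le> 1 then bar_face G M act 1 i m [g] else \<one>\<^bsub>bar 0\<^esub>"
  have c: "?f i \<in> carrier (bar 0)" for i
    using bar_face_hom[OF gs _, of i] m B.one_closed by (auto simp: hom_def Pi_iff)
  have "face_sum 1 [g] m = finprod (bar 0) (\<lambda>i. ?f i [^]\<^bsub>bar 0\<^esub> ((- 1 :: int) ^ i)) {..1}"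
    unfolding face_sum_def diff_self_eq_0
    by (rule B.finprod_cong') (use B.int_pow_closed[OF c] in auto)
  hence e: "face_sum 1 [g] m = bar_face G M act 1 0 m [g] \<otimes>\<^bsub>bar 0\<^esub> inv\<^bsub>bar 0\<^esub> bar_face G M act 1 1 m [g]"
    unfolding B.finprod_alternating(1)[OF c] by simp
  have c1: "bar_face G M act 1 1 m [g] \<in> carrier (bar 0)" using c[of 1] by simp
  have "inv\<^bsub>bar 0\<^esub> bar_face G M act 1 1 m [g] = (\<lambda>i\<in>bar_tuples G 0. inv\<^bsub>M\<^esub> (bar_face G M act 1 1 m [g] i))"
    using c1 unfolding bar_chain_group_def by (intro inv_sum_group) (auto simp: M.is_group)
  moreover have "[] \<in> bar_tuples G 0" by (simp add: bar_tuples_def)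
  ultimately show ?thesis unfolding e by (simp add: bar_chain_group_def bar_face_def bar_elem_def)
qed

lemma finprod_bar_apply:
  assumes "finite T" "\<phi> \<in> T \<rightarrow> carrier (bar q)" "gs \<in> bar_tuples G q"
  shows "finprod (bar q) \<phi> T gs = finprod M (\<lambda>x. \<phi> x gs) T"
  using assms(1,2)
proof (induction T rule: finite_induct)
  case empty
  interpret B: comm_group "bar q" by (rule comm_group_bar)
  show ?case unfolding B.finprod_empty M.finprod_empty using assms(3) by (simp add: bar_chain_group_def)
next
  case (insert x T)
  interpret B: comm_group "bar q" by (rule comm_group_bar)
  have c: "\<phi> x \<in> carrier (bar q)" "\<phi> \<in> T \<rightarrow> carrier (bar q)" using insert.prems by auto
  have a: "\<phi> y gs \<in> carrier M" if "y \<in> insert x T" for y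
    using insert.prems that assms(3) unfolding carrier_bar by (auto simp: Pi_iff PiE_iff)
  have "finprod (bar q) \<phi> (insert x T) gs = (\<phi> x \<otimes>\<^bsub>bar q\<^esub> finprod (bar q) \<phi> T) gs"
    using insert.hyps c by (simp add: B.finprod_insert)
  also have "\<dots> = \<phi> x gs \<otimes>\<^bsub>M\<^esub> finprod (bar q) \<phi> T gs" using assms(3) by (simp add: bar_chain_group_def)
  also have "\<dots> = \<phi> x gs \<otimes>\<^bsub>M\<^esub> finprod M (\<lambda>x. \<phi> x gs) T" using insert.IH[OF c(2)] by simp
  also have "\<dots> = finprod M (\<lambda>x. \<phi> x gs) (insert x T)"
    by (rule M.finprod_insert[symmetric]) (use insert.hyps a in auto)
  finally show ?case .
qed

text \<open>Degree 0 has only the empty tuple, so the cycle condition is one equation in M, obtained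
  by evaluation there; T is the finite support of c.\<close>

lemma first_cycle:
  assumes c: "c \<in> bar_cycles G M act 1" and T: "T = {g \<in> carrier G. c [g] \<noteq> \<one>\<^bsub>M\<^esub>}"
  shows "finite T" "finprod M (\<lambda>g. act (inv g) (c [g]) \<otimes>\<^bsub>M\<^esub> inv\<^bsub>M\<^esub> (c [g])) T = \<one>\<^bsub>M\<^esub>"
proof -
  interpret B: comm_group "bar 0" by (rule comm_group_bar)
  have cc: "c \<in> carrier (bar 1)" and b: "bar_boundary G M act 1 c = \<one>\<^bsub>bar 0\<^esub>"
    using c by (simp_all add: bar_cycles_def kernel_def)
  have cM: "c [g] \<in> carrier M" if "g \<in> carrier G" for g
    using cc that unfolding carrier_bar by (auto simp: bar_tuples_def PiE_iff)
  have t1: "bar_tuples G 1 = (\<lambda>g. [g]) ` carrier G" by (auto simp: bar_tuples_def length_Suc_conv)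
  have "finite {gs \<in> bar_tuples G 1. c gs \<noteq> \<one>\<^bsub>M\<^esub>}" using cc by (simp add: carrier_bar)
  hence "finite ((\<lambda>g. [g]) ` T)" by (rule rev_finite_subset) (auto simp: T bar_tuples_def)
  thus fin: "finite T" by (rule finite_imageD) (simp add: inj_on_def)
  have fc: "face_sum 1 [g] m \<in> carrier (bar 0)" if "g \<in> carrier G" "m \<in> carrier M" for g m
    using face_sum_hom[of "[g]" 1] that by (auto simp: hom_def bar_tuples_def Pi_iff)
  have "bar_boundary G M act 1 c = gfinprod (bar 0) (\<lambda>gs. face_sum 1 gs (c gs)) ((\<lambda>g. [g]) ` T)"
    unfolding bar_boundary_face_sum diff_self_eq_0
  proof (rule B.gfinprod_mono_neutral_cong_right)
    show "(\<lambda>g. [g]) ` T \<subseteq> bar_tuples G 1" by (auto simp: T bar_tuples_def)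
    show "face_sum 1 gs (c gs) = \<one>\<^bsub>bar 0\<^esub>" if "gs \<in> bar_tuples G 1 - (\<lambda>g. [g]) ` T" for gs
    proof -
      have "c gs = \<one>\<^bsub>M\<^esub>" using that unfolding T t1 by blast
      thus ?thesis using face_sum_one[of gs 1] that by simp
    qed
    show "(\<lambda>gs. face_sum 1 gs (c gs)) \<in> bar_tuples G 1 \<rightarrow> carrier (bar 0)" using fc cM unfolding t1 by blast
  qed simp
  also have "\<dots> = finprod (bar 0) (\<lambda>gs. face_sum 1 gs (c gs)) ((\<lambda>g. [g]) ` T)"
    by (rule B.gfinprod_eq_finprod) (use fin fc cM T in auto)
  also have "\<dots> = finprod (bar 0) (\<lambda>g. face_sum 1 [g] (c [g])) T"
    by (rule B.finprod_reindex) (use fc cM T in \<open>auto simp: inj_on_def\<close>)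
  finally have "finprod (bar 0) (\<lambda>g. face_sum 1 [g] (c [g])) T = \<one>\<^bsub>bar 0\<^esub>" using b by simp
  hence "finprod (bar 0) (\<lambda>g. face_sum 1 [g] (c [g])) T [] = \<one>\<^bsub>M\<^esub>" by (simp add: bar_chain_group_def bar_tuples_def)
  moreover have "finprod (bar 0) (\<lambda>g. face_sum 1 [g] (c [g])) S [] = finprod M (\<lambda>g. face_sum 1 [g] (c [g]) []) S" if "S \<subseteq> T" for S
    by (rule finprod_bar_apply) (use that T finite_subset[OF that fin] fc cM in \<open>auto simp: bar_tuples_def\<close>)
  ultimately have "finprod M (\<lambda>g. face_sum 1 [g] (c [g]) []) T = \<one>\<^bsub>M\<^esub>" by simp
  moreover have "finprod M (\<lambda>g. act (inv g) (c [g]) \<otimes>\<^bsub>M\<^esub> inv\<^bsub>M\<^esub> (c [g])) T = finprod M (\<lambda>g. face_sum 1 [g] (c [g]) []) T"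
  proof (rule M.finprod_cong')
    show "(\<lambda>g. face_sum 1 [g] (c [g]) []) \<in> T \<rightarrow> carrier M"
      using fc cM T unfolding carrier_bar by (auto simp: bar_tuples_def PiE_iff)
  qed (use face_sum_one_cycle cM T in auto)
  ultimately show "finprod M (\<lambda>g. act (inv g) (c [g]) \<otimes>\<^bsub>M\<^esub> inv\<^bsub>M\<^esub> (c [g])) T = \<one>\<^bsub>M\<^esub>" by simp
qed

text \<open>A cycle with coefficients c_g is congruent to the sum of all U(g^-1 c_g) - U(c_g), hence
  by additivity to U of the product in \<open>first_cycle\<close>, and that product is 1. The
  quantification over N moves the search for U into a free abelian group, where additive notation is
  available.\<close>

theorem first_homology_trivialI:
  assumes U: "\<And>N. subgrp N \<Longrightarrow>
      (\<And>m m' g. m \<in> carrier M \<Longrightarrow> m' \<in> carrier M \<Longrightarrow> g \<in> carrier G \<Longrightarrow>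
        frag_of (m \<otimes>\<^bsub>M\<^esub> m', g) - frag_of (m, g) - frag_of (m', g) \<in> N) \<Longrightarrow>
      (\<And>m g h. m \<in> carrier M \<Longrightarrow> g \<in> carrier G \<Longrightarrow> h \<in> carrier G \<Longrightarrow>
        frag_of (m, g \<otimes> h) - frag_of (m, g) - frag_of (act (inv g) m, h) \<in> N) \<Longrightarrow>
      \<exists>U. (\<forall>m\<in>carrier M. \<forall>m'\<in>carrier M. U (m \<otimes>\<^bsub>M\<^esub> m') - U m - U m' \<in> N) \<and>
        (\<forall>m\<in>carrier M. \<forall>g\<in>carrier G. frag_of (m, g) - (U (act (inv g) m) - U m) \<in> N)"
  shows "trivial_group (group_homology 1 G M act)"
proof -
  let ?C = "carrier M \<times> carrier G"
  interpret B1: comm_group "bar 1" by (rule comm_group_bar)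
  let ?F = "free_Abelian_group (?C)"
  let ?B = "bar_boundary G M act 2 ` carrier (bar 2)"
  have bh: "bar_boundary G M act 2 \<in> hom (bar 2) (bar 1)" using bar_boundary_hom[of 2] by simp
  interpret bd: group_hom "bar 2" "bar 1" "bar_boundary G M act 2"
    by (rule group_hom.intro[OF group_bar group_bar]) (rule group_hom_axioms.intro[OF bh])
  have Bs: "subgroup ?B (bar 1)" by (rule bd.img_is_subgroup)
  have ec: "bar_elem G M q m gs \<in> carrier (bar q)" if "gs \<in> bar_tuples G q" "m \<in> carrier M" for q m gs
    using bar_elem_hom[OF that(1)] that(2) by (auto simp: hom_def)
  have t1: "[g] \<in> bar_tuples G 1" if "g \<in> carrier G" for g using that by (simp add: bar_tuples_def)
  obtain \<rho> where \<rho>: "\<rho> \<in> hom ?F (bar 1)" "\<And>p. p \<in> ?C \<Longrightarrow> \<rho> (frag_of p) = (\<lambda>(m, g). bar_elem G M 1 m [g]) p"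
    using B1.free_Abelian_group_universal[of "\<lambda>(m, g). bar_elem G M 1 m [g]" "?C"] ec t1 by (auto simp: image_subset_iff)
  interpret rh: group_hom ?F "bar 1" \<rho>
    by (rule group_hom.intro[OF group_free_Abelian_group group_bar]) (rule group_hom_axioms.intro[OF \<rho>(1)])
  have \<rho>e: "\<rho> (frag_of (m, g)) = bar_elem G M 1 m [g]" if "m \<in> carrier M" "g \<in> carrier G" for m g using \<rho>(2) that by auto
  have \<rho>c: "\<rho> z \<in> carrier (bar 1)" if "keys z \<subseteq> ?C" for z using rh.hom_closed[of z] that by simp
  have \<rho>add: "\<rho> (z + z') = \<rho> z \<otimes>\<^bsub>bar 1\<^esub> \<rho> z'" if "keys z \<subseteq> ?C" "keys z' \<subseteq> ?C" for z z'
    using rh.hom_mult[of z z'] that by simp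
  have \<rho>minus: "\<rho> (- z) = inv\<^bsub>bar 1\<^esub> \<rho> z" if "keys z \<subseteq> ?C" for z
    using rh.hom_inv[of z] that by simp
  have \<rho>diff: "\<rho> (z - z') = \<rho> z \<otimes>\<^bsub>bar 1\<^esub> inv\<^bsub>bar 1\<^esub> \<rho> z'" if "keys z \<subseteq> ?C" "keys z' \<subseteq> ?C" for z z'
    using \<rho>add[OF that(1), of "- z'"] \<rho>minus[OF that(2)] that(2) by simp
  \<comment> \<open>Formal sums of pairs whose interpretation as one-chains is a boundary; the
    hypothesis is applied to this N.\<close>
  define N where "N = {z. keys z \<subseteq> ?C \<and> \<rho> z \<in> ?B}"
  have "subgrp N"
    unfolding subgrp_def
  proof (intro conjI ballI)
    show "0 \<in> N" using rh.hom_one subgroup.one_closed[OF Bs] by (simp add: N_def)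
    fix z z' assume "z \<in> N" "z' \<in> N"
    hence z: "keys z \<subseteq> ?C" "keys z' \<subseteq> ?C" "\<rho> z \<in> ?B" "\<rho> z' \<in> ?B" by (auto simp: N_def)
    have "\<rho> (z - z') \<in> ?B"
      unfolding \<rho>diff[OF z(1,2)] by (rule subgroup.m_closed[OF Bs z(3) subgroup.m_inv_closed[OF Bs z(4)]])
    thus "z - z' \<in> N" using z(1,2) keys_diff_subset[OF z(1,2)] by (simp add: N_def)
  qed
  have "frag_of (m \<otimes>\<^bsub>M\<^esub> m', g) - frag_of (m, g) - frag_of (m', g) \<in> N"
    if m: "m \<in> carrier M" "m' \<in> carrier M" "g \<in> carrier G" for m m' g
  proof -
    have k: "keys (frag_of (m \<otimes>\<^bsub>M\<^esub> m', g)) \<subseteq> ?C" "keys (frag_of (m, g)) \<subseteq> ?C"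
      "keys (frag_of (m', g)) \<subseteq> ?C"
      using m by (auto simp: keys_frag_of)
    note k = this keys_diff_subset[OF this(1,2)]
    let ?e = "\<lambda>m. bar_elem G M 1 m [g]"
    have e: "?e m \<in> carrier (bar 1)" "?e m' \<in> carrier (bar 1)" using ec t1 m by auto
    have "?e (m \<otimes>\<^bsub>M\<^esub> m') = ?e m \<otimes>\<^bsub>bar 1\<^esub> ?e m'" using hom_mult[OF bar_elem_hom[OF t1[OF m(3)]] m(1,2)] .
    hence "\<rho> (frag_of (m \<otimes>\<^bsub>M\<^esub> m', g) - frag_of (m, g) - frag_of (m', g)) = ?e m \<otimes>\<^bsub>bar 1\<^esub> ?e m' \<otimes>\<^bsub>bar 1\<^esub> inv\<^bsub>bar 1\<^esub> ?e m \<otimes>\<^bsub>bar 1\<^esub> inv\<^bsub>bar 1\<^esub> ?e m'"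
      unfolding \<rho>diff[OF k(4,3)] \<rho>diff[OF k(1,2)] using m by (simp only: \<rho>e M.m_closed)
    also have "\<dots> = ?e m \<otimes>\<^bsub>bar 1\<^esub> ?e m' \<otimes>\<^bsub>bar 1\<^esub> inv\<^bsub>bar 1\<^esub> (?e m \<otimes>\<^bsub>bar 1\<^esub> ?e m')"
      using B1.inv_mult[OF e] B1.m_assoc e by (metis B1.inv_closed B1.m_closed)
    also have "\<dots> = \<one>\<^bsub>bar 1\<^esub>" by (rule B1.r_inv[OF B1.m_closed[OF e]])
    finally show ?thesis using keys_diff_subset[OF k(4,3)] subgroup.one_closed[OF Bs] by (simp add: N_def)
  qed
  note N_additive = this
  have "frag_of (m, g \<otimes> h) - frag_of (m, g) - frag_of (act (inv g) m, h) \<in> N"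
    if m: "m \<in> carrier M" "g \<in> carrier G" "h \<in> carrier G" for m g h
  proof -
    have am: "act (inv g) m \<in> carrier M" using act_hom[of "inv g"] m by (auto simp: hom_def)
    let ?a = "bar_elem G M 1 (act (inv g) m) [h]" and ?b = "bar_elem G M 1 m [g \<otimes> h]" and ?c = "bar_elem G M 1 m [g]"
    have e: "?a \<in> carrier (bar 1)" "?b \<in> carrier (bar 1)" "?c \<in> carrier (bar 1)" using ec t1 am m by auto
    have k: "keys (frag_of (act (inv g) m, h)) \<subseteq> ?C" "keys (frag_of (m, g \<otimes> h)) \<subseteq> ?C"
      "keys (frag_of (m, g)) \<subseteq> ?C"
      using m am by (auto simp: keys_frag_of)
    note k = this keys_diff_subset[OF this(1,2)] keys_add_subset[OF keys_diff_subset[OF this(1,2)] this(3)]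
    have gs: "[g, h] \<in> bar_tuples G 2" using m by (simp add: bar_tuples_def)
    have "?a \<otimes>\<^bsub>bar 1\<^esub> inv\<^bsub>bar 1\<^esub> ?b \<otimes>\<^bsub>bar 1\<^esub> ?c = bar_boundary G M act 2 (bar_elem G M 2 m [g, h])"
      using bar_boundary_elem[OF gs _ m(1)] face_sum_two[OF m(2,3,1)] by simp
    hence "?a \<otimes>\<^bsub>bar 1\<^esub> inv\<^bsub>bar 1\<^esub> ?b \<otimes>\<^bsub>bar 1\<^esub> ?c \<in> ?B" using ec[OF gs m(1)] by blast
    moreover have "\<rho> (frag_of (act (inv g) m, h) - frag_of (m, g \<otimes> h) + frag_of (m, g)) = ?a \<otimes>\<^bsub>bar 1\<^esub> inv\<^bsub>bar 1\<^esub> ?b \<otimes>\<^bsub>bar 1\<^esub> ?c"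
      unfolding \<rho>add[OF k(4,3)] \<rho>diff[OF k(1,2)] using m am by (simp only: \<rho>e G.m_closed)
    ultimately have "frag_of (act (inv g) m, h) - frag_of (m, g \<otimes> h) + frag_of (m, g) \<in> N" using k(5) by (simp add: N_def)
    thus ?thesis by (rule subgrp_comb[OF \<open>subgrp N\<close> subgrp_0[OF \<open>subgrp N\<close>]]) simp
  qed
  note N_cocycle = this
  obtain U where U: "\<And>m m'. m \<in> carrier M \<Longrightarrow> m' \<in> carrier M \<Longrightarrow> U (m \<otimes>\<^bsub>M\<^esub> m') - U m - U m' \<in> N"
    "\<And>m g. m \<in> carrier M \<Longrightarrow> g \<in> carrier G \<Longrightarrow> frag_of (m, g) - (U (act (inv g) m) - U m) \<in> N"
    using assms[OF \<open>subgrp N\<close> N_additive N_cocycle] by blast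
  note comb = subgrp_comb[OF \<open>subgrp N\<close>] and comb_plus = subgrp_comb_plus[OF \<open>subgrp N\<close>] and N0 = subgrp_0[OF \<open>subgrp N\<close>]
  have U1: "U \<one>\<^bsub>M\<^esub> \<in> N" by (rule comb[OF N0 U(1)[OF M.one_closed M.one_closed]]) simp
  have Uinv: "U (a \<otimes>\<^bsub>M\<^esub> inv\<^bsub>M\<^esub> b) - (U a - U b) \<in> N" if "a \<in> carrier M" "b \<in> carrier M" for a b
  proof -
    have "a \<otimes>\<^bsub>M\<^esub> inv\<^bsub>M\<^esub> b \<otimes>\<^bsub>M\<^esub> b = a" using that by (simp add: M.m_assoc)
    hence "U a - U (a \<otimes>\<^bsub>M\<^esub> inv\<^bsub>M\<^esub> b) - U b \<in> N" using U(1)[of "a \<otimes>\<^bsub>M\<^esub> inv\<^bsub>M\<^esub> b" b] that by simp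
    thus ?thesis by (rule comb[OF N0]) simp
  qed
  have Usum: "U (finprod M f T) - (\<Sum>x\<in>T. U (f x)) \<in> N" if "finite T" "f \<in> T \<rightarrow> carrier M" for f and T :: "'g set"
    using that
  proof (induction T rule: finite_induct)
    case (insert x T)
    hence f: "f x \<in> carrier M" "f \<in> T \<rightarrow> carrier M" "finprod M f T \<in> carrier M" by auto
    hence e: "finprod M f (insert x T) = f x \<otimes>\<^bsub>M\<^esub> finprod M f T" using insert.hyps by (intro M.finprod_insert)
    show ?case unfolding e
      by (rule comb_plus[OF U(1)[OF f(1,3)] insert.IH[OF f(2)]]) (use insert.hyps in simp)
  qed (simp add: U1)
  have main: "c \<in> ?B" if c: "c \<in> bar_cycles G M act 1" for c
  proof -
    define T where "T = {g \<in> carrier G. c [g] \<noteq> \<one>\<^bsub>M\<^esub>}"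
    note fc = first_cycle[OF c T_def]
    have cc: "c \<in> carrier (bar 1)" using c by (simp add: bar_cycles_def kernel_def)
    have cM: "c [g] \<in> carrier M" if "g \<in> carrier G" for g
      using cc t1[OF that] unfolding carrier_bar by (auto simp: PiE_iff)
    have TG: "T \<subseteq> carrier G" by (auto simp: T_def)
    let ?z = "\<Sum>g\<in>T. frag_of (c [g], g)"
    let ?v = "\<lambda>g. act (inv g) (c [g]) \<otimes>\<^bsub>M\<^esub> inv\<^bsub>M\<^esub> (c [g])"
    have aM: "act (inv g) (c [g]) \<in> carrier M" if "g \<in> carrier G" for g
      using act_hom[of "inv g"] cM that by (auto simp: hom_def)
    have 1: "(\<Sum>g\<in>T. frag_of (c [g], g) - U (?v g)) \<in> N"
    proof (rule subgrp_sum[OF \<open>subgrp N\<close>])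
      fix g assume "g \<in> T"
      hence g: "g \<in> carrier G" using TG by blast
      show "frag_of (c [g], g) - U (?v g) \<in> N"
        by (rule comb[OF U(2)[OF cM[OF g] g] Uinv[OF aM[OF g] cM[OF g]]]) simp
    qed
    have 2: "U (finprod M ?v T) - (\<Sum>g\<in>T. U (?v g)) \<in> N" by (rule Usum[OF fc(1)]) (use TG aM cM in auto)
    have 3: "(\<Sum>g\<in>T. U (?v g)) \<in> N" by (rule comb[OF U1[folded fc(2)] 2]) simp
    have "?z \<in> N" by (rule comb_plus[OF 1 3]) (simp add: sum_subtractf)
    hence zB: "\<rho> ?z \<in> ?B" by (simp add: N_def)
    have "\<rho> (\<Sum>g\<in>S. frag_of (c [g], g)) = finprod (bar 1) (\<lambda>g. bar_elem G M 1 (c [g]) [g]) S" if "finite S" "S \<subseteq> T" for S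
      using that
    proof (induction S rule: finite_induct)
      case empty
      show ?case unfolding B1.finprod_empty sum.empty using rh.hom_one by simp
    next
      case (insert g S)
      have g: "g \<in> carrier G" and S: "S \<subseteq> carrier G" using insert.prems TG by auto
      have "keys (frag_of (c [g], g)) \<subseteq> ?C" using g cM by (simp add: keys_frag_of)
      moreover have "keys (\<Sum>g\<in>S. frag_of (c [g], g)) \<subseteq> ?C"
        by (rule keys_sum_subset) (use S cM in \<open>auto simp: keys_frag_of\<close>)
      ultimately have "\<rho> (\<Sum>g\<in>insert g S. frag_of (c [g], g)) = \<rho> (frag_of (c [g], g)) \<otimes>\<^bsub>bar 1\<^esub> \<rho> (\<Sum>g\<in>S. frag_of (c [g], g))"
        unfolding sum.insert[OF insert.hyps] by (rule \<rho>add)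
      also have "\<dots> = bar_elem G M 1 (c [g]) [g] \<otimes>\<^bsub>bar 1\<^esub> finprod (bar 1) (\<lambda>g. bar_elem G M 1 (c [g]) [g]) S"
        using insert.IH insert.prems \<rho>e[OF cM[OF g] g] by simp
      also have "\<dots> = finprod (bar 1) (\<lambda>g. bar_elem G M 1 (c [g]) [g]) (insert g S)"
        by (rule B1.finprod_insert[symmetric]) (use insert.hyps g S cM ec[OF t1] in auto)
      finally show ?case .
    qed
    hence \<rho>z: "\<rho> ?z = finprod (bar 1) (\<lambda>g. bar_elem G M 1 (c [g]) [g]) T" using fc(1) by blast
    \<comment> \<open>A chain of finite support is the product of its elementary components;
      equality is checked at each tuple.\<close>
    have "finprod (bar 1) (\<lambda>g. bar_elem G M 1 (c [g]) [g]) T = c"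
    proof (rule PiE_ext)
      have cl: "finprod (bar 1) (\<lambda>g. bar_elem G M 1 (c [g]) [g]) T \<in> carrier (bar 1)"
        by (rule B1.finprod_closed) (use TG cM ec[OF t1] in auto)
      thus "finprod (bar 1) (\<lambda>g. bar_elem G M 1 (c [g]) [g]) T \<in> bar_tuples G 1 \<rightarrow>\<^sub>E carrier M" unfolding carrier_bar by blast
      show "c \<in> bar_tuples G 1 \<rightarrow>\<^sub>E carrier M" using cc unfolding carrier_bar by blast
      fix gs assume gs: "gs \<in> bar_tuples G 1"
      then obtain h where h: "gs = [h]" "h \<in> carrier G" by (auto simp: bar_tuples_def length_Suc_conv)
      have "finprod (bar 1) (\<lambda>g. bar_elem G M 1 (c [g]) [g]) T gs = finprod M (\<lambda>g. bar_elem G M 1 (c [g]) [g] gs) T"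
        by (rule finprod_bar_apply) (use TG cM ec[OF t1] gs fc(1) in auto)
      also have "\<dots> = finprod M (\<lambda>g. if h = g then c [g] else \<one>\<^bsub>M\<^esub>) T"
        by (rule M.finprod_cong') (use TG cM gs h in \<open>auto simp: bar_elem_def\<close>)
      also have "\<dots> = c gs"
      proof (cases "h \<in> T")
        case True
        thus ?thesis using M.finprod_singleton[of h T "\<lambda>g. c [g]"] fc(1) TG cM h by auto
      next
        case False
        hence "finprod M (\<lambda>g. if h = g then c [g] else \<one>\<^bsub>M\<^esub>) T = finprod M (\<lambda>g. \<one>\<^bsub>M\<^esub>) T"
          by (intro M.finprod_cong') auto
        thus ?thesis using False h by (simp add: T_def)
      qed
      finally show "finprod (bar 1) (\<lambda>g. bar_elem G M 1 (c [g]) [g]) T gs = c gs" .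
    qed
    thus ?thesis using zB \<rho>z by simp
  qed
  have Z: "subgroup (bar_cycles G M act 1) (bar 1)"
  proof -
    have "group_hom (bar 1) (bar 0) (bar_boundary G M act 1)"
      using bar_boundary_hom[of 1] by (intro group_hom.intro group_bar group_hom_axioms.intro) simp
    thus ?thesis unfolding bar_cycles_def using group_hom.subgroup_kernel by simp
  qed
  let ?Z = "subgroup_generated (bar 1) (bar_cycles G M act 1)"
  have cz: "carrier ?Z = bar_cycles G M act 1" by (rule subgroup.carrier_subgroup_generated_subgroup[OF Z])
  \<comment> \<open>Every cycle is a boundary, so there is only one coset.\<close>
  have "?B #>\<^bsub>?Z\<^esub> c = ?B" if "c \<in> bar_cycles G M act 1" for c
    using B1.coset_join2[OF _ Bs main[OF that]] subgroup.mem_carrier[OF Z that] by (simp add: r_coset_def)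
  moreover have "\<one>\<^bsub>bar 1\<^esub> \<in> bar_cycles G M act 1" by (rule subgroup.one_closed[OF Z])
  ultimately have "rcosets\<^bsub>?Z\<^esub> ?B = {?B}" unfolding RCOSETS_def cz by auto
  moreover have "?B <#>\<^bsub>?Z\<^esub> ?B = ?B"
    using B1.subgroup_mult_id[OF Bs] by (simp add: set_mult_def)
  ultimately have "trivial_group (?Z Mod ?B)"
    unfolding trivial_group_def FactGroup_def by (auto intro!: groupI)
  thus ?thesis by (simp add: group_homology_def numeral_2_eq_2)
qed

end

section \<open>Tensor products and functions that are biadditive modulo a subgroup\<close>

locale tensor_pair = S: comm_group S + K: comm_group K
  for S :: "('s, 'x) monoid_scheme" and K :: "('k, 'y) monoid_scheme"
begin

abbreviation "pairs \<equiv> carrier S \<times> carrier K"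
abbreviation "F \<equiv> free_Abelian_group pairs"
abbreviation "R \<equiv> tensor_relations S K"
abbreviation "M \<equiv> tensor_product S K"

definition tens :: "('s \<times> 'k \<Rightarrow>\<^sub>0 int) \<Rightarrow> ('s \<times> 'k \<Rightarrow>\<^sub>0 int) set" where
  "tens z = R #>\<^bsub>F\<^esub> z"

lemma relations_subgroup: "subgroup R F"
  unfolding tensor_relations_def
proof (rule group.generate_is_subgroup[OF group_free_Abelian_group])
  have "keys (frag_of a - frag_of b - frag_of c) \<subseteq> pairs" if "a \<in> pairs" "b \<in> pairs" "c \<in> pairs" for a b c
    using that by (intro keys_diff_subset) (auto simp: keys_frag_of)
  thus "{frag_of (a \<otimes>\<^bsub>S\<^esub> a', b) - frag_of (a, b) - frag_of (a', b) | a a' b.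
         a \<in> carrier S \<and> a' \<in> carrier S \<and> b \<in> carrier K}
    \<union> {frag_of (a, b \<otimes>\<^bsub>K\<^esub> b') - frag_of (a, b) - frag_of (a, b') | a b b'.
         a \<in> carrier S \<and> b \<in> carrier K \<and> b' \<in> carrier K} \<subseteq> carrier F"
    by (auto simp del: subset_iff)
qed

lemma relations_subgrp: "subgrp R"
  unfolding subgrp_def
proof (intro conjI ballI)
  show "0 \<in> R" using subgroup.one_closed[OF relations_subgroup] by simp
  fix a b assume ab: "a \<in> R" "b \<in> R"
  hence "keys b \<subseteq> pairs" using subgroup.mem_carrier[OF relations_subgroup] by force
  thus "a - b \<in> R"
    using subgroup.m_closed[OF relations_subgroup ab(1) subgroup.m_inv_closed[OF relations_subgroup ab(2)]] by simp
qed

lemma relations_left: "a \<in> carrier S \<Longrightarrow> a' \<in> carrier S \<Longrightarrow> b \<in> carrier K \<Longrightarrow>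
    frag_of (a \<otimes>\<^bsub>S\<^esub> a', b) - frag_of (a, b) - frag_of (a', b) \<in> R"
  and relations_right: "a \<in> carrier S \<Longrightarrow> b \<in> carrier K \<Longrightarrow> b' \<in> carrier K \<Longrightarrow>
    frag_of (a, b \<otimes>\<^bsub>K\<^esub> b') - frag_of (a, b) - frag_of (a, b') \<in> R"
  unfolding tensor_relations_def by (rule generate.incl, blast)+

text \<open>The universal property of the tensor product, relative to N: biadditivity up to N is
  just what sends the defining relations into N, and N absorbs the subgroup they generate.\<close>

lemma relations_map:
  assumes N: "subgrp N"
    and left: "\<And>a a' b. a \<in> carrier S \<Longrightarrow> a' \<in> carrier S \<Longrightarrow> b \<in> carrier K \<Longrightarrow> f (a \<otimes>\<^bsub>S\<^esub> a', b) - f (a, b) - f (a', b) \<in> N"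
    and right: "\<And>a b b'. a \<in> carrier S \<Longrightarrow> b \<in> carrier K \<Longrightarrow> b' \<in> carrier K \<Longrightarrow> f (a, b \<otimes>\<^bsub>K\<^esub> b') - f (a, b) - f (a, b') \<in> N"
    and z: "z \<in> R"
  shows "frag_extend f z \<in> N"
  using z unfolding tensor_relations_def
proof (induction rule: generate.induct)
  case one
  show ?case using N by (simp add: subgrp_def)
next
  case (incl h)
  thus ?case using left right by (auto simp: frag_extend_diff)
next
  case (inv h)
  hence "keys h \<subseteq> pairs"
    using subgroup.mem_carrier[OF relations_subgroup, unfolded tensor_relations_def, OF generate.incl[OF inv]] by simp
  moreover have "frag_extend f h \<in> N" using inv left right by (auto simp: frag_extend_diff)
  ultimately show ?case using subgrp_diff[OF N subgrp_0[OF N]] by (simp add: frag_extend_minus)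
next
  case (eng h1 h2)
  thus ?case using subgrp_add[OF N] by (simp add: frag_extend_add)
qed

lemma comm_group_tensor: "comm_group M"
  unfolding tensor_product_def by (rule comm_group.abelian_FactGroup[OF abelian_free_Abelian_group relations_subgroup])

lemma relations_normal: "R \<lhd> F"
  by (rule comm_group.subgroup_imp_normal[OF abelian_free_Abelian_group relations_subgroup])

lemma carrier_tensor: "carrier M = tens ` {z. keys z \<subseteq> pairs}"
  by (auto simp: tensor_product_def FactGroup_def RCOSETS_def tens_def)

lemma tens_add:
  assumes "keys z \<subseteq> pairs" "keys z' \<subseteq> pairs"
  shows "tens (z + z') = tens z \<otimes>\<^bsub>M\<^esub> tens z'"
  using normal.rcos_sum[OF relations_normal, of z z'] assms
  by (simp add: tens_def tensor_product_def FactGroup_def)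

lemma tens_set: "tens z = {u + z | u. u \<in> R}"
  by (auto simp: tens_def r_coset_def)

lemma tens_eq_iff: "tens z = tens z' \<longleftrightarrow> z - z' \<in> R"
proof
  assume "tens z = tens z'"
  moreover have "0 + z \<in> tens z" using subgrp_0[OF relations_subgrp] unfolding tens_set by blast
  ultimately obtain u where "u \<in> R" "0 + z = u + z'" unfolding tens_set by blast
  thus "z - z' \<in> R" by simp
next
  assume d: "z - z' \<in> R"
  have *: "tens a \<subseteq> tens b" if "a - b \<in> R" for a b
  proof
    fix x assume "x \<in> tens a"
    then obtain u where u: "u \<in> R" "x = u + a" unfolding tens_set by blast
    have "x = (u + (a - b)) + b" using u(2) by simp
    thus "x \<in> tens b" unfolding tens_set using subgrp_add[OF relations_subgrp u(1) that] by blast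
  qed
  have "z' - z \<in> R" by (rule subgrp_comb[OF relations_subgrp subgrp_0[OF relations_subgrp] d]) simp
  thus "tens z = tens z'" using *[OF d] *[of z' z] by blast
qed

definition pushforward :: "('s \<Rightarrow> 's) \<Rightarrow> ('s \<times> 'k \<Rightarrow>\<^sub>0 int) \<Rightarrow> ('s \<times> 'k \<Rightarrow>\<^sub>0 int)" where
  "pushforward \<sigma> = frag_extend (\<lambda>(a, b). frag_of (\<sigma> a, id b))"

lemma pushforward_keys: "\<sigma> \<in> hom S S \<Longrightarrow> keys z \<subseteq> pairs \<Longrightarrow> keys (pushforward \<sigma> z) \<subseteq> pairs"
  unfolding pushforward_def by (erule keys_frag_extend_subset) (auto simp: keys_frag_of hom_def)

lemma pushforward_relations: assumes \<sigma>: "\<sigma> \<in> hom S S" and z: "z \<in> R" shows "pushforward \<sigma> z \<in> R"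
  unfolding pushforward_def
proof (rule relations_map[OF relations_subgrp _ _ z])
  have c: "\<sigma> a \<in> carrier S" if "a \<in> carrier S" for a using \<sigma> that by (auto simp: hom_def)
  show "(case (a \<otimes>\<^bsub>S\<^esub> a', b) of (a, b) \<Rightarrow> frag_of (\<sigma> a, id b)) - (case (a, b) of (a, b) \<Rightarrow> frag_of (\<sigma> a, id b))
    - (case (a', b) of (a, b) \<Rightarrow> frag_of (\<sigma> a, id b)) \<in> R"
    if "a \<in> carrier S" "a' \<in> carrier S" "b \<in> carrier K" for a a' b
    using relations_left[of "\<sigma> a" "\<sigma> a'" b] hom_mult[OF \<sigma> that(1,2)] c that by simp
  show "(case (a, b \<otimes>\<^bsub>K\<^esub> b') of (a, b) \<Rightarrow> frag_of (\<sigma> a, id b)) - (case (a, b) of (a, b) \<Rightarrow> frag_of (\<sigma> a, id b))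
    - (case (a, b') of (a, b) \<Rightarrow> frag_of (\<sigma> a, id b)) \<in> R"
    if "a \<in> carrier S" "b \<in> carrier K" "b' \<in> carrier K" for a b b'
    using relations_right[of "\<sigma> a" b b'] c that by simp
qed

text \<open>\<open>pushforward\<close> preserves R, so another representative changes the image only
  by an element of R, which the factor R in \<open>tensor_map\<close> absorbs.\<close>

lemma tensor_map_tens:
  assumes \<sigma>: "\<sigma> \<in> hom S S" shows "tensor_map S K \<sigma> id (tens z) = tens (pushforward \<sigma> z)"
proof -
  have "tensor_map S K \<sigma> id (tens z) = {u + pushforward \<sigma> (w + z) | u w. u \<in> R \<and> w \<in> R}"
    unfolding tensor_map_def tens_set set_mult_def pushforward_def by auto
  also have "\<dots> = {u + pushforward \<sigma> z | u. u \<in> R}"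
  proof (rule subset_antisym; rule subsetI)
    fix x assume "x \<in> {u + pushforward \<sigma> (w + z) | u w. u \<in> R \<and> w \<in> R}"
    then obtain u w where uw: "u \<in> R" "w \<in> R" "x = u + pushforward \<sigma> (w + z)" by blast
    have "x = (u + pushforward \<sigma> w) + pushforward \<sigma> z" using uw(3) by (simp add: pushforward_def frag_extend_add add.assoc)
    moreover have "u + pushforward \<sigma> w \<in> R" using subgrp_add[OF relations_subgrp] uw pushforward_relations[OF \<sigma>] by blast
    ultimately show "x \<in> {u + pushforward \<sigma> z | u. u \<in> R}" by blast
  next
    fix x assume "x \<in> {u + pushforward \<sigma> z | u. u \<in> R}"
    then obtain u where u: "u \<in> R" "x = u + pushforward \<sigma> z" by blast
    have "x = u + pushforward \<sigma> (0 + z)" using u by simp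
    thus "x \<in> {u + pushforward \<sigma> (w + z) | u w. u \<in> R \<and> w \<in> R}" using u(1) subgrp_0[OF relations_subgrp] by blast
  qed
  finally show ?thesis unfolding tens_set .
qed

lemma tensor_map_hom:
  assumes \<sigma>: "\<sigma> \<in> hom S S" shows "tensor_map S K \<sigma> id \<in> hom M M"
proof (rule homI)
  fix x y assume "x \<in> carrier M" "y \<in> carrier M"
  then obtain z w where z: "keys z \<subseteq> pairs" "x = tens z" and w: "keys w \<subseteq> pairs" "y = tens w" unfolding carrier_tensor by blast
  show "tensor_map S K \<sigma> id x \<in> carrier M"
    unfolding z(2) tensor_map_tens[OF \<sigma>] carrier_tensor using pushforward_keys[OF \<sigma> z(1)] by blast
  show "tensor_map S K \<sigma> id (x \<otimes>\<^bsub>M\<^esub> y) = tensor_map S K \<sigma> id x \<otimes>\<^bsub>M\<^esub> tensor_map S K \<sigma> id y"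
    unfolding z(2) w(2) tens_add[OF z(1) w(1), symmetric] tensor_map_tens[OF \<sigma>]
      tens_add[OF pushforward_keys[OF \<sigma> z(1)] pushforward_keys[OF \<sigma> w(1)], symmetric]
    by (simp add: pushforward_def frag_extend_add)
qed

text \<open>U evaluates V on a chosen representative; by \<open>relations_map\<close> another choice
  changes the value only within N. The coboundary equation is additive in the representative modulo
  N, so pure tensors suffice.\<close>

lemma primitive_extends:
  assumes N: "subgrp N" and \<sigma>: "\<And>g. g \<in> carrier G \<Longrightarrow> \<sigma> g \<in> hom S S" and G: "group G"
    and add: "\<And>m m' g. m \<in> carrier M \<Longrightarrow> m' \<in> carrier M \<Longrightarrow> g \<in> carrier G \<Longrightarrow>
      frag_of (m \<otimes>\<^bsub>M\<^esub> m', g) - frag_of (m, g) - frag_of (m', g) \<in> N"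
    and left: "\<And>a a' b. a \<in> carrier S \<Longrightarrow> a' \<in> carrier S \<Longrightarrow> b \<in> carrier K \<Longrightarrow> V (a \<otimes>\<^bsub>S\<^esub> a') b - V a b - V a' b \<in> N"
    and right: "\<And>a b b'. a \<in> carrier S \<Longrightarrow> b \<in> carrier K \<Longrightarrow> b' \<in> carrier K \<Longrightarrow> V a (b \<otimes>\<^bsub>K\<^esub> b') - V a b - V a b' \<in> N"
    and prim: "\<And>a b g. a \<in> carrier S \<Longrightarrow> b \<in> carrier K \<Longrightarrow> g \<in> carrier G \<Longrightarrow>
      frag_of (tens (frag_of (a, b)), g) - (V (\<sigma> (inv\<^bsub>G\<^esub> g) a) b - V a b) \<in> N"
  shows "\<exists>U. (\<forall>m\<in>carrier M. \<forall>m'\<in>carrier M. U (m \<otimes>\<^bsub>M\<^esub> m') - U m - U m' \<in> N) \<and>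
        (\<forall>m\<in>carrier M. \<forall>g\<in>carrier G. frag_of (m, g) - (U (tensor_map S K (\<sigma> (inv\<^bsub>G\<^esub> g)) id m) - U m) \<in> N)"
proof -
  note comb = subgrp_comb[OF N] and comb_plus = subgrp_comb_plus[OF N] and N0 = subgrp_0[OF N]
  interpret G: group G by (rule G)
  let ?V = "frag_extend (\<lambda>(a, b). V a b)"
  define U where "U = (\<lambda>m. ?V (SOME z. keys z \<subseteq> pairs \<and> tens z = m))"
  have VR: "?V z \<in> N" if "z \<in> R" for z
    by (rule relations_map[OF N _ _ that]) (use left right in auto)
  have U: "U (tens z) - ?V z \<in> N" if "keys z \<subseteq> pairs" for z
  proof -
    let ?w = "SOME w. keys w \<subseteq> pairs \<and> tens w = tens z"
    have "keys ?w \<subseteq> pairs \<and> tens ?w = tens z" by (rule someI[of _ z]) (use that in blast)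
    hence "?w - z \<in> R" by (simp add: tens_eq_iff)
    from VR[OF this] show ?thesis by (simp add: U_def frag_extend_diff)
  qed
  have z: "frag_of (tens z, g) - (?V (pushforward (\<sigma> (inv\<^bsub>G\<^esub> g)) z) - ?V z) \<in> N" if "keys z \<subseteq> pairs" "g \<in> carrier G" for z g
  proof (rule free_Abelian_group_induct[OF that(1), where P = "\<lambda>z. frag_of (tens z, g) - (?V (pushforward (\<sigma> (inv\<^bsub>G\<^esub> g)) z) - ?V z) \<in> N"])
    have "tens 0 \<in> carrier M" unfolding carrier_tensor by (intro imageI) simp
    moreover have "tens 0 \<otimes>\<^bsub>M\<^esub> tens 0 = tens 0" using tens_add[of 0 0] by simp
    ultimately have "frag_of (tens 0, g) - frag_of (tens 0, g) - frag_of (tens 0, g) \<in> N"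
      using add[of "tens 0" "tens 0" g] that(2) by simp
    hence "frag_of (tens 0, g) \<in> N" by (rule comb[OF N0]) simp
    thus "frag_of (tens 0, g) - (?V (pushforward (\<sigma> (inv\<^bsub>G\<^esub> g)) 0) - ?V 0) \<in> N" by (simp add: pushforward_def)
  next
    fix x y :: "'s \<times> 'k \<Rightarrow>\<^sub>0 int"
    assume 2: "keys x \<subseteq> pairs" "keys y \<subseteq> pairs"
      "frag_of (tens x, g) - (?V (pushforward (\<sigma> (inv\<^bsub>G\<^esub> g)) x) - ?V x) \<in> N"
      "frag_of (tens y, g) - (?V (pushforward (\<sigma> (inv\<^bsub>G\<^esub> g)) y) - ?V y) \<in> N"
    have "keys (x - y) \<subseteq> pairs" by (rule keys_diff_subset[OF 2(1,2)])
    hence c: "tens (x - y) \<in> carrier M" "tens y \<in> carrier M" using 2(2) unfolding carrier_tensor by blast+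
    have "tens x = tens (x - y) \<otimes>\<^bsub>M\<^esub> tens y" using tens_add[OF \<open>keys (x - y) \<subseteq> pairs\<close> 2(2)] by simp
    hence t: "frag_of (tens x, g) - frag_of (tens (x - y), g) - frag_of (tens y, g) \<in> N"
      using add[OF c that(2)] by simp
    have e: "a' - ((b - c) - (d - f)) = (a - (b - d)) - (a'' - (c - f)) - (a - a' - a'')"
      for a a' a'' b c d f :: "('s \<times> 'k \<Rightarrow>\<^sub>0 int) set \<times> 'g \<Rightarrow>\<^sub>0 int"
      by simp
    show "frag_of (tens (x - y), g) - (?V (pushforward (\<sigma> (inv\<^bsub>G\<^esub> g)) (x - y)) - ?V (x - y)) \<in> N"
      unfolding pushforward_def frag_extend_diff
      by (rule comb[OF comb[OF 2(3,4) refl] t]) (unfold pushforward_def, rule e)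
  next
    fix p assume "p \<in> pairs"
    thus "frag_of (tens (frag_of p), g) - (?V (pushforward (\<sigma> (inv\<^bsub>G\<^esub> g)) (frag_of p)) - ?V (frag_of p)) \<in> N" using prim[of "fst p" "snd p" g] that(2) by (auto simp: pushforward_def)
  qed
  show ?thesis
  proof (intro exI[of _ U] conjI ballI)
    fix m m' assume "m \<in> carrier M" "m' \<in> carrier M"
    then obtain z w where zw: "keys z \<subseteq> pairs" "m = tens z" "keys w \<subseteq> pairs" "m' = tens w" unfolding carrier_tensor by blast
    have "U (tens (z + w)) - ?V (z + w) \<in> N" by (rule U[OF keys_add_subset[OF zw(1,3)]])
    from comb[OF comb[OF this U[OF zw(1)] refl] U[OF zw(3)] refl]
    show "U (m \<otimes>\<^bsub>M\<^esub> m') - U m - U m' \<in> N"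
      unfolding zw(2,4) tens_add[OF zw(1,3), symmetric] by (simp add: frag_extend_add algebra_simps)
  next
    fix m g assume "m \<in> carrier M" and g: "g \<in> carrier G"
    then obtain y where y: "keys y \<subseteq> pairs" "m = tens y" unfolding carrier_tensor by blast
    have \<sigma>g: "\<sigma> (inv\<^bsub>G\<^esub> g) \<in> hom S S" using \<sigma> g by simp
    show "frag_of (m, g) - (U (tensor_map S K (\<sigma> (inv\<^bsub>G\<^esub> g)) id m) - U m) \<in> N"
      unfolding y(2) tensor_map_tens[OF \<sigma>g]
      by (rule comb[OF z[OF y(1) g] comb[OF U[OF pushforward_keys[OF \<sigma>g y(1)]] U[OF y(1)] refl]]) (simp add: algebra_simps)
  qed
qed

end

section \<open>Vanishing\<close>

lemma signed_perm_GL: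
  assumes \<pi>: "\<And>j. j < n \<Longrightarrow> \<pi> j < n" "\<And>j. j < n \<Longrightarrow> \<pi> (\<pi> j) = j" and s: "signs n s"
  shows "signed_perm n \<pi> s \<in> GL n"
proof -
  have sq: "s j * s j = 1" if "j < n" for j using s that by auto
  have "signed_perm n \<pi> (\<lambda>j. s (\<pi> j)) * signed_perm n \<pi> s = 1\<^sub>m n" "signed_perm n \<pi> s * signed_perm n \<pi> (\<lambda>j. s (\<pi> j)) = 1\<^sub>m n"
    unfolding signed_perm_one[symmetric] by (subst signed_perm_mult, (use \<pi> sq in \<open>auto intro!: signed_perm_eqI\<close>)[2])+
  thus ?thesis unfolding GL_int_iff by (auto intro!: bexI[of _ "signed_perm n \<pi> (\<lambda>j. s (\<pi> j))"])
qed

lemma translate_add: "translate A (y + y') = translate A y + translate A y'"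
  by (simp add: translate_def frag_extend_add)

lemma frag_extend_translate: "frag_extend f (translate A y) = frag_extend (\<lambda>a. f (A * a)) y"
  by (simp add: translate_def frag_extend_frag_extend)

lemma translate_translate:
  assumes "A \<in> carrier_mat n n" "B \<in> carrier_mat n n" "A * B = 1\<^sub>m n" "keys y \<subseteq> GL n"
  shows "translate A (translate B y) = y"
proof -
  have "translate A (translate B y) = frag_extend frag_of y"
    unfolding translate_def frag_extend_frag_extend frag_extend_of
  proof (rule frag_extend_eq)
    fix a assume "a \<in> keys y"
    hence a: "a \<in> carrier_mat n n" using assms(4) GL_int_iff by blast
    have "A * (B * a) = A * B * a" using assoc_mult_mat[OF assms(1,2) a] by simp
    thus "frag_of (A * (B * a)) = frag_of a" using assms(3) left_mult_one_mat[OF a] by simp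
  qed
  thus ?thesis by (simp flip: frag_expansion)
qed

lemma steinberg_action_hom:
  assumes n: "n \<ge> 3" and A: "A \<in> GL n"
  shows "steinberg_action n A \<in> hom (steinberg n) (steinberg n)"
proof (rule homI)
  fix x y assume "x \<in> carrier (steinberg n)" "y \<in> carrier (steinberg n)"
  obtain a where a: "keys a \<subseteq> GL n" "x = steinberg_class n a" using steinberg_class_surj[OF n \<open>x \<in> _\<close>] .
  obtain b where b: "keys b \<subseteq> GL n" "y = steinberg_class n b" using steinberg_class_surj[OF n \<open>y \<in> _\<close>] .
  note t = translate_keys[OF A a(1)] translate_keys[OF A b(1)]
  show "steinberg_action n A x \<in> carrier (steinberg n)"
    unfolding a(2) steinberg_action_class[OF n A a(1)] by (rule steinberg_class_carrier[OF n t(1)])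
  have "steinberg_action n A (steinberg_class n (a + b)) = steinberg_class n (translate A a + translate A b)"
    unfolding steinberg_action_class[OF n A keys_add_subset[OF a(1) b(1)]] translate_add ..
  thus "steinberg_action n A (x \<otimes>\<^bsub>steinberg n\<^esub> y) = steinberg_action n A x \<otimes>\<^bsub>steinberg n\<^esub> steinberg_action n A y"
    unfolding a(2) b(2) steinberg_class_add[OF n a(1) b(1), symmetric]
      steinberg_action_class[OF n A a(1)] steinberg_action_class[OF n A b(1)] steinberg_class_add[OF n t] .
qed

text \<open>For each coefficient \<kappa> the cocycle locale supplies a primitive on matrices. The
  presentation lets it descend to the Steinberg module, and its additivity in \<kappa> extends it to
  the tensor product.\<close>

theorem first_homology_arithmetic:
  fixes G :: "int mat monoid" and k :: "('k, 'r) ring_scheme"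
  assumes G: "group G" and k: "cring k" and n: "n \<ge> 6"
    and mult: "\<And>g h. g \<otimes>\<^bsub>G\<^esub> h = g * h" and one: "\<one>\<^bsub>G\<^esub> = 1\<^sub>m n"
    and G_GL: "carrier G \<subseteq> GL n"
    and SL_G: "\<And>A. A \<in> carrier_mat n n \<Longrightarrow> Determinant.det A = 1 \<Longrightarrow> A \<in> carrier G"
    and reflection_G: "\<And>g. g \<in> GL n \<Longrightarrow> g \<notin> carrier G \<Longrightarrow> g * reflection n \<in> carrier G"
  shows "trivial_group (group_homology 1 G (steinberg_coeff n k) (steinberg_coeff_action n k))"
proof -
  have n3: "n \<ge> 3" and n2: "n \<ge> 2" using n by auto
  interpret G: group G by (rule G)
  interpret S: comm_group "steinberg n" by (rule comm_group_steinberg[OF n3])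
  interpret k: cring k by (rule k)
  interpret T: tensor_pair "steinberg n" "add_monoid k"
    by (intro tensor_pair.intro S.comm_group_axioms k.a_comm_group)
  let ?S = "steinberg n" and ?K = "add_monoid k" and ?GL = "GL n"
  let ?c = "steinberg_class n" and ?\<sigma> = "steinberg_action n"
  have coeff: "steinberg_coeff n k = T.M" "steinberg_coeff_action n k = (\<lambda>g. tensor_map ?S ?K (?\<sigma> g) id)"
    by (simp_all add: steinberg_coeff_def steinberg_coeff_action_def fun_eq_iff)
  have \<sigma>: "?\<sigma> g \<in> hom ?S ?S" if "g \<in> carrier G" for g using steinberg_action_hom[OF n3] G_GL that by blast
  interpret bm: bar_module G T.M "\<lambda>g. tensor_map ?S ?K (?\<sigma> g) id"
    by (intro bar_module.intro bar_module_axioms.intro T.comm_group_tensor G T.tensor_map_hom \<sigma>)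
  have G_mat: "g \<in> carrier_mat n n" if "g \<in> carrier G" for g using G_GL that GL_int_iff by blast
  have G_inv: "inv\<^bsub>G\<^esub> g * g = 1\<^sub>m n" "g * inv\<^bsub>G\<^esub> g = 1\<^sub>m n" if "g \<in> carrier G" for g
    using G.l_inv[OF that] G.r_inv[OF that] by (simp_all add: one mult)
  have r_GL: "rotation3 n \<in> ?GL" using SL_G[of "rotation3 n"] det_rotation3[OF n2] G_GL by auto
  show ?thesis
    unfolding coeff
  proof (rule bm.first_homology_trivialI)
    fix N :: "((_ \<times> 'k \<Rightarrow>\<^sub>0 int) set \<times> int mat \<Rightarrow>\<^sub>0 int) set"
    assume N: "subgrp N"
      and N_add: "\<And>m m' g. m \<in> carrier T.M \<Longrightarrow> m' \<in> carrier T.M \<Longrightarrow> g \<in> carrier G \<Longrightarrow>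
        frag_of (m \<otimes>\<^bsub>T.M\<^esub> m', g) - frag_of (m, g) - frag_of (m', g) \<in> N"
      and N_cocycle: "\<And>m g h. m \<in> carrier T.M \<Longrightarrow> g \<in> carrier G \<Longrightarrow> h \<in> carrier G \<Longrightarrow>
        frag_of (m, g \<otimes>\<^bsub>G\<^esub> h) - frag_of (m, g) - frag_of (tensor_map ?S ?K (?\<sigma> (inv\<^bsub>G\<^esub> g)) id m, h) \<in> N"
    note comb = subgrp_comb[OF N] and comb_plus = subgrp_comb_plus[OF N] and N0 = subgrp_0[OF N]
    \<comment> \<open>The one-chain (s tensored with \<kappa>)[g], which is biadditive in s and
      \<kappa> modulo N.\<close>
    define B where "B = (\<lambda>s \<kappa> g. frag_of (T.tens (frag_of (s, \<kappa>)), g :: int mat))"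
    define \<beta> where "\<beta> = (\<lambda>\<kappa> a g. B (?c (frag_of a)) \<kappa> g)"
    have c_carrier: "?c y \<in> carrier ?S" if "keys y \<subseteq> ?GL" for y by (rule steinberg_class_carrier[OF n3 that])
    have pk: "keys (frag_of (s, \<kappa>)) \<subseteq> T.pairs" if "s \<in> carrier ?S" "\<kappa> \<in> carrier ?K" for s \<kappa> using that by (simp add: keys_frag_of)
    have tc: "T.tens (frag_of (s, \<kappa>)) \<in> carrier T.M" if "s \<in> carrier ?S" "\<kappa> \<in> carrier ?K" for s \<kappa>
      unfolding T.carrier_tensor using pk[OF that] by blast
    have B_left: "B (s \<otimes>\<^bsub>?S\<^esub> s') \<kappa> g - B s \<kappa> g - B s' \<kappa> g \<in> N"
      if "s \<in> carrier ?S" "s' \<in> carrier ?S" "\<kappa> \<in> carrier ?K" "g \<in> carrier G" for s s' \<kappa> g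
    proof -
      have "T.tens (frag_of (s \<otimes>\<^bsub>?S\<^esub> s', \<kappa>)) = T.tens (frag_of (s, \<kappa>) + frag_of (s', \<kappa>))"
        unfolding T.tens_eq_iff using T.relations_left[OF that(1-3)] by (simp add: diff_diff_add)
      also have "\<dots> = T.tens (frag_of (s, \<kappa>)) \<otimes>\<^bsub>T.M\<^esub> T.tens (frag_of (s', \<kappa>))"
        by (rule T.tens_add[OF pk[OF that(1,3)] pk[OF that(2,3)]])
      finally show ?thesis using N_add[OF tc[OF that(1,3)] tc[OF that(2,3)] that(4)] by (simp add: B_def)
    qed
    have B_right: "B s (\<kappa> \<otimes>\<^bsub>?K\<^esub> \<kappa>') g - B s \<kappa> g - B s \<kappa>' g \<in> N"
      if "s \<in> carrier ?S" "\<kappa> \<in> carrier ?K" "\<kappa>' \<in> carrier ?K" "g \<in> carrier G" for s \<kappa> \<kappa>' g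
    proof -
      have "T.tens (frag_of (s, \<kappa> \<otimes>\<^bsub>?K\<^esub> \<kappa>')) = T.tens (frag_of (s, \<kappa>) + frag_of (s, \<kappa>'))"
        unfolding T.tens_eq_iff using T.relations_right[OF that(1-3)] by (simp add: diff_diff_add)
      also have "\<dots> = T.tens (frag_of (s, \<kappa>)) \<otimes>\<^bsub>T.M\<^esub> T.tens (frag_of (s, \<kappa>'))"
        by (rule T.tens_add[OF pk[OF that(1,2)] pk[OF that(1,3)]])
      finally show ?thesis using N_add[OF tc[OF that(1,2)] tc[OF that(1,3)] that(4)] by (simp add: B_def)
    qed
    have B_class: "B (?c y) \<kappa> g - frag_extend (\<lambda>a. \<beta> \<kappa> a g) y \<in> N"
      if y: "keys y \<subseteq> ?GL" and \<kappa>: "\<kappa> \<in> carrier ?K" and g: "g \<in> carrier G" for y \<kappa> g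
    proof (rule free_Abelian_group_induct[OF y, where P = "\<lambda>y. B (?c y) \<kappa> g - frag_extend (\<lambda>a. \<beta> \<kappa> a g) y \<in> N"])
      have k0: "keys (0 :: int mat \<Rightarrow>\<^sub>0 int) \<subseteq> ?GL" by simp
      have "?c 0 \<otimes>\<^bsub>?S\<^esub> ?c 0 = ?c 0" using steinberg_class_add[OF n3 k0 k0] by simp
      hence "B (?c 0) \<kappa> g - B (?c 0) \<kappa> g - B (?c 0) \<kappa> g \<in> N" using B_left[OF c_carrier[OF k0] c_carrier[OF k0] \<kappa> g] by simp
      hence "B (?c 0) \<kappa> g \<in> N" by (rule comb[OF N0]) simp
      thus "B (?c 0) \<kappa> g - frag_extend (\<lambda>a. \<beta> \<kappa> a g) 0 \<in> N" by simp
    next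
      fix x y :: "int mat \<Rightarrow>\<^sub>0 int"
      assume k: "keys x \<subseteq> ?GL" "keys y \<subseteq> ?GL"
        and h: "B (?c x) \<kappa> g - frag_extend (\<lambda>a. \<beta> \<kappa> a g) x \<in> N" "B (?c y) \<kappa> g - frag_extend (\<lambda>a. \<beta> \<kappa> a g) y \<in> N"
      note kd = keys_diff_subset[OF k]
      have "?c x = ?c (x - y) \<otimes>\<^bsub>?S\<^esub> ?c y" using steinberg_class_add[OF n3 kd k(2)] by simp
      hence 1: "B (?c x) \<kappa> g - B (?c (x - y)) \<kappa> g - B (?c y) \<kappa> g \<in> N"
        using B_left[OF c_carrier[OF kd] c_carrier[OF k(2)] \<kappa> g] by simp
      show "B (?c (x - y)) \<kappa> g - frag_extend (\<lambda>a. \<beta> \<kappa> a g) (x - y) \<in> N"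
        unfolding frag_extend_diff by (rule comb[OF comb[OF h refl] 1]) simp
    next
      fix a assume "a \<in> ?GL"
      show "B (?c (frag_of a)) \<kappa> g - frag_extend (\<lambda>a. \<beta> \<kappa> a g) (frag_of a) \<in> N" by (simp add: \<beta>_def N0)
    qed
    \<comment> \<open>Every identity between apartment chains passes to \<beta> modulo N; the
      geometric assumptions of the locale are instances.\<close>
    have relation: "frag_extend (\<lambda>a. \<beta> \<kappa> a g) y \<in> N"
      if y: "keys y \<subseteq> ?GL" "frag_extend (apartment_class n) y = 0" and \<kappa>: "\<kappa> \<in> carrier ?K" and g: "g \<in> carrier G" for y \<kappa> g
    proof -
      have k0: "keys (0 :: int mat \<Rightarrow>\<^sub>0 int) \<subseteq> ?GL" by simp
      have "?c y = ?c 0" using y(2) by (simp add: steinberg_class_def)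
      thus ?thesis using comb[OF B_class[OF k0 \<kappa> g] B_class[OF y(1) \<kappa> g]] by simp
    qed
    have ac: "arithmetic_cocycle G n (\<beta> \<kappa>) N" if \<kappa>: "\<kappa> \<in> carrier ?K" for \<kappa>
    proof (intro arithmetic_cocycle.intro arithmetic_cocycle_axioms.intro)
      show "group G" by (rule G)
      show "6 \<le> n" by (rule n)
      show "g \<otimes>\<^bsub>G\<^esub> h = g * h" for g h by (rule mult)
      show "\<one>\<^bsub>G\<^esub> = 1\<^sub>m n" by (rule one)
      show "carrier G \<subseteq> ?GL" by (rule G_GL)
      show "A \<in> carrier G" if "A \<in> carrier_mat n n" "Determinant.det A = 1" for A using SL_G that .
      show "g * reflection n \<in> carrier G" if "g \<in> ?GL" "g \<notin> carrier G" for g using reflection_G that .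
      show "subgrp N" by (rule N)
    next
      fix a g h assume a: "a \<in> ?GL" and g: "g \<in> carrier G" and h: "h \<in> carrier G"
      have ga: "g * a \<in> ?GL" using GL_int_mult a g G_GL by blast
      have ka: "keys (frag_of (g * a)) \<subseteq> ?GL" using ga by (simp add: keys_frag_of)
      have ig: "inv\<^bsub>G\<^esub> g \<in> carrier G" "inv\<^bsub>G\<^esub> g \<in> ?GL" using g G_GL by auto
      have am: "a \<in> carrier_mat n n" using a GL_int_iff by blast
      have "inv\<^bsub>G\<^esub> g * (g * a) = inv\<^bsub>G\<^esub> g * g * a" using assoc_mult_mat[OF G_mat[OF ig(1)] G_mat[OF g] am] by simp
      hence e: "inv\<^bsub>G\<^esub> g * (g * a) = a" using G_inv[OF g] left_mult_one_mat[OF am] by simp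
      have "?\<sigma> (inv\<^bsub>G\<^esub> g) (?c (frag_of (g * a))) = ?c (frag_of a)"
        unfolding steinberg_action_class[OF n3 ig(2) ka] by (simp add: translate_def e)
      hence "tensor_map ?S ?K (?\<sigma> (inv\<^bsub>G\<^esub> g)) id (T.tens (frag_of (?c (frag_of (g * a)), \<kappa>))) = T.tens (frag_of (?c (frag_of a), \<kappa>))"
        unfolding T.tensor_map_tens[OF \<sigma>[OF ig(1)]] by (simp add: T.pushforward_def)
      thus "\<beta> \<kappa> (g * a) (g * h) - \<beta> \<kappa> (g * a) g - \<beta> \<kappa> a h \<in> N"
        using N_cocycle[OF tc[OF c_carrier[OF ka] \<kappa>] g h] by (simp add: \<beta>_def B_def mult)
    next
      fix a g s assume a: "a \<in> ?GL" and g: "g \<in> carrier G" and s: "signs n s"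
      have "a * signed_perm n id s \<in> ?GL" by (rule GL_int_mult[OF a signed_perm_GL]) (use s in auto)
      hence y: "keys (frag_of (a * signed_perm n id s) - frag_of a) \<subseteq> ?GL" using a by (intro keys_diff_subset) (auto simp: keys_frag_of)
      have "apartment_class n (a * signed_perm n id s) = apartment_class n a"
        by (rule apartment_class_diag) (use a s GL_int_iff in auto)
      thus "\<beta> \<kappa> (a * signed_perm n id s) g - \<beta> \<kappa> a g \<in> N"
        using relation[OF y _ \<kappa> g] by (simp add: frag_extend_diff)
    next
      fix a g s i assume a: "a \<in> ?GL" and g: "g \<in> carrier G" and s: "signs n s" and i: "Suc i < n"
      let ?w = "signed_perm n (adjacent_swap i) s"
      have "a * ?w \<in> ?GL" by (rule GL_int_mult[OF a signed_perm_GL]) (use s i in \<open>auto simp: transpose_less\<close>)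
      hence y: "keys (frag_of (a * ?w) + frag_of a) \<subseteq> ?GL" using a by (intro keys_add_subset) (auto simp: keys_frag_of)
      have "apartment_class n (a * ?w) = - apartment_class n a"
        by (rule apartment_class_swap) (use a s i GL_int_iff in auto)
      thus "\<beta> \<kappa> (a * ?w) g + \<beta> \<kappa> a g \<in> N"
        using relation[OF y _ \<kappa> g] by (simp add: frag_extend_add)
    next
      fix a g assume a: "a \<in> ?GL" and g: "g \<in> carrier G"
      let ?r = "rotation3 n"
      have "a * ?r \<in> ?GL" "a * ?r * ?r \<in> ?GL" using GL_int_mult a r_GL by blast+
      hence y: "keys (frag_of a + frag_of (a * ?r) + frag_of (a * ?r * ?r)) \<subseteq> ?GL" using a by (intro keys_add_subset) (auto simp: keys_frag_of)
      have "apartment_class n a + apartment_class n (a * ?r) + apartment_class n (a * ?r * ?r) = 0"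
        by (rule apartment_class_rotation3) (use a n2 GL_int_iff in auto)
      thus "\<beta> \<kappa> a g + \<beta> \<kappa> (a * ?r) g + \<beta> \<kappa> (a * ?r * ?r) g \<in> N"
        using relation[OF y _ \<kappa> g] by (simp add: frag_extend_add)
    qed
    define P where "P = (\<lambda>\<kappa>. arithmetic_cocycle.primitive G n (\<beta> \<kappa>))"
    \<comment> \<open>A chain of matrices is chosen for each class; \<open>P_class\<close> shows
      that another choice changes the value only within N.\<close>
    define V where "V = (\<lambda>s \<kappa>. frag_extend (P \<kappa>) (SOME y. keys y \<subseteq> ?GL \<and> ?c y = s))"
    have P_kernel: "frag_extend (P \<kappa>) y \<in> N" if y: "keys y \<subseteq> ?GL" "?c y = \<one>\<^bsub>?S\<^esub>" and \<kappa>: "\<kappa> \<in> carrier ?K" for y \<kappa>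
    proof -
      interpret c: arithmetic_cocycle G n "\<beta> \<kappa>" N by (rule ac[OF \<kappa>])
      show ?thesis
        unfolding P_def
        by (rule apartment_class_kernel[OF n2 y(1) steinberg_class_eq_one[OF n3 y] N c.primitive_swap c.primitive_diag c.primitive_three]) auto
    qed
    have P_class: "frag_extend (P \<kappa>) y - frag_extend (P \<kappa>) y' \<in> N"
      if y: "keys y \<subseteq> ?GL" "keys y' \<subseteq> ?GL" "?c y = ?c y'" and \<kappa>: "\<kappa> \<in> carrier ?K" for y y' \<kappa>
    proof -
      note kd = keys_diff_subset[OF y(1,2)]
      have "?c (y - y') \<otimes>\<^bsub>?S\<^esub> ?c y' = ?c y'" using steinberg_class_add[OF n3 kd y(2)] y(3) by simp
      hence "?c (y - y') = \<one>\<^bsub>?S\<^esub>" using S.r_cancel_one[OF c_carrier[OF y(2)] c_carrier[OF kd]] by simp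
      from P_kernel[OF kd this \<kappa>] show ?thesis by (simp add: frag_extend_diff)
    qed
    have V_class: "V (?c y) \<kappa> - frag_extend (P \<kappa>) y \<in> N" if y: "keys y \<subseteq> ?GL" and \<kappa>: "\<kappa> \<in> carrier ?K" for y \<kappa>
    proof -
      let ?y = "SOME z. keys z \<subseteq> ?GL \<and> ?c z = ?c y"
      have "keys ?y \<subseteq> ?GL \<and> ?c ?y = ?c y" by (rule someI[of _ y]) (use y in blast)
      thus ?thesis unfolding V_def using P_class[OF _ y _ \<kappa>, of ?y] by blast
    qed
    have V_left: "V (s \<otimes>\<^bsub>?S\<^esub> s') \<kappa> - V s \<kappa> - V s' \<kappa> \<in> N"
      if s: "s \<in> carrier ?S" "s' \<in> carrier ?S" and \<kappa>: "\<kappa> \<in> carrier ?K" for s s' \<kappa>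
    proof -
      obtain y where y: "keys y \<subseteq> ?GL" "s = ?c y" using steinberg_class_surj[OF n3 s(1)] .
      obtain z where z: "keys z \<subseteq> ?GL" "s' = ?c z" using steinberg_class_surj[OF n3 s(2)] .
      show ?thesis
        unfolding y(2) z(2) steinberg_class_add[OF n3 y(1) z(1), symmetric]
        by (rule comb[OF comb[OF V_class[OF keys_add_subset[OF y(1) z(1)] \<kappa>] V_class[OF y(1) \<kappa>] refl] V_class[OF z(1) \<kappa>]])
          (simp add: frag_extend_add)
    qed
    have V_right: "V s (\<kappa> \<otimes>\<^bsub>?K\<^esub> \<kappa>') - V s \<kappa> - V s \<kappa>' \<in> N"
      if s: "s \<in> carrier ?S" and \<kappa>: "\<kappa> \<in> carrier ?K" "\<kappa>' \<in> carrier ?K" for s \<kappa> \<kappa>'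
    proof -
      have \<kappa>2: "\<kappa> \<otimes>\<^bsub>?K\<^esub> \<kappa>' \<in> carrier ?K" using \<kappa> by simp
      interpret c1: arithmetic_cocycle G n "\<beta> \<kappa>" N by (rule ac[OF \<kappa>(1)])
      interpret c2: arithmetic_cocycle G n "\<beta> \<kappa>'" N by (rule ac[OF \<kappa>(2)])
      interpret c3: arithmetic_cocycle G n "\<beta> (\<kappa> \<otimes>\<^bsub>?K\<^esub> \<kappa>')" N by (rule ac[OF \<kappa>2])
      have b: "\<beta> (\<kappa> \<otimes>\<^bsub>?K\<^esub> \<kappa>') (1\<^sub>m n) g - \<beta> \<kappa> (1\<^sub>m n) g - \<beta> \<kappa>' (1\<^sub>m n) g \<in> N" if "g \<in> carrier G" for g
        unfolding \<beta>_def by (rule B_right[OF c_carrier \<kappa> that]) (use c1.I_GL in \<open>simp add: keys_frag_of\<close>)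
      \<comment> \<open>The chain chosen for s is the same for all three coefficients, so additivity
        is needed only on single matrices, where P is an integral combination of values of
        \<beta>.\<close>
      have P: "P (\<kappa> \<otimes>\<^bsub>?K\<^esub> \<kappa>') a - P \<kappa> a - P \<kappa>' a \<in> N" if a: "a \<in> ?GL" for a
      proof -
        have W: "weyl n 2 \<in> carrier G" by (rule c1.W_G) (use n in simp)
        show ?thesis
          unfolding P_def c1.primitive_def c2.primitive_def c3.primitive_def c1.t_def c2.t_def c3.t_def
          by (rule comb[OF comb[OF comb_plus[OF b[OF G.inv_closed[OF c1.base_G[OF a]]] b[OF W] refl] b[OF c1.r_G] refl] b[OF c1.rr_G]]) simp
      qed
      let ?y = "SOME y. keys y \<subseteq> ?GL \<and> ?c y = s"
      have "keys ?y \<subseteq> ?GL \<and> ?c ?y = s" by (rule someI_ex) (use steinberg_class_surj[OF n3 s] in metis)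
      hence "keys ?y \<subseteq> ?GL" by simp
      hence "frag_extend (\<lambda>a. P (\<kappa> \<otimes>\<^bsub>?K\<^esub> \<kappa>') a - P \<kappa> a - P \<kappa>' a) ?y \<in> N"
        using P by (intro subgrp_frag_extend[OF N]) blast
      thus ?thesis unfolding V_def frag_extend_diff_fun .
    qed
    have V_primitive: "frag_of (T.tens (frag_of (s, \<kappa>)), g) - (V (?\<sigma> (inv\<^bsub>G\<^esub> g) s) \<kappa> - V s \<kappa>) \<in> N"
      if s: "s \<in> carrier ?S" and \<kappa>: "\<kappa> \<in> carrier ?K" and g: "g \<in> carrier G" for s \<kappa> g
    proof -
      interpret c: arithmetic_cocycle G n "\<beta> \<kappa>" N by (rule ac[OF \<kappa>])
      obtain y where y: "keys y \<subseteq> ?GL" "s = ?c y" using steinberg_class_surj[OF n3 s] .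
      have ig: "inv\<^bsub>G\<^esub> g \<in> carrier G" "inv\<^bsub>G\<^esub> g \<in> ?GL" "g \<in> ?GL" using g G_GL by auto
      \<comment> \<open>\<open>primitive_coboundary\<close> describes the value at g a on g, so it
        is applied to the matrices a of the translate of y by g^-1.\<close>
      let ?z = "translate (inv\<^bsub>G\<^esub> g) y"
      have kz: "keys ?z \<subseteq> ?GL" by (rule translate_keys[OF ig(2) y(1)])
      have yz: "translate g ?z = y" by (rule translate_translate[OF G_mat[OF g] G_mat[OF ig(1)] G_inv(2)[OF g] y(1)])
      have "frag_extend (\<lambda>a. \<beta> \<kappa> (g * a) g - (P \<kappa> a - P \<kappa> (g * a))) ?z \<in> N"
        unfolding P_def using c.primitive_coboundary[OF _ g] kz by (intro subgrp_frag_extend[OF N]) blast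
      moreover have "frag_extend (\<lambda>a. \<beta> \<kappa> (g * a) g) ?z = frag_extend (\<lambda>a. \<beta> \<kappa> a g) y"
        "frag_extend (\<lambda>a. P \<kappa> (g * a)) ?z = frag_extend (P \<kappa>) y"
        using frag_extend_translate[of "\<lambda>a. \<beta> \<kappa> a g" g ?z] frag_extend_translate[of "P \<kappa>" g ?z] yz by simp_all
      ultimately have 1: "frag_extend (\<lambda>a. \<beta> \<kappa> a g) y - (frag_extend (P \<kappa>) ?z - frag_extend (P \<kappa>) y) \<in> N"
        unfolding frag_extend_diff_fun by simp
      have 2: "B (?c y) \<kappa> g - (frag_extend (P \<kappa>) ?z - frag_extend (P \<kappa>) y) \<in> N"
        by (rule comb_plus[OF 1 B_class[OF y(1) \<kappa> g]]) simp
      have 3: "V (?c ?z) \<kappa> - V (?c y) \<kappa> - (frag_extend (P \<kappa>) ?z - frag_extend (P \<kappa>) y) \<in> N"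
        by (rule comb[OF V_class[OF kz \<kappa>] V_class[OF y(1) \<kappa>]]) simp
      have "B (?c y) \<kappa> g - (V (?c ?z) \<kappa> - V (?c y) \<kappa>) \<in> N" by (rule comb[OF 2 3]) simp
      thus ?thesis unfolding y(2) steinberg_action_class[OF n3 ig(2) y(1)] B_def .
    qed
    show "\<exists>U. (\<forall>m\<in>carrier T.M. \<forall>m'\<in>carrier T.M. U (m \<otimes>\<^bsub>T.M\<^esub> m') - U m - U m' \<in> N) \<and>
        (\<forall>m\<in>carrier T.M. \<forall>g\<in>carrier G. frag_of (m, g) - (U (tensor_map ?S ?K (?\<sigma> (inv\<^bsub>G\<^esub> g)) id m) - U m) \<in> N)"
      by (rule T.primitive_extends[OF N \<sigma> G N_add V_left V_right V_primitive])
  qed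
qed

section \<open>The groups GL and SL over the integers\<close>

lemma group_GL_int: "group (GL_int n)"
proof -
  interpret ring "ring_mat TYPE(int) n ()" by (rule ring_mat)
  show ?thesis unfolding GL_int_def by (rule units_group)
qed

lemma GL_int_mult_one: "g \<otimes>\<^bsub>GL_int n\<^esub> h = g * h" "\<one>\<^bsub>GL_int n\<^esub> = 1\<^sub>m n"
  by (simp_all add: GL_int_def units_of_def ring_mat_simps)

text \<open>The units of the integers are 1 and -1, and for such a determinant the adjugate provides
  the inverse.\<close>

lemma GL_int_det: "g \<in> GL n \<longleftrightarrow> g \<in> carrier_mat n n \<and> (Determinant.det g = 1 \<or> Determinant.det g = - 1)"
proof
  assume "g \<in> GL n"
  then obtain h where h: "g \<in> carrier_mat n n" "h \<in> carrier_mat n n" "h * g = 1\<^sub>m n" by (auto simp: GL_int_iff)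
  hence "Determinant.det h * Determinant.det g = 1" using det_mult[OF h(2,1)] by simp
  thus "g \<in> carrier_mat n n \<and> (Determinant.det g = 1 \<or> Determinant.det g = - 1)"
    using h(1) by (auto simp: zmult_eq_1_iff)
next
  assume g: "g \<in> carrier_mat n n \<and> (Determinant.det g = 1 \<or> Determinant.det g = - 1)"
  let ?d = "Determinant.det g"
  have d: "?d * ?d = 1" using g by auto
  have a: "adj_mat g \<in> carrier_mat n n" "g * adj_mat g = ?d \<cdot>\<^sub>m 1\<^sub>m n" "adj_mat g * g = ?d \<cdot>\<^sub>m 1\<^sub>m n"
    using adj_mat[of g n] g by auto
  let ?h = "?d \<cdot>\<^sub>m adj_mat g"
  have "?h * g = ?d \<cdot>\<^sub>m (adj_mat g * g)" "g * ?h = ?d \<cdot>\<^sub>m (g * adj_mat g)"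
    using a(1) g by auto
  moreover have "?d \<cdot>\<^sub>m (?d \<cdot>\<^sub>m 1\<^sub>m n) = 1\<^sub>m n" using d by (intro eq_matI) auto
  ultimately show "g \<in> GL n" unfolding GL_int_iff using g a by (auto intro!: bexI[of _ ?h])
qed

lemma group_SL_int: "group (SL_int n)"
proof -
  interpret GL: group "GL_int n" by (rule group_GL_int)
  have sub: "carrier (SL_int n) \<subseteq> GL n" by (auto simp: SL_int_def GL_int_det)
  have "subgroup (carrier (SL_int n)) (GL_int n)"
  proof (rule GL.subgroupI[OF sub])
    have "1\<^sub>m n \<in> carrier (SL_int n)" by (simp add: SL_int_def)
    thus "carrier (SL_int n) \<noteq> {}" by blast
    fix a assume a: "a \<in> carrier (SL_int n)"
    hence i: "inv\<^bsub>GL_int n\<^esub> a \<in> GL n" "inv\<^bsub>GL_int n\<^esub> a * a = 1\<^sub>m n"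
      using sub GL.l_inv[of a] by (auto simp: GL_int_mult_one)
    hence "Determinant.det (inv\<^bsub>GL_int n\<^esub> a) * Determinant.det a = 1"
      using det_mult[of "inv\<^bsub>GL_int n\<^esub> a" n a] a by (simp add: GL_int_det SL_int_def)
    thus "inv\<^bsub>GL_int n\<^esub> a \<in> carrier (SL_int n)" using a i(1) by (simp add: GL_int_det SL_int_def)
    fix b assume b: "b \<in> carrier (SL_int n)"
    thus "a \<otimes>\<^bsub>GL_int n\<^esub> b \<in> carrier (SL_int n)"
      using a det_mult[of a n b] by (auto simp: SL_int_def GL_int_mult_one intro!: mult_carrier_mat[of _ n n])
  qed
  from GL.subgroup_imp_group[OF this] show ?thesis by (simp add: SL_int_def)
qed

lemma det_reflection: assumes "n > 0" shows "Determinant.det (reflection n) = - 1"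
proof -
  have "reflection n = multrow (n - 1) (- 1) (1\<^sub>m n)"
    by (rule eq_matI) (auto simp: reflection_def signed_perm_def)
  thus ?thesis using det_multrow[of "n - 1" n "1\<^sub>m n" "- 1 :: int"] assms by simp
qed

theorem theorem1p10:
  fixes k :: "('k, 'r) ring_scheme" and n :: nat
  assumes "cring k" and "n \<ge> 6"
  shows "trivial_group
           (group_homology 1 (GL_int n) (steinberg_coeff n k) (steinberg_coeff_action n k))
       \<and> trivial_group
           (group_homology 1 (SL_int n) (steinberg_coeff n k) (steinberg_coeff_action n k))"
proof
  show "trivial_group (group_homology 1 (GL_int n) (steinberg_coeff n k) (steinberg_coeff_action n k))"
    by (rule first_homology_arithmetic[OF group_GL_int assms])
      (auto simp: GL_int_mult_one GL_int_det)
  show "trivial_group (group_homology 1 (SL_int n) (steinberg_coeff n k) (steinberg_coeff_action n k))"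
  proof (rule first_homology_arithmetic[OF group_SL_int assms])
    \<comment> \<open>The reflection has determinant -1, so it carries the other coset of SL into
      SL.\<close>
    show "g * reflection n \<in> carrier (SL_int n)" if "g \<in> GL n" "g \<notin> carrier (SL_int n)" for g
      using that det_mult[of g n "reflection n"] det_reflection[of n] assms(2)
      by (auto simp: GL_int_det SL_int_def reflection_def intro!: mult_carrier_mat[of _ n n])
  qed (auto simp: SL_int_def GL_int_mult_one GL_int_det)
qed

end
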